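(* Let $\lambda\in\mathbb{C}\setminus\mathbb{R}$ with $\lambda\notin\Lambda$. If $n_+\ne n_-$, then one of $|\tau(c,\lambda)|$ and $|\tau(c,\overline{\lambda})|$ tends to $0$ and the other to infinity as $c$ tends to $b$. In particular, if $|\tau(c,\lambda)|$ does not have a limit (in $[0,\infty]$) as $c$ tends to $b$, then $n_+=n_-$.
   Context: Let $0<b\le\infty$ and $J=\begin{pmatrix}0&-1\\1&0\end{pmatrix}$. Let $q,w$ be $2\times2$ matrices whose entries are distributions of order $0$ on $(0,b)$, equivalently local complex measures on $(0,b)$ (complex measures when restricted to compact subsets of $(0,b)$). Here $q$ is Hermitian ($q=q^*$; off-diagonal entries may be non-real), and $w$ is non-negative (a matrix-valued measure with $w(E)\ge0$ as a Hermitian matrix) and not identically $0$. The endpoint $0$ is regular: $q$ and $w$ are finite measures on $(0,c)$ for each $c\in(0,b)$. For a function $u$ of locally bounded variation put $u^\pm(x)$ for its right/left limits; $u$ is balanced if $u=\frac12(u^-+u^+)$. A solution of $Ju'+qu=\lambda wu$ is a balanced function $u:(0,b)\to\mathbb{C}^2$ of locally bounded variation satisfying the equation as an identity of local measures. Let $\Delta_q(x)=q(\{x\})$, $\Delta_w(x)=w(\{x\})$, $B_\pm(x,\lambda)=J\pm\frac12(\Delta_q(x)-\lambda\Delta_w(x))$, and $\Lambda=\{\lambda\in\mathbb{C}:\exists x\in(0,b):\det B_+(x,\lambda)\det B_-(x,\lambda)=0\}$; it is assumed throughout that $\Lambda\ne\mathbb{C}$. The set $\Lambda$ is symmetric with respect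 to the real axis. Let $(x_n)$ enumerate the (at most countably many) points of $(0,b)$ at which $\Delta_q$ or $\Delta_w$ is different from $0$. For $\lambda\notin\Lambda$ and $x\in[0,b)$ set $P(x,\lambda)=\prod_{x_n\in(0,x)}\frac{\det B_-(x_n,\lambda)}{\det B_+(x_n,\lambda)}$ (empty products are $1$; the product converges independently of the order of the factors to a non-zero number) and $$\tau(x,\lambda)=P(x,\lambda)\exp\Big(2\mathrm{i}\int_{(0,x)}\big(\operatorname{Im}(q_{c,12})-\lambda\operatorname{Im}(w_{c,12})\big)\Big),$$ where $q_{c,12}$ and $w_{c,12}$ are the continuous (atom-free) parts of the local measures $q_{12}$ and $w_{12}$. Let $\|u\|^2=\int_{(0,b)}u^*wu\in[0,\infty]$; $\mathcal{L}^2(w)$ is the space of functions with $\|u\|<\infty$. $\mathcal{L}_0$ is the space of solutions of $Ju'+qu=0$ with norm $0$ (these solve $Ju'+qu=\lambda wu$ for every $\lambda$). The deficiency index $n_+$ (resp. $n_-$) is the number of linearly independent solutions of $Ju'+qu=\lambda wu$ of positive finite norm, i.e. the dimension of the space of solutions in $\mathcal{L}^2(w)$ modulo $\mathcal{L}_0$, for $\lambda$ in the upper (resp. lower) half-plane; it is known not to depend on the choice of $\lambda$ in that half-plane. *)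

theory Defs
  imports "HOL-Analysis.Analysis"
begin

section \<open>Local complex measures on the interval from 0 to b\<close>

definition ivl :: "ereal \<Rightarrow> real set" where
  "ivl b = {x. 0 < x \<and> ereal x < b}"

text \<open>The Borel sets contained in some compact subset of the interval.\<close>

definition bounded_borel :: "ereal \<Rightarrow> real set set" where
  "bounded_borel b = {E \<in> sets borel. \<exists>K. compact K \<and> K \<subseteq> ivl b \<and> E \<subseteq> K}"

definition complex_measure_on :: "real set \<Rightarrow> (real set \<Rightarrow> complex) \<Rightarrow> bool" where
  "complex_measure_on S \<mu> \<longleftrightarrow>
     (\<forall>A :: nat \<Rightarrow> real set. (\<forall>n. A n \<in> sets borel \<and> A n \<subseteq> S) \<longrightarrow> disjoint_family A \<longrightarrow>
        (\<lambda>n. \<mu> (A n)) sums \<mu> (\<Union>n. A n))"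

definition local_measure :: "ereal \<Rightarrow> (real set \<Rightarrow> complex) \<Rightarrow> bool" where
  "local_measure b \<mu> \<longleftrightarrow> (\<forall>K. compact K \<longrightarrow> K \<subseteq> ivl b \<longrightarrow> complex_measure_on K \<mu>)"

text \<open>Regularity of the endpoint 0: the local measure is a finite (complex) measure on \<open>(0, c)\<close>
  for every \<open>c\<close>. The values of \<open>\<mu>\<close> on sets not contained in such an interval never matter.\<close>

definition regular_at_0 :: "ereal \<Rightarrow> (real set \<Rightarrow> complex) \<Rightarrow> bool" where
  "regular_at_0 b \<mu> \<longleftrightarrow> (\<forall>c \<in> ivl b. complex_measure_on {0<..<c} \<mu>)"

text \<open>For a real-valued local measure \<open>\<rho>\<close> this is the positive part of its Jordan decomposition,
  a positive Borel measure concentrated on the interval, possibly of infinite total mass.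
  (Negative values are mapped to 0 by \<open>ennreal\<close>, and the empty set is a competitor anyway.)\<close>

definition pos_part :: "ereal \<Rightarrow> (real set \<Rightarrow> real) \<Rightarrow> real measure" where
  "pos_part b \<rho> =
     measure_of UNIV (sets borel) (\<lambda>E. SUP F \<in> {F \<in> bounded_borel b. F \<subseteq> E}. ennreal (\<rho> F))"

definition signed_integral :: "ereal \<Rightarrow> (real set \<Rightarrow> real) \<Rightarrow> (real \<Rightarrow> complex) \<Rightarrow> real set \<Rightarrow> complex" where
  "signed_integral b \<rho> f E =
     set_lebesgue_integral (pos_part b \<rho>) E f - set_lebesgue_integral (pos_part b (\<lambda>F. - \<rho> F)) E f"

text \<open>The integral of \<open>f\<close> over \<open>E\<close> with respect to \<open>\<mu>\<close>; equivalently, the value on \<open>E\<close> of the local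
  measure \<open>f \<mu>\<close>. It is used for locally bounded Borel functions \<open>f\<close> and sets
  \<open>E\<close> in \<open>bounded_borel b\<close>, for which all four integrals exist.\<close>

definition cm_integral :: "ereal \<Rightarrow> (real set \<Rightarrow> complex) \<Rightarrow> (real \<Rightarrow> complex) \<Rightarrow> real set \<Rightarrow> complex" where
  "cm_integral b \<mu> f E =
     signed_integral b (\<lambda>F. Re (\<mu> F)) f E + \<i> * signed_integral b (\<lambda>F. Im (\<mu> F)) f E"

definition cont_part :: "(real set \<Rightarrow> complex) \<Rightarrow> real set \<Rightarrow> complex" where
  "cont_part \<mu> E = \<mu> E - (\<Sum>\<^sub>\<infinity>x\<in>E. \<mu> {x})"


section \<open>Matrix-valued local measures\<close>

definition entry :: "(real set \<Rightarrow> complex^2^2) \<Rightarrow> 2 \<Rightarrow> 2 \<Rightarrow> real set \<Rightarrow> complex" where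
  "entry m j k E = m E $ j $ k"

definition local_matrix_measure :: "ereal \<Rightarrow> (real set \<Rightarrow> complex^2^2) \<Rightarrow> bool" where
  "local_matrix_measure b m \<longleftrightarrow> (\<forall>j k. local_measure b (entry m j k))"

definition matrix_regular_at_0 :: "ereal \<Rightarrow> (real set \<Rightarrow> complex^2^2) \<Rightarrow> bool" where
  "matrix_regular_at_0 b m \<longleftrightarrow> (\<forall>j k. regular_at_0 b (entry m j k))"

definition hermitian :: "complex^2^2 \<Rightarrow> bool" where
  "hermitian A \<longleftrightarrow> (\<forall>j k. A $ j $ k = cnj (A $ k $ j))"

definition nonneg_matrix :: "complex^2^2 \<Rightarrow> bool" where
  "nonneg_matrix A \<longleftrightarrow> hermitian A \<and>
     (\<forall>v :: complex^2. 0 \<le> Re (\<Sum>j\<in>UNIV. \<Sum>k\<in>UNIV. cnj (v $ j) * A $ j $ k * v $ k))"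

definition hermitian_measure :: "ereal \<Rightarrow> (real set \<Rightarrow> complex^2^2) \<Rightarrow> bool" where
  "hermitian_measure b m \<longleftrightarrow> (\<forall>E \<in> bounded_borel b. hermitian (m E))"

definition nonneg_measure :: "ereal \<Rightarrow> (real set \<Rightarrow> complex^2^2) \<Rightarrow> bool" where
  "nonneg_measure b m \<longleftrightarrow> (\<forall>E \<in> bounded_borel b. nonneg_matrix (m E))"

text \<open>The value on \<open>E\<close> of the vector-valued local measure \<open>m u\<close>.\<close>

definition mat_times :: "ereal \<Rightarrow> (real set \<Rightarrow> complex^2^2) \<Rightarrow> (real \<Rightarrow> complex^2) \<Rightarrow> real set \<Rightarrow> complex^2" where
  "mat_times b m u E = (\<chi> j. \<Sum>k\<in>UNIV. cm_integral b (entry m j k) (\<lambda>x. u x $ k) E)"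


section \<open>Solutions of \<open>J u' + q u = \<lambda> w u\<close>\<close>

definition J :: "complex^2^2" where
  "J = vector [vector [0, -1], vector [1, 0]]"

definition rlim :: "(real \<Rightarrow> complex^2) \<Rightarrow> real \<Rightarrow> complex^2" where
  "rlim u x = Lim (at_right x) u"

definition llim :: "(real \<Rightarrow> complex^2) \<Rightarrow> real \<Rightarrow> complex^2" where
  "llim u x = Lim (at_left x) u"

definition bounded_variation_on :: "real \<Rightarrow> real \<Rightarrow> (real \<Rightarrow> complex^2) \<Rightarrow> bool" where
  "bounded_variation_on s t u \<longleftrightarrow>
     (\<exists>C. \<forall>(n::nat) p. mono p \<longrightarrow> (\<forall>i. p i \<in> {s..t}) \<longrightarrow> (\<Sum>i<n. norm (u (p (Suc i)) - u (p i))) \<le> C)"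

definition locally_bv :: "ereal \<Rightarrow> (real \<Rightarrow> complex^2) \<Rightarrow> bool" where
  "locally_bv b u \<longleftrightarrow> (\<forall>s \<in> ivl b. \<forall>t \<in> ivl b. bounded_variation_on s t u)"

definition balanced :: "ereal \<Rightarrow> (real \<Rightarrow> complex^2) \<Rightarrow> bool" where
  "balanced b u \<longleftrightarrow> (\<forall>x \<in> ivl b. u x = (1/2) *\<^sub>R (llim u x + rlim u x))"

text \<open>\<open>du\<close> is the local (Stieltjes) measure which is the derivative of \<open>u\<close>.\<close>

definition derivative_measure :: "ereal \<Rightarrow> (real \<Rightarrow> complex^2) \<Rightarrow> (real set \<Rightarrow> complex^2) \<Rightarrow> bool" where
  "derivative_measure b u du \<longleftrightarrow>
     (\<forall>j. local_measure b (\<lambda>E. du E $ j)) \<and>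
     (\<forall>s \<in> ivl b. \<forall>t \<in> ivl b. s \<le> t \<longrightarrow> du {s..t} = rlim u t - llim u s)"

text \<open>Only the values of \<open>u\<close> on the interval matter.\<close>

definition is_solution ::
  "ereal \<Rightarrow> (real set \<Rightarrow> complex^2^2) \<Rightarrow> (real set \<Rightarrow> complex^2^2) \<Rightarrow> complex \<Rightarrow> (real \<Rightarrow> complex^2) \<Rightarrow> bool" where
  "is_solution b q w l u \<longleftrightarrow>
     locally_bv b u \<and> balanced b u \<and>
     (\<exists>du. derivative_measure b u du \<and>
        (\<forall>E \<in> bounded_borel b. J *v du E + mat_times b q u E = l *s mat_times b w u E))"


section \<open>The exceptional set and the function \<open>\<tau>\<close>\<close>

definition B_plus :: "(real set \<Rightarrow> complex^2^2) \<Rightarrow> (real set \<Rightarrow> complex^2^2) \<Rightarrow> real \<Rightarrow> complex \<Rightarrow> complex^2^2" where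
  "B_plus q w x l = (\<chi> j k. J $ j $ k + (1/2) * (q {x} $ j $ k - l * w {x} $ j $ k))"

definition B_minus :: "(real set \<Rightarrow> complex^2^2) \<Rightarrow> (real set \<Rightarrow> complex^2^2) \<Rightarrow> real \<Rightarrow> complex \<Rightarrow> complex^2^2" where
  "B_minus q w x l = (\<chi> j k. J $ j $ k - (1/2) * (q {x} $ j $ k - l * w {x} $ j $ k))"

definition Lam :: "ereal \<Rightarrow> (real set \<Rightarrow> complex^2^2) \<Rightarrow> (real set \<Rightarrow> complex^2^2) \<Rightarrow> complex set" where
  "Lam b q w = {l. \<exists>x \<in> ivl b. det (B_plus q w x l) * det (B_minus q w x l) = 0}"

text \<open>The product is the limit along the net of finite sets of factors, i.e. it does not refer to an
  order of the factors.\<close>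

definition P :: "(real set \<Rightarrow> complex^2^2) \<Rightarrow> (real set \<Rightarrow> complex^2^2) \<Rightarrow> real \<Rightarrow> complex \<Rightarrow> complex" where
  "P q w x l =
     Lim (finite_subsets_at_top {y. 0 < y \<and> y < x \<and> (q {y} \<noteq> 0 \<or> w {y} \<noteq> 0)})
         (\<lambda>F. \<Prod>y\<in>F. det (B_minus q w y l) / det (B_plus q w y l))"

definition tau :: "(real set \<Rightarrow> complex^2^2) \<Rightarrow> (real set \<Rightarrow> complex^2^2) \<Rightarrow> real \<Rightarrow> complex \<Rightarrow> complex" where
  "tau q w x l = P q w x l *
     exp (2 * \<i> * (of_real (Im (cont_part (entry q 1 2) {0<..<x}))
                   - l * of_real (Im (cont_part (entry w 1 2) {0<..<x}))))"


section \<open>Deficiency indices\<close>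

text \<open>The total mass of the non-negative local measure \<open>u\<^sup>* w u\<close>.\<close>

definition norm_sq :: "ereal \<Rightarrow> (real set \<Rightarrow> complex^2^2) \<Rightarrow> (real \<Rightarrow> complex^2) \<Rightarrow> ennreal" where
  "norm_sq b w u =
     (SUP E \<in> bounded_borel b. ennreal (Re
        (\<Sum>j\<in>UNIV. \<Sum>k\<in>UNIV. cm_integral b (entry w j k) (\<lambda>x. cnj (u x $ j) * u x $ k) E)))"

definition L2_solutions ::
  "ereal \<Rightarrow> (real set \<Rightarrow> complex^2^2) \<Rightarrow> (real set \<Rightarrow> complex^2^2) \<Rightarrow> complex \<Rightarrow> (real \<Rightarrow> complex^2) set" where
  "L2_solutions b q w l = {u. is_solution b q w l u \<and> norm_sq b w u < \<infinity>}"

definition L_zero ::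
  "ereal \<Rightarrow> (real set \<Rightarrow> complex^2^2) \<Rightarrow> (real set \<Rightarrow> complex^2^2) \<Rightarrow> (real \<Rightarrow> complex^2) set" where
  "L_zero b q w = {u. is_solution b q w 0 u \<and> norm_sq b w u = 0}"

definition independent_mod :: "(real \<Rightarrow> complex^2) set \<Rightarrow> (real \<Rightarrow> complex^2) set \<Rightarrow> bool" where
  "independent_mod N S \<longleftrightarrow>
     (\<forall>a :: (real \<Rightarrow> complex^2) \<Rightarrow> complex. (\<lambda>x. \<Sum>u\<in>S. a u *s u x) \<in> N \<longrightarrow> (\<forall>u\<in>S. a u = 0))"

text \<open>The dimension of \<open>L2_solutions b q w l\<close> modulo \<open>L_zero b q w\<close>, in the extended naturals so that
  no finiteness is presupposed. Functions vanishing on the interval belong to \<open>L_zero b q w\<close>, hence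
  arbitrary values outside the interval do not contribute. The deficiency indices \<open>n\<^sub>+\<close> and \<open>n\<^sub>-\<close> are
  the values for \<open>l\<close> in the open upper and lower half-plane, respectively.\<close>

definition deficiency ::
  "ereal \<Rightarrow> (real set \<Rightarrow> complex^2^2) \<Rightarrow> (real set \<Rightarrow> complex^2^2) \<Rightarrow> complex \<Rightarrow> enat" where
  "deficiency b q w l =
     (SUP S \<in> {S. finite S \<and> S \<subseteq> L2_solutions b q w l \<and> independent_mod (L_zero b q w) S}.
        enat (card S))"


text \<open>The filter on the reals for \<open>c\<close> tending to \<open>b\<close> from within the interval, also if \<open>b = \<infinity>\<close>.\<close>

definition tending_to_b :: "ereal \<Rightarrow> real filter" where
  "tending_to_b b = filtercomap ereal (at_left b)"

end

theory Submission
 imports Defs "HOL-Library.Diagonal_Subsequence"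
begin

text \<open>The four entries of \<open>q\<close> and of \<open>w\<close> have densities \<open>Q\<close>, \<open>W\<close> with respect to one positive measure
\<open>\<nu>\<close> that is finite near 0, and since \<open>J\<^sup>2 = -1\<close> the equation becomes \<open>du = A u d\<nu>\<close> with \<open>A
= J (Q - z W)\<close>. The balance of \<open>u\<close> makes this the integral equation in which every atom at an end of the interval of integration
counts one half, and \<open>u\<close> extends to the regular endpoint 0 (\<open>canonical_representation\<close>, \<open>solution_extends\<close>,
\<open>gsol_is_solution\<close>). Three facts about this system give the theorem.

Let \<open>D(c, l)\<close> be the determinant at \<open>c-\<close> of the fundamental matrix which is the identity at 0. Liouville's formula
identifies \<open>D(c, l)\<close> with \<open>\<tau>(c, l)\<close> (\<open>liouville\<close>, \<open>tau_eq_fdet\<close>), and Lagrange's identity for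
the parameters \<open>l\<close> and \<open>cnj l\<close>, where the inner product drops out, gives \<open>D(c, l) cnj D(c, cnj l) = 1\<close>
(\<open>fdet_conjugate\<close>). Hence it suffices to show that \<open>D(c, l)\<close> or \<open>D(c, cnj l)\<close> tends to 0.

Suppose that all solutions at \<open>l\<close> have finite norm. By Lagrange's identity the brackets of any two of them converge as \<open>c\<close>
tends to \<open>b\<close>. The squared modulus of \<open>D(c, l)\<close> is minus the determinant of the Hermitian 2 by 2 matrix of the brackets of
the fundamental solutions, so it converges. If its limit is positive, then the brackets of the solutions at \<open>cnj l\<close>, which are conjugates
of solutions at \<open>l\<close> divided by \<open>D(c, l)\<close>, stay bounded, and Lagrange's identity bounds the norms of these solutions. So if
some solution at \<open>cnj l\<close> has infinite norm, then \<open>D(c, l)\<close> tends to 0 (\<open>det_dichotomy\<close>).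

It remains to see that different deficiency indices force this situation for \<open>l\<close> or for \<open>cnj l\<close>. There is always a
non-trivial solution of finite norm (\<open>weyl_solution\<close>). Hence if each of the two solution spaces contains solutions of infinite norm, then
the solutions of finite norm form a line in both, and if neither does, they are two-dimensional; in both cases the dimensions modulo
\<open>L_zero\<close> agree, because solutions of norm 0 solve the equation for every parameter (\<open>transfer_map\<close>). Since
\<open>n\<^sub>+\<close> and \<open>n\<^sub>-\<close> may be computed at any point of a half-plane, the indices are also compared for two parameters
\<open>z\<close>, \<open>k\<close> in one half-plane (\<open>limit_map\<close>). There \<open>z\<close> may belong to \<open>Lam\<close>, so that
initial value problems are of no use. Instead one decomposes a solution \<open>p\<close> at \<open>k\<close>, as far as its boundary values on a
compact interval are concerned, into a solution \<open>v\<close> at \<open>z\<close> and one at \<open>cnj z\<close> (von Neumann,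
\<open>bdry_decomposition\<close>), and lets the intervals grow. The norm of \<open>v\<close> is comparable to that of \<open>p\<close>, so the
\<open>v\<close> have a convergent subsequence. The single parameter \<open>l\<close> outside of \<open>Lam\<close> enters by unique solvability at
\<open>l\<close>: a solution at \<open>z\<close> vanishing at both ends has norm 0, hence is a solution at \<open>l\<close> and vanishes.\<close>

section \<open>The system in terms of densities\<close>

abbreviation Borel :: "('a::topological_space \<Rightarrow> 'b::topological_space) set" where "Borel \<equiv> borel_measurable borel"

lemmas bochner_cong = Bochner_Integration.integral_cong
lemmas component_norm_le = Finite_Cartesian_Product.norm_nth_le

lemma borel_measurable_vecI:
 fixes f :: "'a \<Rightarrow> 'b::euclidean_space^'n"
 assumes "\<And>i. (\<lambda>x. f x $ i) \<in> borel_measurable M"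
 shows "f \<in> borel_measurable M"
proof -
 have "(\<lambda>x. f x \<bullet> b) \<in> borel_measurable M" if b: "b \<in> Basis" for b
 proof -
  obtain i k where "b = axis i k" using b unfolding Basis_vec_def by blast
  then have "(\<lambda>x. f x \<bullet> b) = (\<lambda>x. f x $ i \<bullet> k)" by (simp add: inner_axis)
  then show ?thesis using assms[of i] by simp
 qed
 then show ?thesis using borel_measurable_euclidean_space by blast
qed

lemma borel_measurable_complex2I:
 fixes f :: "'a \<Rightarrow> complex^2"
 assumes "(\<lambda>x. f x $ 1) \<in> borel_measurable M" "(\<lambda>x. f x $ 2) \<in> borel_measurable M"
 shows "f \<in> borel_measurable M"
proof (rule borel_measurable_vecI)
 show "(\<lambda>x. f x $ i) \<in> borel_measurable M" for i using assms exhaust_2[of i] by auto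
qed

text \<open>The coefficient \<open>J (Q - z W)\<close> of the equation solved for the derivative, as \<open>J\<^sup>2 = -1\<close>.\<close>
definition gen :: "(real \<Rightarrow> complex^2^2) \<Rightarrow> (real \<Rightarrow> complex^2^2) \<Rightarrow> complex \<Rightarrow> real \<Rightarrow> complex^2^2" where
 "gen Q W z x = J ** (\<chi> j k. Q x $ j $ k - z * W x $ j $ k)"

lemma J_components [simp]: "J $ 1 $ 1 = 0" "J $ 1 $ 2 = -1" "J $ 2 $ 1 = 1" "J $ 2 $ 2 = 0"
 by (simp_all add: J_def)

lemma gen_components:
 "(gen Q W z x *v v) $ 1 = - ((Q x $ 2 $ 1 - z * W x $ 2 $ 1) * v $ 1 + (Q x $ 2 $ 2 - z * W x $ 2 $ 2) * v $ 2)"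
 "(gen Q W z x *v v) $ 2 = (Q x $ 1 $ 1 - z * W x $ 1 $ 1) * v $ 1 + (Q x $ 1 $ 2 - z * W x $ 1 $ 2) * v $ 2"
 by (simp_all add: gen_def matrix_vector_mult_def matrix_matrix_mult_def sum_2 algebra_simps)

lemma norm_complex2_le: "norm (v :: complex^2) \<le> norm (v $ 1) + norm (v $ 2)"
 using L2_set_le_sum[of UNIV "\<lambda>i. norm (v $ i)"] by (simp add: norm_vec_def sum_2)

text \<open>The equation in terms of densities. The measure \<open>\<nu>\<close> lives on all of the reals but is concentrated on \<open>ivl \<beta>\<close>;
in particular 0 is not an atom, and 0 may be used as an ordinary initial point. The bounds hold everywhere, not only almost
everywhere, so that the values at atoms are meaningful.\<close>
locale canonical_system =
 fixes \<nu> :: "real measure" and \<beta> :: ereal and Q W :: "real \<Rightarrow> complex^2^2" and K :: real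
 assumes sets_nu [measurable_cong, simp]: "sets \<nu> = sets borel"
  and null_outside: "emeasure \<nu> (- ivl \<beta>) = 0"
  and beta_pos: "0 < \<beta>"
  and finite_initial: "\<And>c. 0 \<le> c \<Longrightarrow> ereal c < \<beta> \<Longrightarrow> emeasure \<nu> {0..c} < \<infinity>"
  and Q_meas [measurable]: "\<And>j k. (\<lambda>x. Q x $ j $ k) \<in> Borel"
  and W_meas [measurable]: "\<And>j k. (\<lambda>x. W x $ j $ k) \<in> Borel"
  and Q_bound: "\<And>x j k. norm (Q x $ j $ k) \<le> K"
  and W_bound: "\<And>x j k. norm (W x $ j $ k) \<le> K"
  and Q_herm: "\<And>x. hermitian (Q x)"
  and W_nonneg: "\<And>x. nonneg_matrix (W x)"
begin

abbreviation mass :: "real set \<Rightarrow> real" where "mass \<equiv> measure \<nu>"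

abbreviation A :: "complex \<Rightarrow> real \<Rightarrow> complex^2^2" where "A \<equiv> gen Q W"

definition dom :: "real set" where "dom = {c. 0 \<le> c \<and> ereal c < \<beta>}"

lemma domD: "c \<in> dom \<Longrightarrow> 0 \<le> c" "c \<in> dom \<Longrightarrow> ereal c < \<beta>"
 by (auto simp: dom_def)

lemma zero_in_dom [simp]: "0 \<in> dom"
 using beta_pos by (auto simp: dom_def zero_ereal_def)

lemma dom_down: "c \<in> dom \<Longrightarrow> 0 \<le> s \<Longrightarrow> s \<le> c \<Longrightarrow> s \<in> dom"
 unfolding dom_def using le_less_trans[of "ereal s" "ereal c" \<beta>] by simp

lemma ivl_eq_dom: "ivl \<beta> = dom - {0}"
 by (auto simp: ivl_def dom_def zero_ereal_def)

lemma dom_increase: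
 assumes "c \<in> dom"
 shows "\<exists>c'\<in>dom. c < c'"
proof -
 obtain z where "ereal c < ereal z" "ereal z < \<beta>"
  using ereal_dense2[OF domD(2)[OF assms]] by blast
 then show ?thesis using domD(1)[OF assms] by (intro bexI[of _ z]) (auto simp: dom_def)
qed

lemma space_nu [simp]: "space \<nu> = UNIV"
 using sets_eq_imp_space_eq[OF sets_nu] by simp

lemma ivl_borel [measurable]: "ivl \<beta> \<in> sets borel"
 unfolding ivl_def by measurable

lemma dom_borel: "dom \<in> sets borel"
proof -
 have "dom = insert 0 (ivl \<beta>)" unfolding ivl_eq_dom by auto
 then show ?thesis using ivl_borel by (metis borel_singleton)
qed

lemma emeasure_finite: "E \<subseteq> {0..c} \<Longrightarrow> c \<in> dom \<Longrightarrow> emeasure \<nu> E < \<infinity>"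
 using emeasure_mono[of E "{0..c}" \<nu>] finite_initial[of c] by (auto simp: dom_def)

lemma nu_zero: "emeasure \<nu> {0} = 0"
proof -
 have "emeasure \<nu> {0} \<le> emeasure \<nu> (- ivl \<beta>)" 
  by (rule emeasure_mono) (auto simp: ivl_def)
 then show ?thesis by (simp add: null_outside)
qed

lemma measure_zero [simp]: "mass {0} = 0"
 by (simp add: measure_def nu_zero)

lemma dom_cofinal: "\<exists>c::nat \<Rightarrow> real. (\<forall>n. c n \<in> dom) \<and> (\<forall>d\<in>dom. \<exists>n. d \<le> c n)"
proof -
 define c where "c = from_nat_into {q \<in> \<rat>. q \<in> dom}"
 have ne: "{q \<in> \<rat>. q \<in> dom} \<noteq> {}" using zero_in_dom Rats_0 by blast
 have cnt: "countable {q \<in> \<rat>. q \<in> dom}" using countable_rat by (rule countable_subset[rotated]) auto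
 have r: "range c = {q \<in> \<rat>. q \<in> dom}" unfolding c_def by (rule range_from_nat_into[OF ne cnt])
 have "\<exists>n. d \<le> c n" if d: "d \<in> dom" for d
 proof -
  obtain e where e: "e \<in> dom" "d < e" using dom_increase[OF d] by blast
  obtain q where q: "q \<in> \<rat>" "d < q" "q < e" using Rats_dense_in_real[OF e(2)] by blast
  then have "q \<in> range c" unfolding r using dom_down[OF e(1), of q] domD(1)[OF d] by auto
  then obtain n where "q = c n" by blast
  then show ?thesis using q by (intro exI[of _ n]) simp
 qed
 moreover have "c n \<in> dom" for n using r by blast
 ultimately show ?thesis by blast
qed

lemma sigma_finite: "sigma_finite_measure \<nu>"
proof -
 obtain c :: "nat \<Rightarrow> real" where c: "\<And>n. c n \<in> dom" "\<And>d. d \<in> dom \<Longrightarrow> \<exists>n. d \<le> c n"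
  using dom_cofinal by blast
 show ?thesis
 proof
  show "\<exists>F. countable F \<and> F \<subseteq> sets \<nu> \<and> \<Union> F = space \<nu> \<and> (\<forall>a\<in>F. emeasure \<nu> a \<noteq> \<infinity>)"
  proof (intro exI conjI ballI)
   let ?F = "insert (- ivl \<beta>) (range (\<lambda>n. {0..c n}))"
   show "countable ?F" by simp
   show "?F \<subseteq> sets \<nu>" by (auto simp: sets_nu)
   show "\<Union> ?F = space \<nu>" using c by (auto simp: ivl_eq_dom) (metis domD(1))
   show "emeasure \<nu> a \<noteq> \<infinity>" if "a \<in> ?F" for a 
    using that emeasure_finite[OF order_refl c(1)] null_outside by (auto simp: less_top)
  qed
 qed
qed

lemma set_integrableI_bounded:
 fixes f :: "real \<Rightarrow> 'b::euclidean_space"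
 assumes "f \<in> Borel" "E \<in> sets borel" "E \<subseteq> {0..c}" "c \<in> dom"
  "\<And>x. x \<in> E \<Longrightarrow> norm (f x) \<le> B"
 shows "set_integrable \<nu> E f"
 unfolding set_integrable_def
proof (rule integrableI_bounded_set_indicator[where B=B])
 show "emeasure \<nu> E < \<infinity>" using emeasure_finite assms by blast
qed (use assms in auto)

lemma set_integral_norm_le:
 fixes f :: "real \<Rightarrow> 'b::euclidean_space"
 assumes "f \<in> Borel" "E \<in> sets borel" "E \<subseteq> {0..c}" "c \<in> dom"
  "\<And>x. x \<in> E \<Longrightarrow> norm (f x) \<le> B"
 shows "norm (LINT x:E|\<nu>. f x) \<le> B * mass E"
proof -
 have fin: "emeasure \<nu> E < \<infinity>" using emeasure_finite assms by blast
 have i: "set_integrable \<nu> E f" using set_integrableI_bounded assms by metis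
 have "norm (LINT x:E|\<nu>. f x) \<le> (LINT x:E|\<nu>. norm (f x))"
  using i by (rule set_integral_norm_bound)
 also have "\<dots> \<le> (LINT x:E|\<nu>. B)"
  using i assms fin by (intro set_integral_mono set_integrable_norm) 
   (auto simp: set_integrable_def integrable_real_indicator)
 also have "\<dots> = B * mass E"
  using fin assms by (simp add: set_lebesgue_integral_def)
 finally show ?thesis .
qed

text \<open>The integral from \<open>s\<close> to \<open>t\<close> in which atoms at the two endpoints are counted with weight one half. A function
\<open>t \<mapsto> u s + hint f s t\<close> is balanced, and these integrals are additive in the interval.\<close>
definition hint :: "(real \<Rightarrow> 'b::euclidean_space) \<Rightarrow> real \<Rightarrow> real \<Rightarrow> 'b" where
 "hint f s t = (1/2) *\<^sub>R ((LINT x:{s..<t}|\<nu>. f x) + (LINT x:{s<..t}|\<nu>. f x))"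

lemma hint_refl [simp]: "hint f s s = 0"
 by (simp add: hint_def set_lebesgue_integral_def)

lemma hint_cong: "(\<And>x. x \<in> {s..t} \<Longrightarrow> f x = g x) \<Longrightarrow> hint f s t = hint g s t"
 unfolding hint_def by (rule arg_cong2[where f="\<lambda>a b. (1/2) *\<^sub>R (a + b)"]; rule set_lebesgue_integral_cong) auto

lemma hint_cong_AE: "f \<in> Borel \<Longrightarrow> g \<in> Borel \<Longrightarrow>
  (AE x in \<nu>. x \<in> {s..t} \<longrightarrow> f x = g x) \<Longrightarrow> hint f s t = hint g s t"
 unfolding hint_def by (rule arg_cong2[where f="\<lambda>a b. (1/2) *\<^sub>R (a + b)"]; rule set_lebesgue_integral_cong_AE) auto

lemma hint_add:
 fixes f :: "real \<Rightarrow> 'b::euclidean_space"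
 assumes m: "f \<in> Borel" and b: "\<And>x. x \<in> {s..r} \<Longrightarrow> norm (f x) \<le> B"
  and "0 \<le> s" "s \<le> t" "t \<le> r" "r \<in> dom"
 shows "hint f s r = hint f s t + hint f t r"
proof -
 have i: "set_integrable \<nu> E f" if "E \<in> sets borel" "E \<subseteq> {s..r}" for E
  using set_integrableI_bounded[OF m that(1) _ \<open>r \<in> dom\<close>, of B] b that assms(3) by force
 have 1: "(LINT x:{s..<r}|\<nu>. f x) = (LINT x:{s..<t}|\<nu>. f x) + (LINT x:{t..<r}|\<nu>. f x)"
  using assms by (subst set_integral_Un[symmetric]) (auto intro!: i simp: ivl_disj_un)
 have 2: "(LINT x:{s<..r}|\<nu>. f x) = (LINT x:{s<..t}|\<nu>. f x) + (LINT x:{t<..r}|\<nu>. f x)"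
  using assms by (subst set_integral_Un[symmetric]) (auto intro!: i simp: ivl_disj_un)
 show ?thesis by (simp add: hint_def 1 2 algebra_simps)
qed

lemma hint_linear:
 fixes f g :: "real \<Rightarrow> 'b::euclidean_space"
 assumes "f \<in> Borel" "\<And>x. x \<in> {s..t} \<Longrightarrow> norm (f x) \<le> B"
  and "g \<in> Borel" "\<And>x. x \<in> {s..t} \<Longrightarrow> norm (g x) \<le> B'"
  and "0 \<le> s" "t \<in> dom"
 shows "hint (\<lambda>x. f x + g x) s t = hint f s t + hint g s t"
  and "hint (\<lambda>x. f x - g x) s t = hint f s t - hint g s t"
proof -
 have i: "set_integrable \<nu> E f" if "E \<in> sets borel" "E \<subseteq> {s..t}" for E
  using set_integrableI_bounded[OF assms(1) that(1) _ \<open>t \<in> dom\<close>, of B] assms that by force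
 have j: "set_integrable \<nu> E g" if "E \<in> sets borel" "E \<subseteq> {s..t}" for E
  using set_integrableI_bounded[OF assms(3) that(1) _ \<open>t \<in> dom\<close>, of B'] assms that by force
 show "hint (\<lambda>x. f x + g x) s t = hint f s t + hint g s t"
  unfolding hint_def using assms
  by (subst set_integral_add, (auto intro!: i j)[2])+ (simp add: algebra_simps)
 show "hint (\<lambda>x. f x - g x) s t = hint f s t - hint g s t"
  unfolding hint_def using assms
  by (subst set_integral_diff, (auto intro!: i j)[2])+ (simp add: algebra_simps)
qed

lemma hint_bounded_linear:
 fixes f :: "real \<Rightarrow> 'b::euclidean_space" and T :: "'b \<Rightarrow> 'c::euclidean_space"
 assumes "bounded_linear T" "f \<in> Borel" "\<And>x. x \<in> {s..t} \<Longrightarrow> norm (f x) \<le> B"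
  and "0 \<le> s" "t \<in> dom"
 shows "hint (\<lambda>x. T (f x)) s t = T (hint f s t)"
proof -
 interpret bounded_linear T by fact
 have i: "set_integrable \<nu> E f" if "E \<in> sets borel" "E \<subseteq> {s..t}" for E
  using set_integrableI_bounded[OF assms(2) that(1) _ \<open>t \<in> dom\<close>, of B] assms that by force
 have *: "(LINT x:E|\<nu>. T (f x)) = T (LINT x:E|\<nu>. f x)" if "E \<in> sets borel" "E \<subseteq> {s..t}" for E
  using integral_bounded_linear[OF assms(1) i[OF that, unfolded set_integrable_def]]
  by (simp add: set_lebesgue_integral_def scaleR)
 show ?thesis unfolding hint_def by (subst *, auto)+ (simp add: scaleR add)
qed

lemma hint_bound:
 fixes f :: "real \<Rightarrow> 'b::euclidean_space"
 assumes m: "f \<in> Borel" and b: "\<And>x. x \<in> {s..t} \<Longrightarrow> norm (f x) \<le> B"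
  and z: "\<And>x. x \<in> {s..t} \<Longrightarrow> x \<notin> E \<Longrightarrow> f x = 0" and E: "E \<in> sets borel" "E \<subseteq> {s..t}" "0 \<le> B"
  and "0 \<le> s" "t \<in> dom"
 shows "norm (hint f s t) \<le> B * mass E"
proof -
 have *: "norm (LINT x:F|\<nu>. f x) \<le> B * mass E" if F: "F \<in> sets borel" "F \<subseteq> {s..t}" for F
 proof -
  have "(LINT x:F|\<nu>. f x) = (LINT x:F \<inter> E|\<nu>. f x)"
   unfolding set_lebesgue_integral_def using z F E
   by (intro bochner_cong) (auto simp: indicator_def subset_iff)
  also have "norm \<dots> \<le> B * mass (F \<inter> E)"
   using assms that by (intro set_integral_norm_le[where c=t]) force+
  also have "\<dots> \<le> B * mass E"
  proof (intro mult_left_mono \<open>0 \<le> B\<close> measure_mono_fmeasurable)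
   show "E \<in> fmeasurable \<nu>" using emeasure_finite[of E t] assms by (intro fmeasurableI) force+
  qed (use F E in auto)
  finally show ?thesis .
 qed
 have "norm (hint f s t) \<le> (1/2) * (norm (LINT x:{s..<t}|\<nu>. f x) + norm (LINT x:{s<..t}|\<nu>. f x))"
  unfolding hint_def by (simp add: norm_triangle_ineq)
 also have "\<dots> \<le> (1/2) * (B * mass E + B * mass E)"
  by (intro mult_left_mono add_mono *) auto
 finally show ?thesis by simp
qed

lemma set_integral_param_measurable:
 fixes f :: "real \<Rightarrow> 'b::euclidean_space"
 assumes [measurable]: "f \<in> Borel" and E: "Measurable.pred (borel \<Otimes>\<^sub>M borel) (\<lambda>p::real\<times>real. snd p \<in> E (fst p))"
 shows "(\<lambda>t. LINT x:E t|\<nu>. f x) \<in> Borel"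
proof -
 interpret sigma_finite_measure \<nu> by (rule sigma_finite)
 have E': "Measurable.pred (borel \<Otimes>\<^sub>M \<nu>) (\<lambda>p::real\<times>real. snd p \<in> E (fst p))"
  using E by simp
 have "(\<lambda>p::real\<times>real. if snd p \<in> E (fst p) then f (snd p) else 0) \<in> borel_measurable (borel \<Otimes>\<^sub>M \<nu>)"
  using E' by measurable
 then have "(\<lambda>t. \<integral>x. (if x \<in> E t then f x else 0) \<partial>\<nu>) \<in> Borel"
  by (intro borel_measurable_lebesgue_integral) (simp add: case_prod_beta')
 moreover have "(\<integral>x. (if x \<in> E t then f x else 0) \<partial>\<nu>) = (LINT x:E t|\<nu>. f x)" for t
  unfolding set_lebesgue_integral_def by (intro bochner_cong) (auto simp: indicator_def)
 ultimately show ?thesis by simp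
qed

lemma hint_measurable:
 fixes f :: "real \<Rightarrow> 'b::euclidean_space"
 assumes [measurable]: "f \<in> Borel"
 shows "(\<lambda>t. hint f s t) \<in> Borel" "(\<lambda>t. hint f t s) \<in> Borel"
 unfolding hint_def
 by (intro borel_measurable_scaleR borel_measurable_add set_integral_param_measurable borel_measurable_const assms; simp)+

end

section \<open>The product rule and solutions of the integral equation\<close>

lemma vec_nth_measurable [measurable]:
 fixes f :: "'a \<Rightarrow> complex^2"
 assumes "f \<in> borel_measurable M"
 shows "(\<lambda>x. f x $ i) \<in> borel_measurable M"
 using borel_measurable_continuous_onI[of "\<lambda>v :: complex^2. v $ i"] assms
 by (rule measurable_compose[rotated]) (intro continuous_intros)

text \<open>Fubini's theorem for \<open>f(x) g(y)\<close> on the square, split along the diagonal: the diagonal, which has positive mass if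
\<open>\<mu>\<close> has atoms, is shared equally between the two triangles. This is where balanced functions make
the product rule free of jump terms.\<close>
lemma balanced_integral_product:
 fixes f g :: "real \<Rightarrow> complex" and \<mu> :: "real measure"
 assumes fin: "finite_measure \<mu>" and sets [measurable_cong, simp]: "sets \<mu> = sets borel"
  and f: "integrable \<mu> f" and g: "integrable \<mu> g"
 shows "(\<integral>x. f x \<partial>\<mu>) * (\<integral>x. g x \<partial>\<mu>) =
  (\<integral>x. f x * ((1/2) *\<^sub>R ((LINT y:{..<x}|\<mu>. g y) + (LINT y:{..x}|\<mu>. g y))) \<partial>\<mu>) +
  (\<integral>x. ((1/2) *\<^sub>R ((LINT y:{..<x}|\<mu>. f y) + (LINT y:{..x}|\<mu>. f y))) * g x \<partial>\<mu>)"
proof -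
 interpret finite_measure \<mu> by fact
 interpret pair_sigma_finite \<mu> \<mu> ..
 define h :: "real \<Rightarrow> real \<Rightarrow> real" where "h x y = (if y < x then 1 else if y = x then 1/2 else 0)" for x y
 have [measurable]: "f \<in> borel_measurable \<mu>" "g \<in> borel_measurable \<mu>" using f g by auto
 have [measurable]: "(\<lambda>(x, y). h x y) \<in> borel_measurable (\<mu> \<Otimes>\<^sub>M \<mu>)"
  unfolding h_def by measurable
 have hint: "(1/2) *\<^sub>R ((LINT y:{..<x}|\<mu>. k y) + (LINT y:{..x}|\<mu>. k y)) = (\<integral>y. h x y *\<^sub>R k y \<partial>\<mu>)"
  if k: "integrable \<mu> k" for k :: "real \<Rightarrow> complex" and x
 proof -
  have "(LINT y:{..<x}|\<mu>. k y) + (LINT y:{..x}|\<mu>. k y) = (\<integral>y. indicat_real {..<x} y *\<^sub>R k y + indicat_real {..x} y *\<^sub>R k y \<partial>\<mu>)"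
   unfolding set_lebesgue_integral_def using k
   by (subst Bochner_Integration.integral_add) (auto intro: integrable_mult_indicator)
  then have "(1/2) *\<^sub>R ((LINT y:{..<x}|\<mu>. k y) + (LINT y:{..x}|\<mu>. k y)) =
    (\<integral>y. (1/2) *\<^sub>R (indicat_real {..<x} y *\<^sub>R k y + indicat_real {..x} y *\<^sub>R k y) \<partial>\<mu>)" by simp
  also have "\<dots> = (\<integral>y. h x y *\<^sub>R k y \<partial>\<mu>)"
   by (intro bochner_cong) (auto simp: h_def indicator_def scaleR_conv_of_real)
  finally show ?thesis .
 qed
 have prod: "integrable (\<mu> \<Otimes>\<^sub>M \<mu>) (\<lambda>(x, y). norm (f x) * norm (g y))"
 proof (rule Fubini_integrable)
  show "integrable \<mu> (\<lambda>x. \<integral>y. norm (case (x, y) of (x, y) \<Rightarrow> norm (f x) * norm (g y)) \<partial>\<mu>)"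
   using f g by simp
 qed (use g in simp_all)
 have int_prod: "integrable (\<mu> \<Otimes>\<^sub>M \<mu>) (\<lambda>(x, y). h x y *\<^sub>R (f x * g y))"
  by (rule Bochner_Integration.integrable_bound[OF prod]) (auto simp: h_def norm_mult)
 have int_prod': "integrable (\<mu> \<Otimes>\<^sub>M \<mu>) (\<lambda>(x, y). h y x *\<^sub>R (f x * g y))"
  by (rule Bochner_Integration.integrable_bound[OF prod]) (auto simp: h_def norm_mult)
 have 1: "(\<integral>x. f x * (\<integral>y. h x y *\<^sub>R g y \<partial>\<mu>) \<partial>\<mu>) = (\<integral>x. \<integral>y. h x y *\<^sub>R (f x * g y) \<partial>\<mu> \<partial>\<mu>)"
  by (intro bochner_cong refl) (simp flip: integral_mult_right_zero)
 have "(\<integral>y. (\<integral>x. h y x *\<^sub>R f x \<partial>\<mu>) * g y \<partial>\<mu>) = (\<integral>y. \<integral>x. h y x *\<^sub>R (f x * g y) \<partial>\<mu> \<partial>\<mu>)"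
  by (intro bochner_cong refl) (simp flip: integral_mult_left_zero)
 also have "\<dots> = (\<integral>x. \<integral>y. h y x *\<^sub>R (f x * g y) \<partial>\<mu> \<partial>\<mu>)"
  using Fubini_integral[OF int_prod'] by simp
 finally have 2: "(\<integral>y. (\<integral>x. h y x *\<^sub>R f x \<partial>\<mu>) * g y \<partial>\<mu>) = \<dots>" .
 have "(\<integral>x. \<integral>y. h x y *\<^sub>R (f x * g y) \<partial>\<mu> \<partial>\<mu>) + (\<integral>x. \<integral>y. h y x *\<^sub>R (f x * g y) \<partial>\<mu> \<partial>\<mu>)
  = (\<integral>p. (case p of (x, y) \<Rightarrow> h x y *\<^sub>R (f x * g y)) \<partial>(\<mu> \<Otimes>\<^sub>M \<mu>)) + (\<integral>p. (case p of (x, y) \<Rightarrow> h y x *\<^sub>R (f x * g y)) \<partial>(\<mu> \<Otimes>\<^sub>M \<mu>))"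
  using integral_fst[OF int_prod] integral_fst[OF int_prod'] by simp
 also have "\<dots> = (\<integral>p. (case p of (x, y) \<Rightarrow> f x * g y) \<partial>(\<mu> \<Otimes>\<^sub>M \<mu>))"
  using int_prod int_prod'
  by (subst Bochner_Integration.integral_add[symmetric], simp, simp, intro bochner_cong)
    (auto simp: h_def algebra_simps simp flip: scaleR_add_left)
 also have "\<dots> = (\<integral>x. \<integral>y. f x * g y \<partial>\<mu> \<partial>\<mu>)"
 proof -
  have "integrable (\<mu> \<Otimes>\<^sub>M \<mu>) (\<lambda>(x, y). f x * g y)"
   by (rule Bochner_Integration.integrable_bound[OF prod]) (auto simp: norm_mult)
  from integral_fst[OF this] show ?thesis by simp
 qed
 also have "\<dots> = (\<integral>x. f x \<partial>\<mu>) * (\<integral>x. g x \<partial>\<mu>)" by simp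
 finally show ?thesis using 1 2 by (simp add: hint[OF f] hint[OF g])
qed

context canonical_system begin

lemma hint_from_zero:
 fixes f :: "real \<Rightarrow> 'b::euclidean_space"
 assumes "f \<in> Borel"
 shows "hint f 0 x = (1/2) *\<^sub>R ((LINT y:{0..<x}|\<nu>. f y) + (LINT y:{0..x}|\<nu>. f y))"
proof -
 have "AE y in \<nu>. y \<noteq> 0" using nu_zero by (intro AE_I[where N="{0}"]) auto
 then have "(LINT y:{0<..x}|\<nu>. f y) = (LINT y:{0..x}|\<nu>. f y)"
  unfolding set_lebesgue_integral_def using assms
  by (intro integral_cong_AE) (auto elim!: eventually_mono simp: indicator_def)
 then show ?thesis by (simp add: hint_def)
qed

text \<open>Integration by parts for balanced primitives; the values on the left are the left limits at \<open>c\<close>.\<close>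
lemma balanced_product_rule:
 fixes f g :: "real \<Rightarrow> complex"
 assumes c: "c \<in> dom" and f: "f \<in> Borel" "\<And>x. x \<in> {0..c} \<Longrightarrow> norm (f x) \<le> B"
  and g: "g \<in> Borel" "\<And>x. x \<in> {0..c} \<Longrightarrow> norm (g x) \<le> B'"
  and F: "\<And>x. x \<in> {0..<c} \<Longrightarrow> F x = F0 + hint f 0 x" and G: "\<And>x. x \<in> {0..<c} \<Longrightarrow> G x = G0 + hint g 0 x"
 shows "(F0 + (LINT x:{0..<c}|\<nu>. f x)) * (G0 + (LINT x:{0..<c}|\<nu>. g x)) =
  F0 * G0 + (LINT x:{0..<c}|\<nu>. f x * G x + F x * g x)"
proof -
 define \<mu> where "\<mu> = density \<nu> (\<lambda>x. ennreal (indicat_real {0..<c} x))"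
 have sets: "sets \<mu> = sets borel" by (simp add: \<mu>_def)
 have ind: "(\<lambda>x. ennreal (indicat_real {0..<c} x)) = indicator {0..<c}"
  by (auto simp: fun_eq_iff indicator_def)
 have fin: "finite_measure \<mu>"
 proof
  show "emeasure \<mu> (space \<mu>) \<noteq> \<infinity>"
   using emeasure_finite[of "{0..<c}" c] c atLeastLessThan_subseteq_atLeastAtMost_iff[of 0 c 0 c]
   by (simp add: \<mu>_def ind emeasure_density nn_integral_indicator less_top)
 qed
 have si: "set_integrable \<nu> {0..<c} k" if "k \<in> Borel" "\<And>x. x \<in> {0..c} \<Longrightarrow> norm (k x) \<le> D" for k :: "real \<Rightarrow> complex" and D
  using that c by (intro set_integrableI_bounded[where c=c and B=D]) auto
 have conv: "(\<integral>x. k x \<partial>\<mu>) = (LINT x:{0..<c}|\<nu>. k x)" if "k \<in> Borel" for k :: "real \<Rightarrow> complex"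
  unfolding \<mu>_def set_lebesgue_integral_def using that by (subst integral_density) auto
 have convi: "integrable \<mu> k \<longleftrightarrow> set_integrable \<nu> {0..<c} k" if "k \<in> Borel" for k :: "real \<Rightarrow> complex"
  unfolding \<mu>_def set_integrable_def using that by (subst integrable_density) auto
 have half: "(1/2) *\<^sub>R ((LINT y:{..<x}|\<mu>. k y) + (LINT y:{..x}|\<mu>. k y)) = hint k 0 x"
  if k: "k \<in> Borel" and x: "x \<in> {0..<c}" for k :: "real \<Rightarrow> complex" and x
 proof -
  have "(LINT y:E|\<mu>. k y) = (LINT y:(E \<inter> {0..<c})|\<nu>. k y)" if [measurable]: "E \<in> sets borel" for E
   unfolding set_lebesgue_integral_def using conv[of "\<lambda>y. indicat_real E y *\<^sub>R k y"] k
   by (simp add: set_lebesgue_integral_def indicator_inter_arith mult.commute)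
  moreover have "{..<x} \<inter> {0..<c} = {0..<x}" "{..x} \<inter> {0..<c} = {0..x}" using x by auto
  ultimately show ?thesis using hint_from_zero[OF k] by simp
 qed
 have FB: "set_integrable \<nu> {0..<c} (\<lambda>x. hint k 0 x * m x)" 
  if k: "k \<in> Borel" "\<And>x. x \<in> {0..c} \<Longrightarrow> norm (k x) \<le> D" and 
    m: "m \<in> Borel" "\<And>x. x \<in> {0..c} \<Longrightarrow> norm (m x) \<le> D'" for k m :: "real \<Rightarrow> complex" and D D'
 proof (rule set_integrableI_bounded[where c=c])
  note [measurable] = hint_measurable[OF k(1)] m(1)
  show "(\<lambda>x. hint k 0 x * m x) \<in> Borel" by measurable
  show "norm (hint k 0 x * m x) \<le> (\<bar>D\<bar> * mass {0..c}) * \<bar>D'\<bar>" if x: "x \<in> {0..<c}" for x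
  proof -
   have "norm (hint k 0 x) \<le> \<bar>D\<bar> * mass {0..x}"
    using k x c dom_down[OF c] by (intro hint_bound) force+
   also have "\<dots> \<le> \<bar>D\<bar> * mass {0..c}"
    using x emeasure_finite[of "{0..c}" c] c by (intro mult_left_mono measure_mono_fmeasurable fmeasurableI) auto
   finally show ?thesis unfolding norm_mult using m(2)[of x] x by (intro mult_mono) auto
  qed
 qed (use c in auto)
 let ?I = "\<lambda>k. (LINT x:{0..<c}|\<nu>. k x)"
 have "?I f * ?I g = ?I (\<lambda>x. f x * hint g 0 x) + ?I (\<lambda>x. hint f 0 x * g x)"
 proof -
  note [measurable] = f(1) g(1) hint_measurable[OF f(1)] hint_measurable[OF g(1)]
  have 1: "?I (\<lambda>x. f x * hint g 0 x) = ?I (\<lambda>x. f x * ((1/2) *\<^sub>R ((LINT y:{..<x}|\<mu>. g y) + (LINT y:{..x}|\<mu>. g y))))"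
   using half[OF g(1)] by (intro set_lebesgue_integral_cong) auto
  have 2: "?I (\<lambda>x. hint f 0 x * g x) = ?I (\<lambda>x. ((1/2) *\<^sub>R ((LINT y:{..<x}|\<mu>. f y) + (LINT y:{..x}|\<mu>. f y))) * g x)"
   using half[OF f(1)] by (intro set_lebesgue_integral_cong) auto
  have m: "(\<lambda>x. (1/2) *\<^sub>R ((LINT y:{..<x}|\<mu>. k y) + (LINT y:{..x}|\<mu>. k y))) \<in> Borel"
   if [measurable]: "k \<in> Borel" for k :: "real \<Rightarrow> complex"
  proof -
   have "(\<lambda>x. (LINT y:E x|\<mu>. k y)) \<in> Borel" 
    if E: "Measurable.pred (borel \<Otimes>\<^sub>M borel) (\<lambda>p::real\<times>real. snd p \<in> E (fst p))" for E :: "real \<Rightarrow> real set"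
   proof -
    have [measurable]: "E x \<in> sets borel" for x 
     using measurable_compose[OF _ E, of "\<lambda>y. (x, y)" borel] by (simp add: pred_def)
    have "(LINT y:E x|\<mu>. k y) = (LINT y:E x|\<nu>. indicator {0..<c} y *\<^sub>R k y)" for x
     unfolding set_lebesgue_integral_def using conv[of "\<lambda>y. indicat_real (E x) y *\<^sub>R k y"]
     by (simp add: set_lebesgue_integral_def mult.commute)
    then show ?thesis using set_integral_param_measurable[OF _ E, of "\<lambda>y. indicator {0..<c} y *\<^sub>R k y"] by simp
   qed
   then show ?thesis by (intro borel_measurable_scaleR borel_measurable_add borel_measurable_const) simp_all
  qed
  note [measurable] = m[OF f(1)] m[OF g(1)]
  have 3: "(\<integral>x. f x * ((1/2) *\<^sub>R ((LINT y:{..<x}|\<mu>. g y) + (LINT y:{..x}|\<mu>. g y))) \<partial>\<mu>) = ?I (\<lambda>x. f x * hint g 0 x)"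
   unfolding 1 by (rule conv) measurable
  have 4: "(\<integral>x. ((1/2) *\<^sub>R ((LINT y:{..<x}|\<mu>. f y) + (LINT y:{..x}|\<mu>. f y))) * g x \<partial>\<mu>) = ?I (\<lambda>x. hint f 0 x * g x)"
   unfolding 2 by (rule conv) measurable
  have "integrable \<mu> f" "integrable \<mu> g" using convi[OF f(1)] convi[OF g(1)] si[OF f] si[OF g] by auto
  from balanced_integral_product[OF fin sets this] show ?thesis
   unfolding conv[OF f(1)] conv[OF g(1)] 3 4 .
 qed
 moreover have "?I (\<lambda>x. f x * G x + F x * g x) = ?I (\<lambda>x. (G0 * f x + hint g 0 x * f x) + (F0 * g x + hint f 0 x * g x))"
  using F G by (intro set_lebesgue_integral_cong) (auto simp: algebra_simps)
 moreover have "\<dots> = (?I (\<lambda>x. G0 * f x) + ?I (\<lambda>x. hint g 0 x * f x)) + (?I (\<lambda>x. F0 * g x) + ?I (\<lambda>x. hint f 0 x * g x))"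
  using si[OF f] si[OF g] FB[OF f g] FB[OF g f]
  by (subst set_integral_add; (intro set_integral_add)?; simp)+
 ultimately show ?thesis by (simp add: algebra_simps)
qed

text \<open>A bound for the operator norm of the coefficient (lemma \<open>gen_norm_le\<close>).\<close>
definition C_gen :: "complex \<Rightarrow> real" where "C_gen z = 4 * (K * (1 + norm z))"

lemma K_nonneg: "0 \<le> K"
 using norm_ge_zero Q_bound order_trans by blast

lemma C_gen_nonneg: "0 \<le> C_gen z"
 using K_nonneg by (simp add: C_gen_def)

lemma entry_bound: "norm (Q x $ j $ k - z * W x $ j $ k) \<le> K * (1 + norm z)"
proof -
 have "norm (Q x $ j $ k - z * W x $ j $ k) \<le> norm (Q x $ j $ k) + norm z * norm (W x $ j $ k)"
  by (metis norm_mult norm_triangle_ineq4)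
 also have "\<dots> \<le> K + norm z * K"
  by (intro add_mono mult_left_mono Q_bound W_bound) simp
 finally show ?thesis by (simp add: algebra_simps)
qed

lemma gen_norm_le: "norm (A z x *v v) \<le> C_gen z * norm v"
proof -
 let ?B = "K * (1 + norm z)"
 have *: "norm ((Q x $ j $ k - z * W x $ j $ k) * v $ k) \<le> ?B * norm v" for j k
  unfolding norm_mult by (intro mult_mono' entry_bound component_norm_le) auto
 have 1: "norm ((A z x *v v) $ 1) \<le> 2 * (?B * norm v)"
  unfolding gen_components norm_minus_cancel mult_2
  by (rule order_trans[OF norm_triangle_ineq add_mono[OF *[of 2 1] *[of 2 2]]])
 have 2: "norm ((A z x *v v) $ 2) \<le> 2 * (?B * norm v)"
  unfolding gen_components mult_2
  by (rule order_trans[OF norm_triangle_ineq add_mono[OF *[of 1 1] *[of 1 2]]])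
 from 1 2 norm_complex2_le[of "A z x *v v"] show ?thesis by (simp add: C_gen_def)
qed

lemma gen_bounded_linear: "bounded_linear ((*v) (A z x))"
proof (rule bounded_linear_intro[where K="C_gen z"])
 show "A z x *v (r *\<^sub>R v) = r *\<^sub>R (A z x *v v)" for r v
  by (simp add: vec_eq_iff forall_2 gen_components algebra_simps)
qed (use gen_norm_le in \<open>auto simp: mult.commute matrix_vector_right_distrib\<close>)

lemma gen_measurable:
 assumes [measurable]: "u \<in> Borel"
 shows "(\<lambda>x. A z x *v u x) \<in> Borel"
 by (rule borel_measurable_complex2I; simp only: gen_components; measurable)

text \<open>Solutions on \<open>[s, t]\<close>. Both ends carry balanced values, so solutions on adjacent intervals with a common value can be
glued and restrictions are solutions, also when the cut is an atom.\<close>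
definition sol :: "complex \<Rightarrow> real \<Rightarrow> real \<Rightarrow> (real \<Rightarrow> complex^2) \<Rightarrow> bool" where
 "sol z s t u \<longleftrightarrow> u \<in> Borel \<and> (\<exists>B. \<forall>x\<in>{s..t}. norm (u x) \<le> B) \<and>
   (\<forall>x\<in>{s..t}. u x = u s + hint (\<lambda>y. A z y *v u y) s x)"

lemma sol_meas: "sol z s t u \<Longrightarrow> u \<in> Borel"
 unfolding sol_def by (rule conjunct1)

lemma sol_bounded: "sol z s t u \<Longrightarrow> \<exists>B. \<forall>x\<in>{s..t}. norm (u x) \<le> B"
 unfolding sol_def by (elim conjE)

lemma sol_eq: "sol z s t u \<Longrightarrow> x \<in> {s..t} \<Longrightarrow> u x = u s + hint (\<lambda>y. A z y *v u y) s x"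
 unfolding sol_def by (elim conjE) (rule bspec)

lemma sol_gen_bounded:
 assumes "sol z s t u"
 obtains B where "0 \<le> B" "\<And>x. x \<in> {s..t} \<Longrightarrow> norm (u x) \<le> B" "\<And>x. x \<in> {s..t} \<Longrightarrow> norm (A z x *v u x) \<le> B"
proof -
 obtain B where "\<forall>x\<in>{s..t}. norm (u x) \<le> B" using sol_bounded[OF assms] by blast
 then have B: "\<And>x. x \<in> {s..t} \<Longrightarrow> norm (u x) \<le> B" by blast
 have "norm (u x) \<le> max \<bar>B\<bar> (C_gen z * \<bar>B\<bar>)" "norm (A z x *v u x) \<le> max \<bar>B\<bar> (C_gen z * \<bar>B\<bar>)" if "x \<in> {s..t}" for x
 proof -
  have 1: "norm (u x) \<le> \<bar>B\<bar>" using B[OF that] by linarith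
  then show "norm (u x) \<le> max \<bar>B\<bar> (C_gen z * \<bar>B\<bar>)" by simp
  have "norm (A z x *v u x) \<le> C_gen z * \<bar>B\<bar>"
   by (rule order_trans[OF gen_norm_le mult_left_mono[OF 1 C_gen_nonneg]])
  then show "norm (A z x *v u x) \<le> max \<bar>B\<bar> (C_gen z * \<bar>B\<bar>)" by simp
 qed
 then show ?thesis by (intro that[of "max \<bar>B\<bar> (C_gen z * \<bar>B\<bar>)"]) auto
qed

lemma sol_increment:
 assumes u: "sol z s t u" and "0 \<le> s" "s \<le> x" "x \<le> y" "y \<le> t" "t \<in> dom"
 shows "u y - u x = hint (\<lambda>y. A z y *v u y) x y"
proof -
 obtain B where B: "\<And>x. x \<in> {s..t} \<Longrightarrow> norm (A z x *v u x) \<le> B" using sol_gen_bounded[OF u] by metis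
 have "hint (\<lambda>y. A z y *v u y) s y = hint (\<lambda>y. A z y *v u y) s x + hint (\<lambda>y. A z y *v u y) x y"
  using assms B dom_down[OF \<open>t \<in> dom\<close>, of y]
  by (intro hint_add[where B=B] gen_measurable sol_meas[OF u]) auto
 moreover have "u x = u s + hint (\<lambda>y. A z y *v u y) s x" "u y = u s + hint (\<lambda>y. A z y *v u y) s y"
  using assms by (auto intro!: sol_eq[OF u])
 ultimately show ?thesis by (simp add: algebra_simps)
qed

lemma sol_restrict:
 assumes u: "sol z s t u" and "0 \<le> s" "s \<le> s'" "t' \<le> t" "t \<in> dom"
 shows "sol z s' t' u"
 unfolding sol_def
proof (intro conjI ballI)
 show "u x = u s' + hint (\<lambda>y. A z y *v u y) s' x" if "x \<in> {s'..t'}" for x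
  using sol_increment[OF u \<open>0 \<le> s\<close> \<open>s \<le> s'\<close>, of x] that assms by (auto simp: diff_eq_eq add.commute)
next
 show "\<exists>B. \<forall>x\<in>{s'..t'}. norm (u x) \<le> B" using sol_bounded[OF u] assms by (meson atLeastAtMost_iff order_trans)
qed (rule sol_meas[OF u])

lemma sol_glue:
 assumes u: "sol z s m u" and v: "sol z m t v" and "u m = v m" and "0 \<le> s" "s \<le> m" "m \<le> t" "t \<in> dom"
 shows "sol z s t (\<lambda>x. if x \<le> m then u x else v x)"
 unfolding sol_def
proof (intro conjI ballI)
 let ?w = "\<lambda>x. if x \<le> m then u x else v x"
 note [measurable] = sol_meas[OF u] sol_meas[OF v]
 show meas: "?w \<in> Borel" by measurable
 obtain B where B: "0 \<le> B" "\<And>x. x \<in> {s..m} \<Longrightarrow> norm (u x) \<le> B" "\<And>x. x \<in> {s..m} \<Longrightarrow> norm (A z x *v u x) \<le> B" using sol_gen_bounded[OF u] by metis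
 obtain B' where B': "0 \<le> B'" "\<And>x. x \<in> {m..t} \<Longrightarrow> norm (v x) \<le> B'" "\<And>x. x \<in> {m..t} \<Longrightarrow> norm (A z x *v v x) \<le> B'" using sol_gen_bounded[OF v] by metis
 show "\<exists>B. \<forall>x\<in>{s..t}. norm (?w x) \<le> B"
 proof (intro exI[of _ "B + B'"] ballI)
  fix x assume "x \<in> {s..t}"
  then show "norm (?w x) \<le> B + B'" using B(2)[of x] B'(2)[of x] B(1) B'(1) by auto
 qed
 have bA: "norm (A z x *v ?w x) \<le> B + B'" if "x \<in> {s..t}" for x
  using B(3)[of x] B'(3)[of x] B(1) B'(1) that by auto
 show "?w x = ?w s + hint (\<lambda>y. A z y *v ?w y) s x" if x: "x \<in> {s..t}" for x
 proof (cases "x \<le> m")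
  case True
  have "hint (\<lambda>y. A z y *v ?w y) s x = hint (\<lambda>y. A z y *v u y) s x"
   using True by (intro hint_cong) auto
  then show ?thesis using sol_eq[OF u, of x] x True \<open>s \<le> m\<close> by simp
 next
  case False
  have "hint (\<lambda>y. A z y *v ?w y) s x = hint (\<lambda>y. A z y *v ?w y) s m + hint (\<lambda>y. A z y *v ?w y) m x"
   using assms x False bA dom_down[OF \<open>t \<in> dom\<close>, of x] by (intro hint_add[where B="B+B'"] gen_measurable meas) auto
  also have "hint (\<lambda>y. A z y *v ?w y) s m = hint (\<lambda>y. A z y *v u y) s m" by (intro hint_cong) auto
  also have "hint (\<lambda>y. A z y *v ?w y) m x = hint (\<lambda>y. A z y *v v y) m x"
   using \<open>u m = v m\<close> by (intro hint_cong) auto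
  also have "hint (\<lambda>y. A z y *v u y) s m = u m - u s"
   using sol_eq[OF u, of m] \<open>s \<le> m\<close> by (simp add: algebra_simps)
  also have "hint (\<lambda>y. A z y *v v y) m x = v x - v m"
   using sol_eq[OF v, of x] x False by (simp add: algebra_simps)
  finally show ?thesis using False \<open>u m = v m\<close> \<open>s \<le> m\<close> by simp
 qed
qed

lemma sol_zero [simp]: "sol z s t (\<lambda>_. 0)"
 by (auto simp: sol_def hint_def set_lebesgue_integral_def)

lemma norm_smult: "norm (a *s (v :: complex^2)) = norm a * norm v"
proof -
 have "(norm (a *s v))\<^sup>2 = (norm a * norm v)\<^sup>2"
  by (simp add: norm_vec_def L2_set_def sum_2 norm_mult power_mult_distrib algebra_simps)
 then show ?thesis by (simp add: power2_eq_iff_nonneg)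
qed

lemma hint_gen_commute:
 assumes "f \<in> Borel" "\<And>x. x \<in> {s..t} \<Longrightarrow> norm (f x) \<le> B" "0 \<le> s" "t \<in> dom"
 shows "hint (\<lambda>x. a *s (f x :: complex^2)) s t = a *s hint f s t"
proof -
 have "bounded_linear ((*s) a :: complex^2 \<Rightarrow> complex^2)"
 proof (rule bounded_linear_intro[where K="2 * norm a"])
  fix v :: "complex^2"
  show "norm (a *s v) \<le> norm v * (2 * norm a)"
   by (simp add: norm_smult)
 qed (auto simp: vec_eq_iff algebra_simps)
 from hint_bounded_linear[OF this assms] show ?thesis .
qed

lemma smult_measurable [measurable]:
 "f \<in> borel_measurable M \<Longrightarrow> (\<lambda>x. a *s (f x :: complex^2)) \<in> borel_measurable M"
 by (rule borel_measurable_complex2I; simp)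

lemma sol_smult:
 assumes u: "sol z s t u" and "0 \<le> s" "t \<in> dom"
 shows "sol z s t (\<lambda>x. a *s u x)"
 unfolding sol_def
proof (intro conjI ballI)
 note [measurable] = sol_meas[OF u]
 obtain B where B: "0 \<le> B" "\<And>x. x \<in> {s..t} \<Longrightarrow> norm (u x) \<le> B" "\<And>x. x \<in> {s..t} \<Longrightarrow> norm (A z x *v u x) \<le> B" using sol_gen_bounded[OF u] by metis
 show "(\<lambda>x. a *s u x) \<in> Borel" by measurable
 show "\<exists>B. \<forall>x\<in>{s..t}. norm (a *s u x) \<le> B" using B
  by (intro exI[of _ "norm a * B"]) (auto simp: norm_smult intro: mult_left_mono)
 fix x assume x: "x \<in> {s..t}"
 have "(\<lambda>y. A z y *v (a *s u y)) = (\<lambda>y. a *s (A z y *v u y))" by (simp add: vector_scalar_commute)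
 moreover have "hint (\<lambda>y. a *s (A z y *v u y)) s x = a *s hint (\<lambda>y. A z y *v u y) s x"
  using x assms B dom_down[OF \<open>t \<in> dom\<close>, of x] by (intro hint_gen_commute[where B=B] gen_measurable sol_meas[OF u]) auto
 moreover have "u x = u s + hint (\<lambda>y. A z y *v u y) s x" by (rule sol_eq[OF u x])
 ultimately show "a *s u x = a *s u s + hint (\<lambda>y. A z y *v (a *s u y)) s x"
  by (metis vector_add_ldistrib)
qed

lemma sol_add:
 assumes u: "sol z s t u" and v: "sol z s t v" and "0 \<le> s" "t \<in> dom"
 shows "sol z s t (\<lambda>x. u x + v x)"
 unfolding sol_def
proof (intro conjI ballI)
 note [measurable] = sol_meas[OF u] sol_meas[OF v]
 obtain B where B: "0 \<le> B" "\<And>x. x \<in> {s..t} \<Longrightarrow> norm (u x) \<le> B" "\<And>x. x \<in> {s..t} \<Longrightarrow> norm (A z x *v u x) \<le> B" using sol_gen_bounded[OF u] by metis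
 obtain B' where B': "0 \<le> B'" "\<And>x. x \<in> {s..t} \<Longrightarrow> norm (v x) \<le> B'" "\<And>x. x \<in> {s..t} \<Longrightarrow> norm (A z x *v v x) \<le> B'" using sol_gen_bounded[OF v] by metis
 show "(\<lambda>x. u x + v x) \<in> Borel" by measurable
 show "\<exists>B. \<forall>x\<in>{s..t}. norm (u x + v x) \<le> B" using B B'
  by (intro exI[of _ "B + B'"]) (auto intro: norm_triangle_mono)
 fix x assume x: "x \<in> {s..t}"
 have "hint (\<lambda>y. A z y *v u y + A z y *v v y) s x = hint (\<lambda>y. A z y *v u y) s x + hint (\<lambda>y. A z y *v v y) s x"
  using x assms B B' dom_down[OF \<open>t \<in> dom\<close>, of x]
  by (intro hint_linear[where B=B and B'=B'] gen_measurable sol_meas[OF u] sol_meas[OF v]) auto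
 moreover have "u x = u s + hint (\<lambda>y. A z y *v u y) s x" "v x = v s + hint (\<lambda>y. A z y *v v y) s x" by (rule sol_eq[OF u x], rule sol_eq[OF v x])
 ultimately show "u x + v x = u s + v s + hint (\<lambda>y. A z y *v (u y + v y)) s x"
  unfolding matrix_vector_right_distrib by (metis (no_types, lifting) add.assoc add.left_commute)
qed

lemma sol_scaleR: "sol z s t u \<Longrightarrow> 0 \<le> s \<Longrightarrow> t \<in> dom \<Longrightarrow> sol z s t (\<lambda>x. r *\<^sub>R u x)"
proof -
 have "r *\<^sub>R v = complex_of_real r *s v" for v :: "complex^2" unfolding vec_eq_iff vector_scaleR_component vector_smult_component by (simp add: scaleR_conv_of_real)
 then show "sol z s t u \<Longrightarrow> 0 \<le> s \<Longrightarrow> t \<in> dom \<Longrightarrow> sol z s t (\<lambda>x. r *\<^sub>R u x)" using sol_smult by simp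
qed

lemma sol_diff:
 assumes u: "sol z s t u" and v: "sol z s t v" and "0 \<le> s" "t \<in> dom"
 shows "sol z s t (\<lambda>x. u x - v x)"
 using sol_add[OF u sol_scaleR[OF v assms(3,4), of "-1"] assms(3,4)] by simp

lemma sol_sum:
 assumes "finite I" "\<And>i. i \<in> I \<Longrightarrow> sol z s t (u i)" and "0 \<le> s" "t \<in> dom"
 shows "sol z s t (\<lambda>x. \<Sum>i\<in>I. a i *s u i x)"
 using assms by (induction I) (simp_all add: sol_add[OF sol_smult])

end

section \<open>Lagrange's identity and uniqueness\<close>

text \<open>The bracket \<open>- i v\<^sup>* J u\<close>: a non-degenerate Hermitian form of signature (1, 1), whose
increments are multiples of inner products by Lagrange's identity.\<close>
definition hf :: "complex^2 \<Rightarrow> complex^2 \<Rightarrow> complex" where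
 "hf u v = - \<i> * (cnj (v $ 2) * u $ 1 - cnj (v $ 1) * u $ 2)"

definition mform :: "complex^2^2 \<Rightarrow> complex^2 \<Rightarrow> complex^2 \<Rightarrow> complex" where
 "mform M u v = cnj (v $ 1) * (M $ 1 $ 1 * u $ 1 + M $ 1 $ 2 * u $ 2) + cnj (v $ 2) * (M $ 2 $ 1 * u $ 1 + M $ 2 $ 2 * u $ 2)"

definition det2 :: "complex^2 \<Rightarrow> complex^2 \<Rightarrow> complex" where
 "det2 u v = u $ 1 * v $ 2 - u $ 2 * v $ 1"

definition tr2 :: "complex^2^2 \<Rightarrow> complex" where
 "tr2 M = M $ 1 $ 1 + M $ 2 $ 2"

lemma det2_derivative: "det2 (M *v u) v + det2 u (M *v v) = tr2 M * det2 u v"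
 by (simp add: det2_def tr2_def matrix_vector_mult_def sum_2 algebra_simps)

context canonical_system begin

lemma sol_functional:
 assumes u: "sol z 0 c u" and c: "c \<in> dom" and S: "bounded_linear (S :: complex^2 \<Rightarrow> complex)"
 obtains D where "D \<ge> 0" "(\<lambda>x. S (A z x *v u x)) \<in> Borel" "(\<lambda>x. S (u x)) \<in> Borel"
   "\<And>x. x \<in> {0..c} \<Longrightarrow> norm (S (A z x *v u x)) \<le> D" "\<And>x. x \<in> {0..c} \<Longrightarrow> norm (S (u x)) \<le> D"
   "\<And>x. x \<in> {0..c} \<Longrightarrow> S (u x) = S (u 0) + hint (\<lambda>x. S (A z x *v u x)) 0 x"
   "S (u 0 + (LINT x:{0..<c}|\<nu>. A z x *v u x)) = S (u 0) + (LINT x:{0..<c}|\<nu>. S (A z x *v u x))"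
proof -
 interpret S: bounded_linear S by fact
 obtain B where B: "0 \<le> B" "\<And>x. x \<in> {0..c} \<Longrightarrow> norm (u x) \<le> B" "\<And>x. x \<in> {0..c} \<Longrightarrow> norm (A z x *v u x) \<le> B" using sol_gen_bounded[OF u] by metis
 obtain L where L: "L > 0" "\<And>x. norm (S x) \<le> norm x * L" using S.pos_bounded by blast
 note [measurable] = gen_measurable[OF sol_meas[OF u], of z] sol_meas[OF u]
 have S_meas: "S \<in> Borel" by (rule borel_measurable_continuous_onI[OF linear_continuous_on[OF S]])
 have 1: "(\<lambda>x. S (A z x *v u x)) \<in> Borel" "(\<lambda>x. S (u x)) \<in> Borel"
  by (rule measurable_compose[OF _ S_meas], measurable)+
 have 2: "norm (S (A z x *v u x)) \<le> B * L" "norm (S (u x)) \<le> B * L" if "x \<in> {0..c}" for x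
  using B(2,3)[of x] that L by (auto intro: order_trans[OF L(2)] mult_right_mono)
 have 3: "S (u x) = S (u 0) + hint (\<lambda>x. S (A z x *v u x)) 0 x" if x: "x \<in> {0..c}" for x
 proof -
  have "S (u x) = S (u 0 + hint (\<lambda>x. A z x *v u x) 0 x)" using sol_eq[OF u x] by (rule arg_cong)
  also have "\<dots> = S (u 0) + S (hint (\<lambda>x. A z x *v u x) 0 x)" by (rule S.add)
  also have "S (hint (\<lambda>x. A z x *v u x) 0 x) = hint (\<lambda>x. S (A z x *v u x)) 0 x"
   using x c B dom_down[OF c, of x] by (intro hint_bounded_linear[OF S, where B=B, symmetric] gen_measurable sol_meas[OF u]) auto
  finally show ?thesis .
 qed
 have "set_integrable \<nu> {0..<c} (\<lambda>x. A z x *v u x)"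
  using B c by (intro set_integrableI_bounded[where c=c and B=B]) auto
 from integral_bounded_linear[OF S this[unfolded set_integrable_def]]
 have 4: "S (u 0 + (LINT x:{0..<c}|\<nu>. A z x *v u x)) = S (u 0) + (LINT x:{0..<c}|\<nu>. S (A z x *v u x))"
  by (simp add: S.add S.scaleR set_lebesgue_integral_def)
 show ?thesis by (rule that[of "B * L", OF _ 1 2 3 4]) (use B(1) L(1) in auto)
qed

lemma sol_bilinear_rule:
 assumes u: "sol z 0 c u" and v: "sol y 0 c v" and c: "c \<in> dom"
  and S: "bounded_linear (S :: complex^2 \<Rightarrow> complex)" and T: "bounded_linear (T :: complex^2 \<Rightarrow> complex)"
 shows "S (u 0 + (LINT x:{0..<c}|\<nu>. A z x *v u x)) * T (v 0 + (LINT x:{0..<c}|\<nu>. A y x *v v x)) =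
   S (u 0) * T (v 0) + (LINT x:{0..<c}|\<nu>. S (A z x *v u x) * T (v x) + S (u x) * T (A y x *v v x))" (is ?thesis1)
  and "set_integrable \<nu> {0..<c} (\<lambda>x. S (A z x *v u x) * T (v x) + S (u x) * T (A y x *v v x))" (is ?thesis2)
proof -
 obtain D where D: "D \<ge> 0" and Su: "(\<lambda>x. S (A z x *v u x)) \<in> Borel" "(\<lambda>x. S (u x)) \<in> Borel"
   "\<And>x. x \<in> {0..c} \<Longrightarrow> norm (S (A z x *v u x)) \<le> D" "\<And>x. x \<in> {0..c} \<Longrightarrow> norm (S (u x)) \<le> D"
   "\<And>x. x \<in> {0..c} \<Longrightarrow> S (u x) = S (u 0) + hint (\<lambda>x. S (A z x *v u x)) 0 x"
   "S (u 0 + (LINT x:{0..<c}|\<nu>. A z x *v u x)) = S (u 0) + (LINT x:{0..<c}|\<nu>. S (A z x *v u x))"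
  by (rule sol_functional[OF u c S]; rule that; assumption)
 obtain E where E: "E \<ge> 0" and Tv: "(\<lambda>x. T (A y x *v v x)) \<in> Borel" "(\<lambda>x. T (v x)) \<in> Borel"
   "\<And>x. x \<in> {0..c} \<Longrightarrow> norm (T (A y x *v v x)) \<le> E" "\<And>x. x \<in> {0..c} \<Longrightarrow> norm (T (v x)) \<le> E"
   "\<And>x. x \<in> {0..c} \<Longrightarrow> T (v x) = T (v 0) + hint (\<lambda>x. T (A y x *v v x)) 0 x"
   "T (v 0 + (LINT x:{0..<c}|\<nu>. A y x *v v x)) = T (v 0) + (LINT x:{0..<c}|\<nu>. T (A y x *v v x))"
  by (rule sol_functional[OF v c T]; rule that; assumption)
 show ?thesis1 unfolding Su(6) Tv(6)
  by (rule balanced_product_rule[OF c Su(1,3) Tv(1,3)]) (auto intro: Su(5) Tv(5))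
 note [measurable] = Su(1,2) Tv(1,2)
 show ?thesis2
 proof (rule set_integrableI_bounded[OF _ _ _ c, where B="D*E+D*E"])
  fix x assume "x \<in> {0..<c}"
  then have x: "x \<in> {0..c}" by simp
  show "norm (S (A z x *v u x) * T (v x) + S (u x) * T (A y x *v v x)) \<le> D*E+D*E"
   by (intro norm_triangle_mono order_trans[OF norm_mult_ineq] mult_mono Su(3,4) Tv(3,4) x D norm_ge_zero)
 qed (measurable, auto)
qed

text \<open>The inner product of \<open>u\<close> and \<open>v\<close> in the \<open>L\<^sup>2\<close> space of \<open>w\<close>, taken over \<open>E\<close>.\<close>
definition gram :: "real set \<Rightarrow> (real \<Rightarrow> complex^2) \<Rightarrow> (real \<Rightarrow> complex^2) \<Rightarrow> complex" where
 "gram E u v = (LINT x:E|\<nu>. mform (W x) (u x) (v x))"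

abbreviation nsq :: "real \<Rightarrow> (real \<Rightarrow> complex^2) \<Rightarrow> real" where "nsq c u \<equiv> Re (gram {0..<c} u u)"

text \<open>The left limit at \<open>c\<close> of a solution on \<open>[0, c]\<close>; it can differ from the balanced value \<open>u c\<close> if \<open>c\<close>
is an atom.\<close>
definition left_lim :: "complex \<Rightarrow> (real \<Rightarrow> complex^2) \<Rightarrow> real \<Rightarrow> complex^2" where
 "left_lim z u c = u 0 + (LINT x:{0..<c}|\<nu>. A z x *v u x)"

lemma set_integral_point:
 fixes f :: "real \<Rightarrow> 'b::euclidean_space"
 assumes c: "c \<in> dom"
 shows "(LINT x:{c}|\<nu>. f x) = mass {c} *\<^sub>R f c"
proof -
 have "(LINT x:{c}|\<nu>. f x) = (\<integral>x. indicat_real {c} x *\<^sub>R f c \<partial>\<nu>)"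
  unfolding set_lebesgue_integral_def by (intro bochner_cong) (auto simp: indicator_def)
 also have "\<dots> = mass {c} *\<^sub>R f c"
  using emeasure_finite[of "{c}" c] domD(1)[OF c] c by (subst integral_scaleR_left) (auto intro!: integrable_real_indicator)
 finally show ?thesis .
qed

lemma left_lim_value:
 assumes u: "sol z 0 c u" and c: "c \<in> dom"
 shows "u c = left_lim z u c + (mass {c} / 2) *\<^sub>R (A z c *v u c)"
proof -
 obtain B where B: "0 \<le> B" "\<And>x. x \<in> {0..c} \<Longrightarrow> norm (u x) \<le> B" "\<And>x. x \<in> {0..c} \<Longrightarrow> norm (A z x *v u x) \<le> B" using sol_gen_bounded[OF u] by metis
 note m = gen_measurable[OF sol_meas[OF u], of z]
 have i: "set_integrable \<nu> E (\<lambda>x. A z x *v u x)" if "E \<in> sets borel" "E \<subseteq> {0..c}" for E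
  using B c that by (intro set_integrableI_bounded[OF m, where c=c and B=B]) auto
 have "{0..c} = {0..<c} \<union> {c}" using domD(1)[OF c] by auto
 then have "(LINT x:{0..c}|\<nu>. A z x *v u x) = (LINT x:{0..<c}|\<nu>. A z x *v u x) + mass {c} *\<^sub>R (A z c *v u c)"
  using i[of "{0..<c}"] i[of "{c}"] domD(1)[OF c] set_integral_Un[of "{0..<c}" "{c}" \<nu> "\<lambda>x. A z x *v u x"] by (simp add: set_integral_point[OF c] del: Un_insert_right)
 then have *: "hint (\<lambda>x. A z x *v u x) 0 c = (LINT x:{0..<c}|\<nu>. A z x *v u x) + (mass {c} / 2) *\<^sub>R (A z c *v u c)"
  unfolding hint_from_zero[OF m] by (simp add: algebra_simps flip: scaleR_add_left)
 have "u c = u 0 + hint (\<lambda>x. A z x *v u x) 0 c" using sol_eq[OF u, of c] domD(1)[OF c] by simp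
 then show ?thesis unfolding left_lim_def * by (simp only: add.assoc)
qed

lemma hermitian_entries:
 assumes "hermitian M"
 shows "cnj (M $ 1 $ 1) = M $ 1 $ 1" "cnj (M $ 1 $ 2) = M $ 2 $ 1" "cnj (M $ 2 $ 1) = M $ 1 $ 2" "cnj (M $ 2 $ 2) = M $ 2 $ 2"
 using assms unfolding hermitian_def by (metis complex_cnj_cnj)+

lemma W_herm: "hermitian (W x)"
 using W_nonneg by (simp add: nonneg_matrix_def)

text \<open>The Hermitian matrix \<open>Q\<close> cancels in the product rule for the bracket, and what is left of the coefficients is the difference
\<open>z - cnj y\<close> times \<open>W\<close>. If \<open>y = cnj z\<close> the bracket is conserved; if \<open>y = z\<close> is non-real it measures the norm.\<close>
theorem lagrange_identity:
 assumes u: "sol z 0 c u" and v: "sol y 0 c v" and c: "c \<in> dom"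
 shows "hf (left_lim z u c) (left_lim y v c) = hf (u 0) (v 0) - \<i> * (z - cnj y) * gram {0..<c} u v"
proof -
 have nth: "bounded_linear (\<lambda>v::complex^2. v $ i)" for i by (rule bounded_linear_vec_nth)
 have cnth: "bounded_linear (\<lambda>v::complex^2. cnj (v $ i))" for i
  using bounded_linear_compose[OF bounded_linear_cnj nth] .
 note 1 = sol_bilinear_rule[OF u v c nth[of 1] cnth[of 2]]
 note 2 = sol_bilinear_rule[OF u v c nth[of 2] cnth[of 1]]
 let ?I1 = "\<lambda>x. (A z x *v u x) $ 1 * cnj (v x $ 2) + u x $ 1 * cnj ((A y x *v v x) $ 2)"
 let ?I2 = "\<lambda>x. (A z x *v u x) $ 2 * cnj (v x $ 1) + u x $ 2 * cnj ((A y x *v v x) $ 1)"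
 have pw: "?I1 x - ?I2 x = (z - cnj y) * mform (W x) (u x) (v x)" for x
  unfolding gen_components
  by (simp add: mform_def hermitian_entries[OF Q_herm] hermitian_entries[OF W_herm]) (simp add: algebra_simps)
 have "(z - cnj y) * gram {0..<c} u v = (LINT x:{0..<c}|\<nu>. ?I1 x - ?I2 x)"
  unfolding pw gram_def by simp
 also have "\<dots> = (LINT x:{0..<c}|\<nu>. ?I1 x) - (LINT x:{0..<c}|\<nu>. ?I2 x)"
  by (rule set_integral_diff(2)[OF 1(2) 2(2)])
 finally have 3: "(z - cnj y) * gram {0..<c} u v = \<dots>" .
 show ?thesis using 1(1) 2(1) unfolding hf_def left_lim_def[symmetric] mult.assoc 3
  by (simp add: algebra_simps)
qed

text \<open>Liouville's differential equation for the determinant, in integrated form.\<close>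
theorem det_identity:
 assumes u: "sol z 0 c u" and v: "sol z 0 c v" and c: "c \<in> dom"
 shows "det2 (left_lim z u c) (left_lim z v c) = det2 (u 0) (v 0) + (LINT x:{0..<c}|\<nu>. tr2 (A z x) * det2 (u x) (v x))"
proof -
 have nth: "bounded_linear (\<lambda>v::complex^2. v $ i)" for i by (rule bounded_linear_vec_nth)
 note 1 = sol_bilinear_rule[OF u v c nth[of 1] nth[of 2]]
 note 2 = sol_bilinear_rule[OF u v c nth[of 2] nth[of 1]]
 let ?I1 = "\<lambda>x. (A z x *v u x) $ 1 * (v x $ 2) + u x $ 1 * ((A z x *v v x) $ 2)"
 let ?I2 = "\<lambda>x. (A z x *v u x) $ 2 * (v x $ 1) + u x $ 2 * ((A z x *v v x) $ 1)"
 have pw: "tr2 (A z x) * det2 (u x) (v x) = ?I1 x - ?I2 x" for x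
  unfolding det2_derivative[symmetric] unfolding det2_def by simp
 have 3: "(LINT x:{0..<c}|\<nu>. tr2 (A z x) * det2 (u x) (v x)) = (LINT x:{0..<c}|\<nu>. ?I1 x) - (LINT x:{0..<c}|\<nu>. ?I2 x)"
  unfolding pw by (rule set_integral_diff(2)[OF 1(2) 2(2)])
 show ?thesis using 1(1) 2(1) unfolding det2_def left_lim_def[symmetric] 3[unfolded det2_def]
  by (simp add: algebra_simps)
qed

lemma small_punctured:
 assumes c: "c \<in> dom" and e: "e > 0"
 shows "\<exists>d>0. mass ({x-d..x+d} \<inter> {0..c} - {x}) < e"
proof -
 let ?A = "\<lambda>n::nat. {x - inverse (Suc n)..x + inverse (Suc n)} \<inter> {0..c} - {x}"
 have "(\<lambda>n. mass (?A n)) \<longlonglongrightarrow> mass (\<Inter>n. ?A n)"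
 proof (rule Lim_measure_decseq)
  have "inverse (real (Suc n)) \<le> inverse (real (Suc m))" if "m \<le> n" for m n
   using that by (intro le_imp_inverse_le) auto
  then show "decseq ?A" unfolding decseq_def
   by (intro allI impI Diff_mono Int_mono order_refl) (simp add: add.commute del: of_nat_Suc)
  show "emeasure \<nu> (?A i) \<noteq> \<infinity>" for i using emeasure_finite[of "?A i" c] c by force
 qed auto
 moreover have "(\<Inter>n. ?A n) = {}"
 proof (rule equals0I)
  fix y assume y: "y \<in> (\<Inter>n. ?A n)"
  then have "\<bar>y - x\<bar> > 0" by auto
  then obtain n where n: "inverse (real (Suc n)) < \<bar>y - x\<bar>" using reals_Archimedean by blast
  have "y \<in> ?A n" using y by blast
  then show False using n by auto
 qed
 ultimately have "(\<lambda>n. mass (?A n)) \<longlonglongrightarrow> 0" by (simp only: measure_empty)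
 from order_tendstoD(2)[OF this e] obtain n where "mass (?A n) < e" by (auto simp: eventually_sequentially)
 then show ?thesis by (intro exI[of _ "inverse (real (Suc n))"]) auto
qed

text \<open>A solution cannot vanish at \<open>p\<close> without vanishing nearby: the atom at \<open>p\<close> is invisible, since \<open>u p = 0\<close>, and on
the rest the equation is a contraction.\<close>
lemma sol_vanishes_small:
 assumes u: "sol z a b u" and a: "0 \<le> a" and b: "b \<in> dom" and p: "p \<in> {a..b}" "u p = 0"
  and small: "C_gen z * mass ({a..b} - {p}) \<le> 1/2"
 shows "\<forall>t\<in>{a..b}. u t = 0"
proof -
 obtain B0 where B0: "\<And>x. x \<in> {a..b} \<Longrightarrow> norm (u x) \<le> B0" using sol_gen_bounded[OF u] by metis
 define S where "S = (SUP t\<in>{a..b}. norm (u t))"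
 have bdd: "bdd_above ((\<lambda>t. norm (u t)) ` {a..b})" using B0 by (intro bdd_aboveI2)
 have S: "norm (u t) \<le> S" if "t \<in> {a..b}" for t unfolding S_def by (rule cSUP_upper[OF that bdd])
 have S0: "0 \<le> S" using S[OF p(1)] norm_ge_zero order_trans by blast
 note m = gen_measurable[OF sol_meas[OF u], of z]
 have half: "norm (u t) \<le> S / 2" if t: "t \<in> {a..b}" for t
 proof -
  have h: "norm (hint (\<lambda>y. A z y *v u y) s r) \<le> (C_gen z * S) * mass ({a..b} - {p})"
   if sr: "a \<le> s" "s \<le> r" "r \<le> b" for s r
  proof -
   have "norm (hint (\<lambda>y. A z y *v u y) s r) \<le> (C_gen z * S) * mass ({s..r} - {p})"
   proof (rule hint_bound[OF m])
    show "norm (A z x *v u x) \<le> C_gen z * S" if "x \<in> {s..r}" for x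
     using gen_norm_le[of z x "u x"] mult_left_mono[OF S[of x] C_gen_nonneg[of z]] that sr by auto
    show "A z x *v u x = 0" if "x \<in> {s..r}" "x \<notin> {s..r} - {p}" for x using that p by auto
   qed (use sr a dom_down[OF b, of r] S0 C_gen_nonneg in auto)
   also have "\<dots> \<le> (C_gen z * S) * mass ({a..b} - {p})"
    using sr S0 C_gen_nonneg a b emeasure_finite[of "{a..b} - {p}" b]
    by (intro mult_left_mono measure_mono_fmeasurable fmeasurableI) force+
   finally show ?thesis .
  qed
  have "norm (u t) = norm (hint (\<lambda>y. A z y *v u y) (min t p) (max t p))"
  proof (cases "t \<le> p")
   case True
   then have "u p - u t = hint (\<lambda>y. A z y *v u y) t p" using t p a b by (intro sol_increment[OF u]) auto
   then show ?thesis using True p(2) by (metis norm_minus_cancel diff_0 max_absorb2 min_absorb1)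
  next
   case False
   then have "u t - u p = hint (\<lambda>y. A z y *v u y) p t" using t p a b by (intro sol_increment[OF u]) auto
   then show ?thesis using False p(2) by (simp add: min_def max_def)
  qed
  also have "\<dots> \<le> (C_gen z * S) * mass ({a..b} - {p})" using t p by (intro h) auto
  also have "\<dots> = S * (C_gen z * mass ({a..b} - {p}))" by simp
  also have "\<dots> \<le> S * (1/2)" using small S0 by (intro mult_left_mono) auto
  finally show ?thesis by simp
 qed
 have "S \<le> S / 2" unfolding S_def using p(1) half by (intro cSUP_least) (auto simp: S_def[symmetric])
 then have "S = 0" using S0 by simp
 then show ?thesis using S by fastforce
qed

text \<open>At each point the left limit and the right limit, \<open>u x \<mp> (\<nu>{x} / 2) A u x\<close>, determine the balanced value. This is
the condition \<open>z \<notin> Lam\<close> in terms of the densities.\<close>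
definition jump_regular :: "complex \<Rightarrow> bool" where
 "jump_regular z \<longleftrightarrow> (\<forall>x\<in>dom. \<forall>v. (v = (mass {x} / 2) *\<^sub>R (A z x *v v) \<longrightarrow> v = 0) \<and> (v = - ((mass {x} / 2) *\<^sub>R (A z x *v v)) \<longrightarrow> v = 0))"

lemma hint_concentrated_right:
 fixes f :: "real \<Rightarrow> 'b::euclidean_space"
 assumes "a < x" "x \<in> dom" "\<And>t. t \<in> {a..<x} \<Longrightarrow> f t = 0"
 shows "hint f a x = (mass {x} / 2) *\<^sub>R f x"
proof -
 have "(LINT t:{a..<x}|\<nu>. f t) = (LINT t:{a..<x}|\<nu>. 0)" using assms by (intro set_lebesgue_integral_cong) auto
 moreover have "(LINT t:{a<..x}|\<nu>. f t) = (LINT t:{x}|\<nu>. f t)"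
  unfolding set_lebesgue_integral_def using assms by (intro bochner_cong) (auto simp: indicator_def)
 ultimately show ?thesis unfolding hint_def set_integral_point[OF assms(2)] by (simp add: set_lebesgue_integral_def)
qed

lemma hint_concentrated_left:
 fixes f :: "real \<Rightarrow> 'b::euclidean_space"
 assumes "x < b" "x \<in> dom" "\<And>t. t \<in> {x<..b} \<Longrightarrow> f t = 0"
 shows "hint f x b = (mass {x} / 2) *\<^sub>R f x"
proof -
 have "(LINT t:{x<..b}|\<nu>. f t) = (LINT t:{x<..b}|\<nu>. 0)" using assms by (intro set_lebesgue_integral_cong) auto
 moreover have "(LINT t:{x..<b}|\<nu>. f t) = (LINT t:{x}|\<nu>. f t)"
  unfolding set_lebesgue_integral_def using assms by (intro bochner_cong) (auto simp: indicator_def)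
 ultimately show ?thesis unfolding hint_def set_integral_point[OF assms(2)] by (simp add: set_lebesgue_integral_def)
qed

text \<open>Every point has a neighbourhood in which all but a possible atom at the point itself is small. Arguments by
compactness (Bolzano's induction rule) therefore see at most one essential atom at a time.\<close>
lemma small_neighbourhood:
 assumes c: "c \<in> dom"
 obtains d where "d > 0" "\<And>a b E. 0 \<le> a \<Longrightarrow> a \<le> x \<Longrightarrow> x \<le> b \<Longrightarrow> b \<le> c \<Longrightarrow> b - a < d \<Longrightarrow> E \<in> sets borel \<Longrightarrow> E \<subseteq> {a..b} - {x} \<Longrightarrow> C_gen z * mass E \<le> 1/4"
proof -
 have "0 < 1 / (4 * (C_gen z + 1))" using C_gen_nonneg[of z] by simp
 from small_punctured[OF c this, of x] obtain d where d: "d > 0"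
  "mass ({x-d..x+d} \<inter> {0..c} - {x}) < 1 / (4 * (C_gen z + 1))" by blast
 show ?thesis
 proof (rule that[OF d(1)])
  fix a b p E assume ab: "0 \<le> a" "a \<le> x" "x \<le> b" "b \<le> c" "b - a < d" and E: "E \<in> sets borel" "E \<subseteq> {a..b} - {x}"
  have "mass E \<le> mass ({x-d..x+d} \<inter> {0..c} - {x})"
   using ab E emeasure_finite[of "{x-d..x+d} \<inter> {0..c} - {x}" c] c by (intro measure_mono_fmeasurable fmeasurableI) force+
  also note d(2)
  finally have "(C_gen z + 1) * mass E \<le> 1/4" using C_gen_nonneg[of z] by (simp add: field_simps)
  moreover have "C_gen z * mass E \<le> (C_gen z + 1) * mass E" by (intro mult_right_mono) auto
  ultimately show "C_gen z * mass E \<le> 1/4" by (rule order_trans[rotated])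
 qed
qed

lemma sol_vanishes_left_of:
 assumes u: "sol z a b u" and "0 \<le> a" "a \<le> x" "x \<le> b" "b \<in> dom" "u a = 0"
  and small: "\<And>E. E \<in> sets borel \<Longrightarrow> E \<subseteq> {a..b} - {x} \<Longrightarrow> C_gen z * mass E \<le> 1/4"
 shows "\<forall>t\<in>{a..<x}. u t = 0" "u x = (mass {x} / 2) *\<^sub>R (A z x *v u x) \<or> u x = 0"
proof -
 show 0: "\<forall>t\<in>{a..<x}. u t = 0"
 proof
  fix t assume t: "t \<in> {a..<x}"
  have "\<forall>s\<in>{a..t}. u s = 0"
  proof (rule sol_vanishes_small[where p=a])
   show "sol z a t u" using t assms by (intro sol_restrict[OF u]) auto
   show "C_gen z * mass ({a..t} - {a}) \<le> 1/2" using order_trans[OF small, of _ "1/2"] t assms by (simp add: subset_iff)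
  qed (use t assms dom_down[of b t] in auto)
  then show "u t = 0" using t by auto
 qed
 show "u x = (mass {x} / 2) *\<^sub>R (A z x *v u x) \<or> u x = 0"
 proof (cases "a = x")
  case True then show ?thesis using assms by simp
 next
  case False
  then have ax: "a < x" using assms by simp
  have x: "x \<in> dom" using dom_down[of b x] assms by simp
  have "u x - u a = hint (\<lambda>y. A z y *v u y) a x" using assms by (intro sol_increment[OF u]) auto
  also have "\<dots> = (mass {x} / 2) *\<^sub>R (A z x *v u x)"
   using 0 by (intro hint_concentrated_right ax x) auto
  finally show ?thesis using \<open>u a = 0\<close> by simp
 qed
qed

lemma sol_vanishes_right_of:
 assumes u: "sol z a b u" and "0 \<le> a" "a \<le> x" "x \<le> b" "b \<in> dom" "u b = 0"
  and small: "\<And>E. E \<in> sets borel \<Longrightarrow> E \<subseteq> {a..b} - {x} \<Longrightarrow> C_gen z * mass E \<le> 1/4"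
 shows "u x = - ((mass {x} / 2) *\<^sub>R (A z x *v u x)) \<or> u x = 0"
proof -
 have 0: "\<forall>t\<in>{x<..b}. u t = 0"
 proof
  fix t assume t: "t \<in> {x<..b}"
  have "\<forall>s\<in>{t..b}. u s = 0"
  proof (rule sol_vanishes_small[where p=b])
   show "sol z t b u" using t assms by (intro sol_restrict[OF u]) auto
   show "C_gen z * mass ({t..b} - {b}) \<le> 1/2" using order_trans[OF small, of _ "1/2"] t assms by (simp add: subset_iff)
  qed (use t assms in auto)
  then show "u t = 0" using t by auto
 qed
 show ?thesis
 proof (cases "x = b")
  case True then show ?thesis using assms by simp
 next
  case False
  then have ax: "x < b" using assms by simp
  have x: "x \<in> dom" using dom_down[of b x] assms by simp
  have "u b - u x = hint (\<lambda>y. A z y *v u y) x b" using assms by (intro sol_increment[OF u]) auto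
  also have "\<dots> = (mass {x} / 2) *\<^sub>R (A z x *v u x)"
   using 0 by (intro hint_concentrated_left ax x) auto
  finally have "- u x = (mass {x} / 2) *\<^sub>R (A z x *v u x)" using \<open>u b = 0\<close> by simp
  then show ?thesis by (metis minus_minus)
 qed
qed

text \<open>Passing an atom from left to right is the only place where regularity is used: a solution which vanishes to the
left of \<open>x\<close> has left limit 0 at \<open>x\<close>.\<close>
theorem uniqueness:
 assumes reg: "jump_regular z" and u: "sol z 0 c u" and c: "c \<in> dom" and "u 0 = 0"
 shows "\<forall>t\<in>{0..c}. u t = 0"
proof -
 define P where "P a b \<longleftrightarrow> (0 \<le> a \<and> b \<le> c \<longrightarrow> u a = 0 \<longrightarrow> (\<forall>t\<in>{a..b}. u t = 0))" for a b
 have "P 0 c" using domD(1)[OF c]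
 proof (induction rule: Bolzano)
  case (trans a b d)
  then show ?case unfolding P_def by (metis atLeastAtMost_iff order_trans linear)
 next
  case (local x)
  obtain d where d: "d > 0" "\<And>a b E. 0 \<le> a \<Longrightarrow> a \<le> x \<Longrightarrow> x \<le> b \<Longrightarrow> b \<le> c \<Longrightarrow> b - a < d \<Longrightarrow> E \<in> sets borel \<Longrightarrow> E \<subseteq> {a..b} - {x} \<Longrightarrow> C_gen z * mass E \<le> 1/4"
   using small_neighbourhood[OF c] by metis
  have "P a b" if ab: "a \<le> x" "x \<le> b" "b - a < d" for a b
   unfolding P_def
  proof (intro impI ballI)
   fix t assume bounds: "0 \<le> a \<and> b \<le> c" and ua: "u a = 0" and t: "t \<in> {a..b}"
   have b: "b \<in> dom" using dom_down[OF c, of b] bounds ab by auto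
   have x: "x \<in> dom" using dom_down[OF b, of x] bounds ab by auto
   have uab: "sol z a b u" using bounds ab c by (intro sol_restrict[OF u]) auto
   have small: "C_gen z * mass E \<le> 1/4" if "E \<in> sets borel" "E \<subseteq> {a..b} - {x}" for E
    using d(2)[of a b E] bounds ab that by auto
   note l = sol_vanishes_left_of[OF uab _ ab(1,2) b ua small]
   have ux: "u x = 0" using l(2) reg x bounds unfolding jump_regular_def by blast
   have "\<forall>t\<in>{x..b}. u t = 0"
   proof (rule sol_vanishes_small[where p=x])
    show "sol z x b u" using bounds ab c by (intro sol_restrict[OF u]) auto
    show "C_gen z * mass ({x..b} - {x}) \<le> 1/2" using order_trans[OF small, of _ "1/2"] ab by (simp add: subset_iff)
   qed (use ab bounds b ux in auto)
   then show "u t = 0" using l(1) bounds t by (cases "t < x") auto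
  qed
  then show ?case using d(1) by blast
 qed
 then show ?thesis using \<open>u 0 = 0\<close> unfolding P_def by auto
qed

end

section \<open>Local solutions and solutions of norm 0\<close>

lemma cnj_measurable [measurable]:
 "f \<in> borel_measurable M \<Longrightarrow> (\<lambda>x. cnj (f x)) \<in> borel_measurable M"
 by (rule measurable_compose[OF _ borel_measurable_continuous_onI[OF continuous_on_cnj[OF continuous_on_id]]])

context canonical_system begin

text \<open>The value is prescribed at the only large atom \<open>x\<close>. All iterates agree there, so the atom does not contribute to
their differences, and the Picard iteration converges also if the jump condition fails at \<open>x\<close>.\<close>
lemma local_existence:
 assumes c: "c \<in> dom" and ab: "0 \<le> a" "a \<le> x" "x \<le> b" "b \<le> c"
  and small: "\<And>E. E \<in> sets borel \<Longrightarrow> E \<subseteq> {a..b} - {x} \<Longrightarrow> C_gen z * mass E \<le> 1/4"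
 shows "\<exists>u. sol z a b u \<and> u x = m"
proof -
 have b: "b \<in> dom" using dom_down[OF c] ab by simp
 \<comment> \<open>integration starting from the interior point x, in both directions\<close>
 define T where "T f t = (if x \<le> t then hint f x t else - hint f t x)" for f :: "real \<Rightarrow> complex^2" and t
 define U where "U = rec_nat (\<lambda>_. m) (\<lambda>_ u t. if t \<in> {a..b} then m + T (\<lambda>y. A z y *v u y) t else 0)"
 have U_0: "U 0 = (\<lambda>_. m)" by (simp add: U_def)
 have U_Suc: "U (Suc n) = (\<lambda>t. if t \<in> {a..b} then m + T (\<lambda>y. A z y *v U n y) t else 0)" for n by (simp only: U_def nat.rec(2))
 have T_meas: "T f \<in> Borel" if [measurable]: "f \<in> Borel" for f
 proof -
  note [measurable] = hint_measurable[OF that]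
  show ?thesis unfolding T_def by measurable
 qed
 have U_meas: "U n \<in> Borel" for n
 proof (induction n)
  case (Suc n)
  note [measurable] = T_meas[OF gen_measurable[OF Suc]]
  show ?case unfolding U_Suc by measurable
 qed (simp add: U_0)
 have T_bound: "norm (T f t) \<le> B * mass E"
  if f: "f \<in> Borel" and B: "\<And>y. y \<in> {a..b} \<Longrightarrow> norm (f y) \<le> B" "0 \<le> B"
   and E: "E \<in> sets borel" "E \<subseteq> {a..b}" "\<And>y. y \<in> {a..b} \<Longrightarrow> y \<notin> E \<Longrightarrow> f y = 0" and t: "t \<in> {a..b}" for f B t E
 proof -
  have h: "norm (hint f s r) \<le> B * mass E" if sr: "a \<le> s" "s \<le> r" "r \<le> b" for s r
  proof -
   have "norm (hint f s r) \<le> B * mass ({s..r} \<inter> E)"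
    using sr ab dom_down[OF b, of r] B E by (intro hint_bound[OF f]) auto
   also have "\<dots> \<le> B * mass E"
    using emeasure_finite[of E b] E B ab b by (intro mult_left_mono measure_mono_fmeasurable fmeasurableI) force+
   finally show ?thesis .
  qed
  show ?thesis unfolding T_def using h[of x t] h[of t x] t ab by auto
 qed
 have T_diff: "T f t - T g t = T (\<lambda>y. f y - g y) t"
  if f: "f \<in> Borel" "\<And>y. y \<in> {a..b} \<Longrightarrow> norm (f y) \<le> B" and g: "g \<in> Borel" "\<And>y. y \<in> {a..b} \<Longrightarrow> norm (g y) \<le> B'"
   and t: "t \<in> {a..b}" for f g B B' t
 proof (cases "x \<le> t")
  case True
  have "hint (\<lambda>y. f y - g y) x t = hint f x t - hint g x t"
   by (rule hint_linear(2)[OF f(1) _ g(1), where B=B and B'=B']) (use f g t True ab dom_down[OF b, of t] in auto)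
  then show ?thesis using True by (simp add: T_def)
 next
  case False
  have "hint (\<lambda>y. f y - g y) t x = hint f t x - hint g t x"
   by (rule hint_linear(2)[OF f(1) _ g(1), where B=B and B'=B']) (use f g t False ab dom_down[OF b, of x] in auto)
  then show ?thesis using False by (simp add: T_def)
 qed
 have "\<exists>B\<ge>0. \<forall>t\<in>{a..b}. norm (U n t) \<le> B" for n
 proof (induction n)
  case 0 then show ?case unfolding U_0 by (intro exI[of _ "norm m"]) auto
 next
  case (Suc n)
  then obtain B where B: "B \<ge> 0" "\<And>t. t \<in> {a..b} \<Longrightarrow> norm (U n t) \<le> B" by blast
  have "norm (U (Suc n) t) \<le> norm m + (C_gen z * B) * mass {a..b}" if t: "t \<in> {a..b}" for t
  proof -
   have "norm (T (\<lambda>y. A z y *v U n y) t) \<le> (C_gen z * B) * mass {a..b}"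
   proof (rule T_bound[OF gen_measurable[OF U_meas]])
    show "norm (A z y *v U n y) \<le> C_gen z * B" if "y \<in> {a..b}" for y
     by (rule order_trans[OF gen_norm_le mult_left_mono[OF B(2)[OF that] C_gen_nonneg]])
   qed (use B(1) C_gen_nonneg t in auto)
   then show ?thesis unfolding U_Suc using t by (auto intro: norm_triangle_mono)
  qed
  then show ?case using B(1) C_gen_nonneg[of z] by (intro exI[of _ "norm m + (C_gen z * B) * mass {a..b}"]) auto
 qed
 then obtain BU where BU: "\<And>n. BU n \<ge> 0" "\<And>n t. t \<in> {a..b} \<Longrightarrow> norm (U n t) \<le> BU n" by metis
 have AU: "norm (A z y *v U n y) \<le> C_gen z * BU n" if "y \<in> {a..b}" for y n
  by (rule order_trans[OF gen_norm_le mult_left_mono[OF BU(2)[OF that] C_gen_nonneg]])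
 have Ux: "U n x = m" for n using ab by (cases n) (simp_all add: U_0 U_Suc T_def)
 define M where "M = BU 1 + BU 0"
 have M0: "0 \<le> M" using BU by (simp add: M_def)
 have step: "norm (U (Suc n) t - U n t) \<le> M * (1/4) ^ n" if t: "t \<in> {a..b}" for n t
  using t
 proof (induction n arbitrary: t)
  case 0
  then show ?case using BU(2)[of t 1] BU(2)[of t 0] norm_triangle_ineq4[of "U 1 t" "U 0 t"] by (simp add: M_def)
 next
  case (Suc n)
  have "U (Suc (Suc n)) t - U (Suc n) t = T (\<lambda>y. A z y *v U (Suc n) y) t - T (\<lambda>y. A z y *v U n y) t"
   using Suc.prems by (subst U_Suc, subst (2) U_Suc) simp
  also have "\<dots> = T (\<lambda>y. A z y *v U (Suc n) y - A z y *v U n y) t"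
   by (rule T_diff[OF gen_measurable[OF U_meas] AU gen_measurable[OF U_meas] AU Suc.prems])
  finally have eq: "U (Suc (Suc n)) t - U (Suc n) t = \<dots>" .
  have "norm (T (\<lambda>y. A z y *v U (Suc n) y - A z y *v U n y) t) \<le> (C_gen z * (M * (1/4)^n)) * mass ({a..b} - {x})"
  proof (rule T_bound)
   show "norm (A z y *v U (Suc n) y - A z y *v U n y) \<le> C_gen z * (M * (1/4)^n)" if "y \<in> {a..b}" for y
    unfolding matrix_vector_mult_diff_distrib[symmetric]
    by (rule order_trans[OF gen_norm_le mult_left_mono[OF Suc.IH[OF that] C_gen_nonneg]])
   show "(\<lambda>y. A z y *v U (Suc n) y - A z y *v U n y) \<in> Borel"
    by (intro borel_measurable_diff gen_measurable U_meas)
  qed (use M0 C_gen_nonneg Suc.prems Ux in auto)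
  also have "\<dots> = (M * (1/4)^n) * (C_gen z * mass ({a..b} - {x}))" by simp
  also have "\<dots> \<le> (M * (1/4)^n) * (1/4)" using small[of "{a..b} - {x}"] M0 by (intro mult_left_mono) auto
  finally show ?case unfolding eq by simp
 qed
 have "uniform_limit {a..b} (\<lambda>n t. \<Sum>k<n. U (Suc k) t - U k t) (\<lambda>t. \<Sum>k. U (Suc k) t - U k t) sequentially"
  by (rule Weierstrass_m_test[OF step]) (assumption, intro summable_mult summable_geometric, simp)
 then have lim: "uniform_limit {a..b} (\<lambda>n t. U n t - m) (\<lambda>t. \<Sum>k. U (Suc k) t - U k t) sequentially"
 proof -
  have "(\<Sum>k<n. U (Suc k) t - U k t) = U n t - m" for n t
   using sum_lessThan_telescope[of "\<lambda>k. U k t" n] by (simp add: U_0)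
  moreover assume "uniform_limit {a..b} (\<lambda>n t. \<Sum>k<n. U (Suc k) t - U k t) (\<lambda>t. \<Sum>k. U (Suc k) t - U k t) sequentially"
  ultimately show ?thesis by simp
 qed
 define u where "u t = (if t \<in> {a..b} then m + (\<Sum>k. U (Suc k) t - U k t) else 0)" for t
 have unif: "\<forall>\<^sub>F n in sequentially. \<forall>t\<in>{a..b}. norm (U n t - u t) < e" if "e > 0" for e
  using uniform_limitD[OF lim that] by eventually_elim (simp add: u_def dist_norm algebra_simps)
 have ptw: "(\<lambda>n. U n t) \<longlonglongrightarrow> u t" if t: "t \<in> {a..b}" for t
 proof (rule tendstoI)
  fix e :: real assume "e > 0"
  from unif[OF this] show "\<forall>\<^sub>F n in sequentially. dist (U n t) (u t) < e"
   by eventually_elim (use t in \<open>simp add: dist_norm\<close>)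
 qed
 have u_meas: "u \<in> Borel"
 proof (rule borel_measurable_LIMSEQ_metric)
  show "(\<lambda>t. if t \<in> {a..b} then U n t else 0) \<in> Borel" for n
   using U_meas[of n] by measurable
  show "(\<lambda>n. if t \<in> {a..b} then U n t else 0) \<longlonglongrightarrow> u t" for t
  proof (cases "t \<in> {a..b}")
   case True
   then show ?thesis using ptw[OF True] by simp
  next
   case False
   then have "u t = 0" unfolding u_def by (rule if_not_P)
   then show ?thesis unfolding if_not_P[OF False] by simp
  qed
 qed
 obtain N where N: "\<forall>t\<in>{a..b}. norm (U N t - u t) < 1" using eventually_happens'[OF _ unif[of 1]] by auto
 have u_bound: "norm (u t) \<le> BU N + 1" if "t \<in> {a..b}" for t
  using N that BU(2)[OF that, of N] norm_triangle_ineq4[of "U N t" "U N t - u t"] by force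
 have Au: "norm (A z y *v u y) \<le> C_gen z * (BU N + 1)" if "y \<in> {a..b}" for y
  by (rule order_trans[OF gen_norm_le mult_left_mono[OF u_bound[OF that] C_gen_nonneg]])
 have u_eq: "u t = m + T (\<lambda>y. A z y *v u y) t" if t: "t \<in> {a..b}" for t
 proof -
  have lim1: "(\<lambda>n. U (Suc n) t) \<longlonglongrightarrow> u t" by (rule LIMSEQ_Suc[OF ptw[OF t]])
  have "(\<lambda>n. T (\<lambda>y. A z y *v U n y) t) \<longlonglongrightarrow> T (\<lambda>y. A z y *v u y) t"
   unfolding tendsto_iff
  proof (intro allI impI)
   fix e :: real assume e: "e > 0"
   define D where "D = C_gen z * mass {a..b} + 1"
   have D: "D > 0" using C_gen_nonneg[of z] measure_nonneg[of \<nu> "{a..b}"] by (simp add: D_def add_nonneg_pos)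
   have "\<forall>\<^sub>F n in sequentially. \<forall>t\<in>{a..b}. norm (U n t - u t) < e / D" using unif[of "e/D"] e D by simp
   then show "\<forall>\<^sub>F n in sequentially. dist (T (\<lambda>y. A z y *v U n y) t) (T (\<lambda>y. A z y *v u y) t) < e"
   proof eventually_elim
    case (elim n)
    have "dist (T (\<lambda>y. A z y *v U n y) t) (T (\<lambda>y. A z y *v u y) t) = norm (T (\<lambda>y. A z y *v U n y - A z y *v u y) t)"
     unfolding dist_norm by (subst T_diff[OF gen_measurable[OF U_meas] AU gen_measurable[OF u_meas] Au t]) simp_all
    also have "\<dots> \<le> (C_gen z * (e / D)) * mass {a..b}"
    proof (rule T_bound)
     show "norm (A z y *v U n y - A z y *v u y) \<le> C_gen z * (e / D)" if "y \<in> {a..b}" for y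
      unfolding matrix_vector_mult_diff_distrib[symmetric]
      by (rule order_trans[OF gen_norm_le mult_left_mono[OF _ C_gen_nonneg]]) (use elim that in force)
     show "(\<lambda>y. A z y *v U n y - A z y *v u y) \<in> Borel"
      by (intro borel_measurable_diff gen_measurable U_meas u_meas)
    qed (use e D C_gen_nonneg t in auto)
    also have "\<dots> = (e / D) * (D - 1)" by (simp add: D_def)
    also have "\<dots> < e" using e D by (simp add: field_simps)
    finally show ?case .
   qed
  qed
  then have "(\<lambda>n. U (Suc n) t) \<longlonglongrightarrow> m + T (\<lambda>y. A z y *v u y) t" unfolding U_Suc using t by (auto intro: tendsto_intros)
  then show ?thesis using lim1 LIMSEQ_unique by blast
 qed
 have "sol z a b u" unfolding sol_def
 proof (intro conjI ballI)
  show "\<exists>B. \<forall>t\<in>{a..b}. norm (u t) \<le> B" using u_bound by blast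
  fix t assume t: "t \<in> {a..b}"
  define f where "f = (\<lambda>y. A z y *v u y)"
  have ha: "hint f s r = hint f s q + hint f q r" if "a \<le> s" "s \<le> q" "q \<le> r" "r \<le> b" for s q r
   unfolding f_def using that ab dom_down[OF b, of r] Au by (intro hint_add[OF gen_measurable[OF u_meas], where B="C_gen z * (BU N + 1)"]) auto
  have ua: "u a = m + T f a" and ut: "u t = m + T f t" unfolding f_def using ab by (auto intro!: u_eq t)
  have Ta: "T f a = - hint f a x" using ab by (cases "x = a") (auto simp: T_def)
  have "T f t = hint f a t - hint f a x"
  proof (cases "x \<le> t")
   case True
   then show ?thesis using ha[of a x t] t ab by (simp add: T_def)
  next
   case False
   then show ?thesis using ha[of a t x] t ab by (simp add: T_def)
  qed
  then have "u t = u a + hint f a t" unfolding ua ut Ta by simp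
  then show "u t = u a + hint (\<lambda>y. A z y *v u y) a t" unfolding f_def .
 qed (rule u_meas)
 moreover have "u x = m" using u_eq[of x] ab by (simp add: T_def)
 ultimately show ?thesis by blast
qed

lemma mform_nonneg: "nonneg_matrix M \<Longrightarrow> 0 \<le> Re (mform M v v)"
 by (simp add: nonneg_matrix_def mform_def sum_2 algebra_simps)

lemma mform_sym: "hermitian M \<Longrightarrow> mform M v u = cnj (mform M u v)"
 by (simp add: mform_def hermitian_entries) (simp add: algebra_simps)

lemma mform_add: "mform M (u + u') v = mform M u v + mform M u' v" "mform M u (v + v') = mform M u v + mform M u v'"
 by (simp_all add: mform_def algebra_simps)

lemma mform_smult: "mform M (a *s u) v = a * mform M u v" "mform M u (a *s v) = cnj a * mform M u v"
 by (simp_all add: mform_def algebra_simps)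

lemma real_quadratic_nonneg:
 fixes a b :: real
 assumes "\<And>t. 0 \<le> a * t + b * t\<^sup>2"
 shows "a = 0"
proof (rule ccontr)
 assume a: "a \<noteq> 0"
 define k where "k = \<bar>b\<bar> + 1"
 have k: "k > 0" "b < k" by (auto simp: k_def)
 have "a * (- a / k) + b * (- a / k)\<^sup>2 = (a / k)\<^sup>2 * (b - k)"
  using k(1) by (simp add: field_simps power2_eq_square)
 moreover have "(a / k)\<^sup>2 > 0" using a k by simp
 ultimately have "a * (- a / k) + b * (- a / k)\<^sup>2 < 0" using k by (simp add: mult_pos_neg)
 then show False using assms[of "- a / k"] by simp
qed

lemma mform_zero_imp:
 assumes M: "nonneg_matrix M" and z: "Re (mform M v v) = 0"
 shows "M *v v = 0"
proof -
 have H: "hermitian M" using M by (simp add: nonneg_matrix_def)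
 define w where "w = M *v v"
 have "0 \<le> (2 * Re (mform M v w)) * t + Re (mform M w w) * t\<^sup>2" for t
 proof -
  have "0 \<le> Re (mform M (v + of_real t *s w) (v + of_real t *s w))" by (rule mform_nonneg[OF M])
  also have "\<dots> = (2 * Re (mform M v w)) * t + Re (mform M w w) * t\<^sup>2"
   using z by (simp add: mform_add mform_smult mform_sym[OF H, of w v] algebra_simps power2_eq_square)
  finally show ?thesis .
 qed
 then have "Re (mform M v w) = 0" using real_quadratic_nonneg[of "2 * Re (mform M v w)" "Re (mform M w w)"] by simp
 moreover have "mform M v w = cnj (w $ 1) * w $ 1 + cnj (w $ 2) * w $ 2"
  by (simp add: mform_def w_def matrix_vector_mult_def sum_2)
 ultimately have "(norm (w $ 1))\<^sup>2 + (norm (w $ 2))\<^sup>2 = 0"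
  by (simp add: cmod_def power2_eq_square)
 then show ?thesis by (simp add: vec_eq_iff forall_2 w_def[symmetric] sum_power2_eq_zero_iff)
qed

lemma mform_measurable [measurable]:
 assumes [measurable]: "u \<in> Borel" "v \<in> Borel"
 shows "(\<lambda>x. mform (W x) (u x) (v x)) \<in> Borel"
 unfolding mform_def by measurable

lemma mform_W_bound: "norm (mform (W x) u v) \<le> 4 * K * norm u * norm v"
proof -
 have *: "norm (cnj (v $ i) * (W x $ i $ 1 * u $ 1 + W x $ i $ 2 * u $ 2)) \<le> norm v * (K * norm u + K * norm u)" for i
  by (intro order_trans[OF norm_mult_ineq] mult_mono norm_triangle_mono W_bound K_nonneg norm_ge_zero) (simp_all add: component_norm_le)
 have "norm (mform (W x) u v) \<le> norm v * (K * norm u + K * norm u) + norm v * (K * norm u + K * norm u)"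
  unfolding mform_def by (intro norm_triangle_mono *)
 then show ?thesis by (simp add: algebra_simps)
qed

text \<open>The functions for which the inner products over subsets of \<open>[0, c]\<close> are defined: Borel functions bounded on \<open>[0, c]\<close>.\<close>
definition lbm :: "real \<Rightarrow> (real \<Rightarrow> complex^2) \<Rightarrow> bool" where
 "lbm c u \<longleftrightarrow> u \<in> Borel \<and> (\<exists>B. \<forall>x\<in>{0..c}. norm (u x) \<le> B)"

lemma sol_lbm: "sol z 0 c u \<Longrightarrow> lbm c u"
 using sol_meas sol_bounded by (simp add: lbm_def)

lemma gram_integrable:
 assumes "lbm c u" "lbm c v" "c \<in> dom" "E \<in> sets borel" "E \<subseteq> {0..c}"
 shows "set_integrable \<nu> E (\<lambda>x. mform (W x) (u x) (v x))"
proof -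
 obtain B where B: "\<forall>x\<in>{0..c}. norm (u x) \<le> B" using assms by (auto simp: lbm_def)
 obtain B' where B': "\<forall>x\<in>{0..c}. norm (v x) \<le> B'" using assms by (auto simp: lbm_def)
 have [measurable]: "u \<in> Borel" "v \<in> Borel" using assms by (auto simp: lbm_def)
 show ?thesis
 proof (rule set_integrableI_bounded[OF _ assms(4,5,3), where B="4 * K * \<bar>B\<bar> * \<bar>B'\<bar>"])
  fix x assume "x \<in> E"
  then have x: "x \<in> {0..c}" using assms by blast
  have "norm (u x) \<le> \<bar>B\<bar>" "norm (v x) \<le> \<bar>B'\<bar>" using B B' x by fastforce+
  then show "norm (mform (W x) (u x) (v x)) \<le> 4 * K * \<bar>B\<bar> * \<bar>B'\<bar>"
   using K_nonneg by (intro order_trans[OF mform_W_bound] mult_mono) auto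
 qed measurable
qed

lemma gram_Re:
 assumes "lbm c u" "lbm c v" "c \<in> dom" "E \<in> sets borel" "E \<subseteq> {0..c}"
 shows "Re (gram E u v) = (LINT x:E|\<nu>. Re (mform (W x) (u x) (v x)))"
 using integral_bounded_linear[OF bounded_linear_Re gram_integrable[OF assms, unfolded set_integrable_def]]
 by (simp add: gram_def set_lebesgue_integral_def)

lemma gram_nonneg:
 assumes "lbm c u" "c \<in> dom" "E \<in> sets borel" "E \<subseteq> {0..c}"
 shows "0 \<le> Re (gram E u u)"
 unfolding gram_Re[OF assms(1,1,2,3,4)] set_lebesgue_integral_def
 by (intro Bochner_Integration.integral_nonneg) (simp add: mform_nonneg[OF W_nonneg])

lemma gram_zero_AE:
 assumes "lbm c u" "c \<in> dom" "E \<in> sets borel" "E \<subseteq> {0..c}" "Re (gram E u u) = 0"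
 shows "AE x in \<nu>. x \<in> E \<longrightarrow> W x *v u x = 0"
proof -
 have i: "set_integrable \<nu> E (\<lambda>x. Re (mform (W x) (u x) (u x)))"
  using integrable_bounded_linear[OF bounded_linear_Re gram_integrable[OF assms(1,1,2,3,4), unfolded set_integrable_def]]
  by (simp add: set_integrable_def)
 have "AE x in \<nu>. indicat_real E x *\<^sub>R Re (mform (W x) (u x) (u x)) = 0"
  using integral_nonneg_eq_0_iff_AE[OF i[unfolded set_integrable_def]] assms(5) unfolding gram_Re[OF assms(1,1,2,3,4)] set_lebesgue_integral_def
  by (simp add: mform_nonneg[OF W_nonneg])
 then show ?thesis by eventually_elim (auto intro: mform_zero_imp[OF W_nonneg])
qed

text \<open>A solution of norm 0 satisfies \<open>w u = 0\<close>, so the spectral parameter does not affect it.\<close>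
lemma sol_change_spectral_parameter:
 assumes u: "sol z 0 c u" and c: "c \<in> dom" and n: "AE x in \<nu>. x \<in> {0..c} \<longrightarrow> W x *v u x = 0"
 shows "sol l 0 c u"
 unfolding sol_def
proof (intro conjI ballI)
 fix t assume t: "t \<in> {0..c}"
 have "hint (\<lambda>y. A z y *v u y) 0 t = hint (\<lambda>y. A l y *v u y) 0 t"
 proof (rule hint_cong_AE[OF gen_measurable gen_measurable])
  show "AE x in \<nu>. x \<in> {0..t} \<longrightarrow> A z x *v u x = A l x *v u x"
   using n
  proof eventually_elim
   case (elim x)
   show ?case
   proof
    assume "x \<in> {0..t}"
    then have "W x *v u x = 0" using elim t by auto
    then have w: "W x $ 1 $ 1 * u x $ 1 + W x $ 1 $ 2 * u x $ 2 = 0" "W x $ 2 $ 1 * u x $ 1 + W x $ 2 $ 2 * u x $ 2 = 0"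
     by (simp_all add: vec_eq_iff forall_2 matrix_vector_mult_def sum_2)
    have "A k x *v u x = vector [- (Q x $ 2 $ 1 * u x $ 1 + Q x $ 2 $ 2 * u x $ 2), Q x $ 1 $ 1 * u x $ 1 + Q x $ 1 $ 2 * u x $ 2]" for k
    proof -
     have "k * (W x $ 1 $ 1 * u x $ 1 + W x $ 1 $ 2 * u x $ 2) = 0" "k * (W x $ 2 $ 1 * u x $ 1 + W x $ 2 $ 2 * u x $ 2) = 0" using w by simp_all
     then show ?thesis unfolding vec_eq_iff forall_2 gen_components by (simp add: algebra_simps)
    qed
    then show "A z x *v u x = A l x *v u x" by simp
   qed
  qed
 qed (use sol_meas[OF u] in auto)
 then show "u t = u 0 + hint (\<lambda>y. A l y *v u y) 0 t" using sol_eq[OF u t] by metis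
qed (use sol_meas[OF u] sol_bounded[OF u] in auto)

lemma hf_zero [simp]: "hf 0 v = 0" "hf u 0 = 0"
 by (simp_all add: hf_def)

text \<open>Lagrange's identity makes the norm of such a solution vanish for non-real \<open>z\<close>, whence it solves the equation at \<open>l\<close> as
well, where uniqueness holds. So uniqueness for the two-point problem is available at every non-real \<open>z\<close>.\<close>
lemma sol_zero_ends:
 assumes reg: "jump_regular l" and z: "Im z \<noteq> 0" and u: "sol z s t u" and st: "0 \<le> s" "s \<le> t" "t \<in> dom" and "u s = 0" "u t = 0"
 shows "\<forall>x\<in>{s..t}. u x = 0"
proof -
 define v where "v x = (if x \<le> s then 0 else u x)" for x
 have v: "sol z 0 t v" unfolding v_def using assms by (intro sol_glue) auto
 have v0: "v 0 = 0" "v t = 0" using st \<open>u t = 0\<close> by (auto simp: v_def)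
 have "left_lim z v t = 0" using left_lim_value[OF v \<open>t \<in> dom\<close>] v0 by (simp add: linear_0[OF bounded_linear.linear[OF gen_bounded_linear]])
 then have "(z - cnj z) * gram {0..<t} v v = 0" using lagrange_identity[OF v v \<open>t \<in> dom\<close>] v0 by simp
 then have g: "gram {0..<t} v v = 0" using z by (auto simp: complex_eq_iff)
 have "AE x in \<nu>. x \<in> {0..<t} \<longrightarrow> W x *v v x = 0"
  using g st by (intro gram_zero_AE[OF sol_lbm[OF v]]) auto
 then have "AE x in \<nu>. x \<in> {0..t} \<longrightarrow> W x *v v x = 0"
  by eventually_elim (use v0 in \<open>force simp: le_less\<close>)
 from uniqueness[OF reg sol_change_spectral_parameter[OF v \<open>t \<in> dom\<close> this] \<open>t \<in> dom\<close> v0(1)]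
 have "\<forall>x\<in>{0..t}. v x = 0" .
 then show ?thesis using st \<open>u s = 0\<close> by (force simp: v_def split: if_splits)
qed

end

section \<open>Boundary values on compact intervals\<close>

text \<open>Composition of linear relations: the pairs \<open>((a, m), (m, e))\<close> of \<open>R1 \<times> R2\<close> form an intersection of subspaces of
known dimensions, and by \<open>inj\<close> the middle component is determined by the outer ones.\<close>
lemma dim_relation_composition:
 fixes R1 R2 :: "('a::euclidean_space \<times> 'a) set"
 assumes s: "subspace R1" "subspace R2"
  and inj: "\<And>m. (0, m) \<in> R1 \<Longrightarrow> (m, 0) \<in> R2 \<Longrightarrow> m = 0"
 shows "dim R1 + dim R2 - DIM('a) \<le> dim (R1 O R2)"
proof -
 define D where "D = range (\<lambda>p::'a\<times>'a\<times>'a. ((fst p, fst (snd p)), (fst (snd p), snd (snd p))))"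
 have lin: "linear (\<lambda>p::'a\<times>'a\<times>'a. ((fst p, fst (snd p)), (fst (snd p), snd (snd p))))"
  by (rule linearI) (simp_all add: prod_eq_iff)
 have subD: "subspace D" unfolding D_def by (rule linear_subspace_image[OF lin subspace_UNIV])
 have dimD: "dim D = 3 * DIM('a)" unfolding D_def
  by (subst dim_image_eq[OF lin]) (auto intro!: injI simp: prod_eq_iff)
 have subR: "subspace (R1 \<times> R2)" using s by (rule subspace_Times)
 have dimR: "dim (R1 \<times> R2) = dim R1 + dim R2" using s by (rule dim_Times)
 let ?F = "(R1 \<times> R2) \<inter> D"
 have "dim {x + y |x y. x \<in> R1 \<times> R2 \<and> y \<in> D} + dim ?F = dim (R1 \<times> R2) + dim D"
  by (rule dim_sums_Int[OF subR subD])
 moreover have "dim {x + y |x y. x \<in> R1 \<times> R2 \<and> y \<in> D} \<le> 4 * DIM('a)"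
  using dim_subset_UNIV[of "{x + y |x y. x \<in> R1 \<times> R2 \<and> y \<in> D}"] by simp
 ultimately have F: "dim R1 + dim R2 - DIM('a) \<le> dim ?F" using dimR dimD by linarith
 have subF: "subspace ?F" by (rule subspace_inter[OF subR subD])
 have linE: "linear (\<lambda>p::('a\<times>'a)\<times>('a\<times>'a). (fst (fst p), snd (snd p)))" by (rule linearI) simp_all
 have "inj_on (\<lambda>p. (fst (fst p), snd (snd p))) (span ?F)"
  unfolding span_eq_iff[THEN iffD2, OF subF]
  unfolding linear_injective_on_subspace_0[OF linE subF]
  using inj by (auto simp: D_def zero_prod_def)
 from dim_image_eq[OF linE this] have "dim ?F = dim ((\<lambda>p. (fst (fst p), snd (snd p))) ` ?F)" by simp
 also have "\<dots> \<le> dim (R1 O R2)"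
  by (rule dim_subset) (force simp: D_def)
 finally show ?thesis using F by simp
qed

context canonical_system begin

text \<open>Pairs of boundary values. As \<open>z\<close> may be a point where solutions fail to be determined by, or to exist for, given initial
values, the solutions on an interval are studied through this linear relation in place of a transfer matrix.\<close>
definition bdry :: "complex \<Rightarrow> real \<Rightarrow> real \<Rightarrow> ((complex^2) \<times> (complex^2)) set" where
 "bdry z s t = {(u s, u t) | u. sol z s t u}"

lemma bdry_subspace:
 assumes "0 \<le> s" "t \<in> dom"
 shows "subspace (bdry z s t)"
proof (rule subspaceI)
 show "0 \<in> bdry z s t" unfolding bdry_def zero_prod_def by (rule CollectI, rule exI[of _ "\<lambda>_. 0"]) simp
next
 fix p q assume "p \<in> bdry z s t" "q \<in> bdry z s t"
 then obtain u v where "sol z s t u" "p = (u s, u t)" "sol z s t v" "q = (v s, v t)" by (auto simp: bdry_def)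
 then show "p + q \<in> bdry z s t" unfolding bdry_def using sol_add[of z s t u v] assms by (intro CollectI exI[of _ "\<lambda>x. u x + v x"]) simp
next
 fix p and r :: real assume "p \<in> bdry z s t"
 then obtain u where "sol z s t u" "p = (u s, u t)" by (auto simp: bdry_def)
 then show "r *\<^sub>R p \<in> bdry z s t" unfolding bdry_def using sol_scaleR[of z s t u r] assms by (intro CollectI exI[of _ "\<lambda>x. r *\<^sub>R u x"]) simp
qed

lemma bdry_dim_local:
 assumes c: "c \<in> dom" and ab: "0 \<le> a" "a \<le> x" "x \<le> b" "b \<le> c"
  and small: "\<And>E. E \<in> sets borel \<Longrightarrow> E \<subseteq> {a..b} - {x} \<Longrightarrow> C_gen z * mass E \<le> 1/4"
 shows "4 \<le> dim (bdry z a b)"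
proof -
 have b: "b \<in> dom" using dom_down[OF c] ab by simp
 define S where "S = {(u x, (u a, u b)) | u. sol z a b u}"
 have subS: "subspace S"
 proof (rule subspaceI)
  show "0 \<in> S" unfolding S_def zero_prod_def by (rule CollectI, rule exI[of _ "\<lambda>_. 0"]) simp
 next
  fix p q assume "p \<in> S" "q \<in> S"
  then obtain u v where "sol z a b u" "p = (u x, u a, u b)" "sol z a b v" "q = (v x, v a, v b)" by (auto simp: S_def)
  then show "p + q \<in> S" unfolding S_def using sol_add[of z a b u v] ab b by (intro CollectI exI[of _ "\<lambda>x. u x + v x"]) simp
 next
  fix p and r :: real assume "p \<in> S"
  then obtain u where "sol z a b u" "p = (u x, u a, u b)" by (auto simp: S_def)
  then show "r *\<^sub>R p \<in> S" unfolding S_def using sol_scaleR[of z a b u r] ab b by (intro CollectI exI[of _ "\<lambda>x. r *\<^sub>R u x"]) simp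
 qed
 have "fst ` S = UNIV" using local_existence[OF c ab small] by (auto simp: S_def image_iff) metis
 then have "4 = dim (fst ` S)" by simp
 also have "\<dots> \<le> dim S" by (rule dim_image_le[OF linear_fst])
 finally have "4 \<le> dim S" .
 also have "dim S = dim (snd ` S)"
 proof (rule dim_image_eq[OF linear_snd, symmetric])
  show "inj_on snd (span S)"
   unfolding span_eq_iff[THEN iffD2, OF subS] linear_injective_on_subspace_0[OF linear_snd subS]
  proof
   fix p assume p: "p \<in> S" 
   show "snd p = 0 \<longrightarrow> p = 0"
   proof
    assume "snd p = 0"
    then obtain u where u: "sol z a b u" "p = (u x, u a, u b)" "u a = 0" "u b = 0" using p by (auto simp: S_def zero_prod_def)
    have "u x = 0"
    proof (rule ccontr)
     assume ne: "u x \<noteq> 0"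
     then have "u x = (mass {x} / 2) *\<^sub>R (A z x *v u x)" "u x = - ((mass {x} / 2) *\<^sub>R (A z x *v u x))"
      using sol_vanishes_left_of(2)[OF u(1) ab(1-3) b u(3) small] sol_vanishes_right_of[OF u(1) ab(1-3) b u(4) small] by blast+
     then have "u x = - u x" by metis
     then show False using ne by (simp add: vec_eq_iff)
    qed
    then show "p = 0" using u by (simp add: zero_prod_def)
   qed
  qed
 qed
 also have "\<dots> \<le> dim (bdry z a b)" by (rule dim_subset) (auto simp: S_def bdry_def)
 finally show ?thesis .
qed

lemma bdry_comp:
 assumes "0 \<le> r" "r \<le> s" "s \<le> t" "t \<in> dom"
 shows "bdry z r s O bdry z s t \<subseteq> bdry z r t"
proof
 fix p assume "p \<in> bdry z r s O bdry z s t"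
 then obtain u v where uv: "sol z r s u" "sol z s t v" "u s = v s" "p = (u r, v t)" by (auto simp: bdry_def)
 have "sol z r t (\<lambda>x. if x \<le> s then u x else v x)" using uv assms by (intro sol_glue) auto
 then show "p \<in> bdry z r t" unfolding bdry_def using uv assms by (intro CollectI exI[of _ "\<lambda>x. if x \<le> s then u x else v x"]) auto
qed

text \<open>There are enough solutions even at atoms where the jump condition degenerates: the relation has at least the dimension 4 (over
the reals) of the graph of a transfer matrix. Locally this is \<open>local_existence\<close>; the relations of adjacent intervals compose without
loss of dimension because of \<open>sol_zero_ends\<close>.\<close>
theorem bdry_dim:
 assumes reg: "jump_regular l" and z: "Im z \<noteq> 0" and c: "c \<in> dom"
 shows "4 \<le> dim (bdry z 0 c)"
proof -
 define P where "P a b \<longleftrightarrow> (0 \<le> a \<and> b \<le> c \<longrightarrow> 4 \<le> dim (bdry z a b))" for a b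
 have "P 0 c" using domD(1)[OF c]
 proof (induction rule: Bolzano)
  case (trans r s t)
  show ?case unfolding P_def
  proof
   assume rt: "0 \<le> r \<and> t \<le> c"
   have d: "4 \<le> dim (bdry z r s)" "4 \<le> dim (bdry z s t)" using trans rt unfolding P_def by auto
   have t: "t \<in> dom" using rt trans c dom_down[of c t] by auto
   then have s: "s \<in> dom" using rt trans dom_down[of t s] by auto
   have sub: "subspace (bdry z r s)" "subspace (bdry z s t)" using rt trans s t by (auto intro!: bdry_subspace)
   have le: "dim (bdry z r s) \<le> 8" "dim (bdry z s t) \<le> 8"
    using dim_subset_UNIV[of "bdry z r s"] dim_subset_UNIV[of "bdry z s t"] by simp_all
   have "m = 0" if m: "(0, m) \<in> bdry z r s" "(m, 0) \<in> bdry z s t" for m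
   proof -
    obtain u v where uv: "sol z r s u" "sol z s t v" "u s = m" "v s = m" "u r = 0" "v t = 0"
     using m by (auto simp: bdry_def)
    have g: "sol z r t (\<lambda>x. if x \<le> s then u x else v x)" using uv rt trans t by (intro sol_glue) auto
    have "\<forall>x\<in>{r..t}. (if x \<le> s then u x else v x) = 0"
     by (rule sol_zero_ends[OF reg z g]) (use uv rt trans t in auto)
    then show "m = 0" using uv trans by force
   qed
   then have "4 \<le> dim (bdry z r s O bdry z s t)"
    using dim_relation_composition[OF sub] d by force
   also have "\<dots> \<le> dim (bdry z r t)" using rt trans t by (intro dim_subset bdry_comp) auto
   finally show "4 \<le> dim (bdry z r t)" .
  qed
 next
  case (local x)
  obtain d where d: "d > 0" "\<And>a b E. 0 \<le> a \<Longrightarrow> a \<le> x \<Longrightarrow> x \<le> b \<Longrightarrow> b \<le> c \<Longrightarrow> b - a < d \<Longrightarrow> E \<in> sets borel \<Longrightarrow> E \<subseteq> {a..b} - {x} \<Longrightarrow> C_gen z * mass E \<le> 1/4"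
   using small_neighbourhood[OF c] by metis
  have "P a b" if ab: "a \<le> x \<and> x \<le> b \<and> b - a < d" for a b
   unfolding P_def using ab d(2)[of a b] by (intro impI bdry_dim_local[OF c]) auto
  then show ?case using d(1) by blast
 qed
 then show ?thesis unfolding P_def by auto
qed

text \<open>The matrix of the real bilinear form \<open>Re (hf u v)\<close>, see \<open>Re_hf\<close>.\<close>
definition jj :: "complex^2 \<Rightarrow> complex^2" where
 "jj v = vector [\<i> * v $ 2, - \<i> * v $ 1]"

lemma Re_hf: "Re (hf u v) = inner u (jj v)"
 by (simp add: hf_def jj_def inner_vec_def sum_2 inner_complex_def algebra_simps)

lemma linear_jj: "linear jj"
 by (rule linearI; simp add: jj_def vec_eq_iff forall_2 algebra_simps)

lemma jj_eq_0: "jj v = 0 \<longleftrightarrow> v = 0"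
 by (auto simp: jj_def vec_eq_iff forall_2)

lemma left_lim_no_atom: "sol z 0 c u \<Longrightarrow> c \<in> dom \<Longrightarrow> mass {c} = 0 \<Longrightarrow> left_lim z u c = u c"
 using left_lim_value[of z c u] by simp

lemma gram_zero_left:
 assumes "AE x in \<nu>. x \<in> E \<longrightarrow> W x *v u x = 0" "E \<in> sets borel"
  "u \<in> Borel" "p \<in> Borel"
 shows "gram E p u = 0" "gram E u p = 0"
proof -
 have mu: "mform (W x) (u x) (p x) = 0" if "W x *v u x = 0" for x
  using that by (simp add: mform_def vec_eq_iff forall_2 matrix_vector_mult_def sum_2)
 have um: "mform (W x) (p x) (u x) = 0" if "W x *v u x = 0" for x
  using mu[OF that] mform_sym[OF W_herm, of x "p x" "u x"] by (metis complex_cnj_cnj complex_cnj_zero)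
 note [measurable] = assms(2-4)
 have "gram E p u = (LINT x:E|\<nu>. 0)" unfolding gram_def
  using assms(1) by (intro set_lebesgue_integral_cong_AE) (auto simp: um elim!: eventually_mono)
 then show "gram E p u = 0" by (simp add: set_lebesgue_integral_def)
 have "gram E u p = (LINT x:E|\<nu>. 0)" unfolding gram_def
  using assms(1) by (intro set_lebesgue_integral_cong_AE) (auto simp: mu elim!: eventually_mono)
 then show "gram E u p = 0" by (simp add: set_lebesgue_integral_def)
qed

text \<open>Von Neumann's decomposition on a compact interval, by counting dimensions. Let \<open>V\<close>, \<open>V'\<close> be the boundary values of the
solutions at \<open>z\<close> and \<open>cnj z\<close>, and \<open>E\<close> their intersection. Lagrange's identity shows that elements of
\<open>E\<close> come from solutions of norm 0, and that \<open>V\<close>, \<open>V'\<close> and the boundary values of \<open>p\<close> all lie in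
the complement \<open>Y\<close> of \<open>E\<close> with respect to the bracket. Since \<open>dim Y + dim E = 8\<close> and \<open>V\<close>,
\<open>V'\<close> have dimension at least 4, \<open>V + V'\<close> is all of \<open>Y\<close>.\<close>
theorem bdry_decomposition:
 assumes reg: "jump_regular l" and z: "Im z \<noteq> 0" and c: "c \<in> dom" "mass {c} = 0" and p: "sol k 0 c p"
 shows "\<exists>v m. sol z 0 c v \<and> sol (cnj z) 0 c m \<and> p 0 = v 0 + m 0 \<and> p c = v c + m c"
proof -
 let ?V = "bdry z 0 c" and ?V' = "bdry (cnj z) 0 c"
 have sub: "subspace ?V" "subspace ?V'" using bdry_subspace[OF _ c(1)] by auto
 have d: "4 \<le> dim ?V" "4 \<le> dim ?V'" using bdry_dim[OF reg _ c(1)] z by auto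
 define E where "E = ?V \<inter> ?V'"
 \<comment> \<open>T turns the indefinite boundary form into the Euclidean inner product (innerT)\<close>
 define T where "T p = (- jj (fst p), jj (snd p))" for p :: "(complex^2) \<times> (complex^2)"
 interpret jj: linear jj by (rule linear_jj)
 have linT: "linear T" by (rule linearI) (simp_all add: T_def jj.add jj.scale)
 have innerT: "inner (a, e) (T (a', e')) = Re (hf e e') - Re (hf a a')" for a e a' e'
  by (simp add: T_def Re_hf)
 have subE: "subspace E" unfolding E_def using sub by (rule subspace_inter)
 have "inj_on T (span E)" unfolding span_eq_iff[THEN iffD2, OF subE] linear_injective_on_subspace_0[OF linT subE]
  by (auto simp: T_def zero_prod_def jj_eq_0)
 then have dimTE: "dim (T ` E) = dim E" by (rule dim_image_eq[OF linT])
 have lag: "hf (u c) (v c) - hf (u 0) (v 0) = - \<i> * (x - cnj y) * gram {0..<c} u v" if "sol x 0 c u" "sol y 0 c v" for x y u v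
  using lagrange_identity[OF that c(1)] left_lim_no_atom[OF that(1) c] left_lim_no_atom[OF that(2) c] by simp
 define Y where "Y = {y. \<forall>x\<in>T ` E. orthogonal x y}"
 have subY: "subspace Y" unfolding Y_def by (rule subspace_orthogonal_to_vectors)
 have "dim {y \<in> UNIV. \<forall>x\<in>T ` E. orthogonal x y} + dim (T ` E) = dim (UNIV :: ((complex^2) \<times> (complex^2)) set)"
  by (rule dim_subspace_orthogonal_to_vectors) (auto intro: linear_subspace_image[OF linT subE] subspace_UNIV)
 then have dimY: "dim Y + dim E = 8" using dimTE by (simp add: Y_def)
 let ?S = "{x + y |x y. x \<in> ?V \<and> y \<in> ?V'}"
 have "dim ?S + dim E = dim ?V + dim ?V'" unfolding E_def by (rule dim_sums_Int[OF sub])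
 then have dimS: "dim Y \<le> dim ?S" using dimY d by linarith
 have ortho: "q \<in> Y" if "q = (u 0, u c)" "\<And>y v. sol z 0 c y \<Longrightarrow> sol (cnj z) 0 c v \<Longrightarrow> y 0 = v 0 \<Longrightarrow> y c = v c \<Longrightarrow> hf (u c) (y c) = hf (u 0) (y 0)" for q u
  unfolding Y_def
 proof (intro CollectI ballI)
  fix x assume "x \<in> T ` E"
  then obtain e where e: "e \<in> E" "x = T e" by blast
  obtain y v where yv: "sol z 0 c y" "sol (cnj z) 0 c v" "y 0 = v 0" "y c = v c" "e = (y 0, y c)"
   using e by (auto simp: E_def bdry_def)
  have "inner (u 0, u c) (T e) = 0" unfolding yv(5) innerT using that(2)[OF yv(1-4)] by simp
  then show "orthogonal x q" by (simp add: orthogonal_def e that inner_commute)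
 qed
 have VY: "?V \<subseteq> Y"
 proof
  fix q assume "q \<in> ?V"
  then obtain u where u: "sol z 0 c u" "q = (u 0, u c)" by (auto simp: bdry_def)
  show "q \<in> Y"
  proof (rule ortho[OF u(2)])
   fix y v assume "sol (cnj z) 0 c v" "y 0 = v 0" "y c = v c"
   then show "hf (u c) (y c) = hf (u 0) (y 0)" using lag[OF u(1), of "cnj z" v] by simp
  qed
 qed
 have V'Y: "?V' \<subseteq> Y"
 proof
  fix q assume "q \<in> ?V'"
  then obtain u where u: "sol (cnj z) 0 c u" "q = (u 0, u c)" by (auto simp: bdry_def)
  show "q \<in> Y"
  proof (rule ortho[OF u(2)])
   fix y assume "sol z 0 c y"
   then show "hf (u c) (y c) = hf (u 0) (y 0)" using lag[OF u(1), of z y] by simp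
  qed
 qed
 have pY: "(p 0, p c) \<in> Y"
 proof (rule ortho[OF refl])
  fix y v assume yv: "sol z 0 c y" "sol (cnj z) 0 c v" "y 0 = v 0" "y c = v c"
  have "hf (y c) (y c) - hf (y 0) (y 0) = of_real (2 * Im z) * gram {0..<c} y y" 
   unfolding lag[OF yv(1,1)] by (simp add: complex_eq_iff)
  moreover have "hf (v c) (v c) - hf (v 0) (v 0) = - of_real (2 * Im z) * gram {0..<c} v v" 
   unfolding lag[OF yv(2,2)] by (simp add: complex_eq_iff)
  ultimately have "of_real (2 * Im z) * gram {0..<c} y y = - of_real (2 * Im z) * gram {0..<c} v v" using yv by simp
  then have "of_real (2 * Im z) * (gram {0..<c} y y + gram {0..<c} v v) = 0" by (simp add: algebra_simps)
  then have "gram {0..<c} y y + gram {0..<c} v v = 0" using z by (simp add: complex_eq_iff)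
  then have "nsq c y + nsq c v = 0" by (simp add: complex_eq_iff)
  moreover have "0 \<le> nsq c y" by (rule gram_nonneg[OF sol_lbm[OF yv(1)] c(1)]) auto
  moreover have "0 \<le> nsq c v" by (rule gram_nonneg[OF sol_lbm[OF yv(2)] c(1)]) auto
  ultimately have "nsq c y = 0" by simp
  then have "AE x in \<nu>. x \<in> {0..<c} \<longrightarrow> W x *v y x = 0" by (intro gram_zero_AE[OF sol_lbm[OF yv(1)] c(1)]) auto
  then have "gram {0..<c} p y = 0" by (rule gram_zero_left) (use sol_meas[OF p] sol_meas[OF yv(1)] in auto)
  then show "hf (p c) (y c) = hf (p 0) (y 0)" using lag[OF p yv(1)] by simp
 qed
 have "?S \<subseteq> Y" using VY V'Y subspace_add[OF subY] by blast
 then have "?S = Y" using dimS by (intro subspace_dim_equal subspace_sums sub subY)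
 then obtain a b where "a \<in> ?V" "b \<in> ?V'" "(p 0, p c) = a + b" using pY by blast
 then show ?thesis by (auto simp: bdry_def) blast
qed

end

section \<open>Inner products and global solutions\<close>

lemma complex_real_iff: "Im z = 0 \<Longrightarrow> z = of_real (Re z)"
 by (simp add: complex_eq_iff)

context canonical_system begin

lemma lbm_meas: "lbm c u \<Longrightarrow> u \<in> Borel" by (simp add: lbm_def)

lemma lbm_add: "lbm c u \<Longrightarrow> lbm c v \<Longrightarrow> lbm c (\<lambda>x. u x + v x)"
 unfolding lbm_def by (safe; (rule borel_measurable_add; assumption)?) (meson norm_triangle_mono)

lemma lbm_smult: "lbm c u \<Longrightarrow> lbm c (\<lambda>x. a *s u x)"
 unfolding lbm_def by (safe; (rule smult_measurable; assumption)?) (metis mult_left_mono norm_ge_zero norm_smult)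

context
 fixes c E assumes cE: "c \<in> dom" "E \<in> sets borel" "E \<subseteq> {0..c}"
begin

lemma gram_add:
 assumes "lbm c u" "lbm c v" "lbm c w"
 shows "gram E (\<lambda>x. u x + v x) w = gram E u w + gram E v w"
  and "gram E w (\<lambda>x. u x + v x) = gram E w u + gram E w v"
 unfolding gram_def mform_add
 by (rule set_integral_add(2); rule gram_integrable[OF _ _ cE]; rule assms)+

lemma gram_smult:
 shows "gram E (\<lambda>x. a *s u x) w = a * gram E u w"
  and "gram E w (\<lambda>x. a *s u x) = cnj a * gram E w u"
 unfolding gram_def mform_smult by simp_all

lemma gram_sym: "gram E v u = cnj (gram E u v)"
 unfolding gram_def set_lebesgue_integral_def mform_sym[OF W_herm, of _ "v _" "u _"]
 by (simp flip: Bochner_Integration.integral_cnj)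

lemma gram_self_real: "gram E u u = of_real (Re (gram E u u))"
proof -
 have "Im (gram E u u) = 0" using gram_sym[of u u] by (simp add: complex_eq_iff)
 then show ?thesis by (rule complex_real_iff)
qed

lemma gram_Cauchy_Schwarz:
 assumes p: "lbm c p" and v: "lbm c v"
 shows "(norm (gram E p v))\<^sup>2 \<le> Re (gram E p p) * Re (gram E v v)"
proof (cases "Re (gram E v v) = 0")
 case True
 have "gram E p v = 0"
  by (rule gram_zero_left(1)[OF gram_zero_AE[OF v cE True] cE(2) lbm_meas[OF v] lbm_meas[OF p]])
 then show ?thesis using True by simp
next
 case False
 define G where "G = Re (gram E v v)"
 have G: "G > 0" using False gram_nonneg[OF v cE] by (simp add: G_def)
 define g where "g = gram E p v"
 define a where "a = - g / of_real G"
 have av: "lbm c (\<lambda>x. a *s v x)" by (rule lbm_smult[OF v])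
 have "0 \<le> Re (gram E (\<lambda>x. p x + a *s v x) (\<lambda>x. p x + a *s v x))" by (rule gram_nonneg[OF lbm_add[OF p av] cE])
 also have "gram E (\<lambda>x. p x + a *s v x) (\<lambda>x. p x + a *s v x) = gram E p p + cnj a * g + a * cnj g + a * cnj a * of_real G"
  unfolding gram_add(1)[OF p av lbm_add[OF p av]] gram_add(2)[OF p av p] gram_add(2)[OF p av av] gram_smult gram_sym[of v p] g_def[symmetric]
  by (simp add: G_def gram_self_real[of v, symmetric] algebra_simps)
 also have "\<dots> = gram E p p - of_real ((norm g)\<^sup>2 / G)"
 proof -
  have "g * cnj g = of_real ((norm g)\<^sup>2)" by (rule complex_norm_square[symmetric])
  then show ?thesis using G unfolding a_def by (simp add: field_simps)
 qed
 finally have "(norm g)\<^sup>2 / G \<le> Re (gram E p p)" by simp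
 then show ?thesis using G by (simp add: g_def[symmetric] G_def[symmetric] field_simps)
qed

lemma gram_add_le:
 assumes u: "lbm c u" and v: "lbm c v"
 shows "Re (gram E (\<lambda>x. u x + v x) (\<lambda>x. u x + v x)) \<le> 2 * Re (gram E u u) + 2 * Re (gram E v v)"
proof -
 have v': "lbm c (\<lambda>x. (-1) *s v x)" by (rule lbm_smult[OF v])
 have "0 \<le> Re (gram E (\<lambda>x. u x + (-1) *s v x) (\<lambda>x. u x + (-1) *s v x))" by (rule gram_nonneg[OF lbm_add[OF u v'] cE])
 then show ?thesis
  unfolding gram_add(1)[OF u v' lbm_add[OF u v']] gram_add(2)[OF u v' u] gram_add(2)[OF u v' v']
   gram_add(1)[OF u v lbm_add[OF u v]] gram_add(2)[OF u v u] gram_add(2)[OF u v v] gram_smult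
  by simp
qed

end

lemma gram_split:
 assumes "lbm c u" "lbm c v" "c \<in> dom" "0 \<le> s" "s \<le> c"
 shows "gram {0..<c} u v = gram {0..<s} u v + gram {s..<c} u v"
proof -
 have "{0..<c} = {0..<s} \<union> {s..<c}" using assms by auto
 then show ?thesis unfolding gram_def using assms
  by (simp only:) (intro set_integral_Un gram_integrable[OF assms(1,2,3)]; auto)
qed

lemma gram_mono:
 assumes "lbm c u" "c \<in> dom" "0 \<le> s" "s \<le> c"
 shows "nsq s u \<le> nsq c u"
proof -
 have "0 \<le> Re (gram {s..<c} u u)" using assms by (intro gram_nonneg[OF assms(1,2)]) auto
 then show ?thesis using gram_split[OF assms(1,1,2,3,4)] by simp
qed

text \<open>Solutions on the whole interval, in terms of the densities and with a value at 0.\<close>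
definition gsol :: "complex \<Rightarrow> (real \<Rightarrow> complex^2) \<Rightarrow> bool" where
 "gsol z u \<longleftrightarrow> (\<forall>c\<in>dom. sol z 0 c u)"

text \<open>Finite norm, expressed without integrals over the whole interval.\<close>
definition L2g :: "complex \<Rightarrow> (real \<Rightarrow> complex^2) \<Rightarrow> bool" where
 "L2g z u \<longleftrightarrow> gsol z u \<and> (\<exists>M. \<forall>c\<in>dom. nsq c u \<le> M)"

definition nullg :: "(real \<Rightarrow> complex^2) \<Rightarrow> bool" where
 "nullg u \<longleftrightarrow> (\<forall>c\<in>dom. nsq c u = 0)"

lemma gsolD: "gsol z u \<Longrightarrow> c \<in> dom \<Longrightarrow> sol z 0 c u" by (simp add: gsol_def)

lemma gsol_lbm: "gsol z u \<Longrightarrow> c \<in> dom \<Longrightarrow> lbm c u" using gsolD sol_lbm by blast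

lemma gsol_sum:
 assumes "finite S" "\<And>p. p \<in> S \<Longrightarrow> gsol z (u p)"
 shows "gsol z (\<lambda>x. \<Sum>p\<in>S. a p *s u p x)"
 unfolding gsol_def using assms domD(1) by (intro ballI sol_sum gsolD) auto

lemma L2g_sum:
 assumes "finite S" "\<And>p. p \<in> S \<Longrightarrow> L2g z (u p)"
 shows "L2g z (\<lambda>x. \<Sum>p\<in>S. a p *s u p x)"
 using assms
proof (induction S rule: finite_induct)
 case empty
 have "gsol z (\<lambda>x. 0)" by (simp add: gsol_def)
 moreover have "gram {0..<c} (\<lambda>x. 0) (\<lambda>x. 0) = 0" for c by (simp add: gram_def mform_def)
 ultimately show ?case by (auto simp: L2g_def intro!: exI[of _ 0])
next
 case (insert p S)
 let ?s = "\<lambda>x. \<Sum>p\<in>S. a p *s u p x"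
 have s: "L2g z ?s" "L2g z (u p)" using insert by auto
 obtain M M' where M: "\<And>c. c \<in> dom \<Longrightarrow> nsq c ?s \<le> M" "\<And>c. c \<in> dom \<Longrightarrow> nsq c (u p) \<le> M'"
  using s unfolding L2g_def by blast
 have g: "gsol z (u p)" "gsol z ?s" using s by (auto simp: L2g_def)
 have "nsq c (\<lambda>x. a p *s u p x + ?s x) \<le> 2 * ((norm (a p))\<^sup>2 * M') + 2 * M" if c: "c \<in> dom" for c
 proof -
  have E: "{0..<c} \<in> sets borel" "{0..<c} \<subseteq> {0..c}" by auto
  have "nsq c (\<lambda>x. a p *s u p x) = (norm (a p))\<^sup>2 * nsq c (u p)"
   unfolding gram_smult[OF c E] by (subst gram_self_real[OF c E]) (simp add: cmod_def power2_eq_square algebra_simps flip: of_real_mult)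
  also have "\<dots> \<le> (norm (a p))\<^sup>2 * M'" using M(2)[OF c] by (intro mult_left_mono) auto
  finally show ?thesis
   using gram_add_le[OF c E lbm_smult[OF gsol_lbm[OF g(1) c], of "a p"] gsol_lbm[OF g(2) c]] M(1)[OF c] by linarith
 qed
 moreover have "gsol z (\<lambda>x. a p *s u p x + ?s x)" unfolding gsol_def by (intro ballI sol_add sol_smult gsolD[OF g(1)] gsolD[OF g(2)]) auto
 ultimately show ?case using insert(1,2) unfolding L2g_def by auto
qed

lemma countable_atoms: "countable {x \<in> dom. mass {x} \<noteq> 0}"
proof -
 obtain c :: "nat \<Rightarrow> real" where c: "\<And>n. c n \<in> dom" "\<And>d. d \<in> dom \<Longrightarrow> \<exists>n. d \<le> c n"
  using dom_cofinal by blast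
 have "countable {x \<in> {0..c n}. mass {x} \<noteq> 0}" for n
 proof -
  let ?M = "density \<nu> (indicator {0..c n})"
  have "finite_measure ?M"
   by standard (use emeasure_finite[OF order_refl c(1)[of n]] in \<open>simp add: emeasure_density nn_integral_indicator less_top\<close>)
  then have "countable {x. measure ?M {x} \<noteq> 0}" by (rule finite_measure.countable_support)
  moreover have "measure ?M {x} = mass {x}" if "x \<in> {0..c n}" for x
  proof -
   have eq: "indicator {0..c n} y * indicator {x} y = (indicator {x} y :: ennreal)" for y
    using that by (auto split: split_indicator)
   have "emeasure ?M {x} = (\<integral>\<^sup>+ y. indicator {0..c n} y * indicator {x} y \<partial>\<nu>)"
    by (rule emeasure_density) auto
   also have "\<dots> = emeasure \<nu> {x}" unfolding eq by simp
   finally show ?thesis by (simp add: measure_def)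
  qed
  ultimately show ?thesis by (auto elim!: countable_subset[rotated])
 qed
 then have "countable (\<Union>n. {x \<in> {0..c n}. mass {x} \<noteq> 0})" by blast
 moreover have "{x \<in> dom. mass {x} \<noteq> 0} \<subseteq> (\<Union>n. {x \<in> {0..c n}. mass {x} \<noteq> 0})"
  using c(2) domD(1) by auto
 ultimately show ?thesis by (rule countable_subset[rotated])
qed

lemma nonatomic_above:
 assumes d: "d \<in> dom"
 shows "\<exists>c\<in>dom. d < c \<and> mass {c} = 0"
proof -
 obtain e where e: "e \<in> dom" "d < e" using dom_increase[OF d] by blast
 have "uncountable {d<..<e}" using e uncountable_open_interval by blast
 then have "\<not> {d<..<e} \<subseteq> {x \<in> dom. mass {x} \<noteq> 0}" using countable_subset[OF _ countable_atoms] by blast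
 moreover have "{d<..<e} \<subseteq> dom" using dom_down[OF e(1)] domD(1)[OF d] by auto
 ultimately show ?thesis by auto
qed

lemma nonatomic_sequence:
 obtains c :: "nat \<Rightarrow> real" where "strict_mono c" "\<And>n. c n \<in> dom" "\<And>n. mass {c n} = 0" "\<And>d. d \<in> dom \<Longrightarrow> \<exists>n. d \<le> c n"
proof -
 obtain d :: "nat \<Rightarrow> real" where d: "\<And>n. d n \<in> dom" "\<And>e. e \<in> dom \<Longrightarrow> \<exists>n. e \<le> d n"
  using dom_cofinal by blast
 have "\<exists>c. \<forall>n. (c n \<in> dom \<and> mass {c n} = 0 \<and> d n \<le> c n) \<and> c n < c (Suc n)"
 proof (rule dependent_nat_choice)
  show "\<exists>x. x \<in> dom \<and> mass {x} = 0 \<and> d 0 \<le> x" using nonatomic_above[OF d(1)[of 0]] by force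
  fix x n assume "x \<in> dom \<and> mass {x} = 0 \<and> d n \<le> x"
  then have "max x (d (Suc n)) \<in> dom" using d(1) by (auto simp: max_def)
  from nonatomic_above[OF this] show "\<exists>y. (y \<in> dom \<and> mass {y} = 0 \<and> d (Suc n) \<le> y) \<and> x < y" by force
 qed
 then obtain c where c: "\<And>n. c n \<in> dom" "\<And>n. mass {c n} = 0" "\<And>n. d n \<le> c n" "\<And>n. c n < c (Suc n)" by blast
 show ?thesis
 proof (rule that[of c])
  show "strict_mono c" using c(4) by (simp add: strict_mono_Suc_iff)
  show "\<exists>n. e \<le> c n" if "e \<in> dom" for e using d(2)[OF that] c(3) order_trans by blast
 qed (use c in auto)
qed

lemma sol_cong:
 assumes u: "sol z s t u" and "s \<le> t" and eq: "\<And>x. x \<in> {s..t} \<Longrightarrow> u x = v x" and v: "v \<in> Borel"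
 shows "sol z s t v"
 unfolding sol_def
proof (intro conjI ballI v)
 obtain B where "\<forall>x\<in>{s..t}. norm (u x) \<le> B" using sol_bounded[OF u] by blast
 then show "\<exists>B. \<forall>x\<in>{s..t}. norm (v x) \<le> B" using eq by force
 fix x assume x: "x \<in> {s..t}"
 have "hint (\<lambda>y. A z y *v u y) s x = hint (\<lambda>y. A z y *v v y) s x"
  using x eq by (intro hint_cong) auto
 then show "v x = v s + hint (\<lambda>y. A z y *v v y) s x" using sol_eq[OF u x] eq[OF x] eq[of s] \<open>s \<le> t\<close> by simp
qed

text \<open>By \<open>sol_zero_ends\<close> solutions are functions of their boundary values; evaluation at \<open>x\<close> is then linear and
continuous, so that limits of solutions can be formed in a finite-dimensional space.\<close>
lemma bdry_representation:
 assumes reg: "jump_regular l" and z: "Im z \<noteq> 0" and c: "c \<in> dom"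
 obtains L :: "real \<Rightarrow> (complex^2) \<times> (complex^2) \<Rightarrow> complex^2" where "\<And>x. linear (L x)"
  "\<And>u x. sol z 0 c u \<Longrightarrow> x \<in> {0..c} \<Longrightarrow> u x = L x (u 0, u c)"
  "\<And>d. d \<in> bdry z 0 c \<Longrightarrow> sol z 0 c (\<lambda>x. L x d)"
proof -
 obtain B where B: "B \<subseteq> bdry z 0 c" "independent B" "bdry z 0 c \<subseteq> span B" using basis_exists[of "bdry z 0 c"] by metis
 have sub: "subspace (bdry z 0 c)" using bdry_subspace[OF _ c] by simp
 have "\<forall>b\<in>B. \<exists>u. sol z 0 c u \<and> (u 0, u c) = b" using B(1) by (auto simp: bdry_def)
 then obtain U where U: "\<And>b. b \<in> B \<Longrightarrow> sol z 0 c (U b)" "\<And>b. b \<in> B \<Longrightarrow> (U b 0, U b c) = b" by metis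
 have "\<exists>g. linear g \<and> (\<forall>b\<in>B. g b = U b x)" for x by (rule linear_independent_extend[OF B(2)])
 then obtain L where L: "\<And>x. linear (L x)" "\<And>x b. b \<in> B \<Longrightarrow> L x b = U b x" by metis
 have rep: "sol z 0 c (\<lambda>x. L x d) \<and> (L 0 d, L c d) = d" if "d \<in> bdry z 0 c" for d
 proof -
  have "d \<in> span B" using that B(3) by blast
  then show ?thesis
  proof (induction rule: span_induct)
   case base
   show ?case
   proof (rule subspaceI)
    show "0 \<in> {x. sol z 0 c (\<lambda>xa. L xa x) \<and> (L 0 x, L c x) = x}" using L(1)[THEN linear_0] by (simp add: zero_prod_def)
   next
    fix x y assume "x \<in> {x. sol z 0 c (\<lambda>xa. L xa x) \<and> (L 0 x, L c x) = x}" "y \<in> {x. sol z 0 c (\<lambda>xa. L xa x) \<and> (L 0 x, L c x) = x}"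
    then show "x + y \<in> {x. sol z 0 c (\<lambda>xa. L xa x) \<and> (L 0 x, L c x) = x}"
     using sol_add[of z 0 c "\<lambda>t. L t x" "\<lambda>t. L t y"] c by (auto simp: linear_add[OF L(1)] prod_eq_iff)
   next
    fix r :: real and x assume "x \<in> {x. sol z 0 c (\<lambda>xa. L xa x) \<and> (L 0 x, L c x) = x}"
    then show "r *\<^sub>R x \<in> {x. sol z 0 c (\<lambda>xa. L xa x) \<and> (L 0 x, L c x) = x}"
     using sol_scaleR[of z 0 c "\<lambda>t. L t x" r] c by (auto simp: linear_scale[OF L(1)] prod_eq_iff)
   qed
  next
   case (step b)
   then show ?case using U[of b] L(2)[of b] by simp
  qed
 qed
 show ?thesis
 proof (rule that[of L])
  show "u x = L x (u 0, u c)" if u: "sol z 0 c u" and x: "x \<in> {0..c}" for u x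
  proof -
   let ?d = "(u 0, u c)"
   have "?d \<in> bdry z 0 c" using u by (auto simp: bdry_def)
   note r = rep[OF this]
   have "\<forall>x\<in>{0..c}. u x - L x ?d = 0"
    by (rule sol_zero_ends[OF reg z sol_diff[OF u r[THEN conjunct1]]]) (use r c domD(1)[OF c] in auto)
   from bspec[OF this x] show ?thesis by (rule eq_iff_diff_eq_0[THEN iffD2])
  qed
 qed (use L(1) rep in auto)
qed

lemma nullsol_change:
 assumes u: "sol z 0 c u" and c: "c \<in> dom" "mass {c} = 0" and n: "nsq c u = 0"
 shows "sol l 0 c u"
proof (rule sol_change_spectral_parameter[OF u c(1)])
 have fin: "emeasure \<nu> {c} < \<infinity>" using emeasure_finite[of "{c}" c] c domD(1)[OF c(1)] by auto
 have "emeasure \<nu> {c} = 0" using c(2) fin by (metis emeasure_eq_ennreal_measure ennreal_0 infinity_ennreal_def less_irrefl)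
 then have "AE x in \<nu>. x \<noteq> c" by (intro AE_I[where N="{c}"]) auto
 moreover have "AE x in \<nu>. x \<in> {0..<c} \<longrightarrow> W x *v u x = 0"
  using n by (intro gram_zero_AE[OF sol_lbm[OF u] c(1)]) auto
 ultimately show "AE x in \<nu>. x \<in> {0..c} \<longrightarrow> W x *v u x = 0" by eventually_elim force
qed

text \<open>Initial values of the solutions of norm 0 on \<open>[0, c]\<close>; these solutions are what the norm fails to control.\<close>
definition nullbdry :: "complex \<Rightarrow> real \<Rightarrow> (complex^2) set" where
 "nullbdry z c = {u 0 | u. sol z 0 c u \<and> nsq c u = 0}"

lemma nullbdry_subspace:
 assumes c: "c \<in> dom"
 shows "subspace (nullbdry z c)"
proof (rule subspaceI)
 have "gram {0..<c} (\<lambda>x. 0) (\<lambda>x. 0) = 0" for c by (simp add: gram_def mform_def)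
 then show "0 \<in> nullbdry z c" unfolding nullbdry_def by (intro CollectI exI[of _ "\<lambda>_. 0"]) simp
next
 have E: "{0..<c} \<in> sets borel" "{0..<c} \<subseteq> {0..c}" by auto
 fix x y assume "x \<in> nullbdry z c" "y \<in> nullbdry z c"
 then obtain u v where uv: "sol z 0 c u" "nsq c u = 0" "sol z 0 c v" "nsq c v = 0" "x = u 0" "y = v 0"
  by (auto simp: nullbdry_def)
 have s: "sol z 0 c (\<lambda>x. u x + v x)" using uv c by (intro sol_add) auto
 have "nsq c (\<lambda>x. u x + v x) \<le> 0"
  using gram_add_le[OF c E sol_lbm[OF uv(1)] sol_lbm[OF uv(3)]] uv by simp
 then have "nsq c (\<lambda>x. u x + v x) = 0" using gram_nonneg[OF sol_lbm[OF s] c E] by simp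
 then show "x + y \<in> nullbdry z c" unfolding nullbdry_def using s uv by (intro CollectI exI[of _ "\<lambda>x. u x + v x"]) simp
next
 have E: "{0..<c} \<in> sets borel" "{0..<c} \<subseteq> {0..c}" by auto
 fix r :: real and x assume "x \<in> nullbdry z c"
 then obtain u where u: "sol z 0 c u" "nsq c u = 0" "x = u 0" by (auto simp: nullbdry_def)
 have g0: "gram {0..<c} u u = 0" using gram_self_real[OF c E, of u] u by simp
 have "r *\<^sub>R v = complex_of_real r *s v" for v :: "complex^2" unfolding vec_eq_iff vector_scaleR_component vector_smult_component by (simp add: scaleR_conv_of_real)
 then have "nsq c (\<lambda>x. r *\<^sub>R u x) = 0" by (simp add: gram_smult[OF c E] g0)
 then show "r *\<^sub>R x \<in> nullbdry z c" unfolding nullbdry_def using sol_scaleR[OF u(1) order_refl c, of r] u by (intro CollectI exI[of _ "\<lambda>x. r *\<^sub>R u x"]) simp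
qed

lemma nullbdry_antimono:
 assumes "0 \<le> c" "c \<le> c'" "c' \<in> dom"
 shows "nullbdry z c' \<subseteq> nullbdry z c"
proof
 fix x assume "x \<in> nullbdry z c'"
 then obtain u where u: "sol z 0 c' u" "nsq c' u = 0" "x = u 0" by (auto simp: nullbdry_def)
 have c: "c \<in> dom" using dom_down assms by blast
 have s: "sol z 0 c u" using assms by (intro sol_restrict[OF u(1)]) auto
 have "nsq c u \<le> 0" using gram_mono[OF sol_lbm[OF u(1)] assms(3,1,2)] u by simp
 moreover have "0 \<le> nsq c u" by (rule gram_nonneg[OF sol_lbm[OF s] c]) auto
 ultimately show "x \<in> nullbdry z c" using s u by (auto simp: nullbdry_def)
qed

lemma sol_norm_sq:
 assumes u: "sol z 0 c u" and c: "c \<in> dom" "mass {c} = 0"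
 shows "Re (hf (u c) (u c)) - Re (hf (u 0) (u 0)) = 2 * Im z * nsq c u"
proof -
 have "hf (u c) (u c) = hf (u 0) (u 0) - \<i> * (z - cnj z) * gram {0..<c} u u"
  using lagrange_identity[OF u u c(1)] left_lim_no_atom[OF u c] by simp
 moreover have "- \<i> * (z - cnj z) = of_real (2 * Im z)" by (simp add: complex_eq_iff)
 ultimately have "hf (u c) (u c) - hf (u 0) (u 0) = of_real (2 * Im z) * gram {0..<c} u u"
  by (metis (no_types, lifting) add_diff_cancel_left' diff_conv_add_uminus mult_minus_left)
 then show ?thesis by (simp add: complex_eq_iff)
qed

lemma continuous_hf: "continuous_on UNIV (\<lambda>p. Re (hf (snd p) (snd p)) - Re (hf (fst p) (fst p)))"
 unfolding hf_def by (intro continuous_intros)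

text \<open>On the complement of the solutions of norm 0 the norm is a positive continuous quadratic function of the boundary
values, hence bounded below on the unit sphere.\<close>
lemma norm_controls_bdry:
 assumes reg: "jump_regular l" and z: "Im z \<noteq> 0" and c: "c \<in> dom" "mass {c} = 0"
 obtains C where "\<And>u. sol z 0 c u \<Longrightarrow> (\<And>k. k \<in> nullbdry z c \<Longrightarrow> inner (u 0) k = 0) \<Longrightarrow> (norm (u 0, u c))\<^sup>2 \<le> C * nsq c u"
proof -
 let ?K = "{p :: (complex^2) \<times> (complex^2). \<forall>k\<in>nullbdry z c. orthogonal (k, 0) p}"
 let ?V = "bdry z 0 c \<inter> ?K"
 have Ksub: "subspace ?K" using subspace_orthogonal_to_vectors[of "(\<lambda>k. (k, 0)) ` nullbdry z c"] by simp
 have Vsub: "subspace ?V" using Ksub bdry_subspace[OF _ c(1)] by (intro subspace_inter) auto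
 define N where "N p = (Re (hf (snd p) (snd p)) - Re (hf (fst p) (fst p))) / (2 * Im z)" for p :: "(complex^2) \<times> (complex^2)"
 have N: "N (u 0, u c) = nsq c u" if "sol z 0 c u" for u
  using sol_norm_sq[OF that c] z by (simp add: N_def)
 have Ncont: "continuous_on UNIV N" unfolding N_def using z by (intro continuous_intros continuous_hf) auto
 have Npos: "N p > 0" if p: "p \<in> ?V" "p \<noteq> 0" for p
 proof -
  obtain u where u: "sol z 0 c u" "p = (u 0, u c)" using p by (auto simp: bdry_def)
  have ge: "0 \<le> nsq c u" by (rule gram_nonneg[OF sol_lbm[OF u(1)] c(1)]) auto
  have "nsq c u \<noteq> 0"
  proof
   assume 0: "nsq c u = 0"
   then have "u 0 \<in> nullbdry z c" using u by (auto simp: nullbdry_def)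
   then have "u 0 = 0" using p u by (auto simp: orthogonal_def)
   from uniqueness[OF reg nullsol_change[OF u(1) c 0] c(1) this] have "u c = 0" using domD(1)[OF c(1)] by auto
   then show False using \<open>u 0 = 0\<close> p u by (simp add: zero_prod_def)
  qed
  then show ?thesis using N[OF u(1)] ge u by simp
 qed
 have comp: "compact (?V \<inter> sphere 0 1)" by (intro closed_Int_compact closed_subspace Vsub compact_sphere)
 have scale: "N (r *\<^sub>R p) = r\<^sup>2 * N p" for r p
  by (simp add: N_def hf_def algebra_simps power2_eq_square diff_divide_distrib)
 have "\<exists>\<mu>>0. \<forall>p\<in>?V \<inter> sphere 0 1. \<mu> \<le> N p"
 proof (cases "?V \<inter> sphere 0 1 = {}")
  case True then show ?thesis by (intro exI[of _ 1]) auto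
 next
  case False
  obtain p where p: "p \<in> ?V \<inter> sphere 0 1" "\<And>q. q \<in> ?V \<inter> sphere 0 1 \<Longrightarrow> N p \<le> N q"
   using continuous_attains_inf[OF comp False continuous_on_subset[OF Ncont]] by blast
  then have "N p > 0" by (intro Npos) auto
  then show ?thesis using p(2) by blast
 qed
 then obtain \<mu> where \<mu>: "\<mu> > 0" "\<And>p. p \<in> ?V \<inter> sphere 0 1 \<Longrightarrow> \<mu> \<le> N p" by blast
 show ?thesis
 proof (rule that[of "1 / \<mu>"])
  fix u assume u: "sol z 0 c u" "\<And>k. k \<in> nullbdry z c \<Longrightarrow> inner (u 0) k = 0"
  let ?p = "(u 0, u c)"
  have "\<mu> * (norm p)\<^sup>2 \<le> N p" if p: "p \<in> ?V" for p
  proof (cases "p = 0")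
   case True then show ?thesis using scale[of 0 p] by simp
  next
   case False
   have "(1 / norm p) *\<^sub>R p \<in> ?V \<inter> sphere 0 1" using subspace_scale[OF Vsub p, of "1 / norm p"] False by simp
   from \<mu>(2)[OF this] show ?thesis unfolding scale using False by (simp add: field_simps)
  qed
  moreover have "?p \<in> ?V" using u by (auto simp: bdry_def orthogonal_def inner_commute)
  ultimately have "\<mu> * (norm ?p)\<^sup>2 \<le> N ?p" by blast
  then show "(norm ?p)\<^sup>2 \<le> 1 / \<mu> * nsq c u" using N[OF u(1)] \<mu>(1) by (simp add: field_simps)
 qed
qed

end

section \<open>Comparison of two parameters in one half-plane\<close>

lemma hf_add: "hf (u + v) w = hf u w + hf v w" "hf w (u + v) = hf w u + hf w v"
 by (simp_all add: hf_def algebra_simps)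

lemma tendsto_hf:
 assumes "(u \<longlongrightarrow> a) F" "(v \<longlongrightarrow> b) F"
 shows "((\<lambda>i. hf (u i) (v i)) \<longlongrightarrow> hf a b) F"
 unfolding hf_def by (intro tendsto_intros assms)

lemma finite_convergent_subsequence:
 fixes f :: "'p \<Rightarrow> nat \<Rightarrow> 'a::heine_borel"
 assumes "finite S" "\<And>p. p \<in> S \<Longrightarrow> bounded (range (f p))"
 shows "\<exists>r::nat\<Rightarrow>nat. strict_mono r \<and> (\<forall>p\<in>S. convergent (\<lambda>i. f p (r i)))"
 using assms
proof (induction S rule: finite_induct)
 case empty
 show ?case by (rule exI[of _ id]) (simp add: strict_mono_def)
next
 case (insert p S)
 then obtain r where r: "strict_mono r" "\<And>q. q \<in> S \<Longrightarrow> convergent (\<lambda>i. f q (r i))" by auto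
 have "bounded (range (\<lambda>i. f p (r i)))" by (rule bounded_subset[OF insert.prems[of p]]) auto
 then obtain l r' where r': "strict_mono r'" "((\<lambda>i. f p (r i)) \<circ> r') \<longlonglongrightarrow> l"
  using bounded_imp_convergent_subsequence by blast
 have "convergent (\<lambda>i. f q (r (r' i)))" if "q \<in> S" for q
  using convergent_subseq_convergent[OF r(2)[OF that] r'(1)] by (simp add: o_def)
 moreover have "convergent (\<lambda>i. f p (r (r' i)))" using r'(2) by (auto simp: o_def convergent_def)
 ultimately show ?case using strict_mono_o[OF r(1) r'(1)] by (intro exI[of _ "r \<circ> r'"]) (auto simp: o_def)
qed

context canonical_system begin

lemma lagrange_no_atom:
 assumes "sol x 0 c u" "sol y 0 c v" "c \<in> dom" "mass {c} = 0"
 shows "hf (u c) (v c) - hf (u 0) (v 0) = - \<i> * (x - cnj y) * gram {0..<c} u v"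
 using lagrange_identity[OF assms(1,2,3)] left_lim_no_atom[OF assms(1,3,4)] left_lim_no_atom[OF assms(2,3,4)] by simp

text \<open>Let \<open>p\<close> and \<open>v + m\<close> have the same boundary values. The bracket depends on boundary values only, and the brackets of
\<open>v\<close> with \<open>m\<close> are conserved, so Lagrange's identity evaluates the norms of \<open>p\<close>, \<open>v\<close>,
\<open>m\<close> and the inner product of \<open>p\<close> and \<open>v\<close> against each other. The assumption that \<open>z\<close> and
\<open>k\<close> lie in the same half-plane gives the term of \<open>m\<close> its favourable sign.\<close>
lemma decomposition_estimates:
 assumes p: "sol k 0 c p" and v: "sol z 0 c v" and m: "sol (cnj z) 0 c m" and c: "c \<in> dom" "mass {c} = 0"
  and eq: "p 0 = v 0 + m 0" "p c = v c + m c" and zk: "Im z * Im k > 0"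
 shows "\<bar>Im k\<bar> * nsq c p \<le> \<bar>Im z\<bar> * nsq c v"
  and "norm (k - cnj z) * norm (gram {0..<c} p v) = 2 * \<bar>Im z\<bar> * nsq c v"
  and "nsq c v \<le> (norm (k - cnj z) / (2 * Im z))\<^sup>2 * nsq c p"
proof -
 have E: "{0..<c} \<in> sets borel" "{0..<c} \<subseteq> {0..c}" by auto
 define gp gv gm where "gp = nsq c p" and "gv = nsq c v" and "gm = nsq c m"
 have g: "gram {0..<c} p p = of_real gp" "gram {0..<c} v v = of_real gv" "gram {0..<c} m m = of_real gm"
  unfolding gp_def gv_def gm_def by (rule gram_self_real[OF c(1) E])+
 have ge: "0 \<le> gp" "0 \<le> gv" "0 \<le> gm" unfolding gp_def gv_def gm_def
  by (rule gram_nonneg[OF sol_lbm[OF p] c(1) E], rule gram_nonneg[OF sol_lbm[OF v] c(1) E], rule gram_nonneg[OF sol_lbm[OF m] c(1) E])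
 note L = lagrange_no_atom[OF _ _ c]
 have vm: "hf (v c) (m c) - hf (v 0) (m 0) = 0" using L[OF v m] by simp
 have mv: "hf (m c) (v c) - hf (m 0) (v 0) = 0" using L[OF m v] by simp
 have zz: "- \<i> * (x - cnj x) = of_real (2 * Im x)" for x by (simp add: complex_eq_iff)
 have vv: "hf (v c) (v c) - hf (v 0) (v 0) = of_real (2 * Im z * gv)" using L[OF v v] unfolding zz g by simp
 have mm: "hf (m c) (m c) - hf (m 0) (m 0) = of_real (- 2 * Im z * gm)" using L[OF m m] unfolding zz g by simp
 have pp: "hf (p c) (p c) - hf (p 0) (p 0) = of_real (2 * Im k * gp)" using L[OF p p] unfolding zz g by simp
 have "of_real (2 * Im k * gp) = (of_real (2 * Im z * gv - 2 * Im z * gm) :: complex)"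
  unfolding pp[symmetric] using vv mm vm mv unfolding eq hf_add by (simp add: algebra_simps)
 then have id: "Im k * gp = Im z * gv - Im z * gm" by (simp only: of_real_eq_iff)
 show 1: "\<bar>Im k\<bar> * gp \<le> \<bar>Im z\<bar> * gv"
 proof (cases "Im z > 0")
  case True
  then have "Im k > 0" using zk by (simp add: zero_less_mult_iff)
  then show ?thesis using True id ge by simp
 next
  case False
  then have z: "Im z < 0" "Im k < 0" using zk by (auto simp: zero_less_mult_iff)
  have "0 \<le> Im z * gm \<longleftrightarrow> gm = 0 \<or> gm < 0" using z by (auto simp: zero_le_mult_iff ge)
  have "Im z * gm \<le> 0" using z ge by (simp add: mult_nonpos_nonneg)
  then show ?thesis using z id by simp
 qed
 have "hf (p c) (v c) - hf (p 0) (v 0) = of_real (2 * Im z * gv)"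
  using vv mv unfolding eq hf_add by (simp add: algebra_simps)
 then have "- \<i> * (k - cnj z) * gram {0..<c} p v = of_real (2 * Im z * gv)" using L[OF p v] by simp
 then have "norm (- \<i> * (k - cnj z) * gram {0..<c} p v) = norm (of_real (2 * Im z * gv) :: complex)" by (rule arg_cong)
 then show 2: "norm (k - cnj z) * norm (gram {0..<c} p v) = 2 * \<bar>Im z\<bar> * gv"
  using ge by (simp add: norm_mult)
 show "gv \<le> (norm (k - cnj z) / (2 * Im z))\<^sup>2 * gp"
 proof (cases "gv = 0")
  case False
  then have pos: "gv > 0" using ge by simp
  have z: "Im z \<noteq> 0" using zk by auto
  have "(norm (k - cnj z) * norm (gram {0..<c} p v))\<^sup>2 \<le> (norm (k - cnj z))\<^sup>2 * (gp * gv)"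
   unfolding power_mult_distrib gp_def gv_def
   by (intro mult_left_mono gram_Cauchy_Schwarz[OF c(1) E sol_lbm[OF p] sol_lbm[OF v]]) auto
  then have "(2 * \<bar>Im z\<bar> * gv)\<^sup>2 \<le> (norm (k - cnj z))\<^sup>2 * (gp * gv)" unfolding 2 .
  then have "(4 * (Im z)\<^sup>2 * gv) * gv \<le> ((norm (k - cnj z))\<^sup>2 * gp) * gv" by (simp add: power2_eq_square algebra_simps)
  then have "4 * (Im z)\<^sup>2 * gv \<le> (norm (k - cnj z))\<^sup>2 * gp" using pos by simp
  then show ?thesis using z by (simp add: power_divide power_mult_distrib field_simps)
 qed (use ge in simp)
qed

text \<open>A solution of norm 0 solves the equation at \<open>z\<close> and at \<open>cnj z\<close>, so it may be moved from one summand to the other.\<close>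
lemma bdry_decomposition_normalized:
 assumes reg: "jump_regular l" and z: "Im z \<noteq> 0" and c: "c \<in> dom" "mass {c} = 0" and p: "sol k 0 c p"
 shows "\<exists>v m. sol z 0 c v \<and> sol (cnj z) 0 c m \<and> p 0 = v 0 + m 0 \<and> p c = v c + m c \<and> (\<forall>h\<in>nullbdry z c. inner (v 0) h = 0)"
proof -
 obtain v m where vm: "sol z 0 c v" "sol (cnj z) 0 c m" "p 0 = v 0 + m 0" "p c = v c + m c"
  using bdry_decomposition[OF assms] by blast
 obtain y w where yw: "y \<in> span (nullbdry z c)" "\<And>h. h \<in> span (nullbdry z c) \<Longrightarrow> orthogonal w h" "v 0 = y + w"
  using orthogonal_subspace_decomp_exists[of "nullbdry z c" "v 0"] by metis
 have "y \<in> nullbdry z c" using yw(1) unfolding span_eq_iff[THEN iffD2, OF nullbdry_subspace[OF c(1)]] .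
 then obtain u where u: "sol z 0 c u" "nsq c u = 0" "y = u 0" by (auto simp: nullbdry_def)
 have u': "sol (cnj z) 0 c u" by (rule nullsol_change[OF u(1) c u(2)])
 show ?thesis
 proof (intro exI conjI ballI)
  show "sol z 0 c (\<lambda>x. v x - u x)" "sol (cnj z) 0 c (\<lambda>x. m x + u x)"
   using vm u u' c by (auto intro: sol_add sol_diff)
  show "inner (v 0 - u 0) h = 0" if "h \<in> nullbdry z c" for h
   using yw(2)[OF span_base[OF that]] yw(3) u(3) by (simp add: orthogonal_def)
 qed (use vm in auto)
qed

text \<open>The image \<open>T p\<close> is a limit of the components \<open>V p n\<close> at \<open>z\<close> of \<open>p\<close> on intervals \<open>[0, c
n]\<close> which exhaust the domain. The initial values of these components are kept orthogonal to the solutions of norm 0, which makes them bounded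
by \<open>norm_controls_bdry\<close>, and a diagonal sequence converges on every interval at once. For the injectivity statement, let
\<open>p0\<close> be a combination for which the limit \<open>v0\<close> has norm 0. Then the inner products of \<open>p0\<close> with the components
over a fixed interval tend to 0, and over the remaining tail they are small because the norm of \<open>p0\<close> is finite; but up to factors these
inner products equal the norms of the components, which dominate that of \<open>p0\<close>.\<close>
theorem limit_map:
 assumes reg: "jump_regular l" and zk: "Im z * Im k > 0" and S: "finite S" "\<And>p. p \<in> S \<Longrightarrow> L2g k p"
 obtains T where "\<And>p. p \<in> S \<Longrightarrow> L2g z (T p)"
  "\<And>a. nullg (\<lambda>x. \<Sum>p\<in>S. a p *s T p x) \<Longrightarrow> nullg (\<lambda>x. \<Sum>p\<in>S. a p *s p x)"
proof -
 have z: "Im z \<noteq> 0" and k: "Im k \<noteq> 0" using zk by auto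
 obtain c :: "nat \<Rightarrow> real" where c: "strict_mono c" "\<And>n. c n \<in> dom" "\<And>n. mass {c n} = 0" "\<And>d. d \<in> dom \<Longrightarrow> \<exists>n. d \<le> c n"
  using nonatomic_sequence by metis
 have c0: "0 \<le> c n" for n using domD(1)[OF c(2)] .
 have cmono: "c i \<le> c j" if "i \<le> j" for i j using c(1) that by (simp add: strict_mono_less_eq)
 \<comment> \<open>the decreasing subspaces of initial values of norm 0 stabilise from some index on\<close>
 obtain N where N: "\<And>n. dim (nullbdry z (c N)) \<le> dim (nullbdry z (c n))"
  using ex_has_least_nat[of "\<lambda>_. True" 0 "\<lambda>n. dim (nullbdry z (c n))"] by auto
 have KN: "nullbdry z (c n) = nullbdry z (c N)" if "N \<le> n" for n
  by (intro subspace_dim_equal nullbdry_subspace c nullbdry_antimono c0 cmono that N)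
 have gk: "gsol k p" if "p \<in> S" for p using S(2)[OF that] by (simp add: L2g_def)
 have "\<exists>v m. sol z 0 (c n) v \<and> sol (cnj z) 0 (c n) m \<and> p 0 = v 0 + m 0 \<and> p (c n) = v (c n) + m (c n) \<and> (\<forall>h\<in>nullbdry z (c n). inner (v 0) h = 0)" if "p \<in> S" for p n
  by (rule bdry_decomposition_normalized[OF reg z c(2,3) gsolD[OF gk[OF that] c(2)]])
 then obtain V M where VM: "\<And>p n. p \<in> S \<Longrightarrow> sol z 0 (c n) (V p n)" "\<And>p n. p \<in> S \<Longrightarrow> sol (cnj z) 0 (c n) (M p n)"
  "\<And>p n. p \<in> S \<Longrightarrow> p 0 = V p n 0 + M p n 0" "\<And>p n. p \<in> S \<Longrightarrow> p (c n) = V p n (c n) + M p n (c n)"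
  "\<And>p n h. p \<in> S \<Longrightarrow> h \<in> nullbdry z (c n) \<Longrightarrow> inner (V p n 0) h = 0"
  by metis
 have "\<exists>B. \<forall>d\<in>dom. nsq d p \<le> B" if "p \<in> S" for p using S(2)[OF that] by (simp add: L2g_def)
 then obtain B where B: "\<And>p d. p \<in> S \<Longrightarrow> d \<in> dom \<Longrightarrow> nsq d p \<le> B p" by metis
 define \<kappa> where "\<kappa> = (norm (k - cnj z) / (2 * Im z))\<^sup>2"
 have \<kappa>0: "0 \<le> \<kappa>" by (simp add: \<kappa>_def)
 have Vj: "sol z 0 (c j) (V p n)" if "p \<in> S" "j \<le> n" for p j n
  by (rule sol_restrict[OF VM(1)[OF that(1)] order_refl order_refl cmono[OF that(2)] c(2)])
 have Vbound: "nsq (c j) (V p n) \<le> \<kappa> * B p" if p: "p \<in> S" and "j \<le> n" for p j n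
 proof -
  have "nsq (c j) (V p n) \<le> nsq (c n) (V p n)"
   using that by (intro gram_mono[OF sol_lbm[OF VM(1)[OF p]] c(2) c0 cmono])
  also have "\<dots> \<le> \<kappa> * nsq (c n) p" unfolding \<kappa>_def
   by (rule decomposition_estimates(3)[OF gsolD[OF gk[OF p] c(2)] VM(1,2)[OF p] c(2,3) VM(3,4)[OF p] zk])
  also have "\<dots> \<le> \<kappa> * B p" by (intro mult_left_mono B p c(2) \<kappa>0)
  finally show ?thesis .
 qed
 \<comment> \<open>boundary values of V p n on a fixed interval, set to 0 while V p n does not solve the equation up to c j\<close>
 define X where "X p j n = (if N \<le> j \<and> j \<le> n then (V p n 0, V p n (c j)) else 0)" for p j n
 have Xbounded: "bounded (range (X p j))" if p: "p \<in> S" for p j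
 proof -
  obtain C where C: "\<And>u. sol z 0 (c j) u \<Longrightarrow> (\<And>h. h \<in> nullbdry z (c j) \<Longrightarrow> inner (u 0) h = 0) \<Longrightarrow> (norm (u 0, u (c j)))\<^sup>2 \<le> C * nsq (c j) u"
   using norm_controls_bdry[OF reg z c(2,3)] by metis
  have "(norm (X p j n))\<^sup>2 \<le> \<bar>C\<bar> * \<bar>\<kappa> * B p\<bar>" for n
  proof (cases "N \<le> j \<and> j \<le> n")
   case True
   have "(norm (V p n 0, V p n (c j)))\<^sup>2 \<le> C * nsq (c j) (V p n)"
    using True KN[of n] KN[of j] by (intro C Vj p VM(5)[OF p]) auto
   also have "\<dots> \<le> \<bar>C\<bar> * \<bar>\<kappa> * B p\<bar>"
   proof -
    have "0 \<le> nsq (c j) (V p n)"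
     using True by (intro gram_nonneg[OF sol_lbm[OF Vj[OF p]] c(2)]) auto
    then show ?thesis using Vbound[OF p, of j n] True by (intro mult_mono) auto
   qed
   finally show ?thesis using True by (simp add: X_def)
  next
   case False
   then have "X p j n = 0" unfolding X_def by (rule if_not_P)
   then show ?thesis by simp
  qed
  then have "norm (X p j n) \<le> sqrt (\<bar>C\<bar> * \<bar>\<kappa> * B p\<bar>)" for n by (simp add: real_le_rsqrt)
  then show ?thesis unfolding bounded_iff by blast
 qed
 interpret subseqs "\<lambda>j s. \<forall>p\<in>S. convergent (\<lambda>i. X p j (s i))"
 proof
  fix j :: nat and s :: "nat \<Rightarrow> nat"
  assume "strict_mono s"
  have "bounded (range (\<lambda>i. X p j (s i)))" if "p \<in> S" for p by (rule bounded_subset[OF Xbounded[OF that, of j]]) auto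
  from finite_convergent_subsequence[OF S(1) this]
  show "\<exists>r. strict_mono r \<and> (\<forall>p\<in>S. convergent (\<lambda>i. X p j ((s \<circ> r) i)))" by simp
 qed
 define r where "r = diagseq"
 have r: "strict_mono r" unfolding r_def by (rule subseq_diagseq)
 have rge: "i \<le> r i" for i by (rule seq_suble[OF r])
 have "convergent (\<lambda>i. X p j (r i))" if "p \<in> S" for p j
 proof -
  have "\<forall>p\<in>S. convergent (\<lambda>i. X p j ((diagseq \<circ> (+) (Suc j)) i))"
  proof (rule diagseq_holds)
   fix r s :: "nat \<Rightarrow> nat" and n assume *: "strict_mono r" "\<forall>p\<in>S. convergent (\<lambda>i. X p n (s i))"
   show "\<forall>p\<in>S. convergent (\<lambda>i. X p n ((s \<circ> r) i))"
    using convergent_subseq_convergent[OF _ *(1)] *(2) by (auto simp: o_def)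
  qed
  then have "convergent (\<lambda>i. X p j (r (i + Suc j)))" using that by (simp add: r_def add.commute)
  then show ?thesis using convergent_ignore_initial_segment[of "\<lambda>i. X p j (r i)" "Suc j"] by simp
 qed
 then obtain \<delta> where \<delta>: "\<And>p j. p \<in> S \<Longrightarrow> (\<lambda>i. X p j (r i)) \<longlonglongrightarrow> \<delta> p j" unfolding convergent_def by metis
 have "\<exists>L. (\<forall>x. linear (L x)) \<and> (\<forall>u x. sol z 0 (c j) u \<longrightarrow> x \<in> {0..c j} \<longrightarrow> u x = L x (u 0, u (c j))) \<and> (\<forall>d\<in>bdry z 0 (c j). sol z 0 (c j) (\<lambda>x. L x d))" for j
  using bdry_representation[OF reg z c(2), of j] by metis
 then obtain L where L: "\<And>j x. linear (L j x)" "\<And>j u x. sol z 0 (c j) u \<Longrightarrow> x \<in> {0..c j} \<Longrightarrow> u x = L j x (u 0, u (c j))"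
  "\<And>j d. d \<in> bdry z 0 (c j) \<Longrightarrow> sol z 0 (c j) (\<lambda>x. L j x d)" by metis
 have VL: "(\<lambda>i. V p (r i) x) \<longlonglongrightarrow> L j x (\<delta> p j)" if p: "p \<in> S" and j: "N \<le> j" and x: "x \<in> {0..c j}" for p j x
 proof -
  have "(\<lambda>i. L j x (X p j (r i))) \<longlonglongrightarrow> L j x (\<delta> p j)"
   by (rule bounded_linear.tendsto[OF _ \<delta>[OF p]]) (use L(1) in \<open>simp add: linear_conv_bounded_linear[symmetric]\<close>)
  moreover have "\<forall>\<^sub>F i in sequentially. L j x (X p j (r i)) = V p (r i) x"
   unfolding eventually_sequentially
  proof (intro exI allI impI)
   fix i assume "j \<le> i"
   then have ji: "j \<le> r i" using rge[of i] by simp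
   show "L j x (X p j (r i)) = V p (r i) x" using L(2)[OF Vj[OF p ji] x] j ji by (simp add: X_def)
  qed
  ultimately show ?thesis by (rule Lim_transform_eventually)
 qed
 define T where "T p x = (if x \<in> dom then lim (\<lambda>i. V p (r i) x) else 0)" for p x
 have index: "\<exists>j\<ge>N. d \<le> c j" if "d \<in> dom" for d
  using c(4)[OF that] cmono by (meson le_cases order_trans)
 have lim: "(\<lambda>i. V p (r i) x) \<longlonglongrightarrow> T p x" if p: "p \<in> S" and x: "x \<in> dom" for p x
 proof -
  obtain j where "N \<le> j" "x \<le> c j" using index[OF x] by blast
  from VL[OF p this(1), of x] this(2) domD(1)[OF x] have *: "(\<lambda>i. V p (r i) x) \<longlonglongrightarrow> L j x (\<delta> p j)" by simp
  then show ?thesis using x by (simp add: T_def limI)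
 qed
 have Tmeas: "T p \<in> Borel" if p: "p \<in> S" for p
 proof (rule borel_measurable_LIMSEQ_metric)
  show "(\<lambda>x. if x \<in> dom then V p (r i) x else 0) \<in> Borel" for i
   using sol_meas[OF VM(1)[OF p]] dom_borel by (intro measurable_If_set) auto
  show "(\<lambda>i. if x \<in> dom then V p (r i) x else 0) \<longlonglongrightarrow> T p x" for x
   using lim[OF p, of x] by (cases "x \<in> dom") (simp_all add: T_def)
 qed
 have Tsol: "sol z 0 (c j) (T p)" if p: "p \<in> S" and j: "N \<le> j" for p j
 proof (rule sol_cong)
  have "\<delta> p j \<in> bdry z 0 (c j)"
  proof (rule Lim_in_closed_set[OF closed_subspace[OF bdry_subspace[OF order_refl c(2)]] _ _ \<delta>[OF p]])
   show "\<forall>\<^sub>F i in sequentially. X p j (r i) \<in> bdry z 0 (c j)"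
    unfolding eventually_sequentially
   proof (intro exI allI impI)
    fix i assume "j \<le> i"
    then have ji: "j \<le> r i" using rge[of i] by simp
    show "X p j (r i) \<in> bdry z 0 (c j)" using Vj[OF p ji] j ji by (auto simp: X_def bdry_def)
   qed
  qed simp
  then show "sol z 0 (c j) (\<lambda>x. L j x (\<delta> p j))" by (rule L(3))
  show "L j x (\<delta> p j) = T p x" if "x \<in> {0..c j}" for x
   using LIMSEQ_unique[OF VL[OF p j that] lim[OF p]] dom_down[OF c(2)] that by auto
 qed (use c0 Tmeas[OF p] in auto)
 have Tg: "gsol z (T p)" if p: "p \<in> S" for p
  unfolding gsol_def
 proof
  fix d assume "d \<in> dom"
  then obtain j where "N \<le> j" "d \<le> c j" using index by blast
  then show "sol z 0 d (T p)" using sol_restrict[OF Tsol[OF p]] c(2) by simp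
 qed
 \<comment> \<open>norms are functions of the boundary values, hence continuous along the sequence\<close>
 have TL2: "L2g z (T p)" if p: "p \<in> S" for p
  unfolding L2g_def
 proof (intro conjI Tg p exI ballI)
  fix d assume d: "d \<in> dom"
  then obtain j where j: "N \<le> j" "d \<le> c j" using index by blast
  have "(\<lambda>i. Re (hf (V p (r i) (c j)) (V p (r i) (c j))) - Re (hf (V p (r i) 0) (V p (r i) 0))) \<longlonglongrightarrow> Re (hf (T p (c j)) (T p (c j))) - Re (hf (T p 0) (T p 0))"
   by (intro tendsto_diff tendsto_Re tendsto_hf lim p c zero_in_dom)
  then have *: "(\<lambda>i. (Re (hf (V p (r i) (c j)) (V p (r i) (c j))) - Re (hf (V p (r i) 0) (V p (r i) 0))) / (2 * Im z)) \<longlonglongrightarrow> nsq (c j) (T p)"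
   unfolding sol_norm_sq[OF Tsol[OF p j(1)] c(2,3)] using tendsto_divide[OF _ tendsto_const[of "2 * Im z"]] z by fastforce
  have "nsq (c j) (T p) \<le> \<kappa> * B p"
  proof (rule LIMSEQ_le_const2[OF *], intro exI allI impI)
   fix i assume "j \<le> i"
   then have ji: "j \<le> r i" using rge[of i] by simp
   show "(Re (hf (V p (r i) (c j)) (V p (r i) (c j))) - Re (hf (V p (r i) 0) (V p (r i) 0))) / (2 * Im z) \<le> \<kappa> * B p"
    unfolding sol_norm_sq[OF Vj[OF p ji] c(2,3)] using Vbound[OF p ji] z by simp
  qed
  then show "nsq d (T p) \<le> \<kappa> * B p"
   using gram_mono[OF sol_lbm[OF Tsol[OF p j(1)]] c(2) domD(1)[OF d] j(2)] by linarith
 qed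
 have Tnull: "nullg (\<lambda>x. \<Sum>p\<in>S. a p *s p x)" if null: "nullg (\<lambda>x. \<Sum>p\<in>S. a p *s T p x)" for a
 proof -
  define p0 where "p0 x = (\<Sum>p\<in>S. a p *s p x)" for x
  define v0 where "v0 x = (\<Sum>p\<in>S. a p *s T p x)" for x
  define v where "v n x = (\<Sum>p\<in>S. a p *s V p n x)" for n x
  define m where "m n x = (\<Sum>p\<in>S. a p *s M p n x)" for n x
  have p0: "L2g k p0" unfolding p0_def by (rule L2g_sum[OF S])
  then obtain D where D: "\<And>d. d \<in> dom \<Longrightarrow> nsq d p0 \<le> D" by (auto simp: L2g_def)
  have p0s: "sol k 0 d p0" if "d \<in> dom" for d using p0 that by (auto simp: L2g_def gsol_def)
  have v0s: "sol z 0 d v0" if "d \<in> dom" for d unfolding v0_def using that gsolD[OF Tg] by (intro sol_sum S) auto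
  have vs: "sol z 0 (c j) (v n)" if "j \<le> n" for j n unfolding v_def using that c by (intro sol_sum S Vj) auto
  have ms: "sol (cnj z) 0 (c n) (m n)" for n unfolding m_def using VM(2) c by (intro sol_sum S) auto
  have eq: "p0 0 = v n 0 + m n 0" "p0 (c n) = v n (c n) + m n (c n)" for n
   unfolding p0_def v_def m_def using VM(3,4)
   by (simp_all add: sum.distrib[symmetric] vector_add_ldistrib[symmetric] cong: sum.cong)
  note est = decomposition_estimates[OF p0s[OF c(2)] vs[OF order_refl] ms c(2,3) eq zk]
  have vbound: "nsq (c n) (v n) \<le> \<kappa> * D" for n
   using est(3)[of n] D[OF c(2), of n] mult_left_mono[OF _ \<kappa>0] unfolding \<kappa>_def[symmetric] by fastforce
  have vlim: "(\<lambda>i. v (r i) x) \<longlonglongrightarrow> v0 x" if "x \<in> dom" for x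
   unfolding v_def v0_def
  proof (intro tendsto_sum)
   fix p assume p: "p \<in> S"
   show "(\<lambda>i. a p *s V p (r i) x) \<longlonglongrightarrow> a p *s T p x"
    by (rule vec_tendstoI) (use lim[OF p that] in \<open>auto intro!: tendsto_intros\<close>)
  qed
  have kz: "k - cnj z \<noteq> 0"
  proof
   assume "k - cnj z = 0"
   then have "Im k = - Im z" by (simp add: complex_eq_iff)
   then show False using zk by (simp add: mult_less_0_iff)
  qed
  have lim0: "(\<lambda>i. gram {0..<c j} p0 (v (r i))) \<longlonglongrightarrow> 0" for j
  proof -
   let ?w = "- \<i> * (k - cnj z)"
   have w: "?w \<noteq> 0" using kz by simp
   have "gram {0..<c j} p0 v0 = 0"
   proof (rule gram_zero_left(1)[OF gram_zero_AE[OF sol_lbm[OF v0s[OF c(2)[of j]]] c(2)[of j]]])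
    show "nsq (c j) v0 = 0" using null c(2) unfolding v0_def nullg_def by blast
   qed (use sol_meas[OF v0s[OF c(2)]] sol_meas[OF p0s[OF c(2)]] in auto)
   then have 0: "hf (p0 (c j)) (v0 (c j)) - hf (p0 0) (v0 0) = 0"
    unfolding lagrange_no_atom[OF p0s[OF c(2)] v0s[OF c(2)] c(2,3)] by simp
   have "(\<lambda>i. hf (p0 (c j)) (v (r i) (c j)) - hf (p0 0) (v (r i) 0)) \<longlonglongrightarrow> hf (p0 (c j)) (v0 (c j)) - hf (p0 0) (v0 0)"
    by (intro tendsto_diff tendsto_hf tendsto_const vlim c zero_in_dom)
   then have lim1: "(\<lambda>i. (hf (p0 (c j)) (v (r i) (c j)) - hf (p0 0) (v (r i) 0)) / ?w) \<longlonglongrightarrow> 0"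
    unfolding 0 using tendsto_divide[OF _ tendsto_const[of ?w] w] by fastforce
   show ?thesis
   proof (rule Lim_transform_eventually[OF lim1])
    show "\<forall>\<^sub>F i in sequentially. (hf (p0 (c j)) (v (r i) (c j)) - hf (p0 0) (v (r i) 0)) / ?w = gram {0..<c j} p0 (v (r i))"
     unfolding eventually_sequentially
    proof (intro exI allI impI)
     fix i assume "j \<le> i"
     then have ji: "j \<le> r i" using rge[of i] by simp
     show "(hf (p0 (c j)) (v (r i) (c j)) - hf (p0 0) (v (r i) 0)) / ?w = gram {0..<c j} p0 (v (r i))"
      unfolding lagrange_no_atom[OF p0s[OF c(2)] vs[OF ji] c(2,3)] using w by simp
    qed
   qed
  qed
  define G where "G n = nsq (c n) p0" for n
  have Gmono: "G i \<le> G j" if "i \<le> j" for i j unfolding G_def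
   by (rule gram_mono[OF sol_lbm[OF p0s[OF c(2)]] c(2) c0 cmono[OF that]])
  have G0: "0 \<le> G n" for n unfolding G_def by (rule gram_nonneg[OF sol_lbm[OF p0s[OF c(2)[of n]]] c(2)[of n]]) auto
  have D0: "0 \<le> D" using G0[of 0] D[OF c(2), of 0] by (simp add: G_def)
  have Gbdd: "bdd_above (range G)" unfolding G_def using D[OF c(2)] by (intro bdd_aboveI2)
  define q where "q = norm (k - cnj z)"
  \<comment> \<open>e measures the tail of the norm of p0\<close>
  have key: "2 * \<bar>Im k\<bar> * G j0 \<le> q * sqrt (e * (\<kappa> * D))" if e: "e > 0" for j0 e
  proof -
   obtain j where j: "(SUP n. G n) - e < G j" using less_cSUP_iff[OF _ Gbdd, of "(SUP n. G n) - e"] e by auto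
   have tail: "norm (gram {c j..<c n} p0 (v n)) \<le> sqrt (e * (\<kappa> * D))" if jn: "j \<le> n" for n
   proof -
    have E: "{c j..<c n} \<in> sets borel" "{c j..<c n} \<subseteq> {0..c n}" using c0[of j] by auto
    have "Re (gram {c j..<c n} p0 p0) = G n - G j"
     unfolding G_def using gram_split[OF sol_lbm[OF p0s[OF c(2)]] sol_lbm[OF p0s[OF c(2)]] c(2) c0 cmono[OF jn]] by simp
    also have "\<dots> \<le> e" using j cSUP_upper[OF _ Gbdd, of n] by simp
    finally have 1: "Re (gram {c j..<c n} p0 p0) \<le> e" .
    have g0: "0 \<le> nsq (c j) (v n)" by (rule gram_nonneg[OF sol_lbm[OF vs[OF jn]] c(2)[of j]]) auto
    have "Re (gram {c j..<c n} (v n) (v n)) \<le> nsq (c n) (v n)"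
     using gram_split[OF sol_lbm[OF vs] sol_lbm[OF vs] c(2) c0 cmono[OF jn]] g0 by auto
    then have 2: "Re (gram {c j..<c n} (v n) (v n)) \<le> \<kappa> * D" using vbound[of n] by simp
    have "(norm (gram {c j..<c n} p0 (v n)))\<^sup>2 \<le> Re (gram {c j..<c n} p0 p0) * Re (gram {c j..<c n} (v n) (v n))"
     by (rule gram_Cauchy_Schwarz[OF c(2) E sol_lbm[OF p0s[OF c(2)]] sol_lbm[OF vs[OF order_refl]]])
    also have "\<dots> \<le> e * (\<kappa> * D)"
     using 1 2 e gram_nonneg[OF sol_lbm[OF vs[OF order_refl]] c(2) E] by (intro mult_mono) auto
    finally show ?thesis by (simp add: real_le_rsqrt)
   qed
   have "(\<lambda>i. q * (norm (gram {0..<c j} p0 (v (r i))) + sqrt (e * (\<kappa> * D)))) \<longlonglongrightarrow> q * (norm (0::complex) + sqrt (e * (\<kappa> * D)))"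
    by (intro tendsto_intros lim0)
   then have lim2: "(\<lambda>i. q * (norm (gram {0..<c j} p0 (v (r i))) + sqrt (e * (\<kappa> * D)))) \<longlonglongrightarrow> q * sqrt (e * (\<kappa> * D))" by simp
   show ?thesis
   proof (rule LIMSEQ_le_const[OF lim2], intro exI allI impI)
    fix i assume "max j j0 \<le> i"
    then have ji: "j \<le> r i" "j0 \<le> r i" using rge[of i] by auto
    have "2 * \<bar>Im k\<bar> * G j0 \<le> 2 * (\<bar>Im k\<bar> * G (r i))" using Gmono[OF ji(2)] by (simp add: mult_left_mono)
    also have "\<dots> \<le> 2 * (\<bar>Im z\<bar> * nsq (c (r i)) (v (r i)))" unfolding G_def using est(1)[of "r i"] by simp
    also have "\<dots> = q * norm (gram {0..<c (r i)} p0 (v (r i)))" unfolding q_def est(2)[of "r i"] by simp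
    also have "gram {0..<c (r i)} p0 (v (r i)) = gram {0..<c j} p0 (v (r i)) + gram {c j..<c (r i)} p0 (v (r i))"
     by (rule gram_split[OF sol_lbm[OF p0s[OF c(2)]] sol_lbm[OF vs[OF order_refl]] c(2) c0 cmono[OF ji(1)]])
    also have "q * norm \<dots> \<le> q * (norm (gram {0..<c j} p0 (v (r i))) + sqrt (e * (\<kappa> * D)))"
     using tail[OF ji(1)] norm_triangle_ineq by (intro mult_left_mono) (fastforce simp: q_def intro: order_trans)+
    finally show "2 * \<bar>Im k\<bar> * G j0 \<le> q * (norm (gram {0..<c j} p0 (v (r i))) + sqrt (e * (\<kappa> * D)))" .
   qed
  qed
  have "G j = 0" for j
  proof (rule ccontr)
   assume "G j \<noteq> 0"
   then have h: "2 * \<bar>Im k\<bar> * G j > 0" using G0[of j] k by simp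
   have "((\<lambda>e. q * sqrt (e * (\<kappa> * D))) \<longlongrightarrow> q * sqrt (0 * (\<kappa> * D))) (at_right 0)"
    by (intro tendsto_intros)
   then have "((\<lambda>e. q * sqrt (e * (\<kappa> * D))) \<longlongrightarrow> 0) (at_right 0)" by simp
   from order_tendstoD(2)[OF this h] have "\<forall>\<^sub>F e in at_right 0. q * sqrt (e * (\<kappa> * D)) < 2 * \<bar>Im k\<bar> * G j" .
   moreover have "\<forall>\<^sub>F e::real in at_right 0. e > 0" by (rule eventually_at_right_less)
   ultimately have "\<forall>\<^sub>F e::real in at_right 0. False"
    by eventually_elim (use key[of _ j] in force)
   then show False by simp
  qed
  then have "nsq d p0 = 0" if d: "d \<in> dom" for d
  proof -
   obtain j where "d \<le> c j" using c(4)[OF d] by blast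
   then have "nsq d p0 \<le> G j" unfolding G_def by (intro gram_mono[OF sol_lbm[OF p0s[OF c(2)]] c(2) domD(1)[OF d]])
   moreover have "0 \<le> nsq d p0" by (rule gram_nonneg[OF sol_lbm[OF p0s[OF d]] d]) auto
   ultimately show ?thesis using \<open>\<And>j. G j = 0\<close>[of j] by simp
  qed
  then show ?thesis unfolding nullg_def p0_def by blast
 qed
 show ?thesis by (rule that[of T, OF TL2 Tnull])
qed

end

section \<open>Weyl solutions and comparison of conjugate parameters\<close>

lemma hf_self: "hf u u = of_real (2 * Im (cnj (u $ 2) * u $ 1))"
 by (simp add: hf_def complex_eq_iff)

lemma independent_pair:
 fixes a b :: "complex^2"
 assumes "a \<noteq> 0" "\<And>k. b \<noteq> k *s a"
 shows "\<exists>x y. v = x *s a + y *s b"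
proof -
 define d where "d = det2 a b"
 have "d \<noteq> 0"
 proof
  assume "d = 0"
  then have e: "a $ 1 * b $ 2 = a $ 2 * b $ 1" by (simp add: d_def det2_def)
  show False
  proof (cases "a $ 1 = 0")
   case True
   then have a2: "a $ 2 \<noteq> 0" using assms(1) by (auto simp: vec_eq_iff forall_2)
   then have "b = (b $ 2 / a $ 2) *s a" using e True by (simp add: vec_eq_iff forall_2)
   then show False using assms(2) by blast
  next
   case False
   then have "b = (b $ 1 / a $ 1) *s a" using e by (simp add: vec_eq_iff forall_2 field_simps)
   then show False using assms(2) by blast
  qed
 qed
 have "d *s v = det2 v b *s a + det2 a v *s b"
  by (simp add: vec_eq_iff forall_2 d_def det2_def algebra_simps)
 then have "(1 / d) *s (d *s v) = (1 / d) *s (det2 v b *s a + det2 a v *s b)" by simp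
 then have "v = (det2 v b / d) *s a + (det2 a v / d) *s b"
  using \<open>d \<noteq> 0\<close> by (simp add: vector_add_ldistrib)
 then show ?thesis by blast
qed

context canonical_system begin

lemma gsol_add: "gsol z u \<Longrightarrow> gsol z v \<Longrightarrow> gsol z (\<lambda>x. u x + v x)"
 unfolding gsol_def using sol_add by blast

lemma gsol_smult: "gsol z u \<Longrightarrow> gsol z (\<lambda>x. a *s u x)"
 unfolding gsol_def using sol_smult by blast

lemma gsol_unique:
 assumes reg: "jump_regular l" and u: "gsol l u" and v: "gsol l v" and "u 0 = v 0" and x: "x \<in> dom"
 shows "u x = v x"
proof -
 have "\<forall>t\<in>{0..x}. u t - v t = 0"
  by (rule uniqueness[OF reg sol_diff[OF gsolD[OF u x] gsolD[OF v x] order_refl x] x]) (use assms in simp)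
 then show ?thesis using domD(1)[OF x] by simp
qed

lemma gsol_cong:
 assumes u: "gsol z u" and eq: "\<And>x. x \<in> dom \<Longrightarrow> u x = v x" and v: "v \<in> Borel"
 shows "gsol z v"
 unfolding gsol_def
proof
 fix c assume c: "c \<in> dom"
 show "sol z 0 c v" using domD(1)[OF c] dom_down[OF c] by (intro sol_cong[OF gsolD[OF u c]] eq v) auto
qed

lemma nullg_cong:
 assumes "\<And>x. x \<in> dom \<Longrightarrow> u x = v x"
 shows "nullg u \<longleftrightarrow> nullg v"
proof -
 have "gram {0..<c} u u = gram {0..<c} v v" if "c \<in> dom" for c
  unfolding gram_def using assms dom_down[OF that] by (intro set_lebesgue_integral_cong) auto
 then show ?thesis by (simp add: nullg_def)
qed

text \<open>Uniqueness makes \<open>u \<mapsto> u 0\<close> injective on a space of real dimension at least 4, hence surjective.\<close>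
lemma solution_exists:
 assumes reg: "jump_regular l" and l: "Im l \<noteq> 0" and c: "c \<in> dom"
 shows "\<exists>u. sol l 0 c u \<and> u 0 = \<alpha>"
proof -
 let ?V = "bdry l 0 c"
 have sub: "subspace ?V" by (rule bdry_subspace[OF order_refl c])
 have "inj_on fst (span ?V)" unfolding span_eq_iff[THEN iffD2, OF sub] linear_injective_on_subspace_0[OF linear_fst sub]
 proof (intro ballI impI)
  fix p :: "(complex^2) \<times> (complex^2)" assume "p \<in> ?V" "fst p = 0"
  then obtain u where u: "sol l 0 c u" "p = (u 0, u c)" "u 0 = 0" by (auto simp: bdry_def)
  then show "p = 0" using uniqueness[OF reg u(1) c u(3)] domD(1)[OF c] by (simp add: zero_prod_def)
 qed
 then have "dim (fst ` ?V) = dim ?V" by (rule dim_image_eq[OF linear_fst])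
 moreover have "4 \<le> dim ?V" by (rule bdry_dim[OF reg l c])
 ultimately have "DIM(complex^2) \<le> dim (fst ` ?V)" by simp
 then have "fst ` ?V = UNIV"
  using subspace_dim_equal[OF linear_subspace_image[OF linear_fst sub] subspace_UNIV] by simp
 then have "\<alpha> \<in> fst ` ?V" by simp
 then show ?thesis by (auto simp: bdry_def)
qed

lemma global_solution_exists:
 assumes reg: "jump_regular l" and l: "Im l \<noteq> 0"
 shows "\<exists>u. gsol l u \<and> u 0 = \<alpha>"
proof -
 obtain c :: "nat \<Rightarrow> real" where c: "strict_mono c" "\<And>n. c n \<in> dom" "\<And>d. d \<in> dom \<Longrightarrow> \<exists>n. d \<le> c n"
  using nonatomic_sequence by metis
 have cmono: "c i \<le> c j" if "i \<le> j" for i j using c(1) that by (simp add: strict_mono_less_eq)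
 have "\<exists>u. sol l 0 (c n) u \<and> u 0 = \<alpha>" for n by (rule solution_exists[OF reg l c(2)])
 then obtain U where U: "\<And>n. sol l 0 (c n) (U n)" "\<And>n. U n 0 = \<alpha>" by metis
 have same: "U m x = U n x" if mn: "m \<le> n" and x: "x \<in> {0..c m}" for m n x
 proof -
  have "sol l 0 (c m) (U n)" by (rule sol_restrict[OF U(1) order_refl order_refl cmono[OF mn] c(2)])
  from uniqueness[OF reg sol_diff[OF U(1) this order_refl c(2)] c(2)] have "\<forall>t\<in>{0..c m}. U m t - U n t = 0" by (simp add: U(2))
  then show ?thesis using x by simp
 qed
 define u where "u x = (if x \<in> dom then U (LEAST n. x \<le> c n) x else 0)" for x
 have u_eq: "u x = U n x" if x: "x \<in> {0..c n}" for x n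
 proof -
  have xd: "x \<in> dom" using x by (intro dom_down[OF c(2)[of n]]) auto
  have "(LEAST n. x \<le> c n) \<le> n" using x by (intro Least_le[of "\<lambda>n. x \<le> c n"]) auto
  moreover have "x \<le> c (LEAST n. x \<le> c n)" using x LeastI[of "\<lambda>n. x \<le> c n" n] by auto
  ultimately have "U (LEAST n. x \<le> c n) x = U n x" using x by (intro same) auto
  then show ?thesis unfolding u_def if_P[OF xd] .
 qed
 have meas: "u \<in> Borel"
 proof (rule borel_measurable_LIMSEQ_metric)
  show "(\<lambda>x. if x \<in> dom then U i x else 0) \<in> Borel" for i
   using sol_meas[OF U(1)] dom_borel by (intro measurable_If_set) auto
  show "(\<lambda>i. if x \<in> dom then U i x else 0) \<longlonglongrightarrow> u x" for x
  proof (cases "x \<in> dom")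
   case True
   then obtain n where n: "x \<le> c n" using c(3) by blast
   have "\<forall>\<^sub>F i in sequentially. u x = (if x \<in> dom then U i x else 0)"
    unfolding eventually_sequentially
   proof (intro exI allI impI)
    fix i assume "n \<le> i"
    then have "x \<in> {0..c i}" using n cmono[of n i] domD(1)[OF True] by auto
    then show "u x = (if x \<in> dom then U i x else 0)" using u_eq True by simp
   qed
   then show ?thesis by (rule tendsto_eventually[OF eventually_mono]) simp
  next
   case False
   then show ?thesis by (simp add: u_def)
  qed
 qed
 have "sol l 0 d u" if d: "d \<in> dom" for d
 proof -
  obtain n where n: "d \<le> c n" using c(3)[OF d] by blast
  have "sol l 0 (c n) u"
   by (rule sol_cong[OF U(1)[of n]]) (use domD(1)[OF c(2)] u_eq meas in auto)
  then show ?thesis by (rule sol_restrict) (use n c(2) in auto)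
 qed
 moreover have "u 0 = \<alpha>" using u_eq[of 0 0] U(2) domD(1)[OF c(2)] by simp
 ultimately show ?thesis unfolding gsol_def by blast
qed

text \<open>The limit circle case.\<close>
definition full :: "complex \<Rightarrow> bool" where
 "full z \<longleftrightarrow> (\<forall>u. gsol z u \<longrightarrow> L2g z u)"

lemma nullg_sol: "gsol z u \<Longrightarrow> nullg u \<Longrightarrow> gsol k u"
 unfolding gsol_def
proof
 fix c assume u: "\<forall>c\<in>dom. sol z 0 c u" and n: "nullg u" and c: "c \<in> dom"
 obtain d where d: "d \<in> dom" "c < d" "mass {d} = 0" using nonatomic_above[OF c] by blast
 have "sol k 0 d u" by (rule nullsol_change) (use u d n in \<open>auto simp: nullg_def\<close>)
 then show "sol k 0 c u" by (rule sol_restrict) (use d in auto)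
qed

lemma nullg_smult: "nullg u \<Longrightarrow> nullg (\<lambda>x. a *s u x)"
 unfolding nullg_def
proof
 fix c assume n: "\<forall>c\<in>dom. nsq c u = 0" and c: "c \<in> dom"
 have E: "{0..<c} \<in> sets borel" "{0..<c} \<subseteq> {0..c}" by auto
 have "gram {0..<c} u u = 0" using gram_self_real[OF c E, of u] n c by simp
 then show "nsq c (\<lambda>x. a *s u x) = 0" by (simp add: gram_smult[OF c E])
qed

lemma L2g_smult: "L2g z u \<Longrightarrow> L2g z (\<lambda>x. a *s u x)"
 using L2g_sum[of "{u}" z "\<lambda>u. u" "\<lambda>_. a"] by simp

lemma L2g_add: "L2g z u \<Longrightarrow> L2g z v \<Longrightarrow> L2g z (\<lambda>x. u x + v x)"
 using L2g_sum[of "{True, False}" z "\<lambda>b. if b then u else v" "\<lambda>_. 1"] by simp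

lemma L2g_cong:
 assumes "L2g z u" "\<And>x. x \<in> dom \<Longrightarrow> u x = v x" "v \<in> Borel"
 shows "L2g z v"
proof -
 have "gram {0..<c} u u = gram {0..<c} v v" if "c \<in> dom" for c
  unfolding gram_def using assms dom_down[OF that] by (intro set_lebesgue_integral_cong) auto
 then show ?thesis using assms gsol_cong[of z u v] by (auto simp: L2g_def)
qed

lemma gsol_meas: "gsol z u \<Longrightarrow> u \<in> Borel"
 using gsolD[OF _ zero_in_dom] sol_meas by blast

text \<open>Weyl's nested discs: for each \<open>c\<close> there is a normalised initial value for which the bracket at \<open>c\<close> has the sign
that bounds the norm on \<open>[0, c]\<close> independently of \<open>c\<close>. A limit point of these initial values works for all \<open>c\<close>.\<close>
theorem weyl_solution:
 assumes reg: "jump_regular l" and l: "Im l \<noteq> 0"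
 shows "\<exists>u. L2g l u \<and> u 0 \<noteq> 0"
proof -
 obtain c :: "nat \<Rightarrow> real" where c: "strict_mono c" "\<And>n. c n \<in> dom" "\<And>n. mass {c n} = 0" "\<And>d. d \<in> dom \<Longrightarrow> \<exists>n. d \<le> c n"
  using nonatomic_sequence by metis
 have cmono: "c i \<le> c j" if "i \<le> j" for i j using c(1) that by (simp add: strict_mono_less_eq)
 obtain U1 where U1: "gsol l U1" "U1 0 = vector [1, 0]" using global_solution_exists[OF reg l] by blast
 obtain U2 where U2: "gsol l U2" "U2 0 = vector [0, 1]" using global_solution_exists[OF reg l] by blast
 define U where "U \<alpha> x = (\<alpha> $ 1) *s U1 x + (\<alpha> $ 2) *s U2 x" for \<alpha> :: "complex^2" and x
 have Ug: "gsol l (U \<alpha>)" for \<alpha> unfolding U_def by (intro gsol_add gsol_smult U1 U2)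
 have U0: "U \<alpha> 0 = \<alpha>" for \<alpha> by (simp add: U_def U1 U2 vec_eq_iff forall_2)
 define s where "s = (if Im l > 0 then 1 else -1 :: real)"
 have s: "s * s = 1" "s * Im l = \<bar>Im l\<bar>" "\<bar>s\<bar> = 1" using l by (auto simp: s_def)
 have ex: "\<exists>\<alpha>. norm \<alpha> = 1 \<and> nsq (c n) (U \<alpha>) \<le> 1 / \<bar>Im l\<bar>" for n
 proof -
  \<comment> \<open>the bracket has the favourable sign on the kernel of this functional\<close>
  define \<phi> where "\<phi> v = v $ 1 + of_real s * \<i> * v $ 2" for v :: "complex^2"
  define a b where "a = \<phi> (U1 (c n))" and "b = \<phi> (U2 (c n))"
  define \<beta> :: "complex^2" where "\<beta> = (if a = 0 \<and> b = 0 then vector [1, 0] else vector [- b, a])"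
  have \<beta>: "\<beta> \<noteq> 0" by (auto simp: \<beta>_def vec_eq_iff forall_2)
  define \<alpha> where "\<alpha> = (1 / norm \<beta>) *\<^sub>R \<beta>"
  have norm: "norm \<alpha> = 1" using \<beta> by (simp add: \<alpha>_def)
  have "\<phi> (U \<alpha> (c n)) = (\<alpha> $ 1) * a + (\<alpha> $ 2) * b" by (simp add: \<phi>_def U_def a_def b_def algebra_simps)
  also have "\<dots> = of_real (1 / norm \<beta>) * (\<beta> $ 1 * a + \<beta> $ 2 * b)" 
  proof -
   have "\<alpha> $ j = of_real (1 / norm \<beta>) * \<beta> $ j" for j
    unfolding \<alpha>_def vector_scaleR_component by (simp add: scaleR_conv_of_real)
   then show ?thesis by (simp only: distrib_left mult.assoc)
  qed
  also have "\<beta> $ 1 * a + \<beta> $ 2 * b = 0" by (auto simp: \<beta>_def)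
  finally have "U \<alpha> (c n) $ 1 = - of_real s * \<i> * U \<alpha> (c n) $ 2" by (simp add: \<phi>_def eq_neg_iff_add_eq_0)
  then have "cnj (U \<alpha> (c n) $ 2) * U \<alpha> (c n) $ 1 = - of_real s * \<i> * (cnj (U \<alpha> (c n) $ 2) * U \<alpha> (c n) $ 2)" by simp
  also have "cnj (U \<alpha> (c n) $ 2) * U \<alpha> (c n) $ 2 = of_real ((norm (U \<alpha> (c n) $ 2))\<^sup>2)" by (metis complex_norm_square mult.commute)
  finally have "Re (hf (U \<alpha> (c n)) (U \<alpha> (c n))) = - 2 * s * (norm (U \<alpha> (c n) $ 2))\<^sup>2" unfolding hf_self by simp
  then have e1: "s * Re (hf (U \<alpha> (c n)) (U \<alpha> (c n))) = - 2 * (norm (U \<alpha> (c n) $ 2))\<^sup>2" using s by (simp add: algebra_simps)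
  have "\<bar>Re (hf \<alpha> \<alpha>)\<bar> \<le> 2 * norm (cnj (\<alpha> $ 2) * \<alpha> $ 1)" unfolding hf_self using abs_Im_le_cmod[of "cnj (\<alpha> $ 2) * \<alpha> $ 1"] by simp
  also have "\<dots> = 2 * (norm (\<alpha> $ 2) * norm (\<alpha> $ 1))" by (simp add: norm_mult)
  also have "\<dots> \<le> 2 * (1 * 1)" using component_norm_le[of \<alpha>] norm by (intro mult_left_mono mult_mono) auto
  finally have e2: "\<bar>Re (hf \<alpha> \<alpha>)\<bar> \<le> 2" by simp
  have "Re (hf (U \<alpha> (c n)) (U \<alpha> (c n))) - Re (hf \<alpha> \<alpha>) = 2 * Im l * nsq (c n) (U \<alpha>)"
   using sol_norm_sq[OF gsolD[OF Ug c(2)] c(2,3)] unfolding U0 .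
  then have "s * Re (hf (U \<alpha> (c n)) (U \<alpha> (c n))) - s * Re (hf \<alpha> \<alpha>) = 2 * (s * Im l) * nsq (c n) (U \<alpha>)"
   by (simp flip: right_diff_distrib)
  then have "2 * \<bar>Im l\<bar> * nsq (c n) (U \<alpha>) \<le> - (s * Re (hf \<alpha> \<alpha>))" unfolding s(2) e1
   using zero_le_power2[of "norm (U \<alpha> (c n) $ 2)"] by linarith
  also have "\<dots> \<le> \<bar>s\<bar> * \<bar>Re (hf \<alpha> \<alpha>)\<bar>" by (simp flip: abs_mult)
  also have "\<dots> \<le> 2" using e2 s(3) by simp
  finally show ?thesis using l norm by (intro exI[of _ \<alpha>]) (simp add: field_simps)
 qed
 then obtain \<alpha> where \<alpha>: "\<And>n. norm (\<alpha> n) = 1" "\<And>n. nsq (c n) (U (\<alpha> n)) \<le> 1 / \<bar>Im l\<bar>" by metis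
 have "bounded (range \<alpha>)" unfolding bounded_iff using \<alpha>(1) by (intro exI[of _ 1]) auto
 then obtain \<gamma> r where r: "strict_mono r" "(\<alpha> \<circ> r) \<longlonglongrightarrow> \<gamma>" using bounded_imp_convergent_subsequence by blast
 have rge: "i \<le> r i" for i by (rule seq_suble[OF r(1)])
 have "(\<lambda>i. norm ((\<alpha> \<circ> r) i)) \<longlonglongrightarrow> norm \<gamma>" by (rule tendsto_norm[OF r(2)])
 then have "norm \<gamma> = 1" using \<alpha>(1) LIMSEQ_unique[OF _ tendsto_const] by simp
 have Ulim: "(\<lambda>i. U (\<alpha> (r i)) x) \<longlonglongrightarrow> U \<gamma> x" for x
 proof (rule vec_tendstoI)
  have a: "(\<lambda>i. \<alpha> (r i) $ j) \<longlonglongrightarrow> \<gamma> $ j" for j using tendsto_vec_nth[OF r(2)] by (simp add: o_def)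
  show "(\<lambda>i. U (\<alpha> (r i)) x $ j) \<longlonglongrightarrow> U \<gamma> x $ j" for j
   unfolding U_def vector_add_component vector_smult_component by (intro tendsto_add tendsto_mult a tendsto_const)
 qed
 have bound: "nsq (c j) (U \<gamma>) \<le> 1 / \<bar>Im l\<bar>" for j
 proof -
  have "(\<lambda>i. Re (hf (U (\<alpha> (r i)) (c j)) (U (\<alpha> (r i)) (c j))) - Re (hf (U (\<alpha> (r i)) 0) (U (\<alpha> (r i)) 0))) \<longlonglongrightarrow> Re (hf (U \<gamma> (c j)) (U \<gamma> (c j))) - Re (hf (U \<gamma> 0) (U \<gamma> 0))"
   by (intro tendsto_diff tendsto_Re tendsto_hf Ulim)
  then have "(\<lambda>i. (2 * Im l * Re (gram {0..<c j} (U (\<alpha> (r i))) (U (\<alpha> (r i))))) / (2 * Im l)) \<longlonglongrightarrow> (2 * Im l * nsq (c j) (U \<gamma>)) / (2 * Im l)"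
   unfolding sol_norm_sq[OF gsolD[OF Ug c(2)] c(2,3)] using l by (intro tendsto_divide tendsto_const) auto
  then have *: "(\<lambda>i. Re (gram {0..<c j} (U (\<alpha> (r i))) (U (\<alpha> (r i))))) \<longlonglongrightarrow> nsq (c j) (U \<gamma>)" using l by simp
  show ?thesis
  proof (rule LIMSEQ_le_const2[OF *], intro exI allI impI)
   fix i assume "j \<le> i"
   then have "j \<le> r i" using rge[of i] by simp
   then have "Re (gram {0..<c j} (U (\<alpha> (r i))) (U (\<alpha> (r i)))) \<le> Re (gram {0..<c (r i)} (U (\<alpha> (r i))) (U (\<alpha> (r i))))"
    using domD(1)[OF c(2)] by (intro gram_mono gsol_lbm[OF Ug] c(2) cmono) auto
   then show "Re (gram {0..<c j} (U (\<alpha> (r i))) (U (\<alpha> (r i)))) \<le> 1 / \<bar>Im l\<bar>" using \<alpha>(2)[of "r i"] by simp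
  qed
 qed
 have "nsq d (U \<gamma>) \<le> 1 / \<bar>Im l\<bar>" if d: "d \<in> dom" for d
 proof -
  obtain j where "d \<le> c j" using c(4)[OF d] by blast
  then have "nsq d (U \<gamma>) \<le> nsq (c j) (U \<gamma>)"
   by (intro gram_mono gsol_lbm[OF Ug] c(2) domD(1)[OF d])
  then show ?thesis using bound[of j] by simp
 qed
 then have "L2g l (U \<gamma>)" using Ug by (auto simp: L2g_def)
 then show ?thesis using U0[of \<gamma>] \<open>norm \<gamma> = 1\<close> by (intro exI[of _ "U \<gamma>"]) auto
qed

text \<open>Two linearly independent solutions of finite norm span the solution space.\<close>
lemma L2g_pair_full:
 assumes reg: "jump_regular l" and u: "L2g l u" "u 0 \<noteq> 0" and v: "L2g l v" "\<And>k. v 0 \<noteq> k *s u 0"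
 shows "full l"
 unfolding full_def
proof (intro allI impI)
 fix w assume w: "gsol l w"
 obtain x y where xy: "w 0 = x *s u 0 + y *s v 0" using independent_pair[OF u(2) v(2)] by blast
 have L: "L2g l (\<lambda>t. x *s u t + y *s v t)" by (intro L2g_add L2g_smult u v)
 then have g: "gsol l (\<lambda>t. x *s u t + y *s v t)" by (simp add: L2g_def)
 show "L2g l w"
  by (rule L2g_cong[OF L]) (use gsol_unique[OF reg g w] xy gsol_meas[OF w] in auto)
qed

text \<open>If \<open>full m\<close>, a solution at \<open>l\<close> is mapped to the solution at \<open>m\<close> with the same initial value; a solution at
\<open>m\<close> of norm 0 is a solution at \<open>l\<close>, hence equal to its preimage. If not \<open>full m\<close>, then not \<open>full
l\<close> either, so every solution at \<open>l\<close> of finite norm is a multiple of Weyl's solution, which is mapped to Weyl's solution at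
\<open>m\<close>.\<close>
theorem transfer_map:
 assumes reg: "jump_regular l" "jump_regular m" and im: "Im l \<noteq> 0" "Im m \<noteq> 0"
  and f: "full l \<Longrightarrow> full m" and S: "finite S" "\<And>p. p \<in> S \<Longrightarrow> L2g l p"
 obtains T where "\<And>p. p \<in> S \<Longrightarrow> L2g m (T p)"
  "\<And>a. nullg (\<lambda>x. \<Sum>p\<in>S. a p *s T p x) \<Longrightarrow> nullg (\<lambda>x. \<Sum>p\<in>S. a p *s p x)"
proof -
 have pg: "gsol l p" if "p \<in> S" for p using S(2)[OF that] by (simp add: L2g_def)
 show thesis
 proof (cases "full m")
  case True
  define T where "T p = (SOME u. gsol m u \<and> u 0 = p 0)" for p :: "real \<Rightarrow> complex^2"
  have T: "gsol m (T p)" "T p 0 = p 0" for p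
   using someI_ex[OF global_solution_exists[OF reg(2) im(2), of "p 0"]] by (auto simp: T_def)
  show thesis
  proof (rule that[of T])
   show "L2g m (T p)" for p using True T(1) by (simp add: full_def)
   fix a assume n: "nullg (\<lambda>x. \<Sum>p\<in>S. a p *s T p x)"
   have "gsol m (\<lambda>x. \<Sum>p\<in>S. a p *s T p x)" by (rule gsol_sum[OF S(1) T(1)])
   from nullg_sol[OF this n] have g: "gsol l (\<lambda>x. \<Sum>p\<in>S. a p *s T p x)" .
   have "(\<Sum>p\<in>S. a p *s T p x) = (\<Sum>p\<in>S. a p *s p x)" if "x \<in> dom" for x
    by (rule gsol_unique[OF reg(1) g gsol_sum[OF S(1) pg] _ that]) (auto simp: T(2))
   from nullg_cong[OF this] n show "nullg (\<lambda>x. \<Sum>p\<in>S. a p *s p x)" by (rule iffD1)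
  qed
 next
  case False
  then have nl: "\<not> full l" using f by blast
  obtain u where u: "L2g l u" "u 0 \<noteq> 0" using weyl_solution[OF reg(1) im(1)] by blast
  obtain v where v: "L2g m v" "v 0 \<noteq> 0" using weyl_solution[OF reg(2) im(2)] by blast
  have ug: "gsol l u" using u by (simp add: L2g_def)
  have "\<exists>k. p 0 = k *s u 0" if "L2g l p" for p using L2g_pair_full[OF reg(1) u that] nl by blast
  then obtain \<kappa> where \<kappa>: "\<And>p. L2g l p \<Longrightarrow> p 0 = \<kappa> p *s u 0" by metis
  have eq: "p x = \<kappa> p *s u x" if "L2g l p" "x \<in> dom" for p x
   by (rule gsol_unique[OF reg(1) _ gsol_smult[OF ug] _ that(2)]) (use that \<kappa> in \<open>auto simp: L2g_def\<close>)
  show thesis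
  proof (rule that[of "\<lambda>p x. \<kappa> p *s v x"])
   show "L2g m (\<lambda>x. \<kappa> p *s v x)" for p by (rule L2g_smult[OF v(1)])
   fix a assume n: "nullg (\<lambda>x. \<Sum>p\<in>S. a p *s (\<kappa> p *s v x))"
   define k where "k = (\<Sum>p\<in>S. a p * \<kappa> p)"
   have kv: "(\<Sum>p\<in>S. a p *s (\<kappa> p *s w)) = k *s w" for w :: "complex^2"
    by (simp add: k_def vec_eq_iff sum_distrib_right mult.assoc)
   have "nullg (\<lambda>x. k *s u x)"
   proof (cases "k = 0")
    case True
    then show ?thesis by (simp add: nullg_def gram_def mform_def)
   next
    case False
    have kn: "nullg (\<lambda>x. k *s v x)" using n unfolding kv .
    then have "nullg (\<lambda>x. (1 / k) *s (k *s v x))" by (rule nullg_smult)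
    then have vn: "nullg v" using False by simp
    have "gsol l v" using v nullg_sol[OF _ vn] by (auto simp: L2g_def)
    then have vl: "L2g l v" using vn by (auto simp: L2g_def nullg_def intro!: exI[of _ 0])
    have "\<kappa> v \<noteq> 0" using \<kappa>[OF vl] v by auto
    then have "u x = (1 / \<kappa> v) *s v x" if "x \<in> dom" for x using eq[OF vl that] by simp
    then have "nullg u" using nullg_smult[OF vn, of "1 / \<kappa> v"] nullg_cong[of u "\<lambda>x. (1 / \<kappa> v) *s v x"] by simp
    then show ?thesis by (rule nullg_smult)
   qed
   moreover have "(\<Sum>p\<in>S. a p *s p x) = k *s u x" if "x \<in> dom" for x
    unfolding kv[symmetric] using eq[OF S(2) that] by (intro sum.cong) auto
   ultimately show "nullg (\<lambda>x. \<Sum>p\<in>S. a p *s p x)" using nullg_cong[of "\<lambda>x. \<Sum>p\<in>S. a p *s p x" "\<lambda>x. k *s u x"] by simp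
  qed
 qed
qed

end

section \<open>The determinant of a fundamental matrix near the endpoint\<close>

text \<open>The bracket has signature (1, 1), so its Gram determinants are minus the squared modulus of the determinant.\<close>
lemma hf_det2: "(norm (det2 a b))\<^sup>2 = (norm (hf a b))\<^sup>2 - Re (hf a a) * Re (hf b b)"
 unfolding cmod_power2 hf_def det2_def by (simp add: power2_eq_square algebra_simps)

text \<open>A vector is determined by its brackets with the columns of an invertible matrix, by Cramer's rule. The conservation
law thus expresses the solutions at \<open>cnj l\<close> through a fundamental matrix at \<open>l\<close>.\<close>
lemma conjugate_solution_algebra:
 assumes a: "hf a v = hf (vector [1, 0]) \<beta>" and b: "hf b v = hf (vector [0, 1]) \<beta>"
 shows "cnj (v $ j) * det2 a b = cnj (\<beta> $ 1) * a $ j + cnj (\<beta> $ 2) * b $ j"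
proof -
 have a': "cnj (v $ 2) * a $ 1 - cnj (v $ 1) * a $ 2 = cnj (\<beta> $ 2)" using a by (simp add: hf_def)
 have b': "cnj (v $ 2) * b $ 1 - cnj (v $ 1) * b $ 2 = - cnj (\<beta> $ 1)"
 proof -
  have "\<i> * (cnj (v $ 2) * b $ 1 - cnj (v $ 1) * b $ 2) = \<i> * (- cnj (\<beta> $ 1))" using b by (simp add: hf_def minus_equation_iff)
  then show ?thesis by (rule mult_left_cancel[THEN iffD1, rotated]) simp
 qed
 have e2: "cnj (\<beta> $ 2) = cnj (v $ 2) * a $ 1 - cnj (v $ 1) * a $ 2" using a' by simp
 have e1: "cnj (\<beta> $ 1) = - (cnj (v $ 2) * b $ 1 - cnj (v $ 1) * b $ 2)" using b' by simp
 consider "j = 1" | "j = 2" using exhaust_2 by blast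
 then show ?thesis unfolding e1 e2 by cases (simp_all add: det2_def algebra_simps)
qed

context canonical_system begin

lemma eventually_tending_to_b:
 "(\<forall>\<^sub>F c in tending_to_b \<beta>. good c) \<longleftrightarrow> (\<exists>d\<in>dom. \<forall>c\<in>dom. d < c \<longrightarrow> good c)"
proof
 assume "\<forall>\<^sub>F c in tending_to_b \<beta>. good c"
 then obtain R where R: "eventually R (at_left \<beta>)" "\<And>c. R (ereal c) \<Longrightarrow> good c"
  unfolding tending_to_b_def eventually_filtercomap by blast
 obtain e where e: "e < \<beta>" "\<And>y. e < y \<Longrightarrow> y < \<beta> \<Longrightarrow> R y"
  using R(1) unfolding eventually_at_left[OF beta_pos] by blast
 obtain d where d: "max e 0 < ereal d" "ereal d < \<beta>" using ereal_dense2[of "max e 0" \<beta>] e(1) beta_pos by auto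
 then have "d \<in> dom" by (simp add: dom_def zero_ereal_def)
 moreover have "good c" if "c \<in> dom" "d < c" for c
 proof (rule R(2)[OF e(2)])
  show "e < ereal c" using d(1) that(2) by (meson ereal_less_eq(3) less_imp_le less_le_trans max_less_iff_conj)
  show "ereal c < \<beta>" using domD(2)[OF that(1)] .
 qed
 ultimately show "\<exists>d\<in>dom. \<forall>c\<in>dom. d < c \<longrightarrow> good c" by blast
next
 assume "\<exists>d\<in>dom. \<forall>c\<in>dom. d < c \<longrightarrow> good c"
 then obtain d where d: "d \<in> dom" "\<And>c. c \<in> dom \<Longrightarrow> d < c \<Longrightarrow> good c" by blast
 have "eventually (\<lambda>y. ereal d < y \<and> y < \<beta>) (at_left \<beta>)"
  unfolding eventually_at_left[OF domD(2)[OF d(1)]] using domD(2)[OF d(1)] by blast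
 moreover have "good c" if "ereal d < ereal c \<and> ereal c < \<beta>" for c
  using that domD(1)[OF d(1)] by (intro d(2)) (auto simp: dom_def)
 ultimately show "\<forall>\<^sub>F c in tending_to_b \<beta>. good c"
  unfolding tending_to_b_def eventually_filtercomap by (intro exI[of _ "\<lambda>y. ereal d < y \<and> y < \<beta>"]) auto
qed

lemma tending_to_b_dom: "\<forall>\<^sub>F c in tending_to_b \<beta>. c \<in> dom"
 unfolding eventually_tending_to_b using zero_in_dom by blast

lemma tending_to_b_nontrivial: "tending_to_b \<beta> \<noteq> bot"
proof
 assume "tending_to_b \<beta> = bot"
 then have "\<forall>\<^sub>F c in tending_to_b \<beta>. False" by simp
 then show False unfolding eventually_tending_to_b using dom_increase by blast
qed

lemma mono_bounded_convergent:
 fixes f :: "real \<Rightarrow> real"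
 assumes mono: "\<And>c d. c \<in> dom \<Longrightarrow> d \<in> dom \<Longrightarrow> c \<le> d \<Longrightarrow> f c \<le> f d" and bd: "\<And>c. c \<in> dom \<Longrightarrow> f c \<le> M"
 shows "\<exists>L. (f \<longlongrightarrow> L) (tending_to_b \<beta>)"
proof -
 have bdd: "bdd_above (f ` dom)" using bd by (intro bdd_aboveI2)
 have ne: "dom \<noteq> {}" using zero_in_dom by blast
 show ?thesis
 proof (intro exI order_tendstoI)
  fix a assume "a < (SUP c\<in>dom. f c)"
  then obtain d where d: "d \<in> dom" "a < f d" using less_cSUP_iff[OF ne bdd] by blast
  then show "\<forall>\<^sub>F c in tending_to_b \<beta>. a < f c"
   unfolding eventually_tending_to_b using mono by (meson less_le_trans less_imp_le)
 next
  fix a assume "(SUP c\<in>dom. f c) < a"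
  then have "f c < a" if "c \<in> dom" for c using cSUP_upper[OF that bdd] by simp
  then show "\<forall>\<^sub>F c in tending_to_b \<beta>. f c < a" unfolding eventually_tending_to_b using zero_in_dom by blast
 qed
qed

lemma gram_self_convergent:
 assumes u: "L2g z u"
 shows "\<exists>L. ((\<lambda>c. nsq c u) \<longlongrightarrow> L) (tending_to_b \<beta>)"
proof -
 obtain M where "\<And>c. c \<in> dom \<Longrightarrow> nsq c u \<le> M" "gsol z u" using u by (auto simp: L2g_def)
 then show ?thesis using gram_mono[OF gsol_lbm] domD(1) by (intro mono_bounded_convergent) auto
qed

lemma gram_convergent:
 assumes u: "L2g z u" and v: "L2g z v"
 shows "\<exists>L. ((\<lambda>c. gram {0..<c} u v) \<longlongrightarrow> L) (tending_to_b \<beta>)"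
proof -
 have g: "gsol z u" "gsol z v" using u v by (auto simp: L2g_def)
 obtain l1 where 1: "((\<lambda>c. nsq c u) \<longlongrightarrow> l1) (tending_to_b \<beta>)" using gram_self_convergent[OF u] by blast
 obtain l2 where 2: "((\<lambda>c. nsq c v) \<longlongrightarrow> l2) (tending_to_b \<beta>)" using gram_self_convergent[OF v] by blast
 let ?s = "\<lambda>x. u x + v x" and ?t = "\<lambda>x. u x + \<i> *s v x"
 obtain l3 where 3: "((\<lambda>c. nsq c ?s) \<longlongrightarrow> l3) (tending_to_b \<beta>)" using gram_self_convergent[OF L2g_add[OF u v]] by blast
 obtain l4 where 4: "((\<lambda>c. nsq c ?t) \<longlongrightarrow> l4) (tending_to_b \<beta>)" using gram_self_convergent[OF L2g_add[OF u L2g_smult[OF v]]] by blast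
 let ?P = "\<lambda>c. Complex ((nsq c ?s - nsq c u - nsq c v) / 2)
   ((nsq c ?t - nsq c u - nsq c v) / 2)"
 have "(?P \<longlongrightarrow> Complex ((l3 - l1 - l2) / 2) ((l4 - l1 - l2) / 2)) (tending_to_b \<beta>)"
  by (intro tendsto_intros 1 2 3 4) auto
 moreover have "\<forall>\<^sub>F c in tending_to_b \<beta>. ?P c = gram {0..<c} u v"
  using tending_to_b_dom
 proof eventually_elim
  case (elim c)
  have E: "{0..<c} \<in> sets borel" "{0..<c} \<subseteq> {0..c}" by auto
  note uc = gsol_lbm[OF g(1) elim] and vc = gsol_lbm[OF g(2) elim]
  note vi = lbm_smult[OF vc, of \<i>]
  show ?case
   unfolding gram_add(1)[OF elim E uc vc lbm_add[OF uc vc]] gram_add(2)[OF elim E uc vc uc] gram_add(2)[OF elim E uc vc vc]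
    gram_add(1)[OF elim E uc vi lbm_add[OF uc vi]] gram_add(2)[OF elim E uc vi uc] gram_add(2)[OF elim E uc vi vi] gram_smult[OF elim E]
    gram_sym[OF elim E, of v u]
   by (simp add: complex_eq_iff)
 qed
 ultimately show ?thesis by (blast intro: Lim_transform_eventually)
qed

lemma hf_left_lim_convergent:
 assumes u: "L2g z u" and v: "L2g z v"
 shows "\<exists>L. ((\<lambda>c. hf (left_lim z u c) (left_lim z v c)) \<longlongrightarrow> L) (tending_to_b \<beta>)"
proof -
 have g: "gsol z u" "gsol z v" using u v by (auto simp: L2g_def)
 obtain L where L: "((\<lambda>c. gram {0..<c} u v) \<longlongrightarrow> L) (tending_to_b \<beta>)" using gram_convergent[OF u v] by blast
 have "((\<lambda>c. hf (u 0) (v 0) - \<i> * (z - cnj z) * gram {0..<c} u v) \<longlongrightarrow> hf (u 0) (v 0) - \<i> * (z - cnj z) * L) (tending_to_b \<beta>)"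
  by (intro tendsto_intros L)
 moreover have "\<forall>\<^sub>F c in tending_to_b \<beta>. hf (u 0) (v 0) - \<i> * (z - cnj z) * gram {0..<c} u v = hf (left_lim z u c) (left_lim z v c)"
  using tending_to_b_dom by eventually_elim (use lagrange_identity[OF gsolD[OF g(1)] gsolD[OF g(2)]] in simp)
 ultimately show ?thesis by (blast intro: Lim_transform_eventually)
qed

text \<open>The solution with initial value \<open>\<alpha>\<close>; its values outside the domain remain arbitrary.\<close>
definition fsol :: "complex \<Rightarrow> complex^2 \<Rightarrow> real \<Rightarrow> complex^2" where
 "fsol z \<alpha> = (SOME u. gsol z u \<and> u 0 = \<alpha>)"

definition fdet :: "complex \<Rightarrow> real \<Rightarrow> complex" where
 "fdet z c = det2 (left_lim z (fsol z (vector [1, 0])) c) (left_lim z (fsol z (vector [0, 1])) c)"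

lemma fsol: 
 assumes "jump_regular z" "Im z \<noteq> 0"
 shows "gsol z (fsol z \<alpha>)" "fsol z \<alpha> 0 = \<alpha>"
 using someI_ex[OF global_solution_exists[OF assms, of \<alpha>]] by (auto simp: fsol_def)

lemma conjugate_left_lim:
 assumes reg: "jump_regular l" and im: "Im l \<noteq> 0" and v: "gsol (cnj l) v" and c: "c \<in> dom"
 shows "cnj (left_lim (cnj l) v c $ j) * fdet l c = cnj (v 0 $ 1) * left_lim l (fsol l (vector [1, 0])) c $ j + cnj (v 0 $ 2) * left_lim l (fsol l (vector [0, 1])) c $ j"
 unfolding fdet_def
proof (rule conjugate_solution_algebra)
 note f = fsol[OF reg im]
 show "hf (left_lim l (fsol l (vector [1, 0])) c) (left_lim (cnj l) v c) = hf (vector [1, 0]) (v 0)"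
  using lagrange_identity[OF gsolD[OF f(1) c] gsolD[OF v c] c] by (simp add: f(2))
 show "hf (left_lim l (fsol l (vector [0, 1])) c) (left_lim (cnj l) v c) = hf (vector [0, 1]) (v 0)"
  using lagrange_identity[OF gsolD[OF f(1) c] gsolD[OF v c] c] by (simp add: f(2))
qed

text \<open>The fundamental matrices at \<open>l\<close> and \<open>cnj l\<close> are inverse to each other up to adjoints and \<open>J\<close>.\<close>
lemma fdet_conjugate:
 assumes reg: "jump_regular l" "jump_regular (cnj l)" and im: "Im l \<noteq> 0" and c: "c \<in> dom"
 shows "fdet l c * cnj (fdet (cnj l) c) = 1"
proof -
 have im': "Im (cnj l) \<noteq> 0" using im by simp
 note f = fsol[OF reg(2) im']
 let ?a = "left_lim l (fsol l (vector [1, 0])) c" and ?b = "left_lim l (fsol l (vector [0, 1])) c"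
 let ?p = "left_lim (cnj l) (fsol (cnj l) (vector [1, 0])) c" and ?q = "left_lim (cnj l) (fsol (cnj l) (vector [0, 1])) c"
 let ?D = "fdet l c"
 have p: "cnj (?p $ j) * ?D = ?a $ j" for j using conjugate_left_lim[OF reg(1) im f(1)[of "vector [1, 0]"] c, of j] by (simp add: f(2))
 have q: "cnj (?q $ j) * ?D = ?b $ j" for j using conjugate_left_lim[OF reg(1) im f(1)[of "vector [0, 1]"] c, of j] by (simp add: f(2))
 have "?D = ?a $ 1 * ?b $ 2 - ?a $ 2 * ?b $ 1" by (simp add: fdet_def det2_def)
 also have "\<dots> = cnj (fdet (cnj l) c) * (?D * ?D)"
  unfolding p[symmetric] q[symmetric] by (simp add: fdet_def[of "cnj l"] det2_def algebra_simps)
 also have "\<dots> = (?D * cnj (fdet (cnj l) c)) * ?D" by (simp only: mult.assoc mult.left_commute mult.commute)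
 finally have e: "?D = (?D * cnj (fdet (cnj l) c)) * ?D" .
 have "?D \<noteq> 0"
 proof
  assume D: "?D = 0"
  have "?a = 0" using p D by (simp add: vec_eq_iff)
  moreover have "hf ?a ?q = hf (vector [1, 0]) (vector [0, 1])"
   using lagrange_identity[OF gsolD[OF fsol(1)[OF reg(1) im] c] gsolD[OF f(1) c] c, of "vector [1, 0]" "vector [0, 1]"]
   by (simp add: f(2) fsol(2)[OF reg(1) im])
  ultimately show False by (simp add: hf_def)
 qed
 moreover have "(?D * cnj (fdet (cnj l) c)) * ?D = 1 * ?D" by (subst mult_1_left) (rule e[symmetric])
 ultimately show ?thesis by (rule mult_right_cancel[THEN iffD1])
qed

text \<open>The brackets of the fundamental solutions converge by Lagrange's identity, hence so does the modulus of the determinant. Were its limit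
\<open>t\<close> non-zero, the bracket of every solution \<open>y\<close> at \<open>cnj l\<close> would have a finite limit, by
\<open>conjugate_left_lim\<close>, and with it the norm of \<open>y\<close>.\<close>
theorem det_dichotomy:
 assumes reg: "jump_regular l" "jump_regular (cnj l)" and im: "Im l \<noteq> 0"
  and full: "full l" and nfull: "\<not> full (cnj l)"
 shows "((\<lambda>c. norm (fdet l c)) \<longlongrightarrow> 0) (tending_to_b \<beta>)"
  and "filterlim (\<lambda>c. norm (fdet (cnj l) c)) at_top (tending_to_b \<beta>)"
proof -
 let ?F = "tending_to_b \<beta>"
 let ?u = "fsol l (vector [1, 0])" and ?v = "fsol l (vector [0, 1])"
 let ?a = "left_lim l ?u" and ?b = "left_lim l ?v"
 have gu: "gsol l (fsol l \<alpha>)" for \<alpha> using fsol[OF reg(1) im] by blast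
 have L2: "L2g l (fsol l \<alpha>)" for \<alpha> using full gu by (simp add: full_def)
 obtain h11 where h11: "((\<lambda>c. hf (?a c) (?a c)) \<longlongrightarrow> h11) ?F" using hf_left_lim_convergent[OF L2 L2] by blast
 obtain h12 where h12: "((\<lambda>c. hf (?a c) (?b c)) \<longlongrightarrow> h12) ?F" using hf_left_lim_convergent[OF L2 L2] by blast
 obtain h22 where h22: "((\<lambda>c. hf (?b c) (?b c)) \<longlongrightarrow> h22) ?F" using hf_left_lim_convergent[OF L2 L2] by blast
 define t where "t = (norm h12)\<^sup>2 - Re h11 * Re h22"
 have lim: "((\<lambda>c. (norm (fdet l c))\<^sup>2) \<longlongrightarrow> t) ?F"
  unfolding fdet_def hf_det2 t_def by (intro tendsto_intros h11 h12 h22)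
 have t: "t = 0"
 proof (rule ccontr)
  assume "t \<noteq> 0"
  moreover have "0 \<le> t" by (rule tendsto_lowerbound[OF lim _ tending_to_b_nontrivial]) auto
  ultimately have t: "t > 0" by simp
  have "full (cnj l)"
   unfolding full_def
  proof (intro allI impI)
   fix y assume y: "gsol (cnj l) y"
   define w where "w c = cnj (y 0 $ 1) *s ?a c + cnj (y 0 $ 2) *s ?b c" for c
   define x1 x2 where "x1 = cnj (y 0 $ 1)" "x2 = cnj (y 0 $ 2)"
   have hw: "hf (w c) (w c) = x1 * cnj x1 * hf (?a c) (?a c) + x2 * cnj x2 * hf (?b c) (?b c) + x1 * cnj x2 * hf (?a c) (?b c) + cnj (x1 * cnj x2 * hf (?a c) (?b c))" for c
    by (simp add: w_def x1_x2_def hf_def algebra_simps)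
   have wlim: "((\<lambda>c. Re (hf (w c) (w c))) \<longlongrightarrow> Re (x1 * cnj x1 * h11 + x2 * cnj x2 * h22 + x1 * cnj x2 * h12 + cnj (x1 * cnj x2 * h12))) ?F"
    unfolding hw by (intro tendsto_intros h11 h12 h22)
   have rel: "Re (hf (left_lim (cnj l) y c) (left_lim (cnj l) y c)) * (norm (fdet l c))\<^sup>2 = - Re (hf (w c) (w c))" if c: "c \<in> dom" for c
   proof -
    let ?Y = "left_lim (cnj l) y c"
    have Y: "w c $ j = cnj (?Y $ j) * fdet l c" for j
     using conjugate_left_lim[OF reg(1) im y c, of j] by (simp add: w_def)
    have "hf (w c) (w c) = - (hf ?Y ?Y * (fdet l c * cnj (fdet l c)))"
     unfolding hf_def Y by (simp add: algebra_simps)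
    also have "fdet l c * cnj (fdet l c) = of_real ((norm (fdet l c))\<^sup>2)" by (rule complex_norm_square[symmetric])
    finally show ?thesis by simp
   qed
   have "((\<lambda>c. - Re (hf (w c) (w c)) / (norm (fdet l c))\<^sup>2) \<longlongrightarrow> - Re (x1 * cnj x1 * h11 + x2 * cnj x2 * h22 + x1 * cnj x2 * h12 + cnj (x1 * cnj x2 * h12)) / t) ?F"
    using t by (intro tendsto_divide tendsto_minus wlim lim) auto
   then have "\<forall>\<^sub>F c in ?F. norm (- Re (hf (w c) (w c)) / (norm (fdet l c))\<^sup>2) < norm (- Re (x1 * cnj x1 * h11 + x2 * cnj x2 * h22 + x1 * cnj x2 * h12 + cnj (x1 * cnj x2 * h12)) / t) + 1"
    by (intro order_tendstoD(2)[OF tendsto_norm]) auto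
   then obtain B d where d: "d \<in> dom" and B: "\<And>c. c \<in> dom \<Longrightarrow> d < c \<Longrightarrow> \<bar>Re (hf (w c) (w c)) / (norm (fdet l c))\<^sup>2\<bar> < B"
    unfolding eventually_tending_to_b by auto
   have bound: "nsq c y \<le> (B + \<bar>Re (hf (y 0) (y 0))\<bar>) / (2 * \<bar>Im l\<bar>)" if c: "c \<in> dom" "d < c" for c
   proof -
    let ?Y = "left_lim (cnj l) y c"
    have D: "fdet l c \<noteq> 0" using fdet_conjugate[OF reg im c(1)] by auto
    have "Re (hf ?Y ?Y) = - (Re (hf (w c) (w c)) / (norm (fdet l c))\<^sup>2)"
     using rel[OF c(1)] D by (simp add: field_simps)
    then have 1: "\<bar>Re (hf ?Y ?Y)\<bar> < B" using B[OF c] by simp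
    have "- \<i> * (cnj l - cnj (cnj l)) = of_real (- 2 * Im l)" by (simp add: complex_eq_iff)
    then have "hf ?Y ?Y = hf (y 0) (y 0) + of_real (- 2 * Im l) * gram {0..<c} y y"
     using lagrange_identity[OF gsolD[OF y c(1)] gsolD[OF y c(1)] c(1)] by (metis (no_types, lifting) diff_conv_add_uminus mult_minus_left)
    then have 2: "Re (hf ?Y ?Y) = Re (hf (y 0) (y 0)) - 2 * Im l * nsq c y" by simp
    have G: "0 \<le> nsq c y" by (rule gram_nonneg[OF gsol_lbm[OF y c(1)] c(1)]) auto
    have "2 * \<bar>Im l\<bar> * nsq c y = \<bar>2 * Im l * nsq c y\<bar>" using G by (simp add: abs_mult)
    also have "\<dots> \<le> B + \<bar>Re (hf (y 0) (y 0))\<bar>" using 1 2 by linarith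
    finally show ?thesis using im by (simp add: field_simps)
   qed
   show "L2g (cnj l) y"
    unfolding L2g_def
   proof (intro conjI y exI ballI)
    fix c assume c: "c \<in> dom"
    obtain e where e: "e \<in> dom" "max c d < e" using dom_increase[of "max c d"] c d by (metis max_def)
    have "nsq c y \<le> nsq e y" using e by (intro gram_mono gsol_lbm[OF y] domD(1)[OF c]) auto
    also have "\<dots> \<le> (B + \<bar>Re (hf (y 0) (y 0))\<bar>) / (2 * \<bar>Im l\<bar>)" using e by (intro bound) auto
    finally show "nsq c y \<le> (B + \<bar>Re (hf (y 0) (y 0))\<bar>) / (2 * \<bar>Im l\<bar>)" .
   qed
  qed
  then show False using nfull by simp
 qed
 have "((\<lambda>c. sqrt ((norm (fdet l c))\<^sup>2)) \<longlongrightarrow> sqrt 0) ?F" using lim unfolding t by (rule tendsto_real_sqrt)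
 then show lim0: "((\<lambda>c. norm (fdet l c)) \<longlongrightarrow> 0) ?F" by simp
 have inv: "filterlim (\<lambda>c. inverse (norm (fdet l c))) at_top ?F"
 proof (rule filterlim_inverse_at_top[OF lim0])
  show "\<forall>\<^sub>F c in ?F. 0 < norm (fdet l c)"
   using tending_to_b_dom by eventually_elim (use fdet_conjugate[OF reg im] in force)
 qed
 have eq: "\<forall>\<^sub>F c in ?F. inverse (norm (fdet l c)) = norm (fdet (cnj l) c)"
  using tending_to_b_dom
 proof eventually_elim
  case (elim c)
  have "norm (fdet l c * cnj (fdet (cnj l) c)) = 1" using fdet_conjugate[OF reg im elim] by simp
  then have "norm (fdet l c) * norm (fdet (cnj l) c) = 1" by (simp add: norm_mult)
  then show ?case by (simp add: inverse_unique)
 qed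
 show "filterlim (\<lambda>c. norm (fdet (cnj l) c)) at_top ?F"
  by (rule filterlim_cong[OF refl refl eq, THEN iffD1, OF inv])
qed

end

section \<open>Liouville's formula\<close>

text \<open>A product over ordered factors solves a discrete linear equation with jumps.\<close>
lemma prod_expansion:
 fixes \<rho> :: "real \<Rightarrow> 'a::comm_ring_1"
 assumes "finite F"
 shows "(\<Prod>y\<in>F. 1 + \<rho> y) = 1 + (\<Sum>y\<in>F. \<rho> y * (\<Prod>x\<in>{x\<in>F. x < y}. 1 + \<rho> x))"
 using assms
proof (induction F rule: finite_linorder_max_induct)
 case (insert b F)
 have b: "b \<notin> F" using insert by auto
 have e1: "{x \<in> insert b F. x < b} = F" using insert by auto
 have e2: "{x \<in> insert b F. x < y} = {x \<in> F. x < y}" if "y \<in> F" for y using insert that by auto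
 have "(\<Sum>y\<in>insert b F. \<rho> y * (\<Prod>x\<in>{x\<in>insert b F. x < y}. 1 + \<rho> x)) =
   \<rho> b * (\<Prod>x\<in>F. 1 + \<rho> x) + (\<Sum>y\<in>F. \<rho> y * (\<Prod>x\<in>{x\<in>F. x < y}. 1 + \<rho> x))"
  using insert(1) b e1 e2 by simp
 then show ?case using insert(1,3) b by (simp add: algebra_simps)
qed simp

lemma discrete_gronwall:
 fixes \<rho> e :: "real \<Rightarrow> real"
 assumes "finite F" "0 \<le> \<eta>" "\<And>y. y \<in> F \<Longrightarrow> 0 \<le> \<rho> y"
  and e: "\<And>t. t \<in> insert t0 F \<Longrightarrow> e t \<le> \<eta> + (\<Sum>y\<in>{y\<in>F. y < t}. \<rho> y * e y)"
 shows "e t0 \<le> \<eta> * (\<Prod>y\<in>{y\<in>F. y < t0}. 1 + \<rho> y)"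
proof -
 have step: "e t \<le> \<eta> * (\<Prod>y\<in>{y\<in>F. y < t}. 1 + \<rho> y)" 
  if t: "t \<in> insert t0 F" and IH: "\<And>y. y \<in> F \<Longrightarrow> y < t \<Longrightarrow> e y \<le> \<eta> * (\<Prod>x\<in>{x\<in>F. x < y}. 1 + \<rho> x)" for t
 proof -
  let ?G = "{y\<in>F. y < t}"
  have "e t \<le> \<eta> + (\<Sum>y\<in>?G. \<rho> y * e y)" by (rule e[OF t])
  also have "\<dots> \<le> \<eta> + (\<Sum>y\<in>?G. \<rho> y * (\<eta> * (\<Prod>x\<in>{x\<in>F. x < y}. 1 + \<rho> x)))"
   using IH assms(3) by (intro add_left_mono sum_mono mult_left_mono) auto
  also have "\<dots> = \<eta> * (1 + (\<Sum>y\<in>?G. \<rho> y * (\<Prod>x\<in>{x\<in>?G. x < y}. 1 + \<rho> x)))"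
  proof -
   have "{x\<in>?G. x < y} = {x\<in>F. x < y}" if "y \<in> ?G" for y using that by auto
   then have "(\<Sum>y\<in>?G. \<rho> y * (\<Prod>x\<in>{x\<in>?G. x < y}. 1 + \<rho> x)) = (\<Sum>y\<in>?G. \<rho> y * (\<Prod>x\<in>{x\<in>F. x < y}. 1 + \<rho> x))"
    by (intro sum.cong) auto
   then show ?thesis by (simp add: distrib_left sum_distrib_left algebra_simps)
  qed
  also have "\<dots> = \<eta> * (\<Prod>y\<in>?G. 1 + \<rho> y)" using prod_expansion[of ?G \<rho>] assms(1) by simp
  finally show ?thesis .
 qed
 have all: "e y \<le> \<eta> * (\<Prod>x\<in>{x\<in>F. x < y}. 1 + \<rho> x)" if "y \<in> F" for y
  using that
 proof (induction "card {x\<in>F. x < y}" arbitrary: y rule: less_induct)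
  case less
  show ?case
  proof (rule step)
   fix x assume x: "x \<in> F" "x < y"
   have "{z\<in>F. z < x} \<subset> {z\<in>F. z < y}" using x by auto
   then have "card {z\<in>F. z < x} < card {z\<in>F. z < y}" using assms(1) by (intro psubset_card_mono) auto
   then show "e x \<le> \<eta> * (\<Prod>z\<in>{z\<in>F. z < x}. 1 + \<rho> z)" using less.hyps x by blast
  qed (use less in auto)
 qed
 show ?thesis by (rule step[OF insertI1 all])
qed

context canonical_system begin

text \<open>The atoms in \<open>S\<close> form a convergent series, whatever the order.\<close>
lemma atoms_tail:
 assumes S: "countable S" "S \<subseteq> {0..c}" and c: "c \<in> dom"
 shows "((\<lambda>F. mass (S - F)) \<longlongrightarrow> 0) (finite_subsets_at_top S)"
proof (rule tendstoI)
 fix e :: real assume e: "e > 0"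
 have meas: "B \<in> sets borel" if "B \<subseteq> S" for B
  using countable_subset[OF that S(1)] by (rule sets.countable[rotated]) simp
 have "\<exists>F0. finite F0 \<and> F0 \<subseteq> S \<and> mass (S - F0) < e"
 proof (cases "finite S")
  case True
  then show ?thesis using e by (intro exI[of _ S]) auto
 next
  case False
  define a where "a = from_nat_into S"
  have ra: "range a = S" unfolding a_def using False S(1) by (intro range_from_nat_into) auto
  let ?B = "\<lambda>n. S - a ` {..<n}"
  have "(\<lambda>n. mass (?B n)) \<longlonglongrightarrow> mass (\<Inter>n. ?B n)"
  proof (rule Lim_measure_decseq)
   show "range ?B \<subseteq> sets \<nu>" using meas by auto
   show "decseq ?B" by (auto simp: decseq_def)
   show "emeasure \<nu> (?B i) \<noteq> \<infinity>" for i using emeasure_finite[of "?B i" c] S c by force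
  qed
  moreover have "(\<Inter>n. ?B n) = {}"
  proof (rule equals0I)
   fix y assume y: "y \<in> (\<Inter>n. ?B n)"
   then have "y \<in> range a" using ra by auto
   then obtain n where "y = a n" by blast
   then have "y \<in> a ` {..<Suc n}" by auto
   then show False using y by blast
  qed
  ultimately have "(\<lambda>n. mass (?B n)) \<longlonglongrightarrow> 0" by (simp only: measure_empty)
  from order_tendstoD(2)[OF this e] obtain n where "mass (?B n) < e" by (auto simp: eventually_sequentially)
  then show ?thesis using ra by (intro exI[of _ "a ` {..<n}"]) auto
 qed
 then obtain F0 where F0: "finite F0" "F0 \<subseteq> S" "mass (S - F0) < e" by blast
 show "\<forall>\<^sub>F F in finite_subsets_at_top S. dist (mass (S - F)) 0 < e"
  unfolding eventually_finite_subsets_at_top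
 proof (rule exI[of _ F0], intro conjI allI impI F0(1,2))
  fix Y assume Y: "finite Y \<and> F0 \<subseteq> Y \<and> Y \<subseteq> S"
  have "mass (S - Y) \<le> mass (S - F0)"
   using Y meas emeasure_finite[of "S - F0" c] S c by (intro measure_mono_fmeasurable fmeasurableI) force+
  then show "dist (mass (S - Y)) 0 < e" using F0(3) by simp
 qed
qed

lemma set_integral_finite_set:
 fixes f :: "real \<Rightarrow> complex"
 assumes "finite F" "F \<subseteq> {0..c}" "c \<in> dom"
 shows "(LINT x:F|\<nu>. f x) = (\<Sum>y\<in>F. of_real (mass {y}) * f y)"
proof -
 have y: "y \<in> dom" if "y \<in> F" for y using dom_down[OF assms(3)] assms(2) that by auto
 have int: "integrable \<nu> (\<lambda>x. indicat_real {y} x *\<^sub>R f x)" if "y \<in> F" for y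
 proof -
  have "integrable \<nu> (\<lambda>x. indicat_real {y} x *\<^sub>R f y)"
   using emeasure_finite[of "{y}" y] y[OF that] domD(1)[OF y[OF that]] by (intro integrable_scaleR_left integrable_real_indicator) auto
  moreover have "(\<lambda>x. indicat_real {y} x *\<^sub>R f y) = (\<lambda>x. indicat_real {y} x *\<^sub>R f x)" by (auto simp: indicator_def fun_eq_iff)
  ultimately show ?thesis by simp
 qed
 have "(LINT x:F|\<nu>. f x) = (\<integral>x. (\<Sum>y\<in>F. indicat_real {y} x *\<^sub>R f x) \<partial>\<nu>)"
  unfolding set_lebesgue_integral_def
 proof (intro bochner_cong refl)
  fix x
  have "indicat_real F x = (\<Sum>y\<in>F. indicat_real {y} x)" using assms(1) by (simp add: indicator_def sum.delta)
  then show "indicat_real F x *\<^sub>R f x = (\<Sum>y\<in>F. indicat_real {y} x *\<^sub>R f x)" by (simp add: scaleR_sum_left)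
 qed
 also have "\<dots> = (\<Sum>y\<in>F. LINT x:{y}|\<nu>. f x)"
  unfolding set_lebesgue_integral_def by (rule Bochner_Integration.integral_sum[OF int])
 also have "\<dots> = (\<Sum>y\<in>F. of_real (mass {y}) * f y)"
  by (intro sum.cong refl) (simp add: set_integral_point[OF y] scaleR_conv_of_real)
 finally show ?thesis .
qed

lemma set_integral_countable_has_sum:
 fixes f :: "real \<Rightarrow> complex"
 assumes S: "countable S" "S \<subseteq> {0..c}" and c: "c \<in> dom" and f: "f \<in> Borel" "\<And>x. x \<in> {0..c} \<Longrightarrow> norm (f x) \<le> B"
 shows "((\<lambda>y. of_real (mass {y}) * f y) has_sum (LINT x:S|\<nu>. f x)) S"
 unfolding has_sum_def
proof (rule LIM_zero_cancel, rule Lim_null_comparison)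
 have meas: "E \<in> sets borel" if "E \<subseteq> S" for E
  using countable_subset[OF that S(1)] by (rule sets.countable[rotated]) simp
 have si: "set_integrable \<nu> E f" if "E \<subseteq> S" for E
  using that S f c meas[OF that] by (intro set_integrableI_bounded[where c=c and B=B]) auto
 show "((\<lambda>F. \<bar>B\<bar> * mass (S - F)) \<longlongrightarrow> 0) (finite_subsets_at_top S)"
  by (rule tendsto_mult_right_zero[OF atoms_tail[OF S c]])
 show "\<forall>\<^sub>F F in finite_subsets_at_top S. norm ((\<Sum>y\<in>F. of_real (mass {y}) * f y) - (LINT x:S|\<nu>. f x)) \<le> \<bar>B\<bar> * mass (S - F)"
 proof (rule eventually_finite_subsets_at_top_weakI)
  fix F assume F: "finite F" "F \<subseteq> S"
  have "S = F \<union> (S - F)" using F by auto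
  then have "(LINT x:S|\<nu>. f x) = (LINT x:F|\<nu>. f x) + (LINT x:(S - F)|\<nu>. f x)"
   using si[of F] si[of "S - F"] F set_integral_Un[of F "S - F" \<nu> f] by auto
  moreover have "(LINT x:F|\<nu>. f x) = (\<Sum>y\<in>F. of_real (mass {y}) * f y)"
   using F S c by (intro set_integral_finite_set) auto
  moreover have "norm (LINT x:(S - F)|\<nu>. f x) \<le> \<bar>B\<bar> * mass (S - F)"
   using f S c meas[of "S - F"] by (intro set_integral_norm_le[where c=c]) force+
  ultimately show "norm ((\<Sum>y\<in>F. of_real (mass {y}) * f y) - (LINT x:S|\<nu>. f x)) \<le> \<bar>B\<bar> * mass (S - F)"
   by simp
 qed
qed

text \<open>For an integrand without atoms the primitive \<open>g\<close> is continuous, so the ordinary chain rule holds. The powers of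
\<open>g\<close> are obtained from the product rule by induction and summed to the exponential.\<close>
lemma exp_primitive:
 fixes \<psi> :: "real \<Rightarrow> complex"
 assumes \<psi>: "\<psi> \<in> Borel" "\<And>x. x \<in> {0..c} \<Longrightarrow> norm (\<psi> x) \<le> B"
  and noatom: "\<And>x. mass {x} \<noteq> 0 \<Longrightarrow> \<psi> x = 0" and c: "c \<in> dom"
 defines "g \<equiv> \<lambda>t. LINT x:{0..<t}|\<nu>. \<psi> x"
 shows "exp (g c) = 1 + (LINT x:{0..<c}|\<nu>. \<psi> x * exp (g x))"
  and "g \<in> Borel" and "\<And>x. x \<in> {0..c} \<Longrightarrow> norm (g x) \<le> \<bar>B\<bar> * mass {0..c}"
  and "\<And>k x. k \<in> Borel \<Longrightarrow> (\<And>x. x \<in> {0..c} \<Longrightarrow> norm (k x) \<le> D) \<Longrightarrow> x \<in> {0..c} \<Longrightarrow> hint (\<lambda>x. \<psi> x * k x) 0 x = (LINT y:{0..<x}|\<nu>. \<psi> y * k y)"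
proof -
 show gm: "g \<in> Borel" unfolding g_def
  by (intro set_integral_param_measurable \<psi>) simp
 have mono: "mass {0..<x} \<le> mass {0..c}" if "x \<in> {0..c}" for x
  using that c emeasure_finite[of "{0..c}" c] by (intro measure_mono_fmeasurable fmeasurableI) auto
 show gb: "norm (g x) \<le> \<bar>B\<bar> * mass {0..c}" if x: "x \<in> {0..c}" for x
 proof -
  have "norm (g x) \<le> \<bar>B\<bar> * mass {0..<x}" unfolding g_def
   using \<psi> x c by (intro set_integral_norm_le[where c=c]) force+
  also have "\<dots> \<le> \<bar>B\<bar> * mass {0..c}" using mono[OF x] by (intro mult_left_mono) auto
  finally show ?thesis .
 qed
 show hint_eq: "hint (\<lambda>x. \<psi> x * k x) 0 x = (LINT y:{0..<x}|\<nu>. \<psi> y * k y)" 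
  if k: "k \<in> Borel" "\<And>x. x \<in> {0..c} \<Longrightarrow> norm (k x) \<le> D" and x: "x \<in> {0..c}" for k x D
 proof -
  have xd: "x \<in> dom" using dom_down[OF c] x by auto
  note [measurable] = \<psi>(1) k(1)
  have si: "set_integrable \<nu> E (\<lambda>y. \<psi> y * k y)" if "E \<in> sets borel" "E \<subseteq> {0..x}" for E
  proof (rule set_integrableI_bounded[OF _ that(1) _ c, where B="\<bar>B\<bar> * \<bar>D\<bar>"])
   fix y assume "y \<in> E"
   then have y: "y \<in> {0..c}" using that x by auto
   have "norm (\<psi> y) \<le> \<bar>B\<bar>" "norm (k y) \<le> \<bar>D\<bar>" using \<psi>(2)[OF y] k(2)[OF y] by linarith+
   then show "norm (\<psi> y * k y) \<le> \<bar>B\<bar> * \<bar>D\<bar>" unfolding norm_mult by (intro mult_mono) auto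
  qed (measurable, use that x in auto)
  have "{0..x} = {0..<x} \<union> {x}" using x by auto
  then have "(LINT y:{0..x}|\<nu>. \<psi> y * k y) = (LINT y:{0..<x}|\<nu>. \<psi> y * k y) + (LINT y:{x}|\<nu>. \<psi> y * k y)"
   using si[of "{0..<x}"] si[of "{x}"] x set_integral_Un[of "{0..<x}" "{x}" \<nu> "\<lambda>y. \<psi> y * k y"] by (simp del: Un_insert_right)
  also have "(LINT y:{x}|\<nu>. \<psi> y * k y) = 0"
   unfolding set_integral_point[OF xd] using noatom[of x] by (cases "mass {x} = 0") auto
  finally have "(LINT y:{0..x}|\<nu>. \<psi> y * k y) = (LINT y:{0..<x}|\<nu>. \<psi> y * k y)" by simp
  moreover have "(\<lambda>y. \<psi> y * k y) \<in> Borel" by measurable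
  ultimately show ?thesis by (subst hint_from_zero) auto
 qed
 define G where "G = \<bar>B\<bar> * mass {0..c}"
 have G0: "0 \<le> G" by (simp add: G_def)
 note gb' = gb[folded G_def]
 have pw: "norm (g x ^ n / fact n) \<le> G ^ n / fact n" if "x \<in> {0..c}" for x n
  using gb'[OF that] by (simp add: norm_divide norm_power divide_right_mono power_mono)
 have pm: "(\<lambda>x. g x ^ n / fact n) \<in> Borel" for n using gm by measurable
 have power: "g t ^ Suc n / fact (Suc n) = (LINT x:{0..<t}|\<nu>. \<psi> x * (g x ^ n / fact n))" if t: "t \<in> {0..c}" for t n
  using t
 proof (induction n arbitrary: t)
  case 0
  then show ?case by (simp add: g_def)
 next
  case (Suc n)
  have td: "t \<in> dom" using dom_down[OF c] Suc.prems by auto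
  have sub: "{0..t} \<subseteq> {0..c}" using Suc.prems by auto
  let ?f = "\<lambda>x. \<psi> x * (g x ^ n / fact n)"
  have fb: "norm (?f x) \<le> \<bar>B\<bar> * (G ^ n / fact n)" if "x \<in> {0..c}" for x
   unfolding norm_mult using \<psi>(2)[OF that] pw[OF that] by (intro mult_mono) auto
  have fm: "?f \<in> Borel" using \<psi>(1) pm[of n] by measurable
  have prod: "(0 + (LINT x:{0..<t}|\<nu>. ?f x)) * (0 + (LINT x:{0..<t}|\<nu>. \<psi> x)) =
   0 * 0 + (LINT x:{0..<t}|\<nu>. ?f x * g x + (g x ^ Suc n / fact (Suc n)) * \<psi> x)"
  proof (rule balanced_product_rule[OF td fm _ \<psi>(1)])
   show "norm (?f x) \<le> \<bar>B\<bar> * (G ^ n / fact n)" if "x \<in> {0..t}" for x using fb sub that by blast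
   show "norm (\<psi> x) \<le> B" if "x \<in> {0..t}" for x using \<psi>(2) sub that by blast
   show "g x ^ Suc n / fact (Suc n) = 0 + hint ?f 0 x" if "x \<in> {0..<t}" for x
   proof -
    have x: "x \<in> {0..c}" using that sub by auto
    show ?thesis using Suc.IH[OF x] hint_eq[OF pm pw x, of n] by simp
   qed
   show "g x = 0 + hint \<psi> 0 x" if "x \<in> {0..<t}" for x
   proof -
    have x: "x \<in> {0..c}" using that sub by auto
    show ?thesis using hint_eq[OF borel_measurable_const[of 1] _ x, of 1] by (simp add: g_def)
   qed
  qed
  have int: "(LINT x:{0..<t}|\<nu>. ?f x) = g t ^ Suc n / fact (Suc n)" by (rule Suc.IH[OF Suc.prems, symmetric])
  have gt: "(LINT x:{0..<t}|\<nu>. \<psi> x) = g t" by (simp add: g_def)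
  have pointwise: "?f x * g x + (g x ^ Suc n / fact (Suc n)) * \<psi> x = of_nat (Suc (Suc n)) * (\<psi> x * (g x ^ Suc n / fact (Suc n)))" for x
  proof -
   have "?f x * g x = of_nat (Suc n) * (\<psi> x * (g x ^ Suc n / fact (Suc n)))"
    by (simp add: field_simps del: of_nat_Suc)
   then have "?f x * g x + (g x ^ Suc n / fact (Suc n)) * \<psi> x = of_nat (Suc n) * (\<psi> x * (g x ^ Suc n / fact (Suc n))) + \<psi> x * (g x ^ Suc n / fact (Suc n))"
    by (simp only: mult.commute[of _ "\<psi> x"])
   also have "\<dots> = of_nat (Suc (Suc n)) * (\<psi> x * (g x ^ Suc n / fact (Suc n)))"
    by (simp only: of_nat_Suc[of "Suc n"] distrib_right mult_1 add.commute)
   finally show ?thesis .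
  qed
  have "g t ^ Suc n / fact (Suc n) * g t = of_nat (Suc (Suc n)) * (LINT x:{0..<t}|\<nu>. \<psi> x * (g x ^ Suc n / fact (Suc n)))"
   using prod unfolding add_0_left mult_zero_left int gt pointwise set_integral_mult_right .
  then have "g t ^ Suc (Suc n) / fact (Suc n) = of_nat (Suc (Suc n)) * (LINT x:{0..<t}|\<nu>. \<psi> x * (g x ^ Suc n / fact (Suc n)))"
   by (simp add: mult.commute del: of_nat_Suc fact_Suc)
  moreover have "(fact (Suc (Suc n)) :: complex) = of_nat (Suc (Suc n)) * fact (Suc n)" by (rule fact_Suc)
  ultimately show ?case by (simp add: divide_simps mult.commute del: of_nat_Suc fact_Suc power_Suc)
 qed
 let ?h = "\<lambda>n x. indicat_real {0..<c} x *\<^sub>R (\<psi> x * (g x ^ n / fact n))"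
 have hb: "norm (\<psi> x * (g x ^ n / fact n)) \<le> \<bar>B\<bar> * (G ^ n / fact n)" if "x \<in> {0..c}" for n x
  unfolding norm_mult using \<psi>(2)[OF that] pw[OF that] by (intro mult_mono) auto
 have hm: "(\<lambda>x. \<psi> x * (g x ^ n / fact n)) \<in> Borel" for n using \<psi>(1) pm[of n] by measurable
 have hi: "set_integrable \<nu> {0..<c} (\<lambda>x. \<psi> x * (g x ^ n / fact n))" for n
  using hb c by (intro set_integrableI_bounded[OF hm, where c=c and B="\<bar>B\<bar> * (G ^ n / fact n)"]) auto
 have sumG: "summable (\<lambda>n. G ^ n / fact n)" using summable_exp_generic[of G] by (simp add: divide_inverse scaleR_conv_of_real mult.commute)
 have sums: "(\<lambda>n. \<integral>x. ?h n x \<partial>\<nu>) sums (\<integral>x. (\<Sum>n. ?h n x) \<partial>\<nu>)"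
 proof (rule sums_integral)
  show "integrable \<nu> (?h n)" for n using hi[of n] by (simp add: set_integrable_def)
  show "AE x in \<nu>. summable (\<lambda>n. norm (?h n x))"
  proof (rule AE_I2)
   fix x
   show "summable (\<lambda>n. norm (?h n x))"
   proof (cases "x \<in> {0..<c}")
    case True
    then show ?thesis using hb[of x] by (intro summable_comparison_test'[OF summable_mult[OF sumG, of "\<bar>B\<bar>"]]) auto
   qed simp
  qed
  show "summable (\<lambda>n. \<integral>x. norm (?h n x) \<partial>\<nu>)"
  proof (rule summable_comparison_test'[OF summable_mult2[OF summable_mult[OF sumG, of "\<bar>B\<bar>"], of "mass {0..<c}"]])
   fix n :: nat
   have "(\<integral>x. norm (?h n x) \<partial>\<nu>) = (LINT x:{0..<c}|\<nu>. norm (\<psi> x * (g x ^ n / fact n)))"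
    unfolding set_lebesgue_integral_def by (intro bochner_cong) auto
   also have "norm \<dots> \<le> \<bar>B\<bar> * (G ^ n / fact n) * mass {0..<c}"
   proof (rule set_integral_norm_le[OF _ _ _ c])
    show "(\<lambda>x. norm (\<psi> x * (g x ^ n / fact n))) \<in> Borel" using hm[of n] by measurable
   qed (use hb in auto)
   finally show "norm (\<integral>x. norm (?h n x) \<partial>\<nu>) \<le> \<bar>B\<bar> * (G ^ n / fact n) * mass {0..<c}" .
  qed
 qed
 have cc: "c \<in> {0..c}" using domD(1)[OF c] by simp
 have l: "(\<integral>x. ?h n x \<partial>\<nu>) = g c ^ Suc n / fact (Suc n)" for n
  using power[OF cc, of n] unfolding set_lebesgue_integral_def by (rule sym)
 have expg: "(\<lambda>n. w ^ n / fact n) sums exp w" for w :: complex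
  using exp_converges[of w] by (simp add: divide_inverse scaleR_conv_of_real mult.commute)
 have r: "(\<Sum>n. ?h n x) = indicat_real {0..<c} x *\<^sub>R (\<psi> x * exp (g x))" for x
 proof -
  have "(\<lambda>n. ?h n x) sums (indicat_real {0..<c} x *\<^sub>R (\<psi> x * exp (g x)))"
   by (intro sums_scaleR_right sums_mult expg)
  then show ?thesis by (rule sums_unique[symmetric])
 qed
 have "(\<lambda>n. g c ^ Suc n / fact (Suc n)) sums (LINT x:{0..<c}|\<nu>. \<psi> x * exp (g x))"
  using sums unfolding l r by (simp add: set_lebesgue_integral_def)
 moreover have "(\<lambda>n. g c ^ Suc n / fact (Suc n)) sums (exp (g c) - 1)"
  using expg[of "g c"] by (subst sums_Suc_iff) simp
 ultimately have "(LINT x:{0..<c}|\<nu>. \<psi> x * exp (g x)) = exp (g c) - 1" by (rule sums_unique2)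
 then show "exp (g c) = 1 + (LINT x:{0..<c}|\<nu>. \<psi> x * exp (g x))" by simp
qed

text \<open>The matrices \<open>B_plus\<close> and \<open>B_minus\<close> in terms of the densities. They describe how the left and the right limit arise from the
balanced value.\<close>
definition jump_plus :: "complex \<Rightarrow> real \<Rightarrow> complex^2^2" where
 "jump_plus z x = (\<chi> j k. J $ j $ k + (1/2) * (of_real (mass {x}) * Q x $ j $ k - z * (of_real (mass {x}) * W x $ j $ k)))"

definition jump_minus :: "complex \<Rightarrow> real \<Rightarrow> complex^2^2" where
 "jump_minus z x = (\<chi> j k. J $ j $ k - (1/2) * (of_real (mass {x}) * Q x $ j $ k - z * (of_real (mass {x}) * W x $ j $ k)))"

lemma tr2_gen: "tr2 (A z x) = (Q x $ 1 $ 2 - z * W x $ 1 $ 2) - (Q x $ 2 $ 1 - z * W x $ 2 $ 1)"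
 by (simp add: tr2_def gen_def matrix_matrix_mult_def sum_2)

lemma jump_dets:
 "det2 (a - (mass {x} / 2) *\<^sub>R (A z x *v a)) (b - (mass {x} / 2) *\<^sub>R (A z x *v b)) = det (jump_plus z x) * det2 a b"
 "det (jump_minus z x) - det (jump_plus z x) = of_real (mass {x}) * tr2 (A z x)"
proof -
 define m where "m = complex_of_real (mass {x})"
 have 1: "(a - (mass {x} / 2) *\<^sub>R (A z x *v a)) $ j = a $ j - m / 2 * (A z x *v a) $ j" for a j
  unfolding vector_minus_component vector_scaleR_component by (simp add: scaleR_conv_of_real m_def)
 show "det2 (a - (mass {x} / 2) *\<^sub>R (A z x *v a)) (b - (mass {x} / 2) *\<^sub>R (A z x *v b)) = det (jump_plus z x) * det2 a b"
  unfolding det2_def 1 gen_components det_2 jump_plus_def m_def[symmetric]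
  by (simp add: field_simps)
 show "det (jump_minus z x) - det (jump_plus z x) = of_real (mass {x}) * tr2 (A z x)"
  unfolding tr2_gen det_2 jump_plus_def jump_minus_def m_def[symmetric] by (simp add: field_simps)
qed

lemma sol_det_jump:
 assumes u: "sol z 0 c u" and v: "sol z 0 c v" and c: "c \<in> dom"
 shows "det2 (left_lim z u c) (left_lim z v c) = det (jump_plus z c) * det2 (u c) (v c)"
proof -
 have "left_lim z u c = u c - (mass {c} / 2) *\<^sub>R (A z c *v u c)" "left_lim z v c = v c - (mass {c} / 2) *\<^sub>R (A z c *v v c)"
  using left_lim_value[OF u c] left_lim_value[OF v c] by (simp_all add: algebra_simps)
 then show ?thesis by (simp only: jump_dets(1))
qed

text \<open>Let \<open>D\<close> be the determinant at left limits. Multiplied by \<open>C = exp (- \<integral> \<psi>)\<close>, where \<open>\<psi>\<close> is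
the trace off the atoms, it becomes a function \<open>X\<close> which changes at atoms only, and there by the factor \<open>r = det B_minus / det
B_plus\<close>. A discrete Gronwall estimate compares \<open>X\<close> with the product over a finite set \<open>F\<close> of atoms; the error is
controlled by the mass of the atoms outside \<open>F\<close>. The lower bound for \<open>D\<close> makes \<open>r y - 1\<close> at most a multiple of
the mass of \<open>y\<close>.\<close>
theorem liouville:
 assumes nz: "\<And>x. x \<in> dom \<Longrightarrow> det (jump_plus z x) \<noteq> 0"
  and u: "gsol z u" and v: "gsol z v" and c: "c \<in> dom"
  and lower: "m > 0" "\<And>x. x \<in> {0..c} \<Longrightarrow> m \<le> norm (det2 (left_lim z u x) (left_lim z v x))"
  and S: "S \<subseteq> {0<..<c}" "countable S" "\<And>x. x \<in> {0<..<c} \<Longrightarrow> x \<notin> S \<Longrightarrow> of_real (mass {x}) * tr2 (A z x) = 0"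
 defines "\<psi> \<equiv> \<lambda>x. if mass {x} = 0 then tr2 (A z x) else 0"
 shows "((\<lambda>F. det2 (u 0) (v 0) * (\<Prod>y\<in>F. det (jump_minus z y) / det (jump_plus z y))) \<longlongrightarrow>
   det2 (left_lim z u c) (left_lim z v c) * exp (- (LINT x:{0..<c}|\<nu>. \<psi> x))) (finite_subsets_at_top S)"
proof -
 define \<phi> where "\<phi> x = tr2 (A z x)" for x
 have \<phi>m [measurable]: "\<phi> \<in> Borel" unfolding \<phi>_def tr2_gen by measurable
 have \<phi>b: "norm (\<phi> x) \<le> C_gen z" for x
 proof -
  have "norm (\<phi> x) \<le> K * (1 + norm z) + K * (1 + norm z)" unfolding \<phi>_def tr2_gen
   by (rule norm_triangle_le_diff[OF add_mono[OF entry_bound entry_bound]])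
  also have "\<dots> \<le> C_gen z" using K_nonneg by (simp add: C_gen_def)
  finally show ?thesis .
 qed
 have atoms: "{x. mass {x} \<noteq> 0} \<in> sets borel"
 proof (rule sets.countable)
  have "{x. mass {x} \<noteq> 0} \<subseteq> {x \<in> dom. mass {x} \<noteq> 0}"
  proof
   fix x assume x: "x \<in> {x. mass {x} \<noteq> 0}"
   have "x \<in> ivl \<beta>"
   proof (rule ccontr)
    assume "x \<notin> ivl \<beta>"
    then have "emeasure \<nu> {x} \<le> emeasure \<nu> (- ivl \<beta>)" by (intro emeasure_mono) auto
    then show False using x by (simp add: null_outside measure_def)
   qed
   then show "x \<in> {x \<in> dom. mass {x} \<noteq> 0}" using x ivl_eq_dom by auto
  qed
  then show "countable {x. mass {x} \<noteq> 0}" by (rule countable_subset[OF _ countable_atoms])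
 qed simp
 then have noatoms [measurable]: "{x. mass {x} = 0} \<in> sets borel"
  using borel_comp[OF atoms] by (simp add: Collect_neg_eq[symmetric])
 have pred: "{x \<in> space borel. mass {x} = 0} \<in> sets borel" using noatoms by simp
 have \<psi>m [measurable]: "\<psi> \<in> Borel" unfolding \<psi>_def \<phi>_def[symmetric]
  by (rule measurable_If[OF \<phi>m borel_measurable_const pred])
 have \<psi>m' [measurable]: "(\<lambda>x. - \<psi> x) \<in> Borel" by measurable
 have \<psi>b: "norm (- \<psi> x) \<le> C_gen z" for x using \<phi>b[of x] C_gen_nonneg[of z] by (simp add: \<psi>_def \<phi>_def)
 have \<psi>0: "- \<psi> x = 0" if "mass {x} \<noteq> 0" for x using that by (simp add: \<psi>_def)
 define g where "g t = (LINT x:{0..<t}|\<nu>. - \<psi> x)" for t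
 have gneg: "g t = - (LINT x:{0..<t}|\<nu>. \<psi> x)" for t by (simp add: g_def set_lebesgue_integral_def)
 define D where "D t = det2 (left_lim z u t) (left_lim z v t)" for t
 define d where "d x = det2 (u x) (v x)" for x
 define C where "C t = exp (g t)" for t
 define X where "X t = D t * C t" for t
 have us: "sol z 0 t u" and vs: "sol z 0 t v" if "t \<in> dom" for t using u v that by (auto simp: gsol_def)
 note [measurable] = gsol_meas[OF u] gsol_meas[OF v]
 have dm [measurable]: "d \<in> Borel" unfolding d_def det2_def by measurable
 obtain Bu where Bu: "\<And>x. x \<in> {0..c} \<Longrightarrow> norm (u x) \<le> Bu" using sol_gen_bounded[OF us[OF c]] by metis
 obtain Bv where Bv: "\<And>x. x \<in> {0..c} \<Longrightarrow> norm (v x) \<le> Bv" using sol_gen_bounded[OF vs[OF c]] by metis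
 define Bd where "Bd = 2 * (\<bar>Bu\<bar> * \<bar>Bv\<bar>)"
 have db: "norm (d x) \<le> Bd" if x: "x \<in> {0..c}" for x
 proof -
  have n: "norm (u x $ i) \<le> \<bar>Bu\<bar>" "norm (v x $ i) \<le> \<bar>Bv\<bar>" for i
   using component_norm_le[of "u x" i] component_norm_le[of "v x" i] Bu[OF x] Bv[OF x] by linarith+
  have "norm (d x) \<le> \<bar>Bu\<bar> * \<bar>Bv\<bar> + \<bar>Bu\<bar> * \<bar>Bv\<bar>" unfolding d_def det2_def
   by (rule norm_triangle_le_diff, unfold norm_mult, intro add_mono mult_mono n) auto
  then show ?thesis by (simp add: Bd_def)
 qed
 have Bd0: "0 \<le> Bd" by (simp add: Bd_def)
 have sub: "t \<in> dom" if "t \<in> {0..c}" for t using dom_down[OF c] that by auto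
 have D_eq: "D t = det2 (u 0) (v 0) + (LINT x:{0..<t}|\<nu>. \<phi> x * d x)" if "t \<in> {0..c}" for t
  unfolding D_def d_def \<phi>_def using det_identity[OF us vs] sub[OF that] by blast
 define M where "M = mass {0..c}"
 have M0: "0 \<le> M" by (simp add: M_def)
 have gb: "norm (g x) \<le> C_gen z * M" if "x \<in> {0..c}" for x
  using exp_primitive(3)[OF \<psi>m' \<psi>b \<psi>0 c that] C_gen_nonneg[of z] by (simp add: g_def M_def)
 have gm [measurable]: "g \<in> Borel" unfolding g_def by (rule exp_primitive(2)[OF \<psi>m' \<psi>b \<psi>0 c])
 have Cm [measurable]: "C \<in> Borel" unfolding C_def by measurable
 define BC where "BC = exp (C_gen z * M)"
 have Cb: "norm (C x) \<le> BC" "1 / BC \<le> norm (C x)" if "x \<in> {0..c}" for x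
 proof -
  have "\<bar>Re (g x)\<bar> \<le> C_gen z * M" using abs_Re_le_cmod[of "g x"] gb[OF that] by linarith
  then have "Re (g x) \<le> C_gen z * M" "- (C_gen z * M) \<le> Re (g x)" by auto
  then show "norm (C x) \<le> BC" "1 / BC \<le> norm (C x)" by (simp_all add: C_def BC_def exp_minus[symmetric] divide_inverse)
 qed
 have BC0: "0 < BC" by (simp add: BC_def)
 let ?a = "\<lambda>x. \<phi> x * d x" and ?b = "\<lambda>x. - \<psi> x * C x"
 have am: "?a \<in> Borel" and bm: "?b \<in> Borel" by measurable
 have ab: "norm (?a x) \<le> C_gen z * Bd" and bb: "norm (?b x) \<le> C_gen z * BC" if "x \<in> {0..c}" for x
 proof -
  show "norm (?a x) \<le> C_gen z * Bd" unfolding norm_mult using \<phi>b db[OF that] C_gen_nonneg by (intro mult_mono) auto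
  show "norm (?b x) \<le> C_gen z * BC" unfolding norm_mult using \<psi>b[of x] Cb(1)[OF that] C_gen_nonneg by (intro mult_mono) auto
 qed
 \<comment> \<open>the density of X, which lives on atoms\<close>
 define a where "a x = (if mass {x} = 0 then 0 else \<phi> x * d x * C x)" for x
 have "(\<lambda>x. \<phi> x * d x * C x) \<in> Borel" by measurable
 then have ameas [measurable]: "a \<in> Borel" unfolding a_def
  by (rule measurable_If[OF borel_measurable_const _ pred])
 define Ba where "Ba = C_gen z * Bd * BC"
 have Ba0: "0 \<le> Ba" using C_gen_nonneg Bd0 BC0 by (simp add: Ba_def)
 have abound: "norm (a x) \<le> Ba" if "x \<in> {0..c}" for x
 proof (cases "mass {x} = 0")
  case False
  have "norm (\<phi> x * d x * C x) \<le> C_gen z * Bd * BC"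
   using ab[OF that] Cb(1)[OF that] C_gen_nonneg Bd0 unfolding norm_mult[of _ "C x"] by (intro mult_mono) auto
  then show ?thesis using False by (simp add: a_def Ba_def)
 qed (use Ba0 in \<open>simp add: a_def\<close>)
 have X_eq: "X t = det2 (u 0) (v 0) + (LINT x:{0..<t}|\<nu>. a x)" if t: "t \<in> {0..c}" for t
 proof -
  have td: "t \<in> dom" by (rule sub[OF t])
  have C_eq: "C s = 1 + (LINT x:{0..<s}|\<nu>. ?b x)" if "s \<in> {0..c}" for s
   unfolding C_def g_def by (rule exp_primitive(1)[OF \<psi>m' \<psi>b \<psi>0 sub[OF that]])
  have "(det2 (u 0) (v 0) + (LINT x:{0..<t}|\<nu>. ?a x)) * (1 + (LINT x:{0..<t}|\<nu>. ?b x)) =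
   det2 (u 0) (v 0) * 1 + (LINT x:{0..<t}|\<nu>. ?a x * C x + (det2 (u 0) (v 0) + hint ?a 0 x) * ?b x)"
  proof (rule balanced_product_rule[OF td am _ bm])
   show "norm (?a x) \<le> C_gen z * Bd" if "x \<in> {0..t}" for x using ab t that by auto
   show "norm (?b x) \<le> C_gen z * BC" if "x \<in> {0..t}" for x using bb t that by auto
   show "C x = 1 + hint ?b 0 x" if "x \<in> {0..<t}" for x
   proof -
    have x: "x \<in> {0..c}" using that t by auto
    show ?thesis using C_eq[OF x] exp_primitive(4)[OF \<psi>m' \<psi>b \<psi>0 c Cm Cb(1) x] by simp
   qed
  qed simp
  moreover have pw: "?a x * C x + (det2 (u 0) (v 0) + hint ?a 0 x) * ?b x = a x" if x: "x \<in> {0..<t}" for x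
  proof (cases "mass {x} = 0")
   case True
   have xc: "x \<in> {0..c}" and xd: "x \<in> dom" using x t sub by auto
   have "{0..x} = {0..<x} \<union> {x}" using x by auto
   moreover have "set_integrable \<nu> {0..<x} ?a" "set_integrable \<nu> {x} ?a"
    using ab xc x by (auto intro!: set_integrableI_bounded[OF am _ _ c, where B="C_gen z * Bd"])
   ultimately have "(LINT y:{0..x}|\<nu>. ?a y) = (LINT y:{0..<x}|\<nu>. ?a y)"
    using set_integral_Un[of "{0..<x}" "{x}" \<nu> ?a] by (simp add: set_integral_point[OF xd] True del: Un_insert_right)
   then have "hint ?a 0 x = (LINT y:{0..<x}|\<nu>. ?a y)" by (subst hint_from_zero[OF am]) simp
   then have "det2 (u 0) (v 0) + hint ?a 0 x = D x" using D_eq[OF xc] by simp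
   also have "D x = d x" using left_lim_no_atom[OF us[OF xd] xd True] left_lim_no_atom[OF vs[OF xd] xd True] by (simp add: D_def d_def)
   finally show ?thesis using True by (simp add: a_def \<psi>_def \<phi>_def)
  qed (simp add: a_def \<psi>_def \<phi>_def)
  moreover have "(LINT x:{0..<t}|\<nu>. ?a x * C x + (det2 (u 0) (v 0) + hint ?a 0 x) * ?b x) = (LINT x:{0..<t}|\<nu>. a x)"
   using pw by (intro set_lebesgue_integral_cong) auto
  ultimately show ?thesis unfolding X_def D_eq[OF t] C_eq[OF t] by simp
 qed
 define r where "r y = det (jump_minus z y) / det (jump_plus z y)" for y
 have jump: "of_real (mass {y}) * a y = (r y - 1) * X y" if y: "y \<in> {0..c}" for y
 proof -
  have yd: "y \<in> dom" by (rule sub[OF y])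
  have Dd: "D y = det (jump_plus z y) * d y" unfolding D_def d_def by (rule sol_det_jump[OF us[OF yd] vs[OF yd] yd])
  have "(r y - 1) * X y = (det (jump_minus z y) - det (jump_plus z y)) * d y * C y"
   unfolding X_def Dd r_def using nz[OF yd] by (simp add: field_simps)
  also have "\<dots> = of_real (mass {y}) * \<phi> y * d y * C y" unfolding jump_dets(2) \<phi>_def ..
  also have "\<dots> = of_real (mass {y}) * a y" by (simp add: a_def)
  finally show ?thesis by simp
 qed
 have Xlow: "m / BC \<le> norm (X y)" if y: "y \<in> {0..c}" for y
 proof -
  have "m * (1 / BC) \<le> norm (D y) * norm (C y)" using lower(2)[OF y] lower(1) Cb(2)[OF y] BC0 unfolding D_def by (intro mult_mono) auto
  then show ?thesis by (simp add: X_def norm_mult)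
 qed
 define k where "k = Ba * BC / m"
 have k0: "0 \<le> k" using Ba0 BC0 lower(1) by (simp add: k_def)
 have rb: "norm (r y - 1) \<le> k * mass {y}" if y: "y \<in> {0..c}" for y
 proof -
  have "norm (r y - 1) * (m / BC) \<le> norm (r y - 1) * norm (X y)" using Xlow[OF y] by (intro mult_left_mono) auto
  also have "\<dots> = mass {y} * norm (a y)" unfolding norm_mult[symmetric] jump[OF y, symmetric] by (simp add: norm_mult)
  also have "\<dots> \<le> mass {y} * Ba" using abound[OF y] by (intro mult_left_mono) auto
  finally show ?thesis using lower(1) BC0 by (simp add: k_def field_simps)
 qed
 have Sc: "S \<subseteq> {0..c}" using S(1) by auto
 have Smeas: "E \<in> sets borel" if "E \<subseteq> S" for E
  using countable_subset[OF that S(2)] by (rule sets.countable[rotated]) simp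
 have aS: "(LINT x:{0..<t}|\<nu>. a x) = (LINT x:(S \<inter> {0..<t})|\<nu>. a x)" if t: "t \<in> {0..c}" for t
  unfolding set_lebesgue_integral_def
 proof (intro integral_cong_AE)
  have "AE y in \<nu>. y \<noteq> 0" using nu_zero by (intro AE_I[where N="{0}"]) auto
  then show "AE x in \<nu>. indicat_real {0..<t} x *\<^sub>R a x = indicat_real (S \<inter> {0..<t}) x *\<^sub>R a x"
  proof eventually_elim
   case (elim x)
   show ?case
   proof (cases "x \<in> {0..<t} \<and> x \<notin> S")
    case True
    then have "x \<in> {0<..<c}" using elim t by auto
    then have "of_real (mass {x}) * tr2 (A z x) = 0" using S(3) True by blast
    then have "a x = 0" by (auto simp: a_def \<phi>_def)
    then show ?thesis by simp
   qed (auto simp: indicator_def)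
  qed
 qed (use Smeas[OF order_refl] in measurable)
 have est: "norm (X c - det2 (u 0) (v 0) * (\<Prod>y\<in>F. r y)) \<le> (Ba * mass (S - F)) * exp (k * M)" if F: "finite F" "F \<subseteq> S" for F
 proof -
  define \<eta> where "\<eta> = Ba * mass (S - F)"
  have \<eta>0: "0 \<le> \<eta>" using Ba0 by (simp add: \<eta>_def)
  have cc: "c \<in> {0..c}" using domD(1)[OF c] by simp
  have Fc: "F \<subseteq> {0..c}" using F Sc by auto
  \<comment> \<open>the function with the same jump factors on F and no others\<close>
  define Y where "Y t = det2 (u 0) (v 0) * (\<Prod>y\<in>{y\<in>F. y < t}. r y)" for t
  have Y_eq: "Y t = det2 (u 0) (v 0) + (\<Sum>y\<in>{y\<in>F. y < t}. (r y - 1) * Y y)" for t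
  proof -
   let ?G = "{y\<in>F. y < t}"
   have "(\<Prod>y\<in>?G. 1 + (r y - 1)) = 1 + (\<Sum>y\<in>?G. (r y - 1) * (\<Prod>x\<in>{x\<in>?G. x < y}. 1 + (r x - 1)))"
    using F(1) by (intro prod_expansion) auto
   moreover have "(\<Sum>y\<in>?G. (r y - 1) * (\<Prod>x\<in>{x\<in>?G. x < y}. 1 + (r x - 1))) = (\<Sum>y\<in>?G. (r y - 1) * (\<Prod>x\<in>{x\<in>F. x < y}. r x))"
   proof (intro sum.cong refl)
    fix y assume "y \<in> ?G"
    then have st: "{x\<in>?G. x < y} = {x\<in>F. x < y}" by auto
    show "(r y - 1) * (\<Prod>x\<in>{x\<in>?G. x < y}. 1 + (r x - 1)) = (r y - 1) * (\<Prod>x\<in>{x\<in>F. x < y}. r x)"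
     unfolding st by simp
   qed
   ultimately have "(\<Prod>y\<in>?G. r y) = 1 + (\<Sum>y\<in>?G. (r y - 1) * (\<Prod>x\<in>{x\<in>F. x < y}. r x))"
    by simp
   then show ?thesis by (simp add: Y_def distrib_left sum_distrib_left algebra_simps)
  qed
  have X_F: "norm (X t - (det2 (u 0) (v 0) + (\<Sum>y\<in>{y\<in>F. y < t}. (r y - 1) * X y))) \<le> \<eta>" if t: "t \<in> {0..c}" for t
  proof -
   let ?F = "{y\<in>F. y < t}" and ?R = "(S - F) \<inter> {0..<t}"
   have si: "set_integrable \<nu> E a" if "E \<subseteq> S" for E
    using that Sc abound Smeas[OF that] by (intro set_integrableI_bounded[OF ameas _ _ c, where B=Ba]) auto
   have "S \<inter> {0..<t} = ?F \<union> ?R" using F Fc by auto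
   moreover have "set_integrable \<nu> ?F a" "set_integrable \<nu> ?R a" using F by (auto intro!: si)
   ultimately have "(LINT x:(S \<inter> {0..<t})|\<nu>. a x) = (LINT x:?F|\<nu>. a x) + (LINT x:?R|\<nu>. a x)"
    using set_integral_Un[of ?F ?R \<nu> a] by auto
   also have "(LINT x:?F|\<nu>. a x) = (\<Sum>y\<in>?F. of_real (mass {y}) * a y)"
    using F Fc by (intro set_integral_finite_set[OF _ _ c]) auto
   also have "\<dots> = (\<Sum>y\<in>?F. (r y - 1) * X y)" using jump Fc by (intro sum.cong) auto
   finally have "X t - (det2 (u 0) (v 0) + (\<Sum>y\<in>{y\<in>F. y < t}. (r y - 1) * X y)) = (LINT x:?R|\<nu>. a x)"
    using X_eq[OF t] aS[OF t] by simp
   moreover have "norm (LINT x:?R|\<nu>. a x) \<le> Ba * mass ?R"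
    using Sc abound Smeas[of ?R] by (intro set_integral_norm_le[OF ameas _ _ c]) auto
   moreover have "Ba * mass ?R \<le> \<eta>" unfolding \<eta>_def
    using Ba0 Smeas[of ?R] Smeas[of "S - F"] emeasure_finite[of "S - F" c] Sc c
    by (intro mult_left_mono measure_mono_fmeasurable fmeasurableI) force+
   ultimately show ?thesis by simp
  qed
  have "norm (X c - Y c) \<le> \<eta> * (\<Prod>y\<in>{y\<in>F. y < c}. 1 + norm (r y - 1))"
  proof (rule discrete_gronwall[OF F(1) \<eta>0, where e="\<lambda>t. norm (X t - Y t)" and \<rho>="\<lambda>y. norm (r y - 1)"])
   fix t assume "t \<in> insert c F"
   then have t: "t \<in> {0..c}" using cc Fc by auto
   let ?F = "{y\<in>F. y < t}"
   have "X t - Y t = (X t - (det2 (u 0) (v 0) + (\<Sum>y\<in>?F. (r y - 1) * X y))) + (\<Sum>y\<in>?F. (r y - 1) * (X y - Y y))"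
    by (subst Y_eq) (simp add: right_diff_distrib sum_subtractf)
   also have "norm \<dots> \<le> \<eta> + (\<Sum>y\<in>?F. norm (r y - 1) * norm (X y - Y y))"
    by (rule norm_triangle_mono[OF X_F[OF t]]) (rule order_trans[OF norm_sum], simp add: norm_mult)
   finally show "norm (X t - Y t) \<le> \<eta> + (\<Sum>y\<in>?F. norm (r y - 1) * norm (X y - Y y))" .
  qed simp
  also have "{y\<in>F. y < c} = F" using F(2) S(1) by auto
  also have "(\<Prod>y\<in>F. 1 + norm (r y - 1)) \<le> (\<Prod>y\<in>F. exp (k * mass {y}))"
  proof (intro prod_mono conjI)
   fix y assume "y \<in> F"
   then have "norm (r y - 1) \<le> k * mass {y}" using Fc by (intro rb) auto
   then show "1 + norm (r y - 1) \<le> exp (k * mass {y})" using exp_ge_add_one_self[of "k * mass {y}"] by linarith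
  qed simp
  also have "\<dots> = exp (k * (\<Sum>y\<in>F. mass {y}))" by (simp add: exp_sum[OF F(1)] sum_distrib_left)
  also have "\<dots> \<le> exp (k * M)"
  proof -
   have "(\<Sum>y\<in>F. mass {y}) = mass F"
   proof (rule measure_eq_sum_singleton[OF F(1), symmetric])
    show "emeasure \<nu> {x} \<noteq> \<infinity>" if "x \<in> F" for x using emeasure_finite[of "{x}" c] that Fc c by auto
   qed simp
   also have "\<dots> \<le> M" unfolding M_def using Fc emeasure_finite[of "{0..c}" c] c Smeas[OF F(2)] by (intro measure_mono_fmeasurable fmeasurableI) auto
   finally show ?thesis using k0 by (simp add: mult_left_mono)
  qed
  finally have "norm (X c - Y c) \<le> \<eta> * exp (k * M)" using \<eta>0 by (simp add: mult_left_mono)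
  moreover have "Y c = det2 (u 0) (v 0) * (\<Prod>y\<in>F. r y)"
  proof -
   have "{y\<in>F. y < c} = F" using F(2) S(1) by auto
   then show ?thesis by (simp add: Y_def)
  qed
  ultimately show ?thesis by (simp add: \<eta>_def)
 qed
 have "((\<lambda>F. det2 (u 0) (v 0) * (\<Prod>y\<in>F. r y)) \<longlongrightarrow> X c) (finite_subsets_at_top S)"
 proof (rule LIM_zero_cancel, rule Lim_null_comparison)
  show "\<forall>\<^sub>F F in finite_subsets_at_top S. norm (det2 (u 0) (v 0) * (\<Prod>y\<in>F. r y) - X c) \<le> (Ba * mass (S - F)) * exp (k * M)"
   by (rule eventually_finite_subsets_at_top_weakI) (use est in \<open>simp add: norm_minus_commute\<close>)
  show "((\<lambda>F. (Ba * mass (S - F)) * exp (k * M)) \<longlongrightarrow> 0) (finite_subsets_at_top S)"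
   by (intro tendsto_mult_left_zero tendsto_mult_right_zero atoms_tail[OF S(2) Sc c])
 qed
 then show ?thesis by (simp add: X_def D_def C_def gneg r_def)
qed

end

section \<open>The Jordan decomposition of local measures\<close>

definition countably_additive_on :: "real set \<Rightarrow> (real set \<Rightarrow> real) \<Rightarrow> bool" where
 "countably_additive_on S \<rho> \<longleftrightarrow>
   (\<forall>A :: nat \<Rightarrow> real set. (\<forall>n. A n \<in> sets borel \<and> A n \<subseteq> S) \<longrightarrow> disjoint_family A \<longrightarrow>
    (\<lambda>n. \<rho> (A n)) sums \<rho> (\<Union>n. A n))"

lemma countably_additive_onD:
 fixes A :: "nat \<Rightarrow> real set"
 assumes "countably_additive_on S \<rho>" "\<And>n. A n \<in> sets borel" "\<And>n. A n \<subseteq> S" "disjoint_family A"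
 shows "(\<lambda>n. \<rho> (A n)) sums \<rho> (\<Union>n. A n)"
 using assms unfolding countably_additive_on_def by blast

lemma complex_measure_on_parts:
 assumes "complex_measure_on S \<mu>"
 shows "countably_additive_on S (\<lambda>E. Re (\<mu> E))" "countably_additive_on S (\<lambda>E. Im (\<mu> E))"
proof -
 have *: "(\<lambda>n. \<mu> (A n)) sums \<mu> (\<Union>n. A n)" if "\<forall>n. A n \<in> sets borel \<and> A n \<subseteq> S" "disjoint_family A" for A :: "nat \<Rightarrow> real set"
  using assms that unfolding complex_measure_on_def by blast
 show "countably_additive_on S (\<lambda>E. Re (\<mu> E))" unfolding countably_additive_on_def
  by (intro allI impI sums_Re; rule *)
 show "countably_additive_on S (\<lambda>E. Im (\<mu> E))" unfolding countably_additive_on_def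
  by (intro allI impI sums_Im; rule *)
qed

lemma countably_additive_on_uminus:
 "countably_additive_on S \<rho> \<Longrightarrow> countably_additive_on S (\<lambda>E. - \<rho> E)"
 unfolding countably_additive_on_def by (intro allI impI sums_minus) blast

lemma countably_additive_on_subset:
 "countably_additive_on S \<rho> \<Longrightarrow> T \<subseteq> S \<Longrightarrow> countably_additive_on T \<rho>"
 unfolding countably_additive_on_def by (meson order_trans)

lemma ca_empty:
 assumes "countably_additive_on S \<rho>"
 shows "\<rho> {} = 0"
proof -
 have "(\<lambda>n::nat. \<rho> {}) sums \<rho> (\<Union>n::nat. {})"
  by (rule countably_additive_onD[OF assms]) (auto simp: disjoint_family_on_def)
 then have "summable (\<lambda>n::nat. \<rho> {})" by (rule sums_summable)
 then show ?thesis by (rule summable_const_iff[THEN iffD1])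
qed

lemma ca_union:
 assumes ca: "countably_additive_on S \<rho>" and E: "E \<in> sets borel" "E \<subseteq> S" and F: "F \<in> sets borel" "F \<subseteq> S" and disj: "E \<inter> F = {}"
 shows "\<rho> (E \<union> F) = \<rho> E + \<rho> F"
proof -
 have "(\<lambda>n. \<rho> (binaryset E F n)) sums \<rho> (\<Union>n. binaryset E F n)"
 proof (rule countably_additive_onD[OF ca])
  show "disjoint_family (binaryset E F)" using disj by (auto simp: disjoint_family_on_def binaryset_def)
 qed (use E F in \<open>auto simp: binaryset_def split: if_splits\<close>)
 moreover have "(\<lambda>n. \<rho> (binaryset E F n)) sums (\<rho> E + \<rho> F)" by (rule binaryset_sums[of \<rho>, OF ca_empty[OF ca]])
 ultimately show ?thesis using sums_unique2 by (metis UN_binaryset_eq)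
qed

lemma ca_diff:
 assumes ca: "countably_additive_on S \<rho>" and E: "E \<in> sets borel" "E \<subseteq> S" and F: "F \<in> sets borel" "F \<subseteq> E"
 shows "\<rho> (E - F) = \<rho> E - \<rho> F"
proof -
 have "\<rho> ((E - F) \<union> F) = \<rho> (E - F) + \<rho> F" using E F by (intro ca_union[OF ca]) auto
 moreover have "(E - F) \<union> F = E" using F by auto
 ultimately show ?thesis by simp
qed

text \<open>Otherwise repeated bisection, each time keeping a part on which the values are unbounded, yields a decreasing
sequence of sets whose differences are disjoint and have values bounded away from 0, contradicting convergence of their sum.\<close>
lemma ca_bounded:
 assumes ca: "countably_additive_on S \<rho>" and S: "S \<in> sets borel"
 shows "\<exists>M. \<forall>F. F \<in> sets borel \<longrightarrow> F \<subseteq> S \<longrightarrow> \<bar>\<rho> F\<bar> \<le> M"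
proof (rule ccontr)
 define bad where "bad X \<longleftrightarrow> X \<in> sets borel \<and> X \<subseteq> S \<and> (\<forall>M. \<exists>F. F \<in> sets borel \<and> F \<subseteq> X \<and> M < \<bar>\<rho> F\<bar>)" for X
 assume "\<not> ?thesis"
 then have S0: "bad S" using S by (auto simp: bad_def not_le)
 have step: "\<exists>Y. bad Y \<and> Y \<subseteq> X \<and> 1 \<le> \<bar>\<rho> (X - Y)\<bar>" if X: "bad X" for X
 proof -
  obtain F where F: "F \<in> sets borel" "F \<subseteq> X" "\<bar>\<rho> X\<bar> + 1 < \<bar>\<rho> F\<bar>" using X unfolding bad_def by blast
  have Xs: "X \<in> sets borel" "X \<subseteq> S" using X by (auto simp: bad_def)
  have d: "\<rho> (X - F) = \<rho> X - \<rho> F" by (rule ca_diff[OF ca Xs F(1,2)])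
  have "bad F \<or> bad (X - F)"
  proof (rule ccontr)
   assume "\<not> (bad F \<or> bad (X - F))"
   moreover have "\<exists>M. \<forall>G. G \<in> sets borel \<longrightarrow> G \<subseteq> Y \<longrightarrow> \<bar>\<rho> G\<bar> \<le> M" if "\<not> bad Y" "Y \<in> sets borel" "Y \<subseteq> S" for Y
    using that unfolding bad_def by (meson not_less)
   moreover have "F \<subseteq> S" "X - F \<subseteq> S" "X - F \<in> sets borel" using F Xs by auto
   ultimately obtain M N where MN: "\<And>G. G \<in> sets borel \<Longrightarrow> G \<subseteq> F \<Longrightarrow> \<bar>\<rho> G\<bar> \<le> M" "\<And>G. G \<in> sets borel \<Longrightarrow> G \<subseteq> X - F \<Longrightarrow> \<bar>\<rho> G\<bar> \<le> N"
    using F(1) by metis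
   obtain G where G: "G \<in> sets borel" "G \<subseteq> X" "M + N < \<bar>\<rho> G\<bar>" using X unfolding bad_def by blast
   have "\<rho> ((G \<inter> F) \<union> (G - F)) = \<rho> (G \<inter> F) + \<rho> (G - F)"
    using G F Xs by (intro ca_union[OF ca]) auto
   moreover have "(G \<inter> F) \<union> (G - F) = G" by auto
   ultimately have "\<rho> G = \<rho> (G \<inter> F) + \<rho> (G - F)" by (simp only:)
   moreover have "\<bar>\<rho> (G \<inter> F)\<bar> \<le> M" using G F by (intro MN) auto
   moreover have "\<bar>\<rho> (G - F)\<bar> \<le> N" using G F by (intro MN) auto
   ultimately show False using G(3) by linarith
  qed
  then show ?thesis
  proof
   assume "bad F"
   then show ?thesis using F d by (intro exI[of _ F]) linarith
  next
   assume "bad (X - F)"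
   moreover have "X - (X - F) = F" using F by auto
   ultimately show ?thesis using F by (intro exI[of _ "X - F"]) auto
  qed
 qed
 have "\<exists>X. \<forall>n::nat. bad (X n) \<and> (X (Suc n) \<subseteq> X n \<and> 1 \<le> \<bar>\<rho> (X n - X (Suc n))\<bar>)"
 proof (rule dependent_nat_choice)
  show "\<exists>x. bad x" using S0 by blast
  show "\<exists>y. bad y \<and> y \<subseteq> x \<and> 1 \<le> \<bar>\<rho> (x - y)\<bar>" if "bad x" for x n using step[OF that] .
 qed
 then obtain X where X: "\<And>n::nat. bad (X n)" "\<And>n. X (Suc n) \<subseteq> X n" "\<And>n. 1 \<le> \<bar>\<rho> (X n - X (Suc n))\<bar>" by blast
 have dec: "X n \<subseteq> X m" if "m \<le> n" for m n using that X(2) by (metis lift_Suc_antimono_le)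
 have disj: "disjoint_family (\<lambda>n. X n - X (Suc n))"
 proof (unfold disjoint_family_on_def, intro ballI impI)
  fix m n :: nat assume "m \<noteq> n"
  then consider "Suc m \<le> n" | "Suc n \<le> m" by linarith
  then show "(X m - X (Suc m)) \<inter> (X n - X (Suc n)) = {}"
   using dec[of "Suc m" n] dec[of "Suc n" m] by cases auto
 qed
 have "(\<lambda>n. \<rho> (X n - X (Suc n))) sums \<rho> (\<Union>n. X n - X (Suc n))"
  by (rule countably_additive_onD[OF ca _ _ disj]) (use X(1) in \<open>auto simp: bad_def\<close>)
 then have "(\<lambda>n. \<rho> (X n - X (Suc n))) \<longlonglongrightarrow> 0" using sums_summable summable_LIMSEQ_zero by blast
 then have "\<forall>\<^sub>F n in sequentially. \<bar>\<rho> (X n - X (Suc n))\<bar> < 1" by (auto simp: tendsto_iff dist_real_def)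
 then obtain n where "\<bar>\<rho> (X n - X (Suc n))\<bar> < 1" by (auto simp: eventually_sequentially)
 then show False using X(3)[of n] by simp
qed

definition real_local_measure :: "ereal \<Rightarrow> (real set \<Rightarrow> real) \<Rightarrow> bool" where
 "real_local_measure b \<rho> \<longleftrightarrow> (\<forall>K. compact K \<longrightarrow> K \<subseteq> ivl b \<longrightarrow> countably_additive_on K \<rho>)"

lemma real_local_measure_uminus: "real_local_measure b \<rho> \<Longrightarrow> real_local_measure b (\<lambda>E. - \<rho> E)"
 unfolding real_local_measure_def using countably_additive_on_uminus by blast

lemma local_measure_parts:
 assumes "local_measure b \<mu>"
 shows "real_local_measure b (\<lambda>E. Re (\<mu> E))" "real_local_measure b (\<lambda>E. Im (\<mu> E))"
 using assms unfolding local_measure_def real_local_measure_def by (auto intro: complex_measure_on_parts)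

lemma bounded_borel_sets: "E \<in> bounded_borel b \<Longrightarrow> E \<in> sets borel"
 by (simp add: bounded_borel_def)

lemma bounded_borel_ivl: "E \<in> bounded_borel b \<Longrightarrow> E \<subseteq> ivl b"
 by (auto simp: bounded_borel_def)

lemma bounded_borel_subset: "E \<in> bounded_borel b \<Longrightarrow> F \<in> sets borel \<Longrightarrow> F \<subseteq> E \<Longrightarrow> F \<in> bounded_borel b"
 by (auto simp: bounded_borel_def)

lemma bounded_borel_empty [simp]: "{} \<in> bounded_borel b"
 by (auto simp: bounded_borel_def intro!: exI[of _ "{}"])

lemma bounded_borel_Un: 
 assumes "E \<in> bounded_borel b" "F \<in> bounded_borel b"
 shows "E \<union> F \<in> bounded_borel b"
proof -
 obtain K L where "compact K" "K \<subseteq> ivl b" "E \<subseteq> K" "compact L" "L \<subseteq> ivl b" "F \<subseteq> L" "E \<in> sets borel" "F \<in> sets borel"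
  using assms by (auto simp: bounded_borel_def)
 then show ?thesis unfolding bounded_borel_def
  by (intro CollectI conjI exI[of _ "K \<union> L"] compact_Un) auto
qed

lemma rlm_ca:
 assumes "real_local_measure b \<rho>" "E \<in> bounded_borel b"
 shows "countably_additive_on E \<rho>"
 using assms unfolding real_local_measure_def bounded_borel_def
 by (auto intro: countably_additive_on_subset)

text \<open>The set function underlying \<open>pos_part\<close>.\<close>
definition pos_value :: "ereal \<Rightarrow> (real set \<Rightarrow> real) \<Rightarrow> real set \<Rightarrow> ennreal" where
 "pos_value b \<rho> E = (SUP F \<in> {F \<in> bounded_borel b. F \<subseteq> E}. ennreal (\<rho> F))"

lemma pos_value_upper: "F \<in> bounded_borel b \<Longrightarrow> F \<subseteq> E \<Longrightarrow> ennreal (\<rho> F) \<le> pos_value b \<rho> E"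
 unfolding pos_value_def by (intro SUP_upper) auto

lemma pos_value_mono: "E \<subseteq> E' \<Longrightarrow> pos_value b \<rho> E \<le> pos_value b \<rho> E'"
 unfolding pos_value_def by (intro SUP_subset_mono) auto

lemma pos_value_superadditive:
 assumes \<rho>: "real_local_measure b \<rho>" and disj: "E \<inter> E' = {}"
 shows "pos_value b \<rho> E + pos_value b \<rho> E' \<le> pos_value b \<rho> (E \<union> E')"
proof -
 let ?S = "\<lambda>E. {F \<in> bounded_borel b. F \<subseteq> E}"
 have *: "ennreal (\<rho> F) + ennreal (\<rho> F') \<le> pos_value b \<rho> (E \<union> E')"
  if F: "F \<in> ?S E" and F': "F' \<in> ?S E'" for F F'
 proof -
  consider "\<rho> F < 0" | "\<rho> F' < 0" | "0 \<le> \<rho> F" "0 \<le> \<rho> F'" by linarith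
  then show ?thesis
  proof cases
   case 1
   then show ?thesis using pos_value_upper[of F' b "E \<union> E'" \<rho>] F' by (auto simp: ennreal_neg)
  next
   case 2
   then show ?thesis using pos_value_upper[of F b "E \<union> E'" \<rho>] F by (auto simp: ennreal_neg)
  next
   case 3
   have bb: "F \<in> bounded_borel b" "F' \<in> bounded_borel b" using F F' by auto
   have "\<rho> (F \<union> F') = \<rho> F + \<rho> F'"
    using F F' disj bounded_borel_sets by (intro ca_union[OF rlm_ca[OF \<rho> bounded_borel_Un[OF bb]]]) auto
   then have "ennreal (\<rho> F) + ennreal (\<rho> F') = ennreal (\<rho> (F \<union> F'))" using 3 by simp
   also have "\<dots> \<le> pos_value b \<rho> (E \<union> E')" using bounded_borel_Un[OF bb] F F' by (intro pos_value_upper) auto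
   finally show ?thesis .
  qed
 qed
 have ne: "?S E \<noteq> {}" for E using bounded_borel_empty by blast
 have "pos_value b \<rho> E + pos_value b \<rho> E' = (SUP F\<in>?S E. ennreal (\<rho> F) + pos_value b \<rho> E')"
  unfolding pos_value_def[of b \<rho> E] by (rule ennreal_SUP_add_left[OF ne, symmetric])
 also have "\<dots> \<le> pos_value b \<rho> (E \<union> E')"
 proof (rule SUP_least)
  fix F assume F: "F \<in> ?S E"
  have "ennreal (\<rho> F) + pos_value b \<rho> E' = (SUP F'\<in>?S E'. ennreal (\<rho> F) + ennreal (\<rho> F'))"
   unfolding pos_value_def[of b \<rho> E'] by (rule ennreal_SUP_add_right[OF ne])
  also have "\<dots> \<le> pos_value b \<rho> (E \<union> E')" using * F by (intro SUP_least) auto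
  finally show "ennreal (\<rho> F) + pos_value b \<rho> E' \<le> pos_value b \<rho> (E \<union> E')" .
 qed
 finally show ?thesis .
qed

lemma sets_pos_part [simp]: "sets (pos_part b \<rho>) = sets borel"
 using sets.sigma_sets_eq[of "borel :: real measure"] by (simp add: pos_part_def)

text \<open>The supremum defining \<open>pos_part\<close> is countably additive, so that \<open>measure_of\<close> does not fall back on the null measure.\<close>
lemma emeasure_pos_part:
 assumes \<rho>: "real_local_measure b \<rho>" and E: "E \<in> sets borel"
 shows "emeasure (pos_part b \<rho>) E = pos_value b \<rho> E"
proof (rule emeasure_measure_of[OF pos_part_def[unfolded pos_value_def[symmetric]]])
 show "E \<in> sets (pos_part b \<rho>)" using E by simp
 have \<rho>0: "\<rho> {} = 0" by (rule ca_empty[OF rlm_ca[OF \<rho> bounded_borel_empty]])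
 have empty: "pos_value b \<rho> {} = 0"
  unfolding pos_value_def using \<rho>0 by (auto simp: bot_ennreal intro!: SUP_eq_const antisym)
 show "positive (sets (pos_part b \<rho>)) (pos_value b \<rho>)" using empty by (simp add: positive_def)
 show "countably_additive (sets (pos_part b \<rho>)) (pos_value b \<rho>)"
 proof (rule countably_additiveI)
  fix A :: "nat \<Rightarrow> real set" assume A: "range A \<subseteq> sets (pos_part b \<rho>)" "disjoint_family A" "(\<Union>i. A i) \<in> sets (pos_part b \<rho>)"
  have Am: "A n \<in> sets borel" for n using A(1) by auto
  show "(\<Sum>i. pos_value b \<rho> (A i)) = pos_value b \<rho> (\<Union>i. A i)"
  proof (rule antisym)
   have "(\<Sum>i<n. pos_value b \<rho> (A i)) \<le> pos_value b \<rho> (\<Union>i<n. A i)" for n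
   proof (induction n)
    case (Suc n)
    have "A i \<inter> A n = {}" if "i < n" for i using disjoint_family_onD[OF A(2), of i n] that by simp
    then have "(\<Union>i<n. A i) \<inter> A n = {}" by blast
    then have "pos_value b \<rho> (\<Union>i<n. A i) + pos_value b \<rho> (A n) \<le> pos_value b \<rho> ((\<Union>i<n. A i) \<union> A n)"
     by (rule pos_value_superadditive[OF \<rho>])
    moreover have "(\<Union>i<n. A i) \<union> A n = (\<Union>i<Suc n. A i)" by (auto simp: lessThan_Suc)
    ultimately have "pos_value b \<rho> (\<Union>i<n. A i) + pos_value b \<rho> (A n) \<le> pos_value b \<rho> (\<Union>i<Suc n. A i)" by (simp only:)
    then show ?case unfolding sum.lessThan_Suc by (rule order_trans[OF add_right_mono[OF Suc]])
   qed simp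
   then have "(\<Sum>i<n. pos_value b \<rho> (A i)) \<le> pos_value b \<rho> (\<Union>i. A i)" for n
    by (rule order_trans[OF _ pos_value_mono]) auto
   then show "(\<Sum>i. pos_value b \<rho> (A i)) \<le> pos_value b \<rho> (\<Union>i. A i)"
    by (intro suminf_le_const[OF summableI])
  next
   show "pos_value b \<rho> (\<Union>i. A i) \<le> (\<Sum>i. pos_value b \<rho> (A i))"
    unfolding pos_value_def[of b \<rho> "\<Union>i. A i"]
   proof (rule SUP_least)
    fix F assume "F \<in> {F \<in> bounded_borel b. F \<subseteq> (\<Union>i. A i)}"
    then have F: "F \<in> bounded_borel b" "F \<subseteq> (\<Union>i. A i)" by auto
    have FA: "F \<inter> A n \<in> bounded_borel b" for n
     by (rule bounded_borel_subset[OF F(1)]) (use bounded_borel_sets[OF F(1)] Am in auto)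
    have "(\<lambda>n. \<rho> (F \<inter> A n)) sums \<rho> (\<Union>n. F \<inter> A n)"
    proof (rule countably_additive_onD[OF rlm_ca[OF \<rho> F(1)]])
     show "disjoint_family (\<lambda>n. F \<inter> A n)"
      unfolding disjoint_family_on_def using disjoint_family_onD[OF A(2)] by blast
    qed (use bounded_borel_sets[OF F(1)] Am in auto)
    moreover have "(\<Union>n. F \<inter> A n) = F" using F(2) by auto
    ultimately have lim: "(\<lambda>n. \<Sum>i<n. \<rho> (F \<inter> A i)) \<longlonglongrightarrow> \<rho> F" by (simp add: sums_def)
    have le: "ennreal (\<Sum>i<n. \<rho> (F \<inter> A i)) \<le> (\<Sum>i. pos_value b \<rho> (A i))" for n
    proof -
     have "(\<Sum>i<n. \<rho> (F \<inter> A i)) \<le> (\<Sum>i<n. max 0 (\<rho> (F \<inter> A i)))" by (intro sum_mono) auto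
     then have "ennreal (\<Sum>i<n. \<rho> (F \<inter> A i)) \<le> ennreal (\<Sum>i<n. max 0 (\<rho> (F \<inter> A i)))" by (rule ennreal_leI)
     also have "\<dots> = (\<Sum>i<n. ennreal (max 0 (\<rho> (F \<inter> A i))))" by (rule sum_ennreal[symmetric]) auto
     also have "\<dots> = (\<Sum>i<n. ennreal (\<rho> (F \<inter> A i)))" by (simp add: ennreal_max_0)
     also have "\<dots> \<le> (\<Sum>i<n. pos_value b \<rho> (A i))" by (intro sum_mono pos_value_upper FA) auto
     also have "\<dots> \<le> (\<Sum>i. pos_value b \<rho> (A i))" by (intro sum_le_suminf summableI) auto
     finally show ?thesis .
    qed
    show "ennreal (\<rho> F) \<le> (\<Sum>i. pos_value b \<rho> (A i))"
     by (rule LIMSEQ_le_const2[OF tendsto_ennrealI[OF lim]]) (use le in auto)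
   qed
  qed
 qed
qed (auto simp: pos_part_def)

lemma pos_part_finite:
 assumes \<rho>: "real_local_measure b \<rho>" and ca: "countably_additive_on S \<rho>" and S: "S \<in> sets borel"
 shows "emeasure (pos_part b \<rho>) S < \<infinity>"
proof -
 obtain M where M: "\<And>F. F \<in> sets borel \<Longrightarrow> F \<subseteq> S \<Longrightarrow> \<bar>\<rho> F\<bar> \<le> M" using ca_bounded[OF ca S] by blast
 have "pos_value b \<rho> S \<le> ennreal M"
  unfolding pos_value_def
 proof (rule SUP_least)
  fix F assume "F \<in> {F \<in> bounded_borel b. F \<subseteq> S}"
  then show "ennreal (\<rho> F) \<le> ennreal M" using M[of F] bounded_borel_sets[of F b] by (intro ennreal_leI) auto
 qed
 then show ?thesis unfolding emeasure_pos_part[OF \<rho> S] by (simp add: le_less_trans)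
qed

text \<open>The Jordan decomposition from the suprema alone: \<open>\<rho> F\<close> is \<open>\<rho> E\<close> minus the value on the complement \<open>E -
F\<close>, so the supremum over \<open>F\<close> of \<open>- \<rho> F\<close> is the one of \<open>\<rho> (E - F)\<close> less \<open>\<rho>
E\<close>.\<close>
lemma jordan_bounded:
 assumes \<rho>: "real_local_measure b \<rho>" and E: "E \<in> bounded_borel b"
 shows "\<rho> E = measure (pos_part b \<rho>) E - measure (pos_part b (\<lambda>F. - \<rho> F)) E"
proof -
 let ?n = "\<lambda>F. - \<rho> F"
 note ca = rlm_ca[OF \<rho> E]
 note Es = bounded_borel_sets[OF E]
 note \<rho>' = real_local_measure_uminus[OF \<rho>]
 have fin: "pos_value b \<rho> E < \<infinity>" "pos_value b ?n E < \<infinity>"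
  using pos_part_finite[OF \<rho> ca Es] pos_part_finite[OF \<rho>' countably_additive_on_uminus[OF ca] Es]
  by (simp_all add: emeasure_pos_part[OF \<rho> Es] emeasure_pos_part[OF \<rho>' Es])
 define p n where "p = enn2real (pos_value b \<rho> E)" and "n = enn2real (pos_value b ?n E)"
 have p: "pos_value b \<rho> E = ennreal p" and n: "pos_value b ?n E = ennreal n" using fin by (simp_all add: p_def n_def less_top)
 have p0: "0 \<le> p" "0 \<le> n" by (simp_all add: p_def n_def)
 have sub: "F \<in> bounded_borel b" if "F \<in> sets borel" "F \<subseteq> E" for F using bounded_borel_subset[OF E that] .
 have le: "\<rho> F \<le> p" "- \<rho> F \<le> n" if "F \<in> sets borel" "F \<subseteq> E" for F
  using pos_value_upper[OF sub[OF that] that(2), of \<rho>] pos_value_upper[OF sub[OF that] that(2), of ?n] p0 unfolding p n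
  by (simp_all add: ennreal_le_iff)
 have "pos_value b \<rho> E \<le> ennreal (max 0 (\<rho> E + n))"
  unfolding pos_value_def
 proof (rule SUP_least)
  fix F assume "F \<in> {F \<in> bounded_borel b. F \<subseteq> E}"
  then have F: "F \<in> sets borel" "F \<subseteq> E" using bounded_borel_sets by auto
  have "\<rho> (E - F) = \<rho> E - \<rho> F" by (rule ca_diff[OF ca Es order_refl F])
  moreover have "- \<rho> (E - F) \<le> n" using F Es by (intro le) auto
  ultimately show "ennreal (\<rho> F) \<le> ennreal (max 0 (\<rho> E + n))" by (intro ennreal_leI) auto
 qed
 then have "p \<le> max 0 (\<rho> E + n)" unfolding p by (simp add: ennreal_le_iff)
 moreover have "0 \<le> \<rho> E + n" using le(2)[OF Es order_refl] by simp
 ultimately have 1: "p \<le> \<rho> E + n" by simp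
 have "pos_value b ?n E \<le> ennreal (max 0 (p - \<rho> E))"
  unfolding pos_value_def
 proof (rule SUP_least)
  fix F assume "F \<in> {F \<in> bounded_borel b. F \<subseteq> E}"
  then have F: "F \<in> sets borel" "F \<subseteq> E" using bounded_borel_sets by auto
  have "\<rho> (E - F) = \<rho> E - \<rho> F" by (rule ca_diff[OF ca Es order_refl F])
  moreover have "\<rho> (E - F) \<le> p" using F Es by (intro le) auto
  ultimately show "ennreal (- \<rho> F) \<le> ennreal (max 0 (p - \<rho> E))" by (intro ennreal_leI) auto
 qed
 then have "n \<le> max 0 (p - \<rho> E)" unfolding n by (simp add: ennreal_le_iff)
 moreover have "0 \<le> p - \<rho> E" using le(1)[OF Es order_refl] by simp
 ultimately have 2: "n \<le> p - \<rho> E" by simp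
 have "measure (pos_part b \<rho>) E = p" "measure (pos_part b ?n) E = n"
  unfolding measure_def emeasure_pos_part[OF \<rho> Es] emeasure_pos_part[OF \<rho>' Es] p_def n_def by simp_all
 then show ?thesis using 1 2 by simp
qed

text \<open>For a set that accumulates at 0 the positive part is a supremum over sets bounded away from 0. Slicing the set by
intervals shrinking to 0 reduces this to \<open>jordan_bounded\<close>, by countable additivity up to the regular endpoint.\<close>
lemma jordan:
 assumes \<rho>: "real_local_measure b \<rho>" and c: "c \<in> ivl b" and ca: "countably_additive_on {0<..<c} \<rho>"
  and E: "E \<in> sets borel" "E \<subseteq> {0<..<c}"
 shows "\<rho> E = measure (pos_part b \<rho>) E - measure (pos_part b (\<lambda>F. - \<rho> F)) E"
proof -
 have c0: "0 < c" using c by (simp add: ivl_def)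
 \<comment> \<open>slices bounded away from 0, with disjoint union E\<close>
 define X where "X n = E \<inter> {c / (real n + 2)<..c / (real n + 1)}" for n
 have Xm: "X n \<in> sets borel" for n using E(1) by (simp add: X_def)
 have XE: "X n \<subseteq> E" for n by (auto simp: X_def)
 have un: "(\<Union>n. X n) = E"
 proof (intro equalityI subsetI)
  fix x assume x: "x \<in> E"
  then have x0: "0 < x" "x < c" using E(2) by auto
  define m where "m = nat \<lfloor>c / x\<rfloor>"
  have "c / x \<ge> 1" using x0 by simp
  then have m: "real m \<le> c / x" "c / x < real m + 1" "m \<ge> 1" unfolding m_def by linarith+
  then obtain n where n: "m = Suc n" by (cases m) auto
  have "x \<in> X n" using m(1,2) x x0 unfolding X_def n by (simp add: field_simps)
  then show "x \<in> (\<Union>n. X n)" by blast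
 qed (use XE in auto)
 have disj: "disjoint_family X"
 proof (unfold disjoint_family_on_def, intro ballI impI)
  fix m n :: nat assume "m \<noteq> n"
  have *: "X m \<inter> X n = {}" if "m < n" for m n
  proof -
   have "c / (real n + 1) \<le> c / (real m + 2)" using that c0 by (intro divide_left_mono) auto
   then show ?thesis by (auto simp: X_def)
  qed
  show "X m \<inter> X n = {}" using \<open>m \<noteq> n\<close> *[of m n] *[of n m] by (cases "m < n") auto
 qed
 have bb: "X n \<in> bounded_borel b" for n
  unfolding bounded_borel_def
 proof (intro CollectI conjI exI[of _ "{c / (real n + 2)..c}"] Xm)
  have "0 < c / (real n + 2)" using c0 by simp
  moreover have "ereal x < b" if "x \<le> c" for x using that c le_less_trans[of "ereal x" "ereal c" b] by (simp add: ivl_def)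
  ultimately show "{c / (real n + 2)..c} \<subseteq> ivl b" unfolding ivl_def by auto
  show "X n \<subseteq> {c / (real n + 2)..c}" using E(2) by (auto simp: X_def)
 qed simp
 have "(\<lambda>n. \<rho> (X n)) sums \<rho> (\<Union>n. X n)" using E XE by (intro countably_additive_onD[OF ca Xm _ disj]) auto
 then have 1: "(\<lambda>n. \<rho> (X n)) sums \<rho> E" unfolding un .
 have S: "{0<..<c} \<in> sets borel" by simp
 have m: "(\<lambda>n. measure (pos_part b \<sigma>) (X n)) sums measure (pos_part b \<sigma>) E"
  if "real_local_measure b \<sigma>" "countably_additive_on {0<..<c} \<sigma>" for \<sigma>
 proof -
  have "emeasure (pos_part b \<sigma>) E \<le> emeasure (pos_part b \<sigma>) {0<..<c}" using E by (intro emeasure_mono) auto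
  then have "emeasure (pos_part b \<sigma>) (\<Union>n. X n) \<noteq> \<infinity>" using pos_part_finite[OF that S] unfolding un by auto
  then have "(\<lambda>n. measure (pos_part b \<sigma>) (X n)) sums measure (pos_part b \<sigma>) (\<Union>n. X n)"
   using Xm disj by (intro measure_UNION) auto
  then show ?thesis unfolding un .
 qed
 have "(\<lambda>n. measure (pos_part b \<rho>) (X n) - measure (pos_part b (\<lambda>F. - \<rho> F)) (X n)) sums (measure (pos_part b \<rho>) E - measure (pos_part b (\<lambda>F. - \<rho> F)) E)"
  by (intro sums_diff m \<rho> ca real_local_measure_uminus countably_additive_on_uminus)
 then have "(\<lambda>n. \<rho> (X n)) sums (measure (pos_part b \<rho>) E - measure (pos_part b (\<lambda>F. - \<rho> F)) E)"
  unfolding jordan_bounded[OF \<rho> bb, symmetric] .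
 then show ?thesis using 1 sums_unique2 by blast
qed

section \<open>Densities of local measures\<close>

lemma ivl_rational_interval:
 assumes x: "x \<in> ivl b"
 obtains p q where "p \<in> \<rat>" "q \<in> \<rat>" "p \<in> ivl b" "q \<in> ivl b" "p \<le> x" "x \<le> q"
proof -
 have x': "0 < x" "ereal x < b" using x by (auto simp: ivl_def)
 obtain p where p: "p \<in> \<rat>" "0 < p" "p < x" using Rats_dense_in_real[OF x'(1)] by blast
 obtain y where y: "ereal x < ereal y" "ereal y < b" using ereal_dense2[OF x'(2)] by blast
 then have "x < y" by simp
 then obtain q where q: "q \<in> \<rat>" "x < q" "q < y" using Rats_dense_in_real by blast
 have "ereal p < b" "ereal q < b" using p q y x' less_trans[of "ereal q" "ereal y" b] less_trans[of "ereal p" "ereal x" b] by auto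
 then show ?thesis using p q x' by (intro that[of p q]) (auto simp: ivl_def)
qed

lemma ivl_nonempty: "0 < b \<Longrightarrow> \<exists>c. c \<in> ivl b"
 using ereal_dense2[of 0 b] by (auto simp: ivl_def zero_ereal_def)

lemma ivl_interval: "p \<in> ivl b \<Longrightarrow> q \<in> ivl b \<Longrightarrow> {p..q} \<subseteq> ivl b"
 unfolding ivl_def by (auto intro: le_less_trans[of "ereal _" "ereal q"])

lemma ivl_exhaustion:
 assumes "0 < b"
 obtains L :: "nat \<Rightarrow> real set" where "\<And>n. compact (L n)" "\<And>n. L n \<subseteq> ivl b" "ivl b = (\<Union>n. L n)"
proof -
 define R where "R = {p. fst p \<in> \<rat> \<and> snd p \<in> \<rat> \<and> fst p \<in> ivl b \<and> snd p \<in> ivl b}"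
 have "R \<subseteq> \<rat> \<times> \<rat>" by (auto simp: R_def)
 then have cnt: "countable R" by (rule countable_subset) (intro countable_SIGMA countable_rat)
 obtain c where c: "c \<in> ivl b" using ivl_nonempty[OF assms] by blast
 have ne: "R \<noteq> {}"
 proof -
  obtain p q where "p \<in> \<rat>" "q \<in> \<rat>" "p \<in> ivl b" "q \<in> ivl b" using ivl_rational_interval[OF c] by metis
  then have "(p, q) \<in> R" by (simp add: R_def)
  then show ?thesis by blast
 qed
 define L where "L n = {fst (from_nat_into R n)..snd (from_nat_into R n)}" for n
 have in_R: "from_nat_into R n \<in> R" for n by (rule from_nat_into[OF ne])
 show ?thesis
 proof (rule that[of L])
  show "compact (L n)" for n by (simp add: L_def)
  show sub: "L n \<subseteq> ivl b" for n using in_R[of n] unfolding L_def by (intro ivl_interval) (auto simp: R_def)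
  show "ivl b = (\<Union>n. L n)"
  proof (intro equalityI subsetI)
   fix x assume "x \<in> ivl b"
   then obtain p q where pq: "p \<in> \<rat>" "q \<in> \<rat>" "p \<in> ivl b" "q \<in> ivl b" "p \<le> x" "x \<le> q" using ivl_rational_interval by metis
   then have "(p, q) \<in> R" by (simp add: R_def)
   then obtain n where "from_nat_into R n = (p, q)" using from_nat_into_surj[OF cnt] by blast
   then have "x \<in> L n" using pq by (simp add: L_def)
   then show "x \<in> (\<Union>n. L n)" by blast
  qed (use sub in blast)
 qed
qed

lemma compact_below:
 assumes "0 < b" "compact L" "L \<subseteq> ivl b"
 obtains c where "c \<in> ivl b" "L \<subseteq> {0<..<c}"
proof (cases "L = {}")
 case True
 then show ?thesis using ivl_nonempty[OF assms(1)] that by blast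
next
 case False
 obtain m where m: "m \<in> L" "\<And>x. x \<in> L \<Longrightarrow> x \<le> m" using compact_attains_sup[OF assms(2) False] by blast
 have "0 < m" "ereal m < b" using m(1) assms(3) by (auto simp: ivl_def)
 obtain c where c: "ereal m < ereal c" "ereal c < b" using ereal_dense2[OF \<open>ereal m < b\<close>] by blast
 show ?thesis
 proof (rule that[of c])
  show "c \<in> ivl b" using c \<open>0 < m\<close> by (simp add: ivl_def)
  show "L \<subseteq> {0<..<c}" using m(2) c(1) assms(3) by (force simp: ivl_def)
 qed
qed

lemma bounded_borel_below:
 assumes "0 < b" "E \<in> bounded_borel b"
 obtains c where "c \<in> ivl b" "E \<subseteq> {0<..<c}"
proof -
 obtain L where "compact L" "L \<subseteq> ivl b" "E \<subseteq> L" using assms(2) by (auto simp: bounded_borel_def)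
 then show ?thesis using compact_below[OF assms(1)] that by (metis order_trans)
qed

lemma ivl_sets_borel [measurable]: "ivl b \<in> sets borel"
 unfolding ivl_def by measurable

lemma sigma_finiteI_ivl:
 assumes b: "0 < b" and sets: "sets \<nu> = sets (borel :: real measure)" and null: "emeasure \<nu> (- ivl b) = 0"
  and fin: "\<And>c. c \<in> ivl b \<Longrightarrow> emeasure \<nu> {0<..<c} < \<infinity>"
 shows "sigma_finite_measure \<nu>"
proof -
 obtain L :: "nat \<Rightarrow> real set" where L: "\<And>n. compact (L n)" "\<And>n. L n \<subseteq> ivl b" "ivl b = (\<Union>n. L n)"
  using ivl_exhaustion[OF b] by metis
 have space: "space \<nu> = UNIV" using sets_eq_imp_space_eq[OF sets] by simp
 show ?thesis
 proof
  show "\<exists>F. countable F \<and> F \<subseteq> sets \<nu> \<and> \<Union> F = space \<nu> \<and> (\<forall>a\<in>F. emeasure \<nu> a \<noteq> \<infinity>)"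
  proof (intro exI conjI ballI)
   let ?F = "insert (- ivl b) (range L)"
   show "countable ?F" by simp
   show "?F \<subseteq> sets \<nu>" using L(1) ivl_sets_borel[of b] by (auto simp: sets borel_compact)
   show "\<Union> ?F = space \<nu>" using L(3) by (auto simp: space)
   fix a assume "a \<in> ?F"
   then consider "a = - ivl b" | n where "a = L n" by blast
   then show "emeasure \<nu> a \<noteq> \<infinity>"
   proof cases
    case (2 n)
    obtain c where c: "c \<in> ivl b" "L n \<subseteq> {0<..<c}" using compact_below[OF b L(1,2)] by blast
    have "emeasure \<nu> (L n) \<le> emeasure \<nu> {0<..<c}" by (rule emeasure_mono[OF c(2)]) (simp add: sets)
    then show ?thesis using fin[OF c(1)] 2 by (auto simp: less_top top_unique)
   qed (simp add: null)
  qed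
 qed
qed

text \<open>Radon and Nikodym, with respect to the sum of the measures: each of them is at most the sum, so its density is at
most 1 almost everywhere, and can be truncated to a bounded one.\<close>
lemma common_density:
 fixes M :: "'i::finite \<Rightarrow> real measure"
 assumes b: "0 < b" and sets: "\<And>i. sets (M i) = sets borel" and null: "\<And>i. emeasure (M i) (- ivl b) = 0"
  and fin: "\<And>i c. c \<in> ivl b \<Longrightarrow> emeasure (M i) {0<..<c} < \<infinity>"
 obtains \<nu> :: "real measure" and g :: "'i \<Rightarrow> real \<Rightarrow> real" where "sets \<nu> = sets borel" "emeasure \<nu> (- ivl b) = 0"
  "\<And>c. c \<in> ivl b \<Longrightarrow> emeasure \<nu> {0<..<c} < \<infinity>" "\<And>i. g i \<in> Borel" "\<And>i x. 0 \<le> g i x" "\<And>i x. g i x \<le> 1"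
  "\<And>i. M i = density \<nu> (\<lambda>x. ennreal (g i x))"
proof -
 define \<nu> where "\<nu> = measure_of UNIV (sets borel) (\<lambda>E. \<Sum>i\<in>UNIV. emeasure (M i) E)"
 have sets\<nu>: "sets \<nu> = sets borel" unfolding \<nu>_def using sets.sigma_sets_eq[of "borel :: real measure"] by simp
 have em: "emeasure \<nu> E = (\<Sum>i\<in>UNIV. emeasure (M i) E)" if E: "E \<in> sets borel" for E
 proof (rule emeasure_measure_of[OF \<nu>_def])
  show "countably_additive (sets \<nu>) (\<lambda>E. \<Sum>i\<in>UNIV. emeasure (M i) E)"
  proof (rule countably_additiveI)
   fix F :: "nat \<Rightarrow> real set" assume F: "range F \<subseteq> sets \<nu>" "disjoint_family F"
   have "(\<Sum>n. \<Sum>i\<in>UNIV. emeasure (M i) (F n)) = (\<Sum>i\<in>UNIV. \<Sum>n. emeasure (M i) (F n))"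
    by (rule suminf_sum) (rule summableI)
   also have "\<dots> = (\<Sum>i\<in>UNIV. emeasure (M i) (\<Union>n. F n))"
    using F by (intro sum.cong refl suminf_emeasure) (auto simp: sets sets\<nu>)
   finally show "(\<Sum>n. \<Sum>i\<in>UNIV. emeasure (M i) (F n)) = (\<Sum>i\<in>UNIV. emeasure (M i) (\<Union>n. F n))" .
  qed
 qed (use E in \<open>auto simp: positive_def sets\<nu>\<close>)
 have null\<nu>: "emeasure \<nu> (- ivl b) = 0" using em[of "- ivl b"] null by simp
 have fin\<nu>: "emeasure \<nu> {0<..<c} < \<infinity>" if "c \<in> ivl b" for c
  using fin[OF that] by (simp add: em)
 interpret sigma_finite_measure \<nu> by (rule sigma_finiteI_ivl[OF b sets\<nu> null\<nu> fin\<nu>])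
 have le: "emeasure (M i) E \<le> emeasure \<nu> E" if "E \<in> sets borel" for i E
  unfolding em[OF that] by (rule member_le_sum) auto
 have space: "space \<nu> = UNIV" using sets_eq_imp_space_eq[OF sets\<nu>] by simp
 have "\<exists>g. g \<in> Borel \<and> (\<forall>x. 0 \<le> g x) \<and> (\<forall>x. g x \<le> 1) \<and> M i = density \<nu> (\<lambda>x. ennreal (g x))" for i
 proof -
  have "absolutely_continuous \<nu> (M i)"
   unfolding absolutely_continuous_def
  proof
   fix E assume "E \<in> null_sets \<nu>"
   then have E: "E \<in> sets borel" "emeasure \<nu> E = 0" by (auto simp: null_sets_def sets\<nu>)
   then show "E \<in> null_sets (M i)" using le[OF E(1), of i] by (auto simp: null_sets_def sets)
  qed
  from Radon_Nikodym[OF this] obtain f where f: "f \<in> borel_measurable \<nu>" "density \<nu> f = M i" using sets sets\<nu> by auto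
  have fm [measurable]: "f \<in> Borel" using f(1) measurable_cong_sets[OF sets\<nu> refl] by blast
  obtain L :: "nat \<Rightarrow> real set" where L: "\<And>n. compact (L n)" "\<And>n. L n \<subseteq> ivl b" "ivl b = (\<Union>n. L n)"
   using ivl_exhaustion[OF b] by metis
  have "AE x in \<nu>. x \<in> L n \<longrightarrow> f x \<le> 1" for n
  proof -
   define N where "N = {x \<in> L n. 1 < f x}"
   have Lm [measurable]: "L n \<in> sets borel" using L(1) by (rule borel_compact)
   have N [measurable]: "N \<in> sets borel" unfolding N_def by measurable
   obtain c where c: "c \<in> ivl b" "L n \<subseteq> {0<..<c}" using compact_below[OF b L(1,2)] by blast
   have "emeasure \<nu> N \<le> emeasure \<nu> {0<..<c}" using c(2) by (intro emeasure_mono) (auto simp: N_def sets\<nu>)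
   then have Nfin: "emeasure \<nu> N < \<infinity>" using fin\<nu>[OF c(1)] le_less_trans by blast
   have m [measurable_cong]: "sets \<nu> = sets borel" by (rule sets\<nu>)
   have "(\<integral>\<^sup>+x. (f x - 1) * indicator N x \<partial>\<nu>) + emeasure \<nu> N = (\<integral>\<^sup>+x. (f x - 1) * indicator N x \<partial>\<nu>) + (\<integral>\<^sup>+x. indicator N x \<partial>\<nu>)"
    by simp
   also have "\<dots> = (\<integral>\<^sup>+x. (f x - 1) * indicator N x + indicator N x \<partial>\<nu>)"
    by (rule nn_integral_add[symmetric]) measurable
   also have "\<dots> = (\<integral>\<^sup>+x. f x * indicator N x \<partial>\<nu>)"
    by (intro nn_integral_cong) (auto simp: N_def indicator_def diff_add_cancel_ennreal less_imp_le)
   also have "\<dots> = emeasure (M i) N" unfolding f(2)[symmetric] by (rule emeasure_density[symmetric]) measurable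
   also have "\<dots> \<le> 0 + emeasure \<nu> N" using le[OF N] by simp
   finally have "(\<integral>\<^sup>+x. (f x - 1) * indicator N x \<partial>\<nu>) \<le> 0"
    using Nfin by (auto simp: ennreal_add_left_cancel_le add.commute)
   then have "(\<integral>\<^sup>+x. (f x - 1) * indicator N x \<partial>\<nu>) = 0" by simp
   then have "AE x in \<nu>. (f x - 1) * indicator N x = 0" by (subst (asm) nn_integral_0_iff_AE) measurable
   then show ?thesis
    by eventually_elim (auto simp: N_def indicator_def not_less diff_eq_0_iff_ennreal split: if_splits)
  qed
  then have "AE x in \<nu>. \<forall>n. x \<in> L n \<longrightarrow> f x \<le> 1" by (subst AE_all_countable) blast
  moreover have "AE x in \<nu>. x \<in> ivl b" using null\<nu> by (intro AE_I[where N="- ivl b"]) (auto simp: sets\<nu>)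
  ultimately have ae: "AE x in \<nu>. f x = ennreal (enn2real (min (f x) 1))"
  proof eventually_elim
   case (elim x)
   then have "f x \<le> 1" using L(3) by blast
   then show ?case by (simp add: min_absorb1 le_less_trans[of "f x" 1 top])
  qed
  have "M i = density \<nu> (\<lambda>x. ennreal (enn2real (min (f x) 1)))"
   unfolding f(2)[symmetric] by (rule density_cong[OF f(1) _ ae]) (use f(1) in measurable)
  moreover have "enn2real (min (f x) 1) \<le> 1" for x
  proof -
   have "enn2real (min (f x) 1) \<le> enn2real 1" by (intro enn2real_mono) auto
   then show ?thesis by simp
  qed
  ultimately show ?thesis by (intro exI[of _ "\<lambda>x. enn2real (min (f x) 1)"]) auto
 qed
 then obtain g where "\<And>i. g i \<in> Borel" "\<And>i x. 0 \<le> g i x" "\<And>i x. g i x \<le> 1" "\<And>i. M i = density \<nu> (\<lambda>x. ennreal (g i x))" by metis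
 then show ?thesis using that[of \<nu> g] sets\<nu> null\<nu> fin\<nu> by blast
qed

lemma pos_part_null_outside:
 assumes \<rho>: "real_local_measure b \<rho>"
 shows "emeasure (pos_part b \<rho>) (- ivl b) = 0"
proof -
 have "pos_value b \<rho> (- ivl b) \<le> 0"
  unfolding pos_value_def
 proof (rule SUP_least)
  fix F assume "F \<in> {F \<in> bounded_borel b. F \<subseteq> - ivl b}"
  then have "F = {}" using bounded_borel_ivl by blast
  then show "ennreal (\<rho> F) \<le> 0" using ca_empty[OF rlm_ca[OF \<rho> bounded_borel_empty]] by simp
 qed
 then show ?thesis using emeasure_pos_part[OF \<rho>, of "- ivl b"] by simp
qed

text \<open>The positive and negative variations of all real and imaginary parts are treated together, so that a single
positive measure serves all components of all the given local measures.\<close>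
theorem complex_densities:
 fixes \<mu> :: "'a::finite \<Rightarrow> real set \<Rightarrow> complex"
 assumes b: "0 < b" and lm: "\<And>a. local_measure b (\<mu> a)" and reg: "\<And>a. regular_at_0 b (\<mu> a)"
 obtains \<nu> :: "real measure" and h :: "'a \<Rightarrow> real \<Rightarrow> complex" where "sets \<nu> = sets borel" "emeasure \<nu> (- ivl b) = 0"
  "\<And>c. c \<in> ivl b \<Longrightarrow> emeasure \<nu> {0<..<c} < \<infinity>" "\<And>a. h a \<in> Borel" "\<And>a x. norm (h a x) \<le> 4"
  "\<And>a c E. c \<in> ivl b \<Longrightarrow> E \<in> sets borel \<Longrightarrow> E \<subseteq> {0<..<c} \<Longrightarrow> \<mu> a E = (LINT x:E|\<nu>. h a x)"
  "\<And>a f E B. E \<in> bounded_borel b \<Longrightarrow> (\<lambda>x. indicat_real E x *\<^sub>R f x) \<in> Borel \<Longrightarrow> (\<And>x. x \<in> E \<Longrightarrow> norm (f x) \<le> B) \<Longrightarrow>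
    cm_integral b (\<mu> a) f E = (LINT x:E|\<nu>. h a x * f x)"
proof -
 define \<rho> where "\<rho> = (\<lambda>(a, re, pos) E. (if pos then 1 else -1) * (if re then Re (\<mu> a E) else Im (\<mu> a E)))"
 have \<rho>_simps: "\<rho> (a, True, True) = (\<lambda>E. Re (\<mu> a E))" "\<rho> (a, True, False) = (\<lambda>E. - Re (\<mu> a E))"
  "\<rho> (a, False, True) = (\<lambda>E. Im (\<mu> a E))" "\<rho> (a, False, False) = (\<lambda>E. - Im (\<mu> a E))" for a
  by (simp_all add: \<rho>_def)
 have cases: "\<exists>a. i = (a, True, True) \<or> i = (a, True, False) \<or> i = (a, False, True) \<or> i = (a, False, False)" for i :: "'a \<times> bool \<times> bool"
  by (cases i) (metis (full_types))
 have rlm: "real_local_measure b (\<rho> i)" for i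
  using cases[of i] by (auto simp: \<rho>_simps local_measure_parts[OF lm] real_local_measure_uminus[OF local_measure_parts(1)[OF lm]] real_local_measure_uminus[OF local_measure_parts(2)[OF lm]])
 have ca: "countably_additive_on {0<..<c} (\<rho> i)" if "c \<in> ivl b" for c i
 proof -
  have cm: "complex_measure_on {0<..<c} (\<mu> a)" for a using reg[of a] that by (simp add: regular_at_0_def)
  show ?thesis using cases[of i]
   by (auto simp: \<rho>_simps complex_measure_on_parts[OF cm] countably_additive_on_uminus[OF complex_measure_on_parts(1)[OF cm]]
     countably_additive_on_uminus[OF complex_measure_on_parts(2)[OF cm]])
 qed
 have fin: "emeasure (pos_part b (\<rho> i)) {0<..<c} < \<infinity>" if "c \<in> ivl b" for i c
  by (rule pos_part_finite[OF rlm ca[OF that]]) simp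
 obtain \<nu> :: "real measure" and g where \<nu>: "sets \<nu> = sets borel" "emeasure \<nu> (- ivl b) = 0" "\<And>c. c \<in> ivl b \<Longrightarrow> emeasure \<nu> {0<..<c} < \<infinity>"
  and g: "\<And>i. g i \<in> Borel" "\<And>i x. 0 \<le> g i x" "\<And>i x. g i x \<le> 1"
  and dens: "\<And>i. pos_part b (\<rho> i) = density \<nu> (\<lambda>x. ennreal (g i x))"
  using common_density[OF b, of "\<lambda>i. pos_part b (\<rho> i)", OF sets_pos_part pos_part_null_outside[OF rlm] fin] by metis
 have m [measurable_cong]: "sets \<nu> = sets borel" by (rule \<nu>(1))
 have g\<nu>: "g i \<in> borel_measurable \<nu>" for i using g(1) measurable_cong_sets[OF \<nu>(1) refl] by blast
 define h where "h a x = complex_of_real (g (a, True, True) x - g (a, True, False) x) + \<i> * complex_of_real (g (a, False, True) x - g (a, False, False) x)" for a x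
 have hm: "h a \<in> Borel" for a
 proof -
  note [measurable] = g(1)
  show ?thesis unfolding h_def by measurable
 qed
 have hb: "norm (h a x) \<le> 4" for a x
 proof -
  have *: "\<bar>g i x - g j x\<bar> \<le> 1" for i j using g(2,3)[of i x] g(2,3)[of j x] by linarith
  have "norm (h a x) \<le> \<bar>g (a, True, True) x - g (a, True, False) x\<bar> + \<bar>g (a, False, True) x - g (a, False, False) x\<bar>"
   unfolding h_def by (rule order_trans[OF norm_triangle_ineq]) (simp add: norm_mult del: of_real_diff)
  then show ?thesis using *[of "(a, True, True)" "(a, True, False)"] *[of "(a, False, True)" "(a, False, False)"] by linarith
 qed
 have integ: "integrable \<nu> (\<lambda>x. indicat_real E x *\<^sub>R k x)" 
  if "c \<in> ivl b" "E \<in> sets borel" "E \<subseteq> {0<..<c}" "(\<lambda>x. indicat_real E x *\<^sub>R k x) \<in> Borel" "\<And>x. x \<in> E \<Longrightarrow> norm (k x) \<le> B" for k :: "real \<Rightarrow> complex" and E c B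
 proof -
  have "emeasure \<nu> E \<le> emeasure \<nu> {0<..<c}" using that by (intro emeasure_mono) (auto simp: \<nu>(1))
  then have "emeasure \<nu> E < \<infinity>" using \<nu>(3)[OF that(1)] le_less_trans by blast
  then have "integrable \<nu> (\<lambda>x. indicat_real E x *\<^sub>R \<bar>B\<bar>)" using that by (intro integrable_scaleR_left integrable_real_indicator) (auto simp: \<nu>(1))
  then show ?thesis
  proof (rule Bochner_Integration.integrable_bound)
   show "(\<lambda>x. indicat_real E x *\<^sub>R k x) \<in> borel_measurable \<nu>" using that(4) measurable_cong_sets[OF \<nu>(1) refl] by blast
   show "AE x in \<nu>. norm (indicat_real E x *\<^sub>R k x) \<le> norm (indicat_real E x *\<^sub>R \<bar>B\<bar>)"
    using that(5) by (intro AE_I2) (force simp: indicator_def)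
  qed
 qed
 have comb: "(LINT x:E|density \<nu> (\<lambda>x. ennreal (g (a, True, True) x)). f x) - (LINT x:E|density \<nu> (\<lambda>x. ennreal (g (a, True, False) x)). f x)
   + \<i> * ((LINT x:E|density \<nu> (\<lambda>x. ennreal (g (a, False, True) x)). f x) - (LINT x:E|density \<nu> (\<lambda>x. ennreal (g (a, False, False) x)). f x))
   = (LINT x:E|\<nu>. h a x * f x)"
  if E: "c \<in> ivl b" "E \<in> sets borel" "E \<subseteq> {0<..<c}" and f: "(\<lambda>x. indicat_real E x *\<^sub>R f x) \<in> Borel" "\<And>x. x \<in> E \<Longrightarrow> norm (f x) \<le> B" for E c B a and f :: "real \<Rightarrow> complex"
 proof -
  define F where "F x = indicat_real E x *\<^sub>R f x" for x
  have Fm [measurable]: "F \<in> Borel" using f(1) unfolding F_def .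
  have F\<nu>: "F \<in> borel_measurable \<nu>" using Fm measurable_cong_sets[OF \<nu>(1) refl] by blast
  have 1: "(LINT x:E|density \<nu> (\<lambda>x. ennreal (g i x)). f x) = (\<integral>x. g i x *\<^sub>R F x \<partial>\<nu>)" for i
   unfolding set_lebesgue_integral_def F_def[symmetric] using g(2) by (intro integral_density F\<nu> g\<nu>) auto
  have 2: "integrable \<nu> (\<lambda>x. g i x *\<^sub>R F x)" for i
  proof -
   have e: "(\<lambda>x. g i x *\<^sub>R F x) = (\<lambda>x. indicat_real E x *\<^sub>R (g i x *\<^sub>R f x))" by (simp add: F_def mult.commute)
   note [measurable] = g(1)
   show ?thesis unfolding e
   proof (rule integ[OF E, where B="\<bar>B\<bar>"])
    show "(\<lambda>x. indicat_real E x *\<^sub>R (g i x *\<^sub>R f x)) \<in> Borel" unfolding e[symmetric] by measurable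
    fix x assume "x \<in> E"
    then have "norm (f x) \<le> \<bar>B\<bar>" using f(2)[of x] by linarith
    then have "g i x * norm (f x) \<le> 1 * \<bar>B\<bar>" using g(2,3)[of i x] by (intro mult_mono) auto
    then show "norm (g i x *\<^sub>R f x) \<le> \<bar>B\<bar>" using g(2)[of i x] by simp
   qed
  qed
  have "(LINT x:E|\<nu>. h a x * f x) = (\<integral>x. (g (a, True, True) x *\<^sub>R F x - g (a, True, False) x *\<^sub>R F x) + \<i> * (g (a, False, True) x *\<^sub>R F x - g (a, False, False) x *\<^sub>R F x) \<partial>\<nu>)"
   unfolding set_lebesgue_integral_def by (intro bochner_cong refl) (simp add: h_def F_def scaleR_conv_of_real algebra_simps)
  also have "\<dots> = (\<integral>x. g (a, True, True) x *\<^sub>R F x - g (a, True, False) x *\<^sub>R F x \<partial>\<nu>) + \<i> * (\<integral>x. g (a, False, True) x *\<^sub>R F x - g (a, False, False) x *\<^sub>R F x \<partial>\<nu>)"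
   by (subst Bochner_Integration.integral_add) (auto intro!: Bochner_Integration.integrable_diff integrable_mult_right 2)
  also have "\<dots> = (\<integral>x. g (a, True, True) x *\<^sub>R F x \<partial>\<nu>) - (\<integral>x. g (a, True, False) x *\<^sub>R F x \<partial>\<nu>) + \<i> * ((\<integral>x. g (a, False, True) x *\<^sub>R F x \<partial>\<nu>) - (\<integral>x. g (a, False, False) x *\<^sub>R F x \<partial>\<nu>))"
   by (simp add: Bochner_Integration.integral_diff 2)
  finally show ?thesis by (simp add: 1)
 qed
 show ?thesis
 proof (rule that[OF \<nu> hm hb])
  show "\<mu> a E = (LINT x:E|\<nu>. h a x)" if E: "c \<in> ivl b" "E \<in> sets borel" "E \<subseteq> {0<..<c}" for a c E
  proof -
   have j: "\<rho> (a, re, True) E = measure (pos_part b (\<rho> (a, re, True))) E - measure (pos_part b (\<rho> (a, re, False))) E" for re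
    using jordan[OF rlm E(1) ca[OF E(1)] E(2,3), of "(a, re, True)"] by (cases re) (simp_all add: \<rho>_simps)
   have me: "complex_of_real (measure (pos_part b (\<rho> i)) E) = (LINT x:E|density \<nu> (\<lambda>x. ennreal (g i x)). 1)" for i
   proof -
    have s: "sets (density \<nu> (\<lambda>x. ennreal (g i x))) = sets borel" by (simp add: \<nu>(1))
    have "emeasure (pos_part b (\<rho> i)) E \<le> emeasure (pos_part b (\<rho> i)) {0<..<c}" using E by (intro emeasure_mono) auto
    then have "emeasure (pos_part b (\<rho> i)) E < \<infinity>" using fin[OF E(1)] le_less_trans by blast
    then show ?thesis unfolding set_lebesgue_integral_def dens using E(2) s
     by (subst integral_scaleR_left) (auto intro!: integrable_real_indicator simp: scaleR_conv_of_real)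
   qed
   have "\<mu> a E = complex_of_real (\<rho> (a, True, True) E) + \<i> * complex_of_real (\<rho> (a, False, True) E)"
    by (simp add: \<rho>_simps complex_eq_iff)
   also have "\<dots> = (LINT x:E|\<nu>. h a x * 1)"
    unfolding j of_real_diff me using E by (intro comb[OF E, where B=1]) auto
   finally show ?thesis by simp
  qed
  show "cm_integral b (\<mu> a) f E = (LINT x:E|\<nu>. h a x * f x)"
   if E: "E \<in> bounded_borel b" and f: "(\<lambda>x. indicat_real E x *\<^sub>R f x) \<in> Borel" "\<And>x. x \<in> E \<Longrightarrow> norm (f x) \<le> B" for a f E B
  proof -
   obtain c where c: "c \<in> ivl b" "E \<subseteq> {0<..<c}" using bounded_borel_below[OF b E] by blast
   note d = dens[of "(a, True, True)", unfolded \<rho>_simps] dens[of "(a, True, False)", unfolded \<rho>_simps]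
    dens[of "(a, False, True)", unfolded \<rho>_simps] dens[of "(a, False, False)", unfolded \<rho>_simps]
   show ?thesis unfolding cm_integral_def signed_integral_def d
    by (rule comb[OF c(1) bounded_borel_sets[OF E] c(2) f])
  qed
 qed
qed

lemma closed_hermitian: "closed {X. hermitian X}"
proof -
 have "{X. hermitian X} = (\<Inter>j. \<Inter>k. {X. X $ j $ k = cnj (X $ k $ j)})" by (auto simp: hermitian_def)
 moreover have "closed {X :: complex^2^2. X $ j $ k = cnj (X $ k $ j)}" for j k
  by (intro closed_Collect_eq continuous_intros)
 ultimately show ?thesis by (metis (no_types, lifting) closed_INT)
qed

lemma closed_nonneg_matrix: "closed {X. nonneg_matrix X}"
proof -
 have "{X. nonneg_matrix X} = {X. hermitian X} \<inter>
  (\<Inter>v :: complex^2. {X. 0 \<le> Re (\<Sum>j\<in>UNIV. \<Sum>k\<in>UNIV. cnj (v $ j) * X $ j $ k * v $ k)})"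
  by (auto simp: nonneg_matrix_def)
 moreover have "closed {X :: complex^2^2. 0 \<le> Re (\<Sum>j\<in>UNIV. \<Sum>k\<in>UNIV. cnj (v $ j) * X $ j $ k * v $ k)}" for v :: "complex^2"
  by (intro closed_Collect_le continuous_intros)
 ultimately show ?thesis using closed_hermitian by (metis (no_types, lifting) closed_INT closed_Int)
qed

lemma hermitian_scaleR: "hermitian X \<Longrightarrow> hermitian (r *\<^sub>R X)"
 unfolding hermitian_def by (metis complex_cnj_scaleR vector_scaleR_component)

lemma nonneg_matrix_scaleR:
 assumes "nonneg_matrix X" "0 \<le> r"
 shows "nonneg_matrix (r *\<^sub>R X)"
proof -
 have "(\<Sum>j\<in>UNIV. \<Sum>k\<in>UNIV. cnj (v $ j) * (r *\<^sub>R X) $ j $ k * v $ k) = r *\<^sub>R (\<Sum>j\<in>UNIV. \<Sum>k\<in>UNIV. cnj (v $ j) * X $ j $ k * v $ k)" for v :: "complex^2"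
  by (simp add: scaleR_sum_right)
 then show ?thesis using assms hermitian_scaleR unfolding nonneg_matrix_def by simp
qed

lemma hermitian_zero [simp]: "hermitian 0"
 by (simp add: hermitian_def)

lemma nonneg_matrix_zero [simp]: "nonneg_matrix 0"
 by (simp add: nonneg_matrix_def)

lemma borel_measurable_matrixI:
 fixes F :: "'a \<Rightarrow> complex^2^2"
 assumes "\<And>j k. (\<lambda>x. F x $ j $ k) \<in> borel_measurable M"
 shows "F \<in> borel_measurable M"
 using assms by (intro borel_measurable_vecI)

text \<open>The averages of the density over sets in the interval are positive multiples of values of the measure. By the
averaging theorem a closed set that contains all averages contains almost all values.\<close>
lemma density_in_cone:
 fixes F :: "real \<Rightarrow> complex^2^2" and m :: "real set \<Rightarrow> complex^2^2"
 assumes b: "0 < b" and \<nu>: "sets \<nu> = sets borel" "emeasure \<nu> (- ivl b) = 0" "\<And>c. c \<in> ivl b \<Longrightarrow> emeasure \<nu> {0<..<c} < \<infinity>"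
  and F: "\<And>j k. (\<lambda>x. F x $ j $ k) \<in> Borel" "\<And>j k x. norm (F x $ j $ k) \<le> K"
  and m: "\<And>E j k. E \<in> bounded_borel b \<Longrightarrow> m E $ j $ k = (LINT x:E|\<nu>. F x $ j $ k)" "\<And>E. E \<in> bounded_borel b \<Longrightarrow> m E \<in> C"
  and C: "closed C" "\<And>X r. X \<in> C \<Longrightarrow> 0 \<le> r \<Longrightarrow> r *\<^sub>R X \<in> C"
 shows "AE x in \<nu>. F x \<in> C"
proof -
 interpret sigma_finite_measure \<nu> by (rule sigma_finiteI_ivl[OF b \<nu>])
 obtain L :: "nat \<Rightarrow> real set" where L: "\<And>n. compact (L n)" "\<And>n. L n \<subseteq> ivl b" "ivl b = (\<Union>n. L n)"
  using ivl_exhaustion[OF b] by metis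
 have Fm: "F \<in> borel_measurable \<nu>" using borel_measurable_matrixI[OF F(1)] measurable_cong_sets[OF \<nu>(1) refl] by blast
 \<comment> \<open>restricted to a compact set the density is integrable\<close>
 have "AE x in \<nu>. indicat_real (L n) x *\<^sub>R F x \<in> C" for n
 proof (rule averaging_theorem[OF _ C(1)])
  have Lm [measurable]: "L n \<in> sets borel" using L(1) by (rule borel_compact)
  obtain c where c: "c \<in> ivl b" "L n \<subseteq> {0<..<c}" using compact_below[OF b L(1,2)] by blast
  have "emeasure \<nu> (L n) \<le> emeasure \<nu> {0<..<c}" using c(2) by (intro emeasure_mono) (auto simp: \<nu>(1))
  then have Lfin: "emeasure \<nu> (L n) < \<infinity>" using \<nu>(3)[OF c(1)] le_less_trans by blast
  have normF: "norm (F x) \<le> 4 * K" for x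
  proof -
   have "norm (F x) \<le> (\<Sum>j\<in>UNIV. norm (F x $ j))" unfolding norm_vec_def[of "F x"] by (rule L2_set_le_sum) simp
   also have "\<dots> \<le> (\<Sum>j\<in>(UNIV::2 set). \<Sum>k\<in>(UNIV::2 set). norm (F x $ j $ k))" by (intro sum_mono, unfold norm_vec_def) (rule L2_set_le_sum, simp)
   also have "\<dots> \<le> (\<Sum>j\<in>(UNIV::2 set). \<Sum>k\<in>(UNIV::2 set). K)" by (intro sum_mono F(2))
   finally show ?thesis by simp
  qed
  have I: "integrable \<nu> (\<lambda>x. indicat_real (L n) x *\<^sub>R F x)"
  proof (rule Bochner_Integration.integrable_bound)
   show "integrable \<nu> (\<lambda>x. indicat_real (L n) x *\<^sub>R (4 * K))" using Lm Lfin by (intro integrable_scaleR_left integrable_real_indicator) (auto simp: \<nu>(1))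
   show "(\<lambda>x. indicat_real (L n) x *\<^sub>R F x) \<in> borel_measurable \<nu>" using Fm Lm by (intro borel_measurable_scaleR borel_measurable_indicator) (auto simp: \<nu>(1))
   show "AE x in \<nu>. norm (indicat_real (L n) x *\<^sub>R F x) \<le> norm (indicat_real (L n) x *\<^sub>R (4 * K))"
   proof (rule AE_I2)
    fix x
    have "norm (F x) \<le> \<bar>4 * K\<bar>" using normF[of x] by linarith
    then show "norm (indicat_real (L n) x *\<^sub>R F x) \<le> norm (indicat_real (L n) x *\<^sub>R (4 * K))"
     by (simp add: indicator_def)
   qed
  qed
  show "integrable \<nu> (\<lambda>x. indicat_real (L n) x *\<^sub>R F x)" by (rule I)
  fix E assume E: "E \<in> sets \<nu>"
  have EL: "E \<inter> L n \<in> bounded_borel b" using E Lm L(1,2)[of n] unfolding bounded_borel_def \<nu>(1) by blast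
  have Elm: "E \<inter> L n \<in> sets \<nu>" using E Lm \<nu>(1) by simp
  have eq: "indicat_real E x *\<^sub>R indicat_real (L n) x *\<^sub>R F x = indicat_real (E \<inter> L n) x *\<^sub>R F x" for x
   by (simp add: indicator_def)
  have I2: "integrable \<nu> (\<lambda>x. indicat_real (E \<inter> L n) x *\<^sub>R F x)"
   using integrable_mult_indicator[OF E I] unfolding eq .
  have "(LINT x:E|\<nu>. indicat_real (L n) x *\<^sub>R F x) = m (E \<inter> L n)"
  proof -
   have "(\<integral>x. indicat_real (E \<inter> L n) x *\<^sub>R F x \<partial>\<nu>) $ j $ k = m (E \<inter> L n) $ j $ k" for j k
   proof -
    have bl: "bounded_linear (\<lambda>X :: complex^2^2. X $ j $ k)"
     by (rule bounded_linear_compose[OF bounded_linear_vec_nth bounded_linear_vec_nth])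
    show ?thesis unfolding m(1)[OF EL] set_lebesgue_integral_def
     using integral_bounded_linear[OF bl I2] by simp
   qed
   then show ?thesis unfolding set_lebesgue_integral_def eq by (simp add: vec_eq_iff)
  qed
  then show "(1 / measure \<nu> E) *\<^sub>R (LINT x:E|\<nu>. indicat_real (L n) x *\<^sub>R F x) \<in> C"
   using C(2)[OF m(2)[OF EL], of "1 / measure \<nu> E"] by simp
 qed
 then have "AE x in \<nu>. \<forall>n. indicat_real (L n) x *\<^sub>R F x \<in> C" by (subst AE_all_countable) blast
 moreover have "AE x in \<nu>. x \<in> ivl b" using \<nu>(2) by (intro AE_I[where N="- ivl b"]) (auto simp: \<nu>(1))
 ultimately show ?thesis
 proof eventually_elim
  case (elim x)
  then obtain n where "x \<in> L n" using L(3) by blast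
  then show ?case using elim(1)[rule_format, of n] by simp
 qed
qed

text \<open>The link between the given local measures and a system with densities. The densities of \<open>q\<close> and \<open>w\<close> are needed up to
the endpoint 0, integrals of functions only over sets in \<open>bounded_borel \<beta>\<close>.\<close>
locale represented_system = canonical_system +
 fixes q w :: "real set \<Rightarrow> complex^2^2"
 assumes q_density: "\<And>c E j k. c \<in> ivl \<beta> \<Longrightarrow> E \<in> sets borel \<Longrightarrow> E \<subseteq> {0<..<c} \<Longrightarrow> entry q j k E = (LINT x:E|\<nu>. Q x $ j $ k)"
  and w_density: "\<And>c E j k. c \<in> ivl \<beta> \<Longrightarrow> E \<in> sets borel \<Longrightarrow> E \<subseteq> {0<..<c} \<Longrightarrow> entry w j k E = (LINT x:E|\<nu>. W x $ j $ k)"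
  and q_integral: "\<And>E f B j k. E \<in> bounded_borel \<beta> \<Longrightarrow> (\<lambda>x. indicat_real E x *\<^sub>R f x) \<in> Borel \<Longrightarrow> (\<And>x. x \<in> E \<Longrightarrow> norm (f x) \<le> B) \<Longrightarrow>
    cm_integral \<beta> (entry q j k) f E = (LINT x:E|\<nu>. Q x $ j $ k * f x)"
  and w_integral: "\<And>E f B j k. E \<in> bounded_borel \<beta> \<Longrightarrow> (\<lambda>x. indicat_real E x *\<^sub>R f x) \<in> Borel \<Longrightarrow> (\<And>x. x \<in> E \<Longrightarrow> norm (f x) \<le> B) \<Longrightarrow>
    cm_integral \<beta> (entry w j k) f E = (LINT x:E|\<nu>. W x $ j $ k * f x)"

lemma set_integral_mult_cong_AE:
 fixes g h f :: "real \<Rightarrow> complex"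
 assumes "sets \<nu> = sets borel" "g \<in> Borel" "h \<in> Borel" "AE x in \<nu>. g x = h x"
  "(\<lambda>x. indicat_real E x *\<^sub>R f x) \<in> Borel"
 shows "(LINT x:E|\<nu>. g x * f x) = (LINT x:E|\<nu>. h x * f x)"
proof -
 have m: "(\<lambda>x. indicat_real E x *\<^sub>R (k x * f x)) \<in> borel_measurable \<nu>" if "k \<in> Borel" for k
 proof -
  have "(\<lambda>x. k x * (indicat_real E x *\<^sub>R f x)) \<in> Borel" by (intro borel_measurable_times that assms(5))
  then have "(\<lambda>x. indicat_real E x *\<^sub>R (k x * f x)) \<in> Borel" by simp
  then show ?thesis using measurable_cong_sets[OF assms(1) refl] by blast
 qed
 show ?thesis unfolding set_lebesgue_integral_def
  by (intro integral_cong_AE m assms(2,3)) (use assms(4) in eventually_elim, simp)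
qed

text \<open>The densities of Hermitian or non-negative matrix measures have the same property almost everywhere; replacing them
by 0 elsewhere makes it hold everywhere and keeps them bounded.\<close>
theorem canonical_representation:
 assumes b: "0 < b"
  and q: "local_matrix_measure b q" "matrix_regular_at_0 b q" "hermitian_measure b q"
  and w: "local_matrix_measure b w" "matrix_regular_at_0 b w" "nonneg_measure b w"
 obtains \<nu> Q W where "represented_system \<nu> b Q W 4 q w"
proof -
 define \<mu> where "\<mu> = (\<lambda>(iq, j, k). entry (if iq then q else w) j k)"
 have lm: "local_measure b (\<mu> a)" for a using q(1) w(1) by (cases a) (simp add: \<mu>_def local_matrix_measure_def)
 have reg: "regular_at_0 b (\<mu> a)" for a using q(2) w(2) by (cases a) (simp add: \<mu>_def matrix_regular_at_0_def)
 obtain \<nu> and h :: "bool \<times> 2 \<times> 2 \<Rightarrow> real \<Rightarrow> complex" where \<nu>: "sets \<nu> = sets borel" "emeasure \<nu> (- ivl b) = 0"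
  "\<And>c. c \<in> ivl b \<Longrightarrow> emeasure \<nu> {0<..<c} < \<infinity>"
  and h: "\<And>a. h a \<in> Borel" "\<And>a x. norm (h a x) \<le> 4"
  and dens: "\<And>a c E. c \<in> ivl b \<Longrightarrow> E \<in> sets borel \<Longrightarrow> E \<subseteq> {0<..<c} \<Longrightarrow> \<mu> a E = (LINT x:E|\<nu>. h a x)"
  and int: "\<And>a f E B. E \<in> bounded_borel b \<Longrightarrow> (\<lambda>x. indicat_real E x *\<^sub>R f x) \<in> Borel \<Longrightarrow> (\<And>x. x \<in> E \<Longrightarrow> norm (f x) \<le> B) \<Longrightarrow>
    cm_integral b (\<mu> a) f E = (LINT x:E|\<nu>. h a x * f x)"
  by (rule complex_densities[of b \<mu>, OF b lm reg]) (blast intro: that)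
 have bb: "\<mu> a E = (LINT x:E|\<nu>. h a x)" if "E \<in> bounded_borel b" for a E
  using bounded_borel_below[OF b that] dens bounded_borel_sets[OF that] by metis
 have ex: "\<exists>F. (\<forall>j k. (\<lambda>x. F x $ j $ k) \<in> Borel) \<and> (\<forall>x j k. norm (F x $ j $ k) \<le> 4) \<and> (\<forall>x. F x \<in> C) \<and>
   (\<forall>j k. AE x in \<nu>. h (iq, j, k) x = F x $ j $ k)"
  if C: "closed C" "\<And>X r. X \<in> C \<Longrightarrow> 0 \<le> r \<Longrightarrow> r *\<^sub>R X \<in> C" "0 \<in> C" "\<And>E. E \<in> bounded_borel b \<Longrightarrow> (if iq then q else w) E \<in> C" for C iq
 proof -
  define G :: "real \<Rightarrow> complex^2^2" where "G x = (\<chi> j k. h (iq, j, k) x)" for x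
  have Gc: "G x $ j $ k = h (iq, j, k) x" for x j k by (simp add: G_def)
  have ae: "AE x in \<nu>. G x \<in> C"
  proof (rule density_in_cone[OF b \<nu>, where m="if iq then q else w" and K=4])
   show "(if iq then q else w) E $ j $ k = (LINT x:E|\<nu>. G x $ j $ k)" if "E \<in> bounded_borel b" for E j k
    using bb[OF that, of "(iq, j, k)"] by (simp add: \<mu>_def entry_def Gc)
  qed (use C h in \<open>simp_all add: Gc\<close>)
  have Gm [measurable]: "G \<in> Borel" by (rule borel_measurable_matrixI) (simp add: Gc h)
  have Cm [measurable]: "C \<in> sets borel" using C(1) by (rule borel_closed)
  have Sm: "{x. G x \<in> C} \<in> sets borel" using measurable_sets[OF Gm Cm] by (simp add: vimage_def)
  show ?thesis
  proof (intro exI[of _ "\<lambda>x. if G x \<in> C then G x else 0"] conjI allI)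
   show "(\<lambda>x. (if G x \<in> C then G x else 0) $ j $ k) \<in> Borel" for j k
   proof -
    have "(\<lambda>x. (if G x \<in> C then G x else 0) $ j $ k) = (\<lambda>x. if x \<in> {x. G x \<in> C} then h (iq, j, k) x else 0)" by (auto simp: Gc)
    also have "\<dots> \<in> Borel" by (rule measurable_If_set) (use h(1) Sm in auto)
    finally show ?thesis .
   qed
   show "norm ((if G x \<in> C then G x else 0) $ j $ k) \<le> 4" for x j k by (simp add: Gc h)
   show "(if G x \<in> C then G x else 0) \<in> C" for x using C(3) by simp
   show "AE x in \<nu>. h (iq, j, k) x = (if G x \<in> C then G x else 0) $ j $ k" for j k
    using ae by eventually_elim (simp add: Gc)
  qed
 qed
 obtain Q where Q: "\<And>j k. (\<lambda>x. Q x $ j $ k) \<in> Borel" "\<And>x j k. norm (Q x $ j $ k) \<le> 4"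
  "\<And>x. hermitian (Q x)" "\<And>j k. AE x in \<nu>. h (True, j, k) x = Q x $ j $ k"
  using ex[of "{X. hermitian X}" True] closed_hermitian hermitian_scaleR q(3) by (auto simp: hermitian_measure_def)
 obtain W where W: "\<And>j k. (\<lambda>x. W x $ j $ k) \<in> Borel" "\<And>x j k. norm (W x $ j $ k) \<le> 4"
  "\<And>x. nonneg_matrix (W x)" "\<And>j k. AE x in \<nu>. h (False, j, k) x = W x $ j $ k"
  using ex[of "{X. nonneg_matrix X}" False] closed_nonneg_matrix nonneg_matrix_scaleR w(3) by (auto simp: nonneg_measure_def)
 have fin: "emeasure \<nu> {0..c} < \<infinity>" if c0: "0 \<le> c" and cb: "ereal c < b" for c
 proof -
  obtain d where d: "ereal c < ereal d" "ereal d < b" using ereal_dense2[OF cb] by blast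
  then have di: "d \<in> ivl b" using c0 by (simp add: ivl_def)
  have "emeasure \<nu> {0..c} \<le> emeasure \<nu> (- ivl b \<union> {0<..<d})"
   using d by (intro emeasure_mono) (auto simp: \<nu>(1) ivl_def)
  also have "\<dots> \<le> emeasure \<nu> (- ivl b) + emeasure \<nu> {0<..<d}" by (intro emeasure_subadditive) (auto simp: \<nu>(1))
  also have "\<dots> < \<infinity>" using \<nu>(2,3) di by simp
  finally show ?thesis .
 qed
 have e: "\<mu> (True, j, k) = entry q j k" "\<mu> (False, j, k) = entry w j k" for j k by (simp_all add: \<mu>_def)
 have "represented_system \<nu> b Q W 4 q w"
 proof (unfold_locales)
  show "entry q j k E = (LINT x:E|\<nu>. Q x $ j $ k)" if E: "c \<in> ivl b" "E \<in> sets borel" "E \<subseteq> {0<..<c}" for c E j k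
   using set_integral_mult_cong_AE[OF \<nu>(1) h(1) Q(1) Q(4), of E "\<lambda>x. 1" j k] dens[OF E, of "(True, j, k)"] E(2) by (simp add: e)
  show "entry w j k E = (LINT x:E|\<nu>. W x $ j $ k)" if E: "c \<in> ivl b" "E \<in> sets borel" "E \<subseteq> {0<..<c}" for c E j k
   using set_integral_mult_cong_AE[OF \<nu>(1) h(1) W(1) W(4), of E "\<lambda>x. 1" j k] dens[OF E, of "(False, j, k)"] E(2) by (simp add: e)
  show "cm_integral b (entry q j k) f E = (LINT x:E|\<nu>. Q x $ j $ k * f x)"
   if E: "E \<in> bounded_borel b" "(\<lambda>x. indicat_real E x *\<^sub>R f x) \<in> Borel" "\<And>x. x \<in> E \<Longrightarrow> norm (f x) \<le> B" for E f B j k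
   using int[OF E, of "(True, j, k)"] set_integral_mult_cong_AE[OF \<nu>(1) h(1) Q(1) Q(4) E(2)] by (simp add: e)
  show "cm_integral b (entry w j k) f E = (LINT x:E|\<nu>. W x $ j $ k * f x)"
   if E: "E \<in> bounded_borel b" "(\<lambda>x. indicat_real E x *\<^sub>R f x) \<in> Borel" "\<And>x. x \<in> E \<Longrightarrow> norm (f x) \<le> B" for E f B j k
   using int[OF E, of "(False, j, k)"] set_integral_mult_cong_AE[OF \<nu>(1) h(1) W(1) W(4) E(2)] by (simp add: e)
 qed (use \<nu> b Q W fin in auto)
 then show ?thesis using that by blast
qed

section \<open>Solutions in the sense of local measures satisfy the integral equation\<close>

lemma bounded_borel_interval: "s \<in> ivl b \<Longrightarrow> t \<in> ivl b \<Longrightarrow> E \<in> sets borel \<Longrightarrow> E \<subseteq> {s..t} \<Longrightarrow> E \<in> bounded_borel b"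
 unfolding bounded_borel_def using ivl_interval by blast

text \<open>By the Jordan decomposition these functions are differences of monotone functions.\<close>
lemma real_local_measure_interval_measurable:
 assumes \<rho>: "real_local_measure b \<rho>" and p: "p \<in> ivl b" and r: "r \<in> ivl b"
 shows "(\<lambda>t. \<rho> ({p..t} \<inter> {p..r})) \<in> Borel" "(\<lambda>t. \<rho> ({p..<t} \<inter> {p..r})) \<in> Borel"
proof -
 have bb: "E \<in> bounded_borel b" if "E \<in> sets borel" "E \<subseteq> {p..r}" for E
  using bounded_borel_interval[OF p r that] .
 have fin: "emeasure (pos_part b \<sigma>) {p..r} < \<infinity>" if "real_local_measure b \<sigma>" for \<sigma>
  by (rule pos_part_finite[OF that rlm_ca[OF that bb]]) auto
 have mono: "mono (\<lambda>t. measure (pos_part b \<sigma>) (E t \<inter> {p..r}))"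
  if "real_local_measure b \<sigma>" "mono E" "\<And>t. E t \<in> sets borel" for \<sigma> and E :: "real \<Rightarrow> real set"
 proof (rule monoI)
  fix s t :: real assume "s \<le> t"
  have "emeasure (pos_part b \<sigma>) (E t \<inter> {p..r}) \<le> emeasure (pos_part b \<sigma>) {p..r}" by (rule emeasure_mono) auto
  then have "emeasure (pos_part b \<sigma>) (E t \<inter> {p..r}) \<noteq> \<infinity>" using fin[OF that(1)] by auto
  then have "E t \<inter> {p..r} \<in> fmeasurable (pos_part b \<sigma>)" using that(3) by (auto simp: fmeasurable_def top.not_eq_extremum)
  then show "measure (pos_part b \<sigma>) (E s \<inter> {p..r}) \<le> measure (pos_part b \<sigma>) (E t \<inter> {p..r})"
   using monoD[OF that(2) \<open>s \<le> t\<close>] that(3) by (intro measure_mono_fmeasurable) auto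
 qed
 have *: "(\<lambda>t. \<rho> (E t \<inter> {p..r})) \<in> Borel" if "mono E" "\<And>t. E t \<in> sets borel" for E :: "real \<Rightarrow> real set"
 proof -
  have "(\<lambda>t. \<rho> (E t \<inter> {p..r})) = (\<lambda>t. measure (pos_part b \<rho>) (E t \<inter> {p..r}) - measure (pos_part b (\<lambda>F. - \<rho> F)) (E t \<inter> {p..r}))"
   using that(2) by (intro ext jordan_bounded[OF \<rho>] bb) auto
  also have "\<dots> \<in> Borel"
   by (intro borel_measurable_diff borel_measurable_mono mono \<rho> real_local_measure_uminus that)
  finally show ?thesis .
 qed
 show "(\<lambda>t. \<rho> ({p..t} \<inter> {p..r})) \<in> Borel" by (rule *) (auto simp: mono_def)
 show "(\<lambda>t. \<rho> ({p..<t} \<inter> {p..r})) \<in> Borel" by (rule *) (auto simp: mono_def)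
qed

lemma local_measure_interval_measurable:
 assumes \<mu>: "local_measure b \<mu>" and p: "p \<in> ivl b" and r: "r \<in> ivl b"
 shows "(\<lambda>t. \<mu> ({p..t} \<inter> {p..r})) \<in> Borel" "(\<lambda>t. \<mu> ({p..<t} \<inter> {p..r})) \<in> Borel"
 unfolding borel_measurable_complex_iff
 using local_measure_parts[OF \<mu>] real_local_measure_interval_measurable[OF _ p r] by auto

lemma local_measure_Un:
 assumes \<mu>: "local_measure b \<mu>" and E: "E \<union> F \<in> bounded_borel b" "E \<in> sets borel" "F \<in> sets borel" "E \<inter> F = {}"
 shows "\<mu> (E \<union> F) = \<mu> E + \<mu> F"
proof -
 have "Re (\<mu> (E \<union> F)) = Re (\<mu> E) + Re (\<mu> F)"
  using ca_union[OF rlm_ca[OF local_measure_parts(1)[OF \<mu>] E(1)] E(2) _ E(3) _ E(4)] by simp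
 moreover have "Im (\<mu> (E \<union> F)) = Im (\<mu> E) + Im (\<mu> F)"
  using ca_union[OF rlm_ca[OF local_measure_parts(2)[OF \<mu>] E(1)] E(2) _ E(3) _ E(4)] by simp
 ultimately show ?thesis by (simp add: complex_eq_iff)
qed

text \<open>The increment of a balanced function is the value of its derivative on an interval whose endpoints count one half.
No limit has to be formed: the one-sided limits enter through their defining identities only.\<close>
lemma derivative_measure_increment:
 assumes bal: "balanced b u" and du: "derivative_measure b u du" and s: "s \<in> ivl b" and t: "t \<in> ivl b" and "s \<le> t"
 shows "u t - u s = du {s..t} - (1/2) *\<^sub>R du {s} - (1/2) *\<^sub>R du {t}"
proof -
 have 1: "du {s..t} = rlim u t - llim u s" "du {s} = rlim u s - llim u s" "du {t} = rlim u t - llim u t"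
  using du s t \<open>s \<le> t\<close> unfolding derivative_measure_def by (force simp flip: atLeastAtMost_singleton)+
 have 2: "u s = (1/2) *\<^sub>R (llim u s + rlim u s)" "u t = (1/2) *\<^sub>R (llim u t + rlim u t)"
  using bal s t by (auto simp: balanced_def)
 show ?thesis unfolding 1 2 by (simp add: vec_eq_iff algebra_simps)
qed

lemma derivative_measure_measurable:
 assumes bal: "balanced b u" and du: "derivative_measure b u du" and p: "p \<in> ivl b" and r: "r \<in> ivl b"
 shows "(\<lambda>x. indicat_real {p..r} x *\<^sub>R u x) \<in> Borel"
proof -
 have lm: "local_measure b (\<lambda>E. du E $ j)" for j using du by (simp add: derivative_measure_def)
 have "(\<lambda>x. (indicat_real {p..r} x *\<^sub>R u x) $ j) \<in> Borel" for j
 proof -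
  have eq: "u x $ j = u p $ j - (1/2) * du {p} $ j + (1/2) * (du ({p..x} \<inter> {p..r}) $ j + du ({p..<x} \<inter> {p..r}) $ j)"
   if x: "x \<in> {p..r}" for x
  proof -
   have xi: "x \<in> ivl b" using ivl_interval[OF p r] x by blast
   have e: "{p..x} \<inter> {p..r} = {p..<x} \<union> {x}" "{p..<x} \<inter> {p..r} = {p..<x}" "{p..<x} \<union> {x} = {p..x}" using x by auto
   have "du ({p..<x} \<union> {x}) $ j = du {p..<x} $ j + du {x} $ j"
    using bounded_borel_interval[OF p xi, of "{p..x}"] by (intro local_measure_Un[OF lm]) (auto simp only: e, auto)
   moreover have "u x $ j - u p $ j = du {p..x} $ j - (1/2) *\<^sub>R du {p} $ j - (1/2) *\<^sub>R du {x} $ j"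
    using derivative_measure_increment[OF bal du p xi] x by (simp flip: vector_minus_component vector_scaleR_component)
   ultimately show ?thesis unfolding e by (simp add: scaleR_conv_of_real algebra_simps)
  qed
  have "(\<lambda>x. (indicat_real {p..r} x *\<^sub>R u x) $ j) = (\<lambda>x. indicat_real {p..r} x *\<^sub>R (u p $ j - (1/2) * du {p} $ j + (1/2) * (du ({p..x} \<inter> {p..r}) $ j + du ({p..<x} \<inter> {p..r}) $ j)))"
  proof (rule ext)
   fix x show "(indicat_real {p..r} x *\<^sub>R u x) $ j = indicat_real {p..r} x *\<^sub>R (u p $ j - (1/2) * du {p} $ j + (1/2) * (du ({p..x} \<inter> {p..r}) $ j + du ({p..<x} \<inter> {p..r}) $ j))"
   proof (cases "x \<in> {p..r}")
    case True
    show ?thesis unfolding vector_scaleR_component eq[OF True] ..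
   next
    case False
    then have "indicat_real {p..r} x = 0" by (simp add: indicator_def)
    then show ?thesis by simp
   qed
  qed
  also have "\<dots> \<in> Borel"
   by (intro borel_measurable_scaleR borel_measurable_indicator borel_measurable_add borel_measurable_diff borel_measurable_times
     borel_measurable_const local_measure_interval_measurable[OF lm p r]) auto
  finally show ?thesis .
 qed
 then show ?thesis by (intro borel_measurable_vecI)
qed

lemma measurable_on_ivl:
 fixes u :: "real \<Rightarrow> complex^2"
 assumes b: "0 < b" and u: "\<And>p r. p \<in> ivl b \<Longrightarrow> r \<in> ivl b \<Longrightarrow> (\<lambda>x. indicat_real {p..r} x *\<^sub>R u x) \<in> Borel"
 shows "(\<lambda>x. indicat_real (ivl b) x *\<^sub>R u x) \<in> Borel"
proof -
 define R where "R = {p. fst p \<in> \<rat> \<and> snd p \<in> \<rat> \<and> fst p \<in> ivl b \<and> snd p \<in> ivl b}"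
 have "R \<subseteq> \<rat> \<times> \<rat>" by (auto simp: R_def)
 then have cnt: "countable R" by (rule countable_subset) (intro countable_SIGMA countable_rat)
 define C where "C = insert (- ivl b) ((\<lambda>p. {fst p..snd p}) ` R)"
 show ?thesis
 proof (rule measurable_piecewise_restrict[where C=C])
  show "countable C" using cnt by (simp add: C_def)
  show "\<Omega> \<inter> space borel \<in> sets borel" if "\<Omega> \<in> C" for \<Omega> using that by (auto simp: C_def)
  have "x \<in> \<Union>C" for x
  proof (cases "x \<in> ivl b")
   case True
   then obtain p q where "p \<in> \<rat>" "q \<in> \<rat>" "p \<in> ivl b" "q \<in> ivl b" "p \<le> x" "x \<le> q" using ivl_rational_interval by metis
   then have "{p..q} \<in> C" "x \<in> {p..q}" unfolding C_def R_def by (auto intro!: image_eqI[of _ _ "(p, q)"])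
   then show ?thesis by blast
  qed (simp add: C_def)
  then show "space borel \<subseteq> \<Union>C" by blast
  show "(\<lambda>x. indicat_real (ivl b) x *\<^sub>R u x) \<in> borel_measurable (restrict_space borel \<Omega>)" if \<Omega>: "\<Omega> \<in> C" for \<Omega>
  proof (cases "\<Omega> = - ivl b")
   case True
   have "(\<lambda>x. indicat_real \<Omega> x *\<^sub>R (indicat_real (ivl b) x *\<^sub>R u x)) = (\<lambda>x. 0)" unfolding True by (auto simp: indicator_def)
   then show ?thesis by (subst borel_measurable_restrict_space_iff) (simp_all add: True)
  next
   case False
   then have "\<Omega> \<in> (\<lambda>p. {fst p..snd p}) ` R" using \<Omega> by (simp add: C_def)
   then obtain d where "d \<in> R" "\<Omega> = {fst d..snd d}" by blast
   then obtain p r where pr: "p \<in> ivl b" "r \<in> ivl b" "\<Omega> = {p..r}" unfolding R_def by blast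
   have "(\<lambda>x. indicat_real \<Omega> x *\<^sub>R (indicat_real (ivl b) x *\<^sub>R u x)) = (\<lambda>x. indicat_real {p..r} x *\<^sub>R u x)"
    using ivl_interval[OF pr(1,2)] unfolding pr(3) by (intro ext) (simp add: indicator_def subset_iff)
   then show ?thesis using u[OF pr(1,2)] by (subst borel_measurable_restrict_space_iff) (simp_all add: pr(3))
  qed
 qed
qed

lemma locally_bv_bounded:
 assumes bv: "locally_bv b u" and s: "s \<in> ivl b" and t: "t \<in> ivl b"
 shows "\<exists>B. \<forall>x\<in>{s..t}. norm (u x) \<le> B"
proof -
 obtain C where C: "\<And>(n::nat) p. mono p \<Longrightarrow> (\<And>i. p i \<in> {s..t}) \<Longrightarrow> (\<Sum>i<n. norm (u (p (Suc i)) - u (p i))) \<le> C"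
  using bv s t unfolding locally_bv_def bounded_variation_on_def by meson
 have "norm (u x) \<le> norm (u s) + C" if x: "x \<in> {s..t}" for x
 proof -
  let ?p = "\<lambda>i::nat. if i = 0 then s else x"
  have "(\<Sum>i<1. norm (u (?p (Suc i)) - u (?p i))) \<le> C"
   using x by (intro C) (auto simp: mono_def)
  then have "norm (u x - u s) \<le> C" by simp
  then show ?thesis using norm_triangle_sub[of "u x" "u s"] by linarith
 qed
 then show ?thesis by blast
qed

lemma J_J: "J *v (J *v v) = - v"
 by (simp add: vec_eq_iff forall_2 matrix_vector_mult_def sum_2)

context represented_system begin

lemma entry_integrable:
 assumes U: "U \<in> Borel" and E: "E \<in> sets borel" "E \<subseteq> {0..c}" "c \<in> dom" and B: "\<And>x. x \<in> E \<Longrightarrow> norm (U x) \<le> B"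
 shows "set_integrable \<nu> E (\<lambda>x. Q x $ j $ k * U x $ k)" "set_integrable \<nu> E (\<lambda>x. W x $ j $ k * U x $ k)"
proof -
 note [measurable] = U
 have n: "norm (U x $ k) \<le> B" if "x \<in> E" for x using order_trans[OF component_norm_le B[OF that]] .
 show "set_integrable \<nu> E (\<lambda>x. Q x $ j $ k * U x $ k)"
  by (rule set_integrableI_bounded[OF _ E, where B="K * B"]) (use n Q_bound K_nonneg in \<open>auto simp: norm_mult intro!: mult_mono\<close>)
 show "set_integrable \<nu> E (\<lambda>x. W x $ j $ k * U x $ k)"
  by (rule set_integrableI_bounded[OF _ E, where B="K * B"]) (use n W_bound K_nonneg in \<open>auto simp: norm_mult intro!: mult_mono\<close>)
qed

lemma gen_set_integral:
 assumes U: "U \<in> Borel" and E: "E \<in> sets borel" "E \<subseteq> {0..c}" "c \<in> dom" and B: "\<And>x. x \<in> E \<Longrightarrow> norm (U x) \<le> B"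
 shows "(LINT x:E|\<nu>. A z x *v U x) =
  J *v ((\<chi> j. \<Sum>k\<in>UNIV. LINT x:E|\<nu>. Q x $ j $ k * U x $ k) - z *s (\<chi> j. \<Sum>k\<in>UNIV. LINT x:E|\<nu>. W x $ j $ k * U x $ k))"
proof -
 note I = entry_integrable[OF U E B]
 have i: "integrable \<nu> (\<lambda>x. indicat_real E x *\<^sub>R (A z x *v U x))"
 proof -
  have "norm (A z x *v U x) \<le> C_gen z * B" if "x \<in> E" for x
   using order_trans[OF gen_norm_le mult_left_mono[OF B[OF that] C_gen_nonneg]] .
  then show ?thesis using set_integrableI_bounded[OF gen_measurable[OF U] E, where B="C_gen z * B"] unfolding set_integrable_def by blast
 qed
 have c: "(LINT x:E|\<nu>. A z x *v U x) $ j = (LINT x:E|\<nu>. (A z x *v U x) $ j)" for j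
  using integral_bounded_linear[OF bounded_linear_vec_nth i] by (simp add: set_lebesgue_integral_def)
 have lin: "(LINT x:E|\<nu>. (Q x $ j $ 1 * U x $ 1 + Q x $ j $ 2 * U x $ 2) - z * (W x $ j $ 1 * U x $ 1 + W x $ j $ 2 * U x $ 2)) =
  (LINT x:E|\<nu>. Q x $ j $ 1 * U x $ 1) + (LINT x:E|\<nu>. Q x $ j $ 2 * U x $ 2) - z * ((LINT x:E|\<nu>. W x $ j $ 1 * U x $ 1) + (LINT x:E|\<nu>. W x $ j $ 2 * U x $ 2))" for j
  by (simp add: I set_integral_add set_integral_diff set_integrable_mult_right)
 have 1: "(A z x *v U x) $ 1 = - ((Q x $ 2 $ 1 * U x $ 1 + Q x $ 2 $ 2 * U x $ 2) - z * (W x $ 2 $ 1 * U x $ 1 + W x $ 2 $ 2 * U x $ 2))" for x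
  by (simp add: gen_components algebra_simps)
 have 2: "(A z x *v U x) $ 2 = (Q x $ 1 $ 1 * U x $ 1 + Q x $ 1 $ 2 * U x $ 2) - z * (W x $ 1 $ 1 * U x $ 1 + W x $ 1 $ 2 * U x $ 2)" for x
  by (simp add: gen_components algebra_simps)
 have neg: "(LINT x:E|\<nu>. - f x) = - (LINT x:E|\<nu>. f x)" for f :: "real \<Rightarrow> complex"
  by (simp add: set_lebesgue_integral_def)
 show ?thesis
  unfolding vec_eq_iff forall_2 c 1 2 neg lin by (simp add: matrix_vector_mult_def sum_2)
qed

lemma mat_times_integral:
 assumes U: "U \<in> Borel" and E: "E \<in> bounded_borel \<beta>" and B: "\<And>x. x \<in> E \<Longrightarrow> norm (U x) \<le> B" and eq: "\<And>x. x \<in> E \<Longrightarrow> u x = U x"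
 shows "mat_times \<beta> q u E = (\<chi> j. \<Sum>k\<in>UNIV. LINT x:E|\<nu>. Q x $ j $ k * U x $ k)"
  "mat_times \<beta> w u E = (\<chi> j. \<Sum>k\<in>UNIV. LINT x:E|\<nu>. W x $ j $ k * U x $ k)"
proof -
 note [measurable] = U
 have [measurable]: "E \<in> sets borel" using E by (rule bounded_borel_sets)
 have m: "(\<lambda>x. indicat_real E x *\<^sub>R u x $ k) \<in> Borel" for k
 proof -
  have "(\<lambda>x. indicat_real E x *\<^sub>R u x $ k) = (\<lambda>x. indicat_real E x *\<^sub>R U x $ k)"
  proof (rule ext)
   fix x show "indicat_real E x *\<^sub>R u x $ k = indicat_real E x *\<^sub>R U x $ k" by (cases "x \<in> E") (simp_all add: eq)
  qed
  also have "\<dots> \<in> Borel" by measurable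
  finally show ?thesis .
 qed
 have n: "norm (u x $ k) \<le> B" if "x \<in> E" for x k
  using order_trans[OF component_norm_le B[OF that]] by (simp add: eq[OF that])
 have c: "(LINT x:E|\<nu>. g x * u x $ k) = (LINT x:E|\<nu>. g x * U x $ k)" for g k
  unfolding set_lebesgue_integral_def
 proof (intro bochner_cong refl)
  fix x show "indicat_real E x *\<^sub>R (g x * u x $ k) = indicat_real E x *\<^sub>R (g x * U x $ k)" by (cases "x \<in> E") (simp_all add: eq)
 qed
 show "mat_times \<beta> q u E = (\<chi> j. \<Sum>k\<in>UNIV. LINT x:E|\<nu>. Q x $ j $ k * U x $ k)"
  unfolding mat_times_def by (simp add: q_integral[OF E m n] c)
 show "mat_times \<beta> w u E = (\<chi> j. \<Sum>k\<in>UNIV. LINT x:E|\<nu>. W x $ j $ k * U x $ k)"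
  unfolding mat_times_def by (simp add: w_integral[OF E m n] c)
qed

lemma ivl_dom: "x \<in> ivl \<beta> \<Longrightarrow> x \<in> dom"
 using ivl_eq_dom by blast

lemma bounded_borel_dom:
 assumes "E \<in> bounded_borel \<beta>"
 obtains c where "c \<in> ivl \<beta>" "c \<in> dom" "E \<subseteq> {0..c}"
proof -
 obtain c where "c \<in> ivl \<beta>" "E \<subseteq> {0<..<c}" using bounded_borel_below[OF beta_pos assms] .
 then show ?thesis using that ivl_dom by (meson greaterThanLessThan_subseteq_atLeastAtMost_iff order.refl order_trans)
qed

lemma solution_integral_equation:
 assumes sol: "is_solution \<beta> q w z u" and U_def: "U = (\<lambda>x. indicat_real (ivl \<beta>) x *\<^sub>R u x)"
 shows "U \<in> Borel"
  and "\<And>s t. s \<in> ivl \<beta> \<Longrightarrow> t \<in> ivl \<beta> \<Longrightarrow> s \<le> t \<Longrightarrow> u t - u s = hint (\<lambda>y. A z y *v U y) s t"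
proof -
 obtain du where bv: "locally_bv \<beta> u" and bal: "balanced \<beta> u" and du: "derivative_measure \<beta> u du"
  and eqn: "\<And>E. E \<in> bounded_borel \<beta> \<Longrightarrow> J *v du E + mat_times \<beta> q u E = z *s mat_times \<beta> w u E"
  using sol unfolding is_solution_def by blast
 show U: "U \<in> Borel" unfolding U_def
  by (rule measurable_on_ivl[OF beta_pos]) (rule derivative_measure_measurable[OF bal du])
 have Uu: "U x = u x" if "x \<in> ivl \<beta>" for x using that by (simp add: U_def)
 fix s t assume st: "s \<in> ivl \<beta>" "t \<in> ivl \<beta>" "s \<le> t"
 obtain B where B: "\<And>x. x \<in> {s..t} \<Longrightarrow> norm (u x) \<le> B" using locally_bv_bounded[OF bv st(1,2)] by blast
 note sub = ivl_interval[OF st(1,2)]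
 have UB: "norm (U x) \<le> B" if "x \<in> {s..t}" for x using B[OF that] Uu[of x] sub that by auto
 have t0: "0 \<le> s" using st by (simp add: ivl_def)
 have duI: "du E = (LINT x:E|\<nu>. A z x *v U x)" if E: "E \<in> sets borel" "E \<subseteq> {s..t}" for E
 proof -
  have bb: "E \<in> bounded_borel \<beta>" by (rule bounded_borel_interval[OF st(1,2) E])
  have Ec: "E \<subseteq> {0..t}" using E(2) t0 by auto
  have b: "norm (U x) \<le> B" if "x \<in> E" for x using UB E(2) that by blast
  have e: "u x = U x" if "x \<in> E" for x using Uu[of x] sub E(2) that by auto
  have m: "mat_times \<beta> q u E = (\<chi> j. \<Sum>k\<in>UNIV. LINT x:E|\<nu>. Q x $ j $ k * U x $ k)"
   "mat_times \<beta> w u E = (\<chi> j. \<Sum>k\<in>UNIV. LINT x:E|\<nu>. W x $ j $ k * U x $ k)"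
   by (rule mat_times_integral[OF U bb]; erule b e)+
  have g: "(LINT x:E|\<nu>. A z x *v U x) = J *v ((\<chi> j. \<Sum>k\<in>UNIV. LINT x:E|\<nu>. Q x $ j $ k * U x $ k) - z *s (\<chi> j. \<Sum>k\<in>UNIV. LINT x:E|\<nu>. W x $ j $ k * U x $ k))"
   by (rule gen_set_integral[OF U E(1) Ec ivl_dom[OF st(2)]]) (rule b)
  have "J *v du E = z *s mat_times \<beta> w u E - mat_times \<beta> q u E" using eqn[OF bb] by (simp add: algebra_simps)
  then have "- (J *v (J *v du E)) = - (J *v (z *s mat_times \<beta> w u E - mat_times \<beta> q u E))" by simp
  then have "du E = J *v (mat_times \<beta> q u E - z *s mat_times \<beta> w u E)"
   unfolding J_J by (simp add: matrix_vector_mult_diff_distrib)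
  then show ?thesis unfolding g m .
 qed
 have int: "set_integrable \<nu> E (\<lambda>x. A z x *v U x)" if E: "E \<in> sets borel" "E \<subseteq> {s..t}" for E
 proof (rule set_integrableI_bounded[OF gen_measurable[OF U] E(1)])
  show "E \<subseteq> {0..t}" using E(2) t0 by auto
  show "norm (A z x *v U x) \<le> C_gen z * B" if "x \<in> E" for x
   using order_trans[OF gen_norm_le mult_left_mono[OF UB C_gen_nonneg]] that E(2) by blast
 qed (rule ivl_dom[OF st(2)])
 show "u t - u s = hint (\<lambda>y. A z y *v U y) s t"
 proof (cases "s = t")
  case False
  then have lt: "s < t" using st(3) by simp
  have "(LINT x:{s..<t} \<union> {t}|\<nu>. A z x *v U x) = (LINT x:{s..<t}|\<nu>. A z x *v U x) + (LINT x:{t}|\<nu>. A z x *v U x)"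
   using lt by (intro set_integral_Un int) auto
  moreover have "(LINT x:{s} \<union> {s<..t}|\<nu>. A z x *v U x) = (LINT x:{s}|\<nu>. A z x *v U x) + (LINT x:{s<..t}|\<nu>. A z x *v U x)"
   using lt by (intro set_integral_Un int) auto
  moreover have "{s..<t} \<union> {t} = {s..t}" "{s} \<union> {s<..t} = {s..t}" using lt by auto
  ultimately have 1: "du {s..t} = (LINT x:{s..<t}|\<nu>. A z x *v U x) + du {t}" "du {s..t} = du {s} + (LINT x:{s<..t}|\<nu>. A z x *v U x)"
   using lt by (simp_all add: duI)
  have "u t - u s = du {s..t} - (1/2) *\<^sub>R du {s} - (1/2) *\<^sub>R du {t}"
   by (rule derivative_measure_increment[OF bal du st])
  also have "\<dots> = (1/2) *\<^sub>R ((du {s..t} - du {t}) + (du {s..t} - du {s}))" by (simp add: vec_eq_iff algebra_simps)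
  also have "\<dots> = hint (\<lambda>y. A z y *v U y) s t" unfolding hint_def using 1(1)[symmetric] 1(2)[symmetric] by (simp add: eq_diff_eq[symmetric] add.commute)
  finally show ?thesis .
 qed simp
qed

text \<open>Solutions are a priori of bounded variation on compact subintervals only. Near 0 the measure is small, as 0
is not an atom, and the integral equation bounds \<open>u\<close> on \<open>[s, r]\<close> by its value at \<open>r\<close>, uniformly in \<open>s\<close>.\<close>
lemma solution_bounded_near_0:
 assumes sol: "is_solution \<beta> q w z u" and c: "c \<in> ivl \<beta>"
 shows "\<exists>B. \<forall>x\<in>{0<..c}. norm (u x) \<le> B"
proof -
 define U where "U = (\<lambda>x. indicat_real (ivl \<beta>) x *\<^sub>R u x)"
 note U = solution_integral_equation[OF sol U_def]
 have bv: "locally_bv \<beta> u" using sol by (simp add: is_solution_def)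
 have Uu: "U x = u x" if "x \<in> ivl \<beta>" for x using that by (simp add: U_def)
 obtain d where d: "d > 0" "\<And>a b E. 0 \<le> a \<Longrightarrow> a \<le> 0 \<Longrightarrow> 0 \<le> b \<Longrightarrow> b \<le> c \<Longrightarrow> b - a < d \<Longrightarrow> E \<in> sets borel \<Longrightarrow> E \<subseteq> {a..b} - {0} \<Longrightarrow> C_gen z * mass E \<le> 1/4"
  using small_neighbourhood[OF ivl_dom[OF c], where x=0 and z=z] by metis
 define r where "r = min c (d / 2)"
 have c0: "0 < c" using c by (simp add: ivl_def)
 have r0: "0 < r" "r \<le> c" "r < d" using c0 d(1) by (auto simp: r_def)
 have ri: "r \<in> ivl \<beta>" using r0 c le_less_trans[of "ereal r" "ereal c" \<beta>] by (simp add: ivl_def)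
 have near: "norm (u s) \<le> 2 * norm (u r)" if s: "0 < s" "s \<le> r" for s
 proof -
  have si: "s \<in> ivl \<beta>" using s ri le_less_trans[of "ereal s" "ereal r" \<beta>] by (simp add: ivl_def)
  note sub = ivl_interval[OF si ri]
  obtain B where B: "\<And>x. x \<in> {s..r} \<Longrightarrow> norm (u x) \<le> B" using locally_bv_bounded[OF bv si ri] by blast
  define M where "M = (SUP x\<in>{s..r}. norm (u x))"
  have bdd: "bdd_above ((\<lambda>x. norm (u x)) ` {s..r})" using B by (intro bdd_aboveI2)
  have up: "norm (u x) \<le> M" if "x \<in> {s..r}" for x unfolding M_def using bdd that by (intro cSUP_upper)
  have M0: "0 \<le> M" using order_trans[OF norm_ge_zero up[of s]] s by simp
  have "norm (u x) \<le> norm (u r) + M / 4" if x: "x \<in> {s..r}" for x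
  proof -
   have xi: "x \<in> ivl \<beta>" using x sub by blast
   have eq: "u r - u x = hint (\<lambda>y. A z y *v U y) x r" using x by (intro U(2) xi ri) auto
   have "norm (hint (\<lambda>y. A z y *v U y) x r) \<le> (C_gen z * M) * mass {x..r}"
   proof (rule hint_bound[OF gen_measurable[OF U(1)]])
    show "norm (A z y *v U y) \<le> C_gen z * M" if "y \<in> {x..r}" for y
    proof -
     have "y \<in> {s..r}" using that x by auto
     then show ?thesis using up[of y] Uu[of y] sub by (intro order_trans[OF gen_norm_le mult_left_mono[OF _ C_gen_nonneg]]) auto
    qed
   qed (use x s M0 ivl_dom[OF ri] C_gen_nonneg in auto)
   also have "\<dots> = M * (C_gen z * mass {x..r})" by simp
   also have "\<dots> \<le> M * (1/4)" using x s r0 by (intro mult_left_mono d(2)[of 0 r] M0) auto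
   finally have "norm (u r - u x) \<le> M / 4" unfolding eq by simp
   then show ?thesis using norm_triangle_ineq4[of "u r" "u r - u x"] by simp
  qed
  then have "M \<le> norm (u r) + M / 4" unfolding M_def using s by (intro cSUP_least) auto
  then have "M \<le> 2 * norm (u r)" using M0 by linarith
  then show ?thesis using up[of s] s by auto
 qed
 obtain B where B: "\<And>x. x \<in> {r..c} \<Longrightarrow> norm (u x) \<le> B" using locally_bv_bounded[OF bv ri c] by blast
 have "norm (u x) \<le> max (2 * norm (u r)) B" if "x \<in> {0<..c}" for x
  using near[of x] B[of x] that by (cases "x \<le> r") auto
 then show ?thesis by blast
qed

text \<open>The value at 0 is prescribed by the integral equation from any base point \<open>r\<close>, the integral up to 0 being finite by
\<open>solution_bounded_near_0\<close>.\<close>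
theorem solution_extends:
 assumes sol: "is_solution \<beta> q w z u"
 obtains v where "gsol z v" "\<And>x. x \<in> ivl \<beta> \<Longrightarrow> v x = u x"
proof -
 define U where "U = (\<lambda>x. indicat_real (ivl \<beta>) x *\<^sub>R u x)"
 note U = solution_integral_equation[OF sol U_def]
 note [measurable] = U(1)
 have Uu: "U x = u x" if "x \<in> ivl \<beta>" for x using that by (simp add: U_def)
 obtain r where r: "r \<in> ivl \<beta>" using ivl_nonempty[OF beta_pos] by blast
 let ?f = "\<lambda>y. A z y *v U y"
 define e where "e = u r - hint ?f 0 r"
 define v where "v x = (if x \<in> ivl \<beta> then u x else e)" for x
 have vU: "v = (\<lambda>x. U x + indicat_real (- ivl \<beta>) x *\<^sub>R e)" by (rule ext) (simp add: v_def U_def)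
 have vm [measurable]: "v \<in> Borel" unfolding vU by measurable
 have bd: "\<exists>B. 0 \<le> B \<and> (\<forall>x\<in>{0..c}. norm (v x) \<le> B \<and> norm (U x) \<le> B)" if c: "c \<in> dom" for c
 proof (cases "c = 0")
  case True
  have "0 \<notin> ivl \<beta>" by (simp add: ivl_def)
  then show ?thesis by (intro exI[of _ "norm e"]) (simp add: True v_def U_def)
 next
  case False
  then have ci: "c \<in> ivl \<beta>" using c ivl_eq_dom by blast
  obtain B where B: "\<And>x. x \<in> {0<..c} \<Longrightarrow> norm (u x) \<le> B" using solution_bounded_near_0[OF sol ci] by blast
  have "norm (v x) \<le> max \<bar>B\<bar> (norm e) \<and> norm (U x) \<le> max \<bar>B\<bar> (norm e)" if "x \<in> {0..c}" for x
   using B[of x] that by (cases "x \<in> ivl \<beta>") (auto simp: v_def U_def ivl_def)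
  then show ?thesis by (intro exI[of _ "max \<bar>B\<bar> (norm e)"]) auto
 qed
 have eqn: "v x = e + hint ?f 0 x" if x: "x \<in> ivl \<beta>" for x
 proof -
  have add: "hint ?f 0 t = hint ?f 0 s + hint ?f s t" if st: "s \<in> ivl \<beta>" "t \<in> ivl \<beta>" "s \<le> t" for s t
  proof -
   obtain B where "0 \<le> B" "\<forall>x\<in>{0..t}. norm (v x) \<le> B \<and> norm (U x) \<le> B" using bd[OF ivl_dom[OF st(2)]] by blast
   then have "norm (?f x) \<le> C_gen z * B" if "x \<in> {0..t}" for x
    using that by (intro order_trans[OF gen_norm_le mult_left_mono[OF _ C_gen_nonneg]]) auto
   then show ?thesis using st ivl_dom[OF st(2)] by (intro hint_add[OF gen_measurable[OF U(1)]]) (auto simp: ivl_def)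
  qed
  have "u x = e + hint ?f 0 x"
  proof (cases "x \<le> r")
   case True
   have "hint ?f 0 r = hint ?f 0 x + (u r - u x)" unfolding U(2)[OF x r True] by (rule add[OF x r True])
   then show ?thesis by (simp add: e_def)
  next
   case False
   then have "r \<le> x" by simp
   have "hint ?f 0 x = hint ?f 0 r + (u x - u r)" unfolding U(2)[OF r x \<open>r \<le> x\<close>] by (rule add[OF r x \<open>r \<le> x\<close>])
   then show ?thesis by (simp add: e_def)
  qed
  then show ?thesis using x by (simp add: v_def)
 qed
 have hc: "hint (\<lambda>y. A z y *v v y) 0 x = hint ?f 0 x" if x: "x \<in> dom" for x
 proof (rule hint_cong_AE)
  have "AE y in \<nu>. y \<in> ivl \<beta>" using null_outside by (intro AE_I[where N="- ivl \<beta>"]) auto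
  then show "AE y in \<nu>. y \<in> {0..x} \<longrightarrow> A z y *v v y = ?f y"
   by eventually_elim (simp add: v_def Uu)
 qed (intro gen_measurable vm U(1))+
 have "gsol z v"
  unfolding gsol_def sol_def
 proof (intro ballI conjI)
  fix c assume c: "c \<in> dom"
  show "v \<in> Borel" by (rule vm)
  show "\<exists>B. \<forall>x\<in>{0..c}. norm (v x) \<le> B" using bd[OF c] by blast
  fix x assume x: "x \<in> {0..c}"
  then have xd: "x \<in> dom" using dom_down[OF c] by auto
  show "v x = v 0 + hint (\<lambda>y. A z y *v v y) 0 x"
  proof (cases "x = 0")
   case False
   then have xi: "x \<in> ivl \<beta>" using xd ivl_eq_dom by blast
   have "v 0 = e" by (simp add: v_def ivl_def)
   then show ?thesis unfolding hc[OF xd] using eqn[OF xi] by simp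
  qed simp
 qed
 then show ?thesis by (rule that) (simp add: v_def)
qed

end

section \<open>Solutions of the integral equation are solutions in the sense of local measures\<close>

lemma open_ivl: "open (ivl b)"
proof -
 have "ivl b = {0<..} \<inter> {x. ereal x < b}" by (auto simp: ivl_def)
 moreover have "open {x. ereal x < b}" by (intro open_Collect_less continuous_intros)
 ultimately show ?thesis by (simp add: open_Int)
qed

lemma one_sided_limits_cong:
 assumes eq: "\<And>x. x \<in> ivl b \<Longrightarrow> u x = v x" and x: "x \<in> ivl b"
 shows "llim u x = llim v x" "rlim u x = rlim v x"
proof -
 have ev: "eventually (\<lambda>y. u y = v y) (at x within S)" for S
  unfolding eventually_at_filter using eventually_nhds_in_open[OF open_ivl x] by eventually_elim (simp add: eq)
 show "llim u x = llim v x" "rlim u x = rlim v x"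
  unfolding llim_def rlim_def t2_space_class.Lim_def tendsto_cong[OF ev] by (rule refl)+
qed

lemma cm_integral_cong:
 assumes "\<And>x. x \<in> E \<Longrightarrow> f x = g x"
 shows "cm_integral b \<mu> f E = cm_integral b \<mu> g E"
proof -
 have "(\<lambda>x. indicat_real E x *\<^sub>R f x) = (\<lambda>x. indicat_real E x *\<^sub>R g x)"
 proof (rule ext)
  fix x show "indicat_real E x *\<^sub>R f x = indicat_real E x *\<^sub>R g x" by (cases "x \<in> E") (simp_all add: assms)
 qed
 then show ?thesis by (simp add: cm_integral_def signed_integral_def set_lebesgue_integral_def)
qed

lemma is_solution_cong:
 assumes u: "is_solution b q w z u" and eq: "\<And>x. x \<in> ivl b \<Longrightarrow> u x = v x"
 shows "is_solution b q w z v"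
proof -
 obtain du where bv: "locally_bv b u" and bal: "balanced b u" and du: "derivative_measure b u du"
  and eqn: "\<And>E. E \<in> bounded_borel b \<Longrightarrow> J *v du E + mat_times b q u E = z *s mat_times b w u E"
  using u unfolding is_solution_def by blast
 note lims = one_sided_limits_cong[of b u v, OF eq]
 have mt: "mat_times b m u E = mat_times b m v E" if "E \<in> bounded_borel b" for m E
 proof -
  have "cm_integral b (entry m j k) (\<lambda>x. u x $ k) E = cm_integral b (entry m j k) (\<lambda>x. v x $ k) E" for j k
   using bounded_borel_ivl[OF that] by (intro cm_integral_cong) (auto simp: eq)
  then show ?thesis by (simp add: mat_times_def)
 qed
 have "locally_bv b v"
  unfolding locally_bv_def
 proof (intro ballI)
  fix s t assume st: "s \<in> ivl b" "t \<in> ivl b"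
  have eqs: "(\<Sum>i<n. norm (v (p (Suc i)) - v (p i))) = (\<Sum>i<n. norm (u (p (Suc i)) - u (p i)))" if "\<forall>i. p i \<in> {s..t}" for n :: nat and p
  proof -
   have "p i \<in> ivl b" for i using that ivl_interval[OF st] by blast
   then show ?thesis by (simp add: eq)
  qed
  obtain C where C: "\<And>(n::nat) p. mono p \<Longrightarrow> \<forall>i. p i \<in> {s..t} \<Longrightarrow> (\<Sum>i<n. norm (u (p (Suc i)) - u (p i))) \<le> C"
   using bv st unfolding locally_bv_def bounded_variation_on_def by meson
  show "bounded_variation_on s t v" unfolding bounded_variation_on_def
  proof (intro exI[of _ C] allI impI)
   fix n :: nat and p :: "nat \<Rightarrow> real" assume p: "mono p" "\<forall>i. p i \<in> {s..t}"
   show "(\<Sum>i<n. norm (v (p (Suc i)) - v (p i))) \<le> C" unfolding eqs[OF p(2)] by (rule C[OF p])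
  qed
 qed
 moreover have "balanced b v" using bal unfolding balanced_def by (simp add: eq[symmetric] lims[symmetric])
 moreover have "derivative_measure b v du" using du unfolding derivative_measure_def by (simp add: lims[symmetric])
 ultimately show ?thesis unfolding is_solution_def using eqn by (metis mt)
qed

lemma half_sum_left:
 fixes L :: "'a::real_vector"
 assumes "L = X + Y" "L = X' + Y'"
 shows "u0 + (1/2) *\<^sub>R (X + X') - (u0 + L) = - ((1/2) *\<^sub>R (Y + Y'))"
proof -
 have Y: "Y = L - X" using assms(1) by simp
 have Y': "Y' = L - X'" using assms(2) by simp
 have "Y + Y' = (L + L) - (X + X')" unfolding Y Y' by simp
 then show ?thesis by (simp only: scaleR_diff_right scaleR_half_double) simp
qed

lemma half_sum_right:
 fixes R :: "'a::real_vector"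
 assumes "X = R + Y" "X' = R + Y'"
 shows "u0 + (1/2) *\<^sub>R (X + X') - (u0 + R) = (1/2) *\<^sub>R (Y + Y')"
proof -
 have "X + X' = (R + R) + (Y + Y')" using assms by simp
 then have "(1/2) *\<^sub>R (X + X') = R + (1/2) *\<^sub>R (Y + Y')" by (simp only: scaleR_add_right[of _ "R + R"] scaleR_half_double)
 then show ?thesis by simp
qed

context represented_system begin

lemma gsol_gen_bounded:
 assumes u: "gsol z u" and c: "c \<in> dom"
 obtains B where "0 \<le> B" "\<And>x. x \<in> {0..c} \<Longrightarrow> norm (u x) \<le> B" "\<And>x. x \<in> {0..c} \<Longrightarrow> norm (A z x *v u x) \<le> B"
 using sol_gen_bounded[of z 0 c u] u c unfolding gsol_def by metis

lemma gsol_gen_integrable: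
 assumes u: "gsol z u" and c: "c \<in> dom" and E: "E \<in> sets borel" "E \<subseteq> {0..c}"
 shows "set_integrable \<nu> E (\<lambda>x. A z x *v u x)"
proof -
 obtain B where B: "0 \<le> B" "\<And>x. x \<in> {0..c} \<Longrightarrow> norm (A z x *v u x) \<le> B" using gsol_gen_bounded[OF u c] by metis
 show ?thesis using E B(2) by (intro set_integrableI_bounded[OF gen_measurable[OF gsol_meas[OF u]] E c, where B=B]) auto
qed

definition right_lim :: "complex \<Rightarrow> (real \<Rightarrow> complex^2) \<Rightarrow> real \<Rightarrow> complex^2" where
 "right_lim z u x = u 0 + (LINT y:{0..x}|\<nu>. A z y *v u y)"

lemma gsol_near_limits:
 assumes u: "gsol z u" and c: "c \<in> dom" and B: "\<And>x. x \<in> {0..c} \<Longrightarrow> norm (A z x *v u x) \<le> B"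
 shows "0 \<le> y \<Longrightarrow> y < x \<Longrightarrow> x \<le> c \<Longrightarrow> norm (u y - left_lim z u x) \<le> B * mass {y..<x}"
  and "0 \<le> x \<Longrightarrow> x < y \<Longrightarrow> y \<le> c \<Longrightarrow> norm (u y - right_lim z u x) \<le> B * mass {x<..y}"
proof -
 let ?f = "\<lambda>y. A z y *v u y"
 note m = gen_measurable[OF gsol_meas[OF u], of z]
 note i = gsol_gen_integrable[OF u c]
 have B0: "0 \<le> B" using B[of 0] domD(1)[OF c] order_trans[OF norm_ge_zero] by force
 have val: "u y = u 0 + (1/2) *\<^sub>R ((LINT t:{0..<y}|\<nu>. ?f t) + (LINT t:{0..y}|\<nu>. ?f t))" if "0 \<le> y" "y \<le> c" for y
  using sol_eq[of z 0 c u y] that u c unfolding gsol_def hint_from_zero[OF m] by auto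
 have nb: "norm (LINT t:E|\<nu>. ?f t) \<le> B * mass F" if "E \<in> sets borel" "F \<in> sets borel" "E \<subseteq> F" "F \<subseteq> {0..c}" for E F
 proof -
  have "norm (LINT t:E|\<nu>. ?f t) \<le> B * mass E" using that B by (intro set_integral_norm_le[OF m _ _ c]) auto
  also have "mass E \<le> mass F"
   using that emeasure_finite[OF that(4) c] by (intro measure_mono_fmeasurable) (auto simp: fmeasurable_def)
  finally show ?thesis using B0 by (simp add: mult_left_mono)
 qed
 have half: "norm ((1/2) *\<^sub>R (a + b)) \<le> D" if "norm a \<le> D" "norm b \<le> D" for a b :: "complex^2" and D
  using norm_triangle_ineq[of a b] that by simp
 show "norm (u y - left_lim z u x) \<le> B * mass {y..<x}" if h: "0 \<le> y" "y < x" "x \<le> c"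
 proof -
  have "(LINT t:{0..<y} \<union> {y..<x}|\<nu>. ?f t) = (LINT t:{0..<y}|\<nu>. ?f t) + (LINT t:{y..<x}|\<nu>. ?f t)"
   using h by (intro set_integral_Un i) auto
  moreover have "(LINT t:{0..y} \<union> {y<..<x}|\<nu>. ?f t) = (LINT t:{0..y}|\<nu>. ?f t) + (LINT t:{y<..<x}|\<nu>. ?f t)"
   using h by (intro set_integral_Un i) auto
  moreover have "{0..<y} \<union> {y..<x} = {0..<x}" "{0..y} \<union> {y<..<x} = {0..<x}" using h by auto
  ultimately have "u y - left_lim z u x = - ((1/2) *\<^sub>R ((LINT t:{y..<x}|\<nu>. ?f t) + (LINT t:{y<..<x}|\<nu>. ?f t)))"
   unfolding left_lim_def val[OF h(1) less_imp_le[OF less_le_trans[OF h(2,3)]]] by (intro half_sum_left) simp_all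
  then show ?thesis using h by (simp only: norm_minus_cancel) (intro half nb; force)
 qed
 show "norm (u y - right_lim z u x) \<le> B * mass {x<..y}" if h: "0 \<le> x" "x < y" "y \<le> c"
 proof -
  have "(LINT t:{0..x} \<union> {x<..<y}|\<nu>. ?f t) = (LINT t:{0..x}|\<nu>. ?f t) + (LINT t:{x<..<y}|\<nu>. ?f t)"
   using h by (intro set_integral_Un i) auto
  moreover have "(LINT t:{0..x} \<union> {x<..y}|\<nu>. ?f t) = (LINT t:{0..x}|\<nu>. ?f t) + (LINT t:{x<..y}|\<nu>. ?f t)"
   using h by (intro set_integral_Un i) auto
  moreover have "{0..x} \<union> {x<..<y} = {0..<y}" "{0..x} \<union> {x<..y} = {0..y}" using h by auto
  ultimately have "u y - right_lim z u x = (1/2) *\<^sub>R ((LINT t:{x<..<y}|\<nu>. ?f t) + (LINT t:{x<..y}|\<nu>. ?f t))"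
   unfolding right_lim_def val[OF less_imp_le[OF le_less_trans[OF h(1,2)]] h(3)] by (intro half_sum_right) simp_all
  then show ?thesis using h by (simp only:) (intro half nb; force)
 qed
qed

lemma gsol_limits:
 assumes u: "gsol z u" and x: "x \<in> ivl \<beta>"
 shows "(u \<longlongrightarrow> left_lim z u x) (at_left x)" "(u \<longlongrightarrow> right_lim z u x) (at_right x)"
proof -
 obtain c where c: "c \<in> dom" "x < c" using dom_increase[OF ivl_dom[OF x]] by blast
 obtain B where B: "0 \<le> B" "\<And>x. x \<in> {0..c} \<Longrightarrow> norm (A z x *v u x) \<le> B" using gsol_gen_bounded[OF u c(1)] by metis
 note near = gsol_near_limits[OF u c(1) B(2)]
 have x0: "0 < x" using x by (simp add: ivl_def)
 have small: "\<exists>d>0. \<forall>E. E \<in> sets borel \<longrightarrow> E \<subseteq> {x-d..x+d} \<inter> {0..c} - {x} \<longrightarrow> B * mass E < e" if e: "e > 0" for e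
 proof -
  have "0 < e / (B + 1)" using e B(1) by simp
  from small_punctured[OF c(1) this, of x] obtain d where d: "d > 0" "mass ({x-d..x+d} \<inter> {0..c} - {x}) < e / (B + 1)" by blast
  have "B * mass E < e" if E: "E \<in> sets borel" "E \<subseteq> {x-d..x+d} \<inter> {0..c} - {x}" for E
  proof -
   have "emeasure \<nu> ({x-d..x+d} \<inter> {0..c} - {x}) < \<infinity>" by (rule emeasure_finite[OF _ c(1)]) auto
   then have "mass E \<le> mass ({x-d..x+d} \<inter> {0..c} - {x})"
    using E by (intro measure_mono_fmeasurable) (auto simp: fmeasurable_def)
   then have "mass E < e / (B + 1)" using d(2) by linarith
   then have "(B + 1) * mass E < e" using B(1) by (simp add: pos_less_divide_eq mult.commute)
   moreover have "(B + 1) * mass E = B * mass E + mass E" by (simp add: algebra_simps)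
   ultimately show ?thesis using measure_nonneg[of \<nu> E] by linarith
  qed
  then show ?thesis using d(1) by blast
 qed
 show "(u \<longlongrightarrow> left_lim z u x) (at_left x)"
 proof (rule tendstoI)
  fix e :: real assume "e > 0"
  then obtain d where d: "d > 0" "\<And>E. E \<in> sets borel \<Longrightarrow> E \<subseteq> {x-d..x+d} \<inter> {0..c} - {x} \<Longrightarrow> B * mass E < e" using small by blast
  have "dist (u y) (left_lim z u x) < e" if y: "max 0 (x - d) < y" "y < x" for y
  proof -
   have "B * mass {y..<x} < e" using y c d(1) by (intro d(2)) auto
   then show ?thesis using near(1)[of y x] y c by (simp add: dist_norm)
  qed
  then show "\<forall>\<^sub>F y in at_left x. dist (u y) (left_lim z u x) < e"
   using x0 d(1) unfolding eventually_at_left[OF x0] by (intro exI[of _ "max 0 (x - d)"]) auto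
 qed
 show "(u \<longlongrightarrow> right_lim z u x) (at_right x)"
 proof (rule tendstoI)
  fix e :: real assume "e > 0"
  then obtain d where d: "d > 0" "\<And>E. E \<in> sets borel \<Longrightarrow> E \<subseteq> {x-d..x+d} \<inter> {0..c} - {x} \<Longrightarrow> B * mass E < e" using small by blast
  have "dist (u y) (right_lim z u x) < e" if y: "x < y" "y < min c (x + d)" for y
  proof -
   have "B * mass {x<..y} < e" using y x0 d(1) by (intro d(2)) auto
   then show ?thesis using near(2)[of x y] y x0 by (simp add: dist_norm)
  qed
  then show "\<forall>\<^sub>F y in at_right x. dist (u y) (right_lim z u x) < e"
   using c(2) d(1) unfolding eventually_at_right[OF c(2)] by (intro exI[of _ "min c (x + d)"]) auto
 qed
qed

lemma gsol_locally_bv: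
 assumes u: "gsol z u"
 shows "locally_bv \<beta> u"
 unfolding locally_bv_def bounded_variation_on_def
proof (intro ballI)
 fix s t assume st: "s \<in> ivl \<beta>" "t \<in> ivl \<beta>"
 note c = ivl_dom[OF st(2)]
 obtain B where B: "0 \<le> B" "\<And>x. x \<in> {0..t} \<Longrightarrow> norm (A z x *v u x) \<le> B" using gsol_gen_bounded[OF u c] by metis
 define \<Phi> where "\<Phi> x = (B / 2) * (mass {0..<x} + mass {0..x})" for x
 note m = gen_measurable[OF gsol_meas[OF u], of z]
 have inc: "norm (u y - u x) \<le> \<Phi> y - \<Phi> x" if h: "0 \<le> x" "x \<le> y" "y \<le> t" for x y
 proof -
  have fin: "emeasure \<nu> E \<noteq> \<infinity>" if "E \<subseteq> {0..t}" for E using emeasure_finite[OF that c] by simp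
  have m1: "mass ({0..<x} \<union> {x..<y}) = mass {0..<x} + mass {x..<y}"
   using h by (intro measure_Union fin) auto
  have m2: "mass ({0..x} \<union> {x<..y}) = mass {0..x} + mass {x<..y}"
   using h by (intro measure_Union fin) auto
  have e: "{0..<x} \<union> {x..<y} = {0..<y}" "{0..x} \<union> {x<..y} = {0..y}" using h by auto
  have "u y - u x = hint (\<lambda>y. A z y *v u y) x y"
   using u c h unfolding gsol_def by (intro sol_increment[where s=0 and t=t]) auto
  then have "norm (u y - u x) \<le> (1/2) * (norm (LINT r:{x..<y}|\<nu>. A z r *v u r) + norm (LINT r:{x<..y}|\<nu>. A z r *v u r))"
   by (simp add: hint_def norm_triangle_ineq)
  also have "\<dots> \<le> (1/2) * (B * mass {x..<y} + B * mass {x<..y})"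
   using h B by (intro mult_left_mono add_mono set_integral_norm_le[OF m _ _ c]) auto
  also have "\<dots> = \<Phi> y - \<Phi> x" using m1 m2 unfolding e \<Phi>_def by (simp add: field_simps)
  finally show ?thesis .
 qed
 have nn: "0 \<le> \<Phi> x" for x using B(1) by (simp add: \<Phi>_def)
 show "\<exists>C. \<forall>(n::nat) p. mono p \<longrightarrow> (\<forall>i. p i \<in> {s..t}) \<longrightarrow> (\<Sum>i<n. norm (u (p (Suc i)) - u (p i))) \<le> C"
 proof (intro exI[of _ "\<Phi> t"] allI impI)
  fix n :: nat and p :: "nat \<Rightarrow> real" assume p: "mono p" "\<forall>i. p i \<in> {s..t}"
  have pr: "0 \<le> p i" "p i \<le> t" for i using p(2)[rule_format, of i] st(1) by (auto simp: ivl_def)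
  have "(\<Sum>i<n. norm (u (p (Suc i)) - u (p i))) \<le> (\<Sum>i<n. \<Phi> (p (Suc i)) - \<Phi> (p i))"
   using p(1) pr by (intro sum_mono inc) (auto simp: mono_def)
  also have "\<dots> = \<Phi> (p n) - \<Phi> (p 0)" by (rule sum_lessThan_telescope)
  also have "\<dots> \<le> \<Phi> t" using inc[of "p n" t] pr[of n] nn[of "p 0"] norm_ge_zero[of "u t - u (p n)"] by linarith
  finally show "(\<Sum>i<n. norm (u (p (Suc i)) - u (p i))) \<le> \<Phi> t" .
 qed
qed

lemma set_integral_local_measure:
 fixes f :: "real \<Rightarrow> complex"
 assumes "\<And>c E. c \<in> dom \<Longrightarrow> E \<in> sets borel \<Longrightarrow> E \<subseteq> {0..c} \<Longrightarrow> set_integrable \<nu> E f"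
 shows "local_measure \<beta> (\<lambda>E. LINT x:E|\<nu>. f x)"
 unfolding local_measure_def complex_measure_on_def
proof (intro allI impI)
 fix L and X :: "nat \<Rightarrow> real set"
 assume L: "compact L" "L \<subseteq> ivl \<beta>" and X: "\<forall>n. X n \<in> sets borel \<and> X n \<subseteq> L" "disjoint_family X"
 obtain c where c: "c \<in> ivl \<beta>" "L \<subseteq> {0<..<c}" using compact_below[OF beta_pos L] .
 have int: "set_integrable \<nu> E f" if "E \<in> sets borel" "E \<subseteq> L" for E
  using that c(2) by (intro assms[OF ivl_dom[OF c(1)]]) auto
 have "(\<lambda>n. LINT x:(\<Union>i<n. X i)|\<nu>. f x) \<longlonglongrightarrow> (LINT x:(\<Union>n. \<Union>i<n. X i)|\<nu>. f x)"
 proof (rule set_integral_cont_up)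
  show "(\<Union>i<n. X i) \<in> sets \<nu>" for n using X(1) by auto
  show "incseq (\<lambda>n. \<Union>i<n. X i)" by (intro incseq_SucI) (auto simp: lessThan_Suc)
  show "set_integrable \<nu> (\<Union>n. \<Union>i<n. X i) f" using X(1) by (intro int) auto
 qed
 moreover have "(\<Union>n. \<Union>i<n. X i) = (\<Union>n. X n)" by auto
 moreover have "(LINT x:(\<Union>i<n. X i)|\<nu>. f x) = (\<Sum>i<n. LINT x:X i|\<nu>. f x)" for n
  using X by (intro set_integral_finite_Union int) (auto simp: disjoint_family_on_def)
 ultimately show "(\<lambda>n. LINT x:X n|\<nu>. f x) sums (LINT x:(\<Union>n. X n)|\<nu>. f x)" by (simp add: sums_def)
qed

text \<open>The derivative of a solution is \<open>A u d\<nu>\<close>; its one-sided limits exist as proper limits by \<open>gsol_limits\<close>.\<close>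
theorem gsol_is_solution:
 assumes u: "gsol z u"
 shows "is_solution \<beta> q w z u"
proof -
 let ?f = "\<lambda>x. A z x *v u x"
 define du where "du E = (LINT x:E|\<nu>. ?f x)" for E
 have lims: "llim u x = left_lim z u x" "rlim u x = right_lim z u x" if "x \<in> ivl \<beta>" for x
  unfolding llim_def rlim_def by (intro tendsto_Lim gsol_limits[OF u that] trivial_limit_at_left_real trivial_limit_at_right_real; simp)+
 have Un: "(LINT x:E \<union> F|\<nu>. ?f x) = (LINT x:E|\<nu>. ?f x) + (LINT x:F|\<nu>. ?f x)"
  if "c \<in> dom" "E \<in> sets borel" "F \<in> sets borel" "E \<subseteq> {0..c}" "F \<subseteq> {0..c}" "E \<inter> F = {}" for c E F
  using that gsol_gen_integrable[OF u that(1)] by (intro set_integral_Un) auto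
 have bal: "balanced \<beta> u"
  unfolding balanced_def
 proof
  fix x assume x: "x \<in> ivl \<beta>"
  have x0: "0 < x" using x by (simp add: ivl_def)
  have "(LINT y:{0..<x} \<union> {x}|\<nu>. ?f y) = (LINT y:{0..<x}|\<nu>. ?f y) + (LINT y:{x}|\<nu>. ?f y)"
   using x0 by (intro Un[OF ivl_dom[OF x]]) auto
  moreover have "{0..<x} \<union> {x} = {0..x}" using x0 by auto
  ultimately have "right_lim z u x = left_lim z u x + mass {x} *\<^sub>R ?f x"
   unfolding right_lim_def left_lim_def by (simp add: set_integral_point[OF ivl_dom[OF x]] add.assoc)
  moreover have "u x = left_lim z u x + (mass {x} / 2) *\<^sub>R ?f x"
   using u ivl_dom[OF x] unfolding gsol_def by (intro left_lim_value) auto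
  ultimately show "u x = (1/2) *\<^sub>R (llim u x + rlim u x)"
   unfolding lims[OF x] by (simp add: vec_eq_iff algebra_simps)
 qed
 have "derivative_measure \<beta> u du"
  unfolding derivative_measure_def
 proof (intro conjI allI ballI impI)
  fix j
  have comp: "du E $ j = (LINT x:E|\<nu>. ?f x $ j)" if "c \<in> dom" "E \<in> sets borel" "E \<subseteq> {0..c}" for c E
   using integral_bounded_linear[OF bounded_linear_vec_nth gsol_gen_integrable[OF u that, unfolded set_integrable_def]]
   by (simp add: du_def set_lebesgue_integral_def)
  have "local_measure \<beta> (\<lambda>E. LINT x:E|\<nu>. ?f x $ j)"
  proof (rule set_integral_local_measure)
   fix c E assume c: "c \<in> dom" "E \<in> sets borel" "E \<subseteq> {0..c}"
   show "set_integrable \<nu> E (\<lambda>x. ?f x $ j)"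
    using integrable_bounded_linear[OF bounded_linear_vec_nth gsol_gen_integrable[OF u c, unfolded set_integrable_def], of j]
    by (simp add: set_integrable_def)
  qed
  note lm = this[unfolded local_measure_def complex_measure_on_def, rule_format]
  show "local_measure \<beta> (\<lambda>E. du E $ j)"
   unfolding local_measure_def complex_measure_on_def
  proof (intro allI impI)
   fix L and X :: "nat \<Rightarrow> real set"
   assume L: "compact L" "L \<subseteq> ivl \<beta>" and X: "\<forall>n. X n \<in> sets borel \<and> X n \<subseteq> L" "disjoint_family X"
   have XL: "\<And>n. X n \<in> sets borel" "\<And>n. X n \<subseteq> L" using X by auto
   obtain c where c: "c \<in> ivl \<beta>" "L \<subseteq> {0<..<c}" using compact_below[OF beta_pos L] .
   have sub: "E \<subseteq> {0..c}" if "E \<subseteq> L" for E using that c(2) by auto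
   have "du (X n) $ j = (LINT x:X n|\<nu>. ?f x $ j)" for n
    by (rule comp[OF ivl_dom[OF c(1)] XL(1) sub[OF XL(2)]])
   moreover have "du (\<Union>n. X n) $ j = (LINT x:(\<Union>n. X n)|\<nu>. ?f x $ j)"
    using XL by (intro comp[OF ivl_dom[OF c(1)]] sub) auto
   moreover have "(\<lambda>n. LINT x:X n|\<nu>. ?f x $ j) sums (LINT x:(\<Union>n. X n)|\<nu>. ?f x $ j)" using XL by (intro lm[OF L _ X(2)]) auto
   ultimately show "(\<lambda>n. du (X n) $ j) sums du (\<Union>n. X n) $ j" by simp
  qed
 next
  fix s t assume st: "s \<in> ivl \<beta>" "t \<in> ivl \<beta>" "s \<le> t"
  have s0: "0 < s" using st by (simp add: ivl_def)
  have "(LINT x:{0..<s} \<union> {s..t}|\<nu>. ?f x) = (LINT x:{0..<s}|\<nu>. ?f x) + (LINT x:{s..t}|\<nu>. ?f x)"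
   using s0 st(3) by (intro Un[OF ivl_dom[OF st(2)]]) auto
  moreover have "{0..<s} \<union> {s..t} = {0..t}" using s0 st by auto
  ultimately have "(LINT x:{0..t}|\<nu>. ?f x) = (LINT x:{0..<s}|\<nu>. ?f x) + du {s..t}" unfolding du_def by simp
  then show "du {s..t} = rlim u t - llim u s" unfolding lims[OF st(1)] lims[OF st(2)] right_lim_def left_lim_def by simp
 qed
 moreover have "J *v du E + mat_times \<beta> q u E = z *s mat_times \<beta> w u E" if E: "E \<in> bounded_borel \<beta>" for E
 proof -
  obtain c where c: "c \<in> dom" "E \<subseteq> {0..c}" using bounded_borel_dom[OF E] by blast
  obtain B where B: "\<And>x. x \<in> {0..c} \<Longrightarrow> norm (u x) \<le> B" using gsol_gen_bounded[OF u c(1)] by metis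
  have b: "norm (u x) \<le> B" if "x \<in> E" for x using B that c(2) by blast
  have m: "mat_times \<beta> q u E = (\<chi> j. \<Sum>k\<in>UNIV. LINT x:E|\<nu>. Q x $ j $ k * u x $ k)"
   "mat_times \<beta> w u E = (\<chi> j. \<Sum>k\<in>UNIV. LINT x:E|\<nu>. W x $ j $ k * u x $ k)"
   by (rule mat_times_integral[OF gsol_meas[OF u] E]; (erule b | rule refl))+
  have "du E = J *v (mat_times \<beta> q u E - z *s mat_times \<beta> w u E)"
   unfolding du_def m by (rule gen_set_integral[OF gsol_meas[OF u] bounded_borel_sets[OF E] c(2,1)]) (rule b)
  then show ?thesis by (simp add: J_J)
 qed
 ultimately show ?thesis unfolding is_solution_def using bal gsol_locally_bv[OF u] by blast
qed

lemma gram_cm_integral: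
 assumes v: "gsol z v" and eq: "\<And>x. x \<in> ivl \<beta> \<Longrightarrow> u x = v x" and E: "E \<in> bounded_borel \<beta>"
 shows "(\<Sum>j\<in>UNIV. \<Sum>k\<in>UNIV. cm_integral \<beta> (entry w j k) (\<lambda>x. cnj (u x $ j) * u x $ k) E) = gram E v v"
proof -
 obtain c where c: "c \<in> dom" "E \<subseteq> {0..c}" using bounded_borel_dom[OF E] by blast
 obtain B where B: "0 \<le> B" "\<And>x. x \<in> {0..c} \<Longrightarrow> norm (v x) \<le> B" using gsol_gen_bounded[OF v c(1)] by metis
 note Eb = bounded_borel_sets[OF E]
 note [measurable] = gsol_meas[OF v]
 have nv: "norm (v x $ j) \<le> B" if "x \<in> E" for x j
  using order_trans[OF component_norm_le B(2)] that c(2) by blast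
 define g where "g j k x = cnj (v x $ j) * v x $ k" for j k x
 have gm [measurable]: "g j k \<in> Borel" for j k unfolding g_def by measurable
 have gb: "norm (g j k x) \<le> B * B" if "x \<in> E" for j k x
  unfolding g_def norm_mult complex_mod_cnj by (intro mult_mono nv that B(1)) simp
 have 1: "cm_integral \<beta> (entry w j k) (\<lambda>x. cnj (u x $ j) * u x $ k) E = (LINT x:E|\<nu>. W x $ j $ k * g j k x)" for j k
 proof -
  have "cm_integral \<beta> (entry w j k) (\<lambda>x. cnj (u x $ j) * u x $ k) E = cm_integral \<beta> (entry w j k) (g j k) E"
   using bounded_borel_ivl[OF E] by (intro cm_integral_cong) (auto simp: g_def eq)
  also have "\<dots> = (LINT x:E|\<nu>. W x $ j $ k * g j k x)"
   by (rule w_integral[OF E _ gb]) (use Eb in measurable)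
  finally show ?thesis .
 qed
 have i: "set_integrable \<nu> E (\<lambda>x. W x $ j $ k * g j k x)" for j k
 proof (rule set_integrableI_bounded[OF _ Eb c(2,1), where B="K * (B * B)"])
  show "norm (W x $ j $ k * g j k x) \<le> K * (B * B)" if "x \<in> E" for x
   unfolding norm_mult by (intro mult_mono W_bound gb that K_nonneg) simp
 qed measurable
 have 2: "mform (W x) (v x) (v x) = (W x $ 1 $ 1 * g 1 1 x + W x $ 1 $ 2 * g 1 2 x) + (W x $ 2 $ 1 * g 2 1 x + W x $ 2 $ 2 * g 2 2 x)" for x
  by (simp add: mform_def g_def algebra_simps)
 show ?thesis unfolding 1 gram_def 2 by (simp add: sum_2 i set_integral_add)
qed

text \<open>The two families of sets are cofinal up to limits: a set in \<open>bounded_borel \<beta>\<close> lies below some \<open>c\<close>, and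
\<open>(0, c)\<close> is exhausted by compact intervals.\<close>
lemma norm_sq_SUP:
 assumes v: "gsol z v" and eq: "\<And>x. x \<in> ivl \<beta> \<Longrightarrow> u x = v x"
 shows "norm_sq \<beta> w u = (SUP c\<in>dom. ennreal (nsq c v))"
proof -
 have n: "norm_sq \<beta> w u = (SUP E\<in>bounded_borel \<beta>. ennreal (Re (gram E v v)))"
  unfolding norm_sq_def by (intro SUP_cong refl) (simp add: gram_cm_integral[OF v eq])
 have lb: "lbm c v" if "c \<in> dom" for c using v that sol_lbm unfolding gsol_def by blast
 show ?thesis unfolding n
 proof (rule antisym; rule SUP_least)
  fix E assume E: "E \<in> bounded_borel \<beta>"
  obtain c where c: "c \<in> ivl \<beta>" "E \<subseteq> {0<..<c}" using bounded_borel_below[OF beta_pos E] .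
  note cd = ivl_dom[OF c(1)]
  note i = gram_integrable[OF lb[OF cd] lb[OF cd] cd]
  have Eb: "E \<in> sets borel" using bounded_borel_sets[OF E] .
  have "gram (E \<union> ({0..<c} - E)) v v = gram E v v + gram ({0..<c} - E) v v"
   unfolding gram_def using c(2) Eb by (intro set_integral_Un i) auto
  moreover have "E \<union> ({0..<c} - E) = {0..<c}" using c(2) by auto
  moreover have "0 \<le> Re (gram ({0..<c} - E) v v)" using Eb by (intro gram_nonneg[OF lb[OF cd] cd]) auto
  ultimately have "Re (gram E v v) \<le> nsq c v" by simp
  then show "ennreal (Re (gram E v v)) \<le> (SUP c\<in>dom. ennreal (nsq c v))"
   using cd by (intro SUP_upper2[of c] ennreal_leI)
 next
  fix c assume c: "c \<in> dom"
  note i = gram_integrable[OF lb[OF c] lb[OF c] c]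
  let ?X = "\<lambda>n. {1 / real (Suc n)..c - 1 / real (Suc n)}"
  have un: "(\<Union>n. ?X n) = {0<..<c}"
  proof (intro equalityI subsetI)
   fix x assume x: "x \<in> {0<..<c}"
   obtain n where n: "1 / real (Suc n) < min x (c - x)" using nat_approx_posE[of "min x (c - x)"] x by auto
   then have "x \<in> ?X n" by auto
   then show "x \<in> (\<Union>n. ?X n)" by blast
  next
   fix x assume "x \<in> (\<Union>n. ?X n)"
   then obtain n where n: "1 / real (Suc n) \<le> x" "x \<le> c - 1 / real (Suc n)" by auto
   have "0 < 1 / real (Suc n)" by simp
   then show "x \<in> {0<..<c}" using n by (simp only: greaterThanLessThan_iff) linarith
  qed
  have sub: "?X n \<subseteq> {0<..<c}" for n using un by blast
  have "(\<lambda>n. gram (?X n) v v) \<longlonglongrightarrow> gram (\<Union>n. ?X n) v v"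
   unfolding gram_def
  proof (rule set_integral_cont_up)
   show "incseq ?X"
   proof (rule incseq_SucI)
    fix n
    have "1 / real (Suc (Suc n)) \<le> 1 / real (Suc n)" by (intro divide_left_mono) auto
    then show "?X n \<subseteq> ?X (Suc n)" by auto
   qed
   show "set_integrable \<nu> (\<Union>n. ?X n) (\<lambda>x. mform (W x) (v x) (v x))" unfolding un by (intro i) auto
  qed simp
  moreover have "gram {0<..<c} v v = gram {0..<c} v v"
  proof -
   have "AE y in \<nu>. y \<noteq> 0" using nu_zero by (intro AE_I[where N="{0}"]) auto
   then have ae: "AE y in \<nu>. y \<in> {0<..<c} \<longleftrightarrow> y \<in> {0..<c}" by eventually_elim auto
   then have ae': "AE y in \<nu>. y \<in> {0..<c} \<longleftrightarrow> y \<in> {0<..<c}" by eventually_elim auto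
   have m: "set_borel_measurable \<nu> E (\<lambda>x. mform (W x) (v x) (v x))" if "E \<in> sets borel" "E \<subseteq> {0..c}" for E
    using borel_measurable_integrable[OF i[OF that, unfolded set_integrable_def]] unfolding set_borel_measurable_def .
   show ?thesis unfolding gram_def by (rule set_integral_cong_set, rule m, simp, force, rule m, simp, force) (rule ae ae')
  qed
  ultimately have "(\<lambda>n. ennreal (Re (gram (?X n) v v))) \<longlonglongrightarrow> ennreal (nsq c v)"
   unfolding un by (intro tendsto_ennrealI tendsto_Re) simp
  moreover have "ennreal (Re (gram (?X n) v v)) \<le> (SUP E\<in>bounded_borel \<beta>. ennreal (Re (gram E v v)))" for n
  proof (rule SUP_upper)
   show "?X n \<in> bounded_borel \<beta>" unfolding bounded_borel_def
   proof (intro CollectI conjI exI[of _ "?X n"])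
    show "?X n \<subseteq> ivl \<beta>" using sub[of n] dom_down[OF c] ivl_eq_dom by force
   qed auto
  qed
  ultimately show "ennreal (nsq c v) \<le> (SUP E\<in>bounded_borel \<beta>. ennreal (Re (gram E v v)))"
   using LIMSEQ_le_const2 by blast
 qed
qed

lemma norm_sq_finite_iff:
 assumes v: "gsol z v" and eq: "\<And>x. x \<in> ivl \<beta> \<Longrightarrow> u x = v x"
 shows "norm_sq \<beta> w u < \<infinity> \<longleftrightarrow> L2g z v"
proof -
 have ns: "norm_sq \<beta> w u = (SUP c\<in>dom. ennreal (nsq c v))" by (rule norm_sq_SUP[OF v]) (rule eq)
 show ?thesis
 proof
 assume fin: "norm_sq \<beta> w u < \<infinity>"
 have "nsq c v \<le> enn2real (norm_sq \<beta> w u)" if c: "c \<in> dom" for c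
 proof -
  have "ennreal (nsq c v) \<le> norm_sq \<beta> w u" unfolding ns by (rule SUP_upper[OF c])
  also have "\<dots> = ennreal (enn2real (norm_sq \<beta> w u))" using fin by simp
  finally show ?thesis by (simp add: ennreal_le_iff)
 qed
 then show "L2g z v" using v unfolding L2g_def by blast
next
 assume "L2g z v"
 then obtain M where "\<forall>c\<in>dom. nsq c v \<le> M" unfolding L2g_def by blast
 then have "norm_sq \<beta> w u \<le> ennreal M" unfolding ns by (intro SUP_least ennreal_leI) blast
 then show "norm_sq \<beta> w u < \<infinity>" using le_less_trans ennreal_less_top by (metis infinity_ennreal_def)
 qed
qed

lemma norm_sq_zero_iff:
 assumes v: "gsol z v" and eq: "\<And>x. x \<in> ivl \<beta> \<Longrightarrow> u x = v x"
 shows "norm_sq \<beta> w u = 0 \<longleftrightarrow> nullg v"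
proof -
 have ns: "norm_sq \<beta> w u = (SUP c\<in>dom. ennreal (nsq c v))" by (rule norm_sq_SUP[OF v]) (rule eq)
 have "ennreal (nsq c v) = 0 \<longleftrightarrow> nsq c v = 0" if c: "c \<in> dom" for c
 proof -
  have "lbm c v" using v c sol_lbm unfolding gsol_def by blast
  then have "0 \<le> nsq c v" using c by (intro gram_nonneg) auto
  then show ?thesis by simp
 qed
 moreover have "norm_sq \<beta> w u = 0 \<longleftrightarrow> (\<forall>c\<in>dom. ennreal (nsq c v) = 0)"
  unfolding ns by (metis (mono_tags, lifting) SUP_upper SUP_least le_zero_eq zero_le order_refl)
 ultimately show ?thesis unfolding nullg_def by blast
qed

end

section \<open>The exceptional set and the function tau\<close>

lemma det_nonzero_kernel:
 fixes M :: "complex^2^2"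
 assumes "det M \<noteq> 0" "M *v v = 0"
 shows "v = 0"
 using assms invertible_det_nz[of M] matrix_left_invertible_ker[of M] by (auto simp: invertible_def)

lemma det2_bound: "norm (det2 a b) \<le> 2 * (norm a * norm b)"
proof -
 have *: "norm (a $ i * b $ j) \<le> norm a * norm b" for i j
  unfolding norm_mult by (intro mult_mono' component_norm_le) auto
 show ?thesis unfolding det2_def using norm_triangle_ineq4[of "a $ 1 * b $ 2" "a $ 2 * b $ 1"] *[of 1 2] *[of 2 1] by linarith
qed

context represented_system begin

lemma atom_entries:
 assumes y: "y \<in> ivl \<beta>"
 shows "q {y} $ j $ k = of_real (mass {y}) * Q y $ j $ k" "w {y} $ j $ k = of_real (mass {y}) * W y $ j $ k"
proof -
 obtain c where c: "c \<in> dom" "y < c" using dom_increase[OF ivl_dom[OF y]] by blast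
 have y0: "0 < y" using y by (simp add: ivl_def)
 then have ci: "c \<in> ivl \<beta>" using c ivl_eq_dom by auto
 show "q {y} $ j $ k = of_real (mass {y}) * Q y $ j $ k" 
  using q_density[OF ci, of "{y}" j k] c y0 by (simp add: entry_def set_integral_point[OF ivl_dom[OF y]] scaleR_conv_of_real)
 show "w {y} $ j $ k = of_real (mass {y}) * W y $ j $ k" 
  using w_density[OF ci, of "{y}" j k] c y0 by (simp add: entry_def set_integral_point[OF ivl_dom[OF y]] scaleR_conv_of_real)
qed

lemma B_jump:
 assumes y: "y \<in> ivl \<beta>"
 shows "B_plus q w y z = jump_plus z y" "B_minus q w y z = jump_minus z y"
 by (simp_all add: B_plus_def B_minus_def jump_plus_def jump_minus_def atom_entries[OF y])

lemma det_jump_nonzero: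
 assumes z: "z \<notin> Lam \<beta> q w" and x: "x \<in> dom"
 shows "det (jump_plus z x) \<noteq> 0" "det (jump_minus z x) \<noteq> 0"
proof -
 have "det (jump_plus z x) \<noteq> 0 \<and> det (jump_minus z x) \<noteq> 0"
 proof (cases "x = 0")
  case True
  then show ?thesis by (simp add: det_2 jump_plus_def jump_minus_def)
 next
  case False
  then have "x \<in> ivl \<beta>" using x ivl_eq_dom by blast
  then show ?thesis using z by (auto simp: Lam_def B_jump)
 qed
 then show "det (jump_plus z x) \<noteq> 0" "det (jump_minus z x) \<noteq> 0" by auto
qed

text \<open>Since \<open>Q\<close>, \<open>W\<close> are Hermitian and \<open>J\<close> is skew, the adjoint of \<open>B_plus\<close> at \<open>z\<close> is minus
\<open>B_minus\<close> at \<open>cnj z\<close>, and a sign does not change a 2 by 2 determinant. Hence \<open>Lam\<close> is symmetric.\<close>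
lemma det_jump_conjugate:
 "det (jump_minus (cnj z) x) = cnj (det (jump_plus z x))" "det (jump_plus (cnj z) x) = cnj (det (jump_minus z x))"
 unfolding det_2 jump_plus_def jump_minus_def
 by (simp_all add: hermitian_entries[OF Q_herm] hermitian_entries[OF W_herm] algebra_simps)

lemma jump_kernel:
 "jump_plus z x *v v = J *v (v - (mass {x} / 2) *\<^sub>R (A z x *v v))"
 "jump_minus z x *v v = J *v (v + (mass {x} / 2) *\<^sub>R (A z x *v v))"
proof -
 have mv: "(M *v y) $ i = M $ i $ 1 * y $ 1 + M $ i $ 2 * y $ 2" for M :: "complex^2^2" and y i
  by (simp add: matrix_vector_mult_def sum_2)
 have s: "((mass {x} / 2) *\<^sub>R (A z x *v v)) $ j = of_real (mass {x}) / 2 * (A z x *v v) $ j" for j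
  unfolding vector_scaleR_component by (simp add: scaleR_conv_of_real)
 show "jump_plus z x *v v = J *v (v - (mass {x} / 2) *\<^sub>R (A z x *v v))"
  "jump_minus z x *v v = J *v (v + (mass {x} / 2) *\<^sub>R (A z x *v v))"
  unfolding vec_eq_iff forall_2 mv[of "jump_plus z x"] mv[of "jump_minus z x"] mv[of J] vector_minus_component vector_add_component s gen_components
  by (simp_all add: jump_plus_def jump_minus_def field_simps)
qed

lemma jump_regularI:
 assumes "\<And>x. x \<in> dom \<Longrightarrow> det (jump_plus z x) \<noteq> 0" "\<And>x. x \<in> dom \<Longrightarrow> det (jump_minus z x) \<noteq> 0"
 shows "jump_regular z"
 unfolding jump_regular_def
proof (intro ballI allI conjI impI)
 fix x v assume x: "x \<in> dom"
 have z0: "J *v 0 = 0" by simp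
 show "v = 0" if h: "v = (mass {x} / 2) *\<^sub>R (A z x *v v)"
 proof -
  have "v - (mass {x} / 2) *\<^sub>R (A z x *v v) = 0" using h by (metis cancel_comm_monoid_add_class.diff_cancel)
  then show ?thesis using det_nonzero_kernel[OF assms(1)[OF x], of v] jump_kernel(1)[of z x v] by simp
 qed
 show "v = 0" if h: "v = - ((mass {x} / 2) *\<^sub>R (A z x *v v))"
 proof -
  have "v + (mass {x} / 2) *\<^sub>R (A z x *v v) = 0" using h by (metis add.left_inverse)
  then show ?thesis using det_nonzero_kernel[OF assms(2)[OF x], of v] jump_kernel(2)[of z x v] by simp
 qed
qed

lemma jump_regular_off_Lam:
 assumes z: "z \<notin> Lam \<beta> q w"
 shows "jump_regular z" "jump_regular (cnj z)"
proof -
 show "jump_regular z" by (intro jump_regularI det_jump_nonzero z)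
 show "jump_regular (cnj z)" by (intro jump_regularI) (simp_all add: det_jump_conjugate det_jump_nonzero[OF z])
qed

text \<open>Subtracting the sum over all atoms leaves the integral over the set of points that are not atoms.\<close>
lemma cont_part_integral:
 fixes f :: "real \<Rightarrow> complex"
 assumes c: "c \<in> ivl \<beta>" and f: "f \<in> Borel" "\<And>x. norm (f x) \<le> B"
  and \<mu>: "\<And>E. E \<in> sets borel \<Longrightarrow> E \<subseteq> {0<..<c} \<Longrightarrow> \<mu> E = (LINT x:E|\<nu>. f x)"
 shows "set_integrable \<nu> {0..<c} (\<lambda>x. if mass {x} = 0 then f x else 0)"
  and "cont_part \<mu> {0<..<c} = (LINT x:{0..<c}|\<nu>. if mass {x} = 0 then f x else 0)"
proof -
 define S where "S = {x \<in> {0<..<c}. mass {x} \<noteq> 0}"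
 note cd = ivl_dom[OF c]
 have c0: "0 < c" using c by (simp add: ivl_def)
 have "S \<subseteq> {x \<in> dom. mass {x} \<noteq> 0}" using dom_down[OF cd] by (auto simp: S_def)
 then have S: "countable S" using countable_atoms countable_subset by blast
 have Sm [measurable]: "S \<in> sets borel" using S by (rule sets.countable[rotated]) simp
 have int: "set_integrable \<nu> E f" if "E \<in> sets borel" "E \<subseteq> {0..c}" for E
  using f(2) by (intro set_integrableI_bounded[OF f(1) that cd])
 have Ss: "S \<subseteq> {0..c}" by (auto simp: S_def)
 have e: "indicat_real {0..<c} x *\<^sub>R (if mass {x} = 0 then f x else 0) = indicat_real ({0..<c} - S) x *\<^sub>R f x" for x
  using nu_zero by (cases "x = 0") (auto simp: S_def indicator_def measure_def)
 show "set_integrable \<nu> {0..<c} (\<lambda>x. if mass {x} = 0 then f x else 0)"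
 proof -
  have "set_integrable \<nu> ({0..<c} - S) f" by (intro int) auto
  then show ?thesis unfolding set_integrable_def e .
 qed
 have "((\<lambda>y. of_real (mass {y}) * f y) has_sum (LINT x:S|\<nu>. f x)) S"
  using f(2) by (intro set_integral_countable_has_sum[OF S _ cd f(1)]) (auto simp: S_def)
 then have "(\<Sum>\<^sub>\<infinity>y\<in>S. of_real (mass {y}) * f y) = (LINT x:S|\<nu>. f x)" by (rule infsumI)
 moreover have "(\<Sum>\<^sub>\<infinity>y\<in>{0<..<c}. \<mu> {y}) = (\<Sum>\<^sub>\<infinity>y\<in>S. of_real (mass {y}) * f y)"
 proof -
  have "\<mu> {y} = of_real (mass {y}) * f y" if "y \<in> {0<..<c}" for y
   using that dom_down[OF cd, of y] by (simp add: \<mu> set_integral_point scaleR_conv_of_real)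
  then show ?thesis by (intro infsum_cong_neutral) (auto simp: S_def)
 qed
 ultimately have "cont_part \<mu> {0<..<c} = (LINT x:{0<..<c}|\<nu>. f x) - (LINT x:S|\<nu>. f x)"
  unfolding cont_part_def by (simp add: \<mu>)
 moreover have "(LINT x:{0} \<union> {0<..<c}|\<nu>. f x) = (LINT x:{0}|\<nu>. f x) + (LINT x:{0<..<c}|\<nu>. f x)"
  using c0 by (intro set_integral_Un int) auto
 moreover have "(LINT x:S \<union> ({0..<c} - S)|\<nu>. f x) = (LINT x:S|\<nu>. f x) + (LINT x:{0..<c} - S|\<nu>. f x)"
  using Ss Sm by (intro set_integral_Un int) auto
 moreover have "{0} \<union> {0<..<c} = {0..<c}" "S \<union> ({0..<c} - S) = {0..<c}" using c0 by (auto simp: S_def)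
 ultimately have "cont_part \<mu> {0<..<c} = (LINT x:{0..<c} - S|\<nu>. f x)"
  by (simp add: set_integral_point)
 then show "cont_part \<mu> {0<..<c} = (LINT x:{0..<c}|\<nu>. if mass {x} = 0 then f x else 0)"
  unfolding set_lebesgue_integral_def e .
qed

lemma fdet_bounded:
 assumes reg: "jump_regular z" and im: "Im z \<noteq> 0" and c: "c \<in> dom"
 shows "\<exists>D. \<forall>x\<in>{0..c}. norm (fdet z x) \<le> D"
proof -
 have b: "\<exists>D. \<forall>x\<in>{0..c}. norm (left_lim z u x) \<le> D" if u: "gsol z u" for u
 proof -
  obtain B where B: "0 \<le> B" "\<And>x. x \<in> {0..c} \<Longrightarrow> norm (A z x *v u x) \<le> B" using gsol_gen_bounded[OF u c] by metis
  have "norm (left_lim z u x) \<le> norm (u 0) + B * mass {0..c}" if x: "x \<in> {0..c}" for x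
  proof -
   have "norm (LINT y:{0..<x}|\<nu>. A z y *v u y) \<le> B * mass {0..<x}"
    using x B by (intro set_integral_norm_le[OF gen_measurable[OF gsol_meas[OF u]] _ _ c]) auto
   also have "\<dots> \<le> B * mass {0..c}"
    using x emeasure_finite[OF order_refl c] B(1) by (intro mult_left_mono measure_mono_fmeasurable) (auto simp: fmeasurable_def)
   finally show ?thesis unfolding left_lim_def by (intro order_trans[OF norm_triangle_ineq add_left_mono])
  qed
  then show ?thesis by blast
 qed
 obtain D1 where D1: "\<And>x. x \<in> {0..c} \<Longrightarrow> norm (left_lim z (fsol z (vector [1, 0])) x) \<le> D1" using b[OF fsol(1)[OF reg im]] by metis
 obtain D2 where D2: "\<And>x. x \<in> {0..c} \<Longrightarrow> norm (left_lim z (fsol z (vector [0, 1])) x) \<le> D2" using b[OF fsol(1)[OF reg im]] by metis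
 have "norm (fdet z x) \<le> 2 * (D1 * D2)" if x: "x \<in> {0..c}" for x
 proof -
  have "norm (left_lim z (fsol z (vector [1, 0])) x) * norm (left_lim z (fsol z (vector [0, 1])) x) \<le> D1 * D2"
   by (intro mult_mono D1 D2 x order_trans[OF norm_ge_zero D1[OF x]]) simp
  then show ?thesis unfolding fdet_def
   using det2_bound[of "left_lim z (fsol z (vector [1, 0])) x" "left_lim z (fsol z (vector [0, 1])) x"] by linarith
 qed
 then show ?thesis by blast
qed

lemma tr2_gen_Im: "tr2 (A z x) = (Q x $ 1 $ 2 - cnj (Q x $ 1 $ 2)) - z * (W x $ 1 $ 2 - cnj (W x $ 1 $ 2))"
 by (simp add: tr2_gen hermitian_entries[OF Q_herm] hermitian_entries[OF W_herm] algebra_simps)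

text \<open>The trace of \<open>A\<close> is \<open>Q12 - Q21 - z (W12 - W21)\<close>, and \<open>Q12 - Q21 = 2 i Im Q12\<close> for a Hermitian matrix, so the
exponents agree. The lower bound for the determinant in \<open>liouville\<close> comes from \<open>fdet_conjugate\<close>, as the determinant at
\<open>cnj l\<close> is bounded.\<close>
theorem tau_eq_fdet:
 assumes l: "l \<notin> Lam \<beta> q w" and im: "Im l \<noteq> 0" and c: "c \<in> ivl \<beta>"
 shows "tau q w c l = fdet l c"
proof -
 note reg = jump_regular_off_Lam[OF l]
 note cd = ivl_dom[OF c]
 define S where "S = {y. 0 < y \<and> y < c \<and> (q {y} \<noteq> 0 \<or> w {y} \<noteq> 0)}"
 define \<psi> where "\<psi> x = (if mass {x} = 0 then tr2 (A l x) else 0)" for x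
 have Si: "y \<in> ivl \<beta>" if "y \<in> {0<..<c}" for y using that dom_down[OF cd, of y] ivl_eq_dom by auto
 have SI: "mass {y} \<noteq> 0" if "y \<in> S" for y
  using that atom_entries[OF Si, of y] by (auto simp: S_def vec_eq_iff)
 have "S \<subseteq> {x \<in> dom. mass {x} \<noteq> 0}" using SI ivl_dom[OF Si] by (auto simp: S_def)
 then have Sc: "countable S" using countable_atoms countable_subset by blast
 have off: "of_real (mass {x}) * tr2 (A l x) = 0" if x: "x \<in> {0<..<c}" "x \<notin> S" for x
 proof -
  have "q {x} = 0" "w {x} = 0" using x by (auto simp: S_def)
  then have "of_real (mass {x}) * Q x $ j $ k = 0" "of_real (mass {x}) * W x $ j $ k = 0" for j k
   using atom_entries[OF Si[OF x(1)], of j k] by simp_all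
  then have z: "mass {x} = 0 \<or> Q x $ j $ k = 0" "mass {x} = 0 \<or> W x $ j $ k = 0" for j k by simp_all
  show ?thesis unfolding tr2_gen using z(1)[of 1 2] z(1)[of 2 1] z(2)[of 1 2] z(2)[of 2 1] by auto
 qed
 have im': "Im (cnj l) \<noteq> 0" using im by simp
 obtain D where D: "\<And>x. x \<in> {0..c} \<Longrightarrow> norm (fdet (cnj l) x) \<le> D" using fdet_bounded[OF reg(2) im' cd] by blast
 have lower: "1 / (\<bar>D\<bar> + 1) \<le> norm (fdet l x)" if x: "x \<in> {0..c}" for x
 proof -
  have "fdet l x * cnj (fdet (cnj l) x) = 1" using x dom_down[OF cd] by (intro fdet_conjugate reg im) auto
  then have p: "norm (fdet l x) * norm (fdet (cnj l) x) = 1" by (metis complex_mod_cnj norm_mult norm_one)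
  have "norm (fdet l x) * norm (fdet (cnj l) x) \<le> norm (fdet l x) * (\<bar>D\<bar> + 1)"
   using D[OF x] by (intro mult_left_mono) auto
  then show ?thesis unfolding p by (simp add: divide_le_eq)
 qed
 have vec0: "det2 (fsol l (vector [1, 0]) 0) (fsol l (vector [0, 1]) 0) = 1"
  by (simp add: fsol(2)[OF reg(1) im] det2_def)
 have "((\<lambda>F. det2 (fsol l (vector [1, 0]) 0) (fsol l (vector [0, 1]) 0) * (\<Prod>y\<in>F. det (jump_minus l y) / det (jump_plus l y))) \<longlongrightarrow>
   fdet l c * exp (- (LINT x:{0..<c}|\<nu>. \<psi> x))) (finite_subsets_at_top S)"
  unfolding fdet_def \<psi>_def
 proof (rule liouville[OF det_jump_nonzero(1)[OF l] fsol(1)[OF reg(1) im] fsol(1)[OF reg(1) im] cd, where m="1 / (\<bar>D\<bar> + 1)"])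
  show "1 / (\<bar>D\<bar> + 1) \<le> norm (det2 (left_lim l (fsol l (vector [1, 0])) x) (left_lim l (fsol l (vector [0, 1])) x))" if "x \<in> {0..c}" for x
   using lower[OF that] unfolding fdet_def .
  show "S \<subseteq> {0<..<c}" by (auto simp: S_def)
 qed (use Sc off in auto)
 moreover have "\<forall>\<^sub>F F in finite_subsets_at_top S. det2 (fsol l (vector [1, 0]) 0) (fsol l (vector [0, 1]) 0) * (\<Prod>y\<in>F. det (jump_minus l y) / det (jump_plus l y)) =
   (\<Prod>y\<in>F. det (B_minus q w y l) / det (B_plus q w y l))"
 proof (rule eventually_finite_subsets_at_top_weakI)
  fix F assume "finite F" "F \<subseteq> S"
  then have "y \<in> ivl \<beta>" if "y \<in> F" for y using that by (intro Si) (auto simp: S_def)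
  then show "det2 (fsol l (vector [1, 0]) 0) (fsol l (vector [0, 1]) 0) * (\<Prod>y\<in>F. det (jump_minus l y) / det (jump_plus l y)) =
   (\<Prod>y\<in>F. det (B_minus q w y l) / det (B_plus q w y l))" unfolding vec0 by (simp add: B_jump)
 qed
 ultimately have "((\<lambda>F. \<Prod>y\<in>F. det (B_minus q w y l) / det (B_plus q w y l)) \<longlongrightarrow> fdet l c * exp (- (LINT x:{0..<c}|\<nu>. \<psi> x))) (finite_subsets_at_top S)"
  by (rule Lim_transform_eventually)
 then have P: "P q w c l = fdet l c * exp (- (LINT x:{0..<c}|\<nu>. \<psi> x))"
  unfolding P_def S_def by (intro tendsto_Lim) simp_all
 define X Y where "X = cont_part (entry q 1 2) {0<..<c}" and "Y = cont_part (entry w 1 2) {0<..<c}"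
 have "(LINT x:{0..<c}|\<nu>. \<psi> x) = (X - cnj X) - l * (Y - cnj Y)"
 proof -
  define f g where "f x = (if mass {x} = 0 then Q x $ 1 $ 2 else 0)" and "g x = (if mass {x} = 0 then W x $ 1 $ 2 else 0)" for x
  note fX = cont_part_integral[OF c Q_meas Q_bound q_density[OF c], of 1 2, folded f_def X_def]
  note gY = cont_part_integral[OF c W_meas W_bound w_density[OF c], of 1 2, folded g_def Y_def]
  have cn: "set_integrable \<nu> {0..<c} (\<lambda>x. cnj (h x))" "(LINT x:{0..<c}|\<nu>. cnj (h x)) = cnj (LINT x:{0..<c}|\<nu>. h x)"
   if "set_integrable \<nu> {0..<c} h" for h
   using integrable_bounded_linear[OF bounded_linear_cnj that[unfolded set_integrable_def]]
    integral_bounded_linear[OF bounded_linear_cnj that[unfolded set_integrable_def]]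
   by (simp_all add: set_integrable_def set_lebesgue_integral_def)
  have e: "\<psi> x = (f x - cnj (f x)) - l * (g x - cnj (g x))" for x
   by (simp add: \<psi>_def f_def g_def tr2_gen_Im)
  have "(LINT x:{0..<c}|\<nu>. \<psi> x) = ((LINT x:{0..<c}|\<nu>. f x) - cnj (LINT x:{0..<c}|\<nu>. f x)) - l * ((LINT x:{0..<c}|\<nu>. g x) - cnj (LINT x:{0..<c}|\<nu>. g x))"
   unfolding e by (simp add: fX(1) gY(1) cn set_integral_diff set_integrable_mult_right)
  then show ?thesis by (simp add: fX(2) gY(2))
 qed
 moreover have "a - cnj a = 2 * \<i> * of_real (Im a)" for a by (simp add: complex_eq_iff)
 ultimately have "(LINT x:{0..<c}|\<nu>. \<psi> x) = 2 * \<i> * (of_real (Im X) - l * of_real (Im Y))" by (simp add: algebra_simps)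
 then show ?thesis unfolding tau_def P X_def[symmetric] Y_def[symmetric] by (simp add: exp_minus)
qed

end

section \<open>Deficiency indices\<close>

context represented_system begin

lemma nullg_zero: "nullg (\<lambda>x. 0)"
 by (simp add: nullg_def gram_def mform_def set_lebesgue_integral_def)

text \<open>Two equal members give a vanishing combination with coefficients 1 and -1.\<close>
lemma independent_family_inj:
 assumes S: "finite S" and ind: "\<And>a. nullg (\<lambda>x. \<Sum>u\<in>S. a u *s f u x) \<Longrightarrow> \<forall>u\<in>S. a u = 0"
 shows "inj_on f S"
proof (rule inj_onI, rule ccontr)
 fix u v assume uv: "u \<in> S" "v \<in> S" "f u = f v" "u \<noteq> v"
 let ?a = "\<lambda>y. if y = u then 1 else if y = v then - 1 else (0 :: complex)"
 have "(\<Sum>y\<in>S. ?a y *s f y x) = (\<Sum>y\<in>{u, v}. ?a y *s f y x)" for x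
  using S uv by (intro sum.mono_neutral_right) auto
 then have "(\<Sum>y\<in>S. ?a y *s f y x) = 0" for x using uv(3,4) by (simp add: vec_eq_iff)
 then have "?a u = 0" using ind[of ?a] nullg_zero uv(1) by auto
 then show False by simp
qed

text \<open>A linear comparison on the level of combinations suffices: \<open>T\<close> maps a family that is independent modulo solutions of norm 0 to one of the
same size. Solutions are replaced by their extensions \<open>E u\<close> to 0; two solutions that differ only off the interval cannot both belong to
an independent family.\<close>
lemma deficiency_le:
 assumes T: "\<And>S. finite S \<Longrightarrow> (\<And>p. p \<in> S \<Longrightarrow> L2g z p) \<Longrightarrow>
  \<exists>T. (\<forall>p\<in>S. L2g z' (T p)) \<and> (\<forall>a. nullg (\<lambda>x. \<Sum>p\<in>S. a p *s T p x) \<longrightarrow> nullg (\<lambda>x. \<Sum>p\<in>S. a p *s p x))"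
 shows "deficiency \<beta> q w z \<le> deficiency \<beta> q w z'"
 unfolding deficiency_def[of _ _ _ z]
proof (rule SUP_least)
 fix S assume "S \<in> {S. finite S \<and> S \<subseteq> L2_solutions \<beta> q w z \<and> independent_mod (L_zero \<beta> q w) S}"
 then have S: "finite S" "\<And>u. u \<in> S \<Longrightarrow> is_solution \<beta> q w z u \<and> norm_sq \<beta> w u < \<infinity>"
  and ind: "\<And>a. (\<lambda>x. \<Sum>u\<in>S. a u *s u x) \<in> L_zero \<beta> q w \<Longrightarrow> \<forall>u\<in>S. a u = 0"
  by (auto simp: L2_solutions_def independent_mod_def)
 have "\<exists>v. gsol z v \<and> (\<forall>x\<in>ivl \<beta>. v x = u x)" if "u \<in> S" for u
  using solution_extends[of z u] S(2)[OF that] by metis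
 then obtain E where E: "\<And>u. u \<in> S \<Longrightarrow> gsol z (E u)" "\<And>u x. u \<in> S \<Longrightarrow> x \<in> ivl \<beta> \<Longrightarrow> u x = E u x" by metis
 have EL: "L2g z (E u)" if "u \<in> S" for u
  using norm_sq_finite_iff[OF E(1)[OF that], of u] E(2)[OF that] S(2)[OF that] by blast
 have indE: "\<forall>u\<in>S. a u = 0" if n: "nullg (\<lambda>x. \<Sum>u\<in>S. a u *s E u x)" for a
 proof (rule ind)
  have g: "gsol z (\<lambda>x. \<Sum>u\<in>S. a u *s E u x)" by (rule gsol_sum[OF S(1) E(1)])
  have e: "(\<Sum>u\<in>S. a u *s u x) = (\<Sum>u\<in>S. a u *s E u x)" if "x \<in> ivl \<beta>" for x
   by (intro sum.cong refl) (simp add: E(2)[OF _ that, symmetric])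
  have "is_solution \<beta> q w 0 (\<lambda>x. \<Sum>u\<in>S. a u *s E u x)" by (rule gsol_is_solution[OF nullg_sol[OF g n]])
  then have "is_solution \<beta> q w 0 (\<lambda>x. \<Sum>u\<in>S. a u *s u x)" by (rule is_solution_cong) (simp add: e)
  moreover have "norm_sq \<beta> w (\<lambda>x. \<Sum>u\<in>S. a u *s u x) = 0" using norm_sq_zero_iff[OF g e] n by blast
  ultimately show "(\<lambda>x. \<Sum>u\<in>S. a u *s u x) \<in> L_zero \<beta> q w" by (simp add: L_zero_def)
 qed
 have injE: "inj_on E S" by (rule independent_family_inj[OF S(1) indE])
 have "\<exists>T. (\<forall>p\<in>E ` S. L2g z' (T p)) \<and> (\<forall>a. nullg (\<lambda>x. \<Sum>p\<in>E ` S. a p *s T p x) \<longrightarrow> nullg (\<lambda>x. \<Sum>p\<in>E ` S. a p *s p x))"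
  by (rule T) (use S(1) EL in auto)
 then obtain T where T: "\<And>p. p \<in> E ` S \<Longrightarrow> L2g z' (T p)"
  "\<And>a. nullg (\<lambda>x. \<Sum>p\<in>E ` S. a p *s T p x) \<Longrightarrow> nullg (\<lambda>x. \<Sum>p\<in>E ` S. a p *s p x)"
  by blast
 define f where "f u = T (E u)" for u
 have fL: "L2g z' (f u)" if "u \<in> S" for u using T(1) that by (simp add: f_def)
 have indf: "\<forall>u\<in>S. a u = 0" if n: "nullg (\<lambda>x. \<Sum>u\<in>S. a u *s f u x)" for a
 proof (rule indE)
  let ?a = "\<lambda>p. a (inv_into S E p)"
  have re: "(\<Sum>p\<in>E ` S. ?a p *s h p) = (\<Sum>u\<in>S. a u *s h (E u))" for h :: "_ \<Rightarrow> complex^2"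
   unfolding sum.reindex[OF injE] by (intro sum.cong refl) (simp add: inv_into_f_f[OF injE])
  have "nullg (\<lambda>x. \<Sum>p\<in>E ` S. ?a p *s T p x)"
   using n unfolding re[of "\<lambda>p. T p _"] f_def .
  from T(2)[OF this] show "nullg (\<lambda>x. \<Sum>u\<in>S. a u *s E u x)" unfolding re[of "\<lambda>p. p _"] .
 qed
 have injf: "inj_on f S" by (rule independent_family_inj[OF S(1) indf])
 have "independent_mod (L_zero \<beta> q w) (f ` S)"
  unfolding independent_mod_def
 proof (intro allI impI ballI)
  fix a r assume a: "(\<lambda>x. \<Sum>r\<in>f ` S. a r *s r x) \<in> L_zero \<beta> q w" and r: "r \<in> f ` S"
  have e: "(\<Sum>r\<in>f ` S. a r *s r x) = (\<Sum>u\<in>S. a (f u) *s f u x)" for x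
   unfolding sum.reindex[OF injf] by simp
  have "gsol z' (\<lambda>x. \<Sum>u\<in>S. a (f u) *s f u x)" using fL by (intro gsol_sum[OF S(1)]) (simp add: L2g_def)
  moreover have "norm_sq \<beta> w (\<lambda>x. \<Sum>u\<in>S. a (f u) *s f u x) = 0" using a by (simp add: L_zero_def e)
  ultimately have "nullg (\<lambda>x. \<Sum>u\<in>S. a (f u) *s f u x)" by (simp add: norm_sq_zero_iff[OF _ refl])
  then show "a r = 0" using indf[of "\<lambda>u. a (f u)"] r by auto
 qed
 moreover have "f ` S \<subseteq> L2_solutions \<beta> q w z'"
 proof
  fix r assume "r \<in> f ` S"
  then have r: "L2g z' r" using fL by auto
  then have g: "gsol z' r" by (simp add: L2g_def)
  show "r \<in> L2_solutions \<beta> q w z'"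
   using gsol_is_solution[OF g] norm_sq_finite_iff[OF g refl] r by (simp add: L2_solutions_def)
 qed
 ultimately have "enat (card (f ` S)) \<le> deficiency \<beta> q w z'"
  unfolding deficiency_def using S(1) by (intro SUP_upper) auto
 then show "enat (card S) \<le> deficiency \<beta> q w z'" by (simp add: card_image[OF injf])
qed

theorem deficiency_half_plane:
 assumes reg: "jump_regular l" and "Im z * Im k > 0"
 shows "deficiency \<beta> q w z = deficiency \<beta> q w k"
proof -
 have "deficiency \<beta> q w k \<le> deficiency \<beta> q w z" if zk: "Im z * Im k > 0" for z k
 proof (rule deficiency_le)
  fix S assume S: "finite S" "\<And>p. p \<in> S \<Longrightarrow> L2g k p"
  show "\<exists>T. (\<forall>p\<in>S. L2g z (T p)) \<and> (\<forall>a. nullg (\<lambda>x. \<Sum>p\<in>S. a p *s T p x) \<longrightarrow> nullg (\<lambda>x. \<Sum>p\<in>S. a p *s p x))"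
   by (rule limit_map[OF reg zk S(1)], erule S(2)) blast
 qed
 from this[OF assms(2)] this[of k z] assms(2) show ?thesis by (simp add: mult.commute antisym)
qed

theorem deficiency_transfer:
 assumes "jump_regular l" "jump_regular m" "Im l \<noteq> 0" "Im m \<noteq> 0" "full l \<Longrightarrow> full m"
 shows "deficiency \<beta> q w l \<le> deficiency \<beta> q w m"
proof (rule deficiency_le)
 fix S assume S: "finite S" "\<And>p. p \<in> S \<Longrightarrow> L2g l p"
 show "\<exists>T. (\<forall>p\<in>S. L2g m (T p)) \<and> (\<forall>a. nullg (\<lambda>x. \<Sum>p\<in>S. a p *s T p x) \<longrightarrow> nullg (\<lambda>x. \<Sum>p\<in>S. a p *s p x))"
  by (rule transfer_map[OF assms(1-4) _ S(1)], erule assms(5), erule S(2)) blast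
qed

lemma cnj_Lam: "l \<notin> Lam \<beta> q w \<Longrightarrow> cnj l \<notin> Lam \<beta> q w"
proof -
 assume l: "l \<notin> Lam \<beta> q w"
 have "det (B_plus q w y (cnj l)) \<noteq> 0 \<and> det (B_minus q w y (cnj l)) \<noteq> 0" if y: "y \<in> ivl \<beta>" for y
  unfolding B_jump[OF y] det_jump_conjugate using det_jump_nonzero[OF l ivl_dom[OF y]] by simp
 then show "cnj l \<notin> Lam \<beta> q w" by (auto simp: Lam_def)
qed

lemma tau_dichotomy:
 assumes l: "l \<notin> Lam \<beta> q w" "Im l \<noteq> 0" and f: "full l" "\<not> full (cnj l)"
 shows "((\<lambda>c. cmod (tau q w c l)) \<longlongrightarrow> 0) (tending_to_b \<beta>)"
  and "filterlim (\<lambda>c. cmod (tau q w c (cnj l))) at_top (tending_to_b \<beta>)"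
proof -
 have iv: "\<forall>\<^sub>F c in tending_to_b \<beta>. c \<in> ivl \<beta>"
  unfolding eventually_tending_to_b using ivl_eq_dom by (intro bexI[of _ 0]) auto
 have e1: "\<forall>\<^sub>F c in tending_to_b \<beta>. cmod (tau q w c l) = cmod (fdet l c)"
  using iv by eventually_elim (simp add: tau_eq_fdet[OF l])
 have e2: "\<forall>\<^sub>F c in tending_to_b \<beta>. cmod (tau q w c (cnj l)) = cmod (fdet (cnj l) c)"
  using iv by eventually_elim (simp add: tau_eq_fdet[OF cnj_Lam[OF l(1)]] l(2))
 note d = det_dichotomy[OF jump_regular_off_Lam[OF l(1)] l(2) f]
 show "((\<lambda>c. cmod (tau q w c l)) \<longlongrightarrow> 0) (tending_to_b \<beta>)" unfolding tendsto_cong[OF e1] by (rule d(1))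
 show "filterlim (\<lambda>c. cmod (tau q w c (cnj l))) at_top (tending_to_b \<beta>)" unfolding filterlim_cong[OF refl refl e2] by (rule d(2))
qed

end

theorem corollary3p5:
 fixes b :: ereal
  and q w :: "real set \<Rightarrow> complex^2^2"
  and l z_plus z_minus :: complex
  and n_plus n_minus :: enat
 assumes "0 < b"
  and "local_matrix_measure b q" "matrix_regular_at_0 b q" "hermitian_measure b q"
  and "local_matrix_measure b w" "matrix_regular_at_0 b w" "nonneg_measure b w"
  and "\<exists>E \<in> bounded_borel b. w E \<noteq> 0"
  and "Lam b q w \<noteq> UNIV"
  and "Im z_plus > 0" "n_plus = deficiency b q w z_plus"
  and "Im z_minus < 0" "n_minus = deficiency b q w z_minus"
  and "l \<notin> \<real>" "l \<notin> Lam b q w"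
 shows "(n_plus \<noteq> n_minus \<longrightarrow>
      (((\<lambda>c. cmod (tau q w c l)) \<longlongrightarrow> 0) (tending_to_b b) \<and>
       filterlim (\<lambda>c. cmod (tau q w c (cnj l))) at_top (tending_to_b b)) \<or>
      (((\<lambda>c. cmod (tau q w c (cnj l))) \<longlongrightarrow> 0) (tending_to_b b) \<and>
       filterlim (\<lambda>c. cmod (tau q w c l)) at_top (tending_to_b b)))
    \<and> ((\<nexists>L :: ennreal. ((\<lambda>c. ennreal (cmod (tau q w c l))) \<longlongrightarrow> L) (tending_to_b b)) \<longrightarrow>
      n_plus = n_minus)"
proof -
 obtain \<nu> Q W where "represented_system \<nu> b Q W 4 q w"
  using canonical_representation assms(1-7) by blast
 then interpret represented_system \<nu> b Q W 4 q w .
 let ?zero = "\<lambda>l. ((\<lambda>c. cmod (tau q w c l)) \<longlongrightarrow> 0) (tending_to_b b)"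
 let ?top = "\<lambda>l. filterlim (\<lambda>c. cmod (tau q w c l)) at_top (tending_to_b b)"
 have l: "l \<notin> Lam b q w" "cnj l \<notin> Lam b q w" using assms(15) cnj_Lam by auto
 have im: "Im l \<noteq> 0" "Im (cnj l) \<noteq> 0" using assms(14) by (auto simp: complex_is_Real_iff)
 note reg = jump_regular_off_Lam[OF l(1)]
 have dichotomy: "(?zero l \<and> ?top (cnj l)) \<or> (?zero (cnj l) \<and> ?top l)" if ne: "n_plus \<noteq> n_minus"
 proof -
  have "deficiency b q w l \<noteq> deficiency b q w (cnj l)"
  proof (cases "Im l > 0")
   case True
   then have "deficiency b q w z_plus = deficiency b q w l" "deficiency b q w z_minus = deficiency b q w (cnj l)"
    using assms(10,12) by (intro deficiency_half_plane[OF reg(1)]; simp add: mult_less_0_iff zero_less_mult_iff)+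
   then show ?thesis using ne assms(11,13) by simp
  next
   case False
   then have "Im l < 0" using im by simp
   then have "deficiency b q w z_minus = deficiency b q w l" "deficiency b q w z_plus = deficiency b q w (cnj l)"
    using assms(10,12) by (intro deficiency_half_plane[OF reg(1)]; simp add: mult_less_0_iff zero_less_mult_iff)+
   then show ?thesis using ne assms(11,13) by simp
  qed
  then have "\<not> (full l \<longleftrightarrow> full (cnj l))"
   using deficiency_transfer[OF reg im] deficiency_transfer[OF reg(2,1) im(2,1)] by (metis antisym)
  then consider "full l" "\<not> full (cnj l)" | "full (cnj l)" "\<not> full l" by blast
  then show ?thesis
  proof cases
   case 1
   then show ?thesis using tau_dichotomy[OF l(1) im(1)] by blast
  next
   case 2
   then show ?thesis using tau_dichotomy[OF l(2) im(2)] by simp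
  qed
 qed
 moreover have "\<exists>L :: ennreal. ((\<lambda>c. ennreal (cmod (tau q w c l))) \<longlongrightarrow> L) (tending_to_b b)" if "n_plus \<noteq> n_minus"
  using dichotomy[OF that]
 proof (elim disjE conjE)
  assume "?zero l"
  then show ?thesis by (intro exI[of _ "ennreal 0"] tendsto_ennrealI)
 next
  assume "?top l"
  then show ?thesis by (intro exI[of _ \<infinity>]) (simp add: ennreal_tendsto_top_eq_at_top)
 qed
 ultimately show ?thesis by blast
qed

end
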